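(* There is a computable function $f$ such that, given a binary structure $\mathcal S$ with domain of size $n$, a $d$-sequence of $\mathcal S$, and a prenex FO+MOD sentence $\varphi$ of quantifier rank $\ell$, one can decide whether $\mathcal S\models\varphi$ in time $f(\ell,d)\cdot n$.
   Context: A binary structure is a relational structure all of whose relation symbols have arity at most $2$. A contraction sequence of a structure with domain $U$ is a sequence of partitions of $U$ from singletons to $\{U\}$, each obtained from the previous one by merging two parts; two distinct parts $X,Y$ are red-adjacent if there are $u,u'\in X$, $v,v'\in Y$ with $(u,v)$ and $(u',v')$ of different atomic types (atomic type of $(u,v)$: which unary relations contain $u$, which contain $v$, which binary relations contain $(u,v)$ and which contain $(v,u)$). A $d$-sequence is a contraction sequence in which at every step every part is red-adjacent to at most $d$ other parts. FO+MOD is first-order logic extended with quantifiers $\exists^{i[p]}x\,\psi(x)$ (fixed integers $p\ge2$, $0\le i<p$), true iff the number of elements $a$ with $\psi(a)$ is congruent to $i$ modulo $p$. A sentence is prenex if it is a sequence of (ordinary or modular) quantifiers followed by a quantifier-free formula.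
   Formalization: For a fixed binary signature and a fixed finite set of moduli, the time bound is f(ℓ,d)·n + g(ℓ)·|φ| with g computable, since φ itself must be read; relations are random-access tables and the d-sequence is given as merges together with the red neighbours of each new part. *)

theory Defs
  imports Main
begin

text \<open>A signature is the list of the arities of its relation symbols; a symbol is its position
  in this list. Nullary symbols are allowed.\<close>

type_synonym signature = "nat list"

definition binary_signature :: "signature \<Rightarrow> bool" where
  "binary_signature \<sigma> \<longleftrightarrow> (\<forall>a\<in>set \<sigma>. a \<le> 2)"

record 'a struc =
  univ :: "'a set"
  rel :: "nat \<Rightarrow> 'a list set"

definition structure_over :: "signature \<Rightarrow> 'a struc \<Rightarrow> bool" where
  "structure_over \<sigma> S \<longleftrightarrow>
     (\<forall>k<length \<sigma>. \<forall>t\<in>rel S k. length t = \<sigma> ! k \<and> set t \<subseteq> univ S)"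

definition atomic_type ::
    "signature \<Rightarrow> 'a struc \<Rightarrow> 'a \<Rightarrow> 'a \<Rightarrow> nat set \<times> nat set \<times> nat set \<times> nat set" where
  "atomic_type \<sigma> S u v =
     ({k. k < length \<sigma> \<and> \<sigma> ! k = 1 \<and> [u] \<in> rel S k},
      {k. k < length \<sigma> \<and> \<sigma> ! k = 1 \<and> [v] \<in> rel S k},
      {k. k < length \<sigma> \<and> \<sigma> ! k = 2 \<and> [u, v] \<in> rel S k},
      {k. k < length \<sigma> \<and> \<sigma> ! k = 2 \<and> [v, u] \<in> rel S k})"

definition red_adjacent :: "signature \<Rightarrow> 'a struc \<Rightarrow> 'a set \<Rightarrow> 'a set \<Rightarrow> bool" where
  "red_adjacent \<sigma> S X Y \<longleftrightarrow> X \<noteq> Y \<and>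
     (\<exists>u\<in>X. \<exists>u'\<in>X. \<exists>v\<in>Y. \<exists>v'\<in>Y. atomic_type \<sigma> S u v \<noteq> atomic_type \<sigma> S u' v')"

definition red_neighbours :: "signature \<Rightarrow> 'a struc \<Rightarrow> 'a set set \<Rightarrow> 'a set \<Rightarrow> 'a set set" where
  "red_neighbours \<sigma> S P X = {Y \<in> P. red_adjacent \<sigma> S X Y}"

definition merge_step :: "'a set set \<Rightarrow> 'a set set \<Rightarrow> bool" where
  "merge_step P Q \<longleftrightarrow> (\<exists>X\<in>P. \<exists>Y\<in>P. X \<noteq> Y \<and> Q = insert (X \<union> Y) (P - {X, Y}))"

definition contraction_sequence :: "'a struc \<Rightarrow> 'a set set list \<Rightarrow> bool" where
  "contraction_sequence S Ps \<longleftrightarrow> Ps \<noteq> [] \<and> hd Ps = (\<lambda>u. {u}) ` univ S \<and> last Ps = {univ S} \<and>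
     (\<forall>i. Suc i < length Ps \<longrightarrow> merge_step (Ps ! i) (Ps ! Suc i))"

definition d_sequence :: "signature \<Rightarrow> 'a struc \<Rightarrow> nat \<Rightarrow> 'a set set list \<Rightarrow> bool" where
  "d_sequence \<sigma> S d Ps \<longleftrightarrow> contraction_sequence S Ps \<and>
     (\<forall>P\<in>set Ps. \<forall>X\<in>P. card (red_neighbours \<sigma> S P X) \<le> d)"

text \<open>Variables are de Bruijn indices: index 0 refers to the innermost enclosing quantifier.\<close>

datatype fm =
    Falsum
  | Rel nat "nat list"
  | Equal nat nat
  | Neg fm
  | Conj fm fm
  | Disj fm fm
  | Exists fm
  | Forall fm
  | ExistsMod nat nat fm  \<comment> \<open>\<open>ExistsMod i p \<psi>\<close> stands for \<open>\<exists>\<close> with superscript \<open>i[p]\<close>\<close>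

fun sat :: "'a struc \<Rightarrow> 'a list \<Rightarrow> fm \<Rightarrow> bool" where
  "sat S e Falsum = False"
| "sat S e (Rel k xs) = (map (\<lambda>x. e ! x) xs \<in> rel S k)"
| "sat S e (Equal x y) = (e ! x = e ! y)"
| "sat S e (Neg \<phi>) = (\<not> sat S e \<phi>)"
| "sat S e (Conj \<phi> \<psi>) = (sat S e \<phi> \<and> sat S e \<psi>)"
| "sat S e (Disj \<phi> \<psi>) = (sat S e \<phi> \<or> sat S e \<psi>)"
| "sat S e (Exists \<phi>) = (\<exists>a\<in>univ S. sat S (a # e) \<phi>)"
| "sat S e (Forall \<phi>) = (\<forall>a\<in>univ S. sat S (a # e) \<phi>)"
| "sat S e (ExistsMod i p \<phi>) = (card {a \<in> univ S. sat S (a # e) \<phi>} mod p = i mod p)"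

text \<open>\<open>formula \<sigma> Mods m \<phi>\<close>: \<open>\<phi>\<close> is a formula over \<open>\<sigma>\<close> with free variables among \<open>0, \<dots>, m - 1\<close>
  and all moduli in \<open>Mods\<close>.\<close>

fun formula :: "signature \<Rightarrow> nat set \<Rightarrow> nat \<Rightarrow> fm \<Rightarrow> bool" where
  "formula \<sigma> Mods m Falsum = True"
| "formula \<sigma> Mods m (Rel k xs) = (k < length \<sigma> \<and> length xs = \<sigma> ! k \<and> (\<forall>x\<in>set xs. x < m))"
| "formula \<sigma> Mods m (Equal x y) = (x < m \<and> y < m)"
| "formula \<sigma> Mods m (Neg \<phi>) = formula \<sigma> Mods m \<phi>"
| "formula \<sigma> Mods m (Conj \<phi> \<psi>) = (formula \<sigma> Mods m \<phi> \<and> formula \<sigma> Mods m \<psi>)"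
| "formula \<sigma> Mods m (Disj \<phi> \<psi>) = (formula \<sigma> Mods m \<phi> \<and> formula \<sigma> Mods m \<psi>)"
| "formula \<sigma> Mods m (Exists \<phi>) = formula \<sigma> Mods (Suc m) \<phi>"
| "formula \<sigma> Mods m (Forall \<phi>) = formula \<sigma> Mods (Suc m) \<phi>"
| "formula \<sigma> Mods m (ExistsMod i p \<phi>) = (p \<in> Mods \<and> i < p \<and> formula \<sigma> Mods (Suc m) \<phi>)"

definition sentence :: "signature \<Rightarrow> nat set \<Rightarrow> fm \<Rightarrow> bool" where
  "sentence \<sigma> Mods \<phi> \<longleftrightarrow> formula \<sigma> Mods 0 \<phi>"

definition models :: "'a struc \<Rightarrow> fm \<Rightarrow> bool" where
  "models S \<phi> \<longleftrightarrow> sat S [] \<phi>"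

fun quantifier_rank :: "fm \<Rightarrow> nat" where
  "quantifier_rank Falsum = 0"
| "quantifier_rank (Rel k xs) = 0"
| "quantifier_rank (Equal x y) = 0"
| "quantifier_rank (Neg \<phi>) = quantifier_rank \<phi>"
| "quantifier_rank (Conj \<phi> \<psi>) = max (quantifier_rank \<phi>) (quantifier_rank \<psi>)"
| "quantifier_rank (Disj \<phi> \<psi>) = max (quantifier_rank \<phi>) (quantifier_rank \<psi>)"
| "quantifier_rank (Exists \<phi>) = Suc (quantifier_rank \<phi>)"
| "quantifier_rank (Forall \<phi>) = Suc (quantifier_rank \<phi>)"
| "quantifier_rank (ExistsMod i p \<phi>) = Suc (quantifier_rank \<phi>)"

definition quantifier_free :: "fm \<Rightarrow> bool" where
  "quantifier_free \<phi> \<longleftrightarrow> quantifier_rank \<phi> = 0"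

fun prenex :: "fm \<Rightarrow> bool" where
  "prenex (Exists \<phi>) = prenex \<phi>"
| "prenex (Forall \<phi>) = prenex \<phi>"
| "prenex (ExistsMod i p \<phi>) = prenex \<phi>"
| "prenex \<phi> = quantifier_free \<phi>"

text \<open>Random access machines with bounded words. Programs act on registers and on a memory, both indexed by natural numbers. Every
  elementary instruction and every test costs one time unit. In a run with word bound \<open>W\<close>, every
  value written to a register (hence every value written to memory and every address used) is at
  most \<open>W\<close>; an instruction that would exceed \<open>W\<close> has no transition. This prevents
  unit-cost arithmetic on long numbers from hiding work.\<close>

datatype operation = Add | Sub | Mul | Div

fun apply_op :: "operation \<Rightarrow> nat \<Rightarrow> nat \<Rightarrow> nat" where
  "apply_op Add x y = x + y"
| "apply_op Sub x y = x - y"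
| "apply_op Mul x y = x * y"
| "apply_op Div x y = x div y"

datatype prog =
    Const nat nat
  | Oper operation nat nat nat
  | Load nat nat
  | Store nat nat
  | Skip
  | Seq prog prog
  | If nat prog prog
  | While nat prog

inductive exec :: "nat \<Rightarrow> prog \<Rightarrow> (nat \<Rightarrow> nat) \<times> (nat \<Rightarrow> nat) \<Rightarrow> nat \<Rightarrow>
    (nat \<Rightarrow> nat) \<times> (nat \<Rightarrow> nat) \<Rightarrow> bool" for W :: nat where
  Const: "v \<le> W \<Longrightarrow> exec W (Const r v) (R, M) 1 (R(r := v), M)"
| Oper: "v = apply_op f (R x) (R y) \<Longrightarrow> v \<le> W \<Longrightarrow> exec W (Oper f r x y) (R, M) 1 (R(r := v), M)"
| Load: "M (R a) \<le> W \<Longrightarrow> exec W (Load r a) (R, M) 1 (R(r := M (R a)), M)"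
| Store: "exec W (Store a r) (R, M) 1 (R, M(R a := R r))"
| Skip: "exec W Skip s 1 s"
| Seq: "exec W c s t s' \<Longrightarrow> exec W c' s' t' s'' \<Longrightarrow> exec W (Seq c c') s (t + t') s''"
| IfTrue: "R x \<noteq> 0 \<Longrightarrow> exec W c (R, M) t s' \<Longrightarrow> exec W (If x c c') (R, M) (Suc t) s'"
| IfFalse: "R x = 0 \<Longrightarrow> exec W c' (R, M) t s' \<Longrightarrow> exec W (If x c c') (R, M) (Suc t) s'"
| WhileFalse: "R x = 0 \<Longrightarrow> exec W (While x c) (R, M) 1 (R, M)"
| WhileTrue: "R x \<noteq> 0 \<Longrightarrow> exec W c (R, M) t s' \<Longrightarrow> exec W (While x c) s' t' s'' \<Longrightarrow>
    exec W (While x c) (R, M) (Suc (t + t')) s''"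

definition initial_state :: "nat list \<Rightarrow> (nat \<Rightarrow> nat) \<times> (nat \<Rightarrow> nat)" where
  "initial_state xs = ((\<lambda>r. 0), (\<lambda>a. if a < length xs then xs ! a else 0))"

definition outputs_within :: "nat \<Rightarrow> nat \<Rightarrow> prog \<Rightarrow> nat list \<Rightarrow> nat \<Rightarrow> bool" where
  "outputs_within W T c xs y \<longleftrightarrow>
     (\<exists>t R M. t \<le> T \<and> exec W c (initial_state xs) t (R, M) \<and> R 0 = y)"

text \<open>For computability of a numeric function, words and time are unbounded.\<close>

definition computable1 :: "(nat \<Rightarrow> nat) \<Rightarrow> bool" where
  "computable1 g \<longleftrightarrow> (\<exists>c. \<forall>x. \<exists>W T. outputs_within W T c [x] (g x))"

definition computable2 :: "(nat \<Rightarrow> nat \<Rightarrow> nat) \<Rightarrow> bool" where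
  "computable2 f \<longleftrightarrow> (\<exists>c. \<forall>x y. \<exists>W T. outputs_within W T c [x, y] (f x y))"

text \<open>Formulas are coded in Polish notation; the number of arguments of a relation symbol is known from the signature.\<close>

fun formula_code :: "fm \<Rightarrow> nat list" where
  "formula_code Falsum = [0]"
| "formula_code (Rel k xs) = 1 # k # xs"
| "formula_code (Equal x y) = [2, x, y]"
| "formula_code (Neg \<phi>) = 3 # formula_code \<phi>"
| "formula_code (Conj \<phi> \<psi>) = 4 # formula_code \<phi> @ formula_code \<psi>"
| "formula_code (Disj \<phi> \<psi>) = 5 # formula_code \<phi> @ formula_code \<psi>"
| "formula_code (Exists \<phi>) = 6 # formula_code \<phi>"
| "formula_code (Forall \<phi>) = 7 # formula_code \<phi>"
| "formula_code (ExistsMod i p \<phi>) = 8 # i # p # formula_code \<phi>"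

definition formula_length :: "fm \<Rightarrow> nat" where
  "formula_length \<phi> = length (formula_code \<phi>)"

text \<open>Structures on \<open>{..<n}\<close> are given by the 0/1 tables of their relations. In the table of a
  binary symbol, the bit of \<open>[u, v]\<close> is at position \<open>u + n * v\<close>.\<close>

definition relation_table :: "nat \<Rightarrow> nat \<Rightarrow> nat list set \<Rightarrow> nat list" where
  "relation_table n a T = map (\<lambda>t. if t \<in> T then 1 else 0) (List.n_lists a [0..<n])"

definition structure_code :: "signature \<Rightarrow> nat \<Rightarrow> nat struc \<Rightarrow> nat list" where
  "structure_code \<sigma> n S = concat (map (\<lambda>k. relation_table n (\<sigma> ! k) (rel S k)) [0..<length \<sigma>])"

text \<open>The part \<open>{v}\<close> is named \<open>v\<close>, and the part created by the step from \<open>Ps ! (i - 1)\<close> to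
  \<open>Ps ! i\<close> is named \<open>n + i - 1\<close>.\<close>

definition part_name :: "nat \<Rightarrow> nat set set list \<Rightarrow> nat set \<Rightarrow> nat" where
  "part_name n Ps X =
     (if X \<in> Ps ! 0 then the_elem X else n + (LEAST i. i < length Ps \<and> X \<in> Ps ! i) - 1)"

text \<open>A contraction sequence is presented as the sequence of its red graphs, incrementally: each
  step lists the names of the two merged parts, the number of red neighbours of the new part
  and the names of these neighbours. This determines all red graphs, since a merge does not
  affect red adjacency between the other parts. (With the merged pairs alone, linear time would
  be impossible: every contraction sequence is a 1-sequence for each graph with at most one edge,
  and detecting the edge requires reading quadratically many table entries.)\<close>

definition step_code ::
    "signature \<Rightarrow> nat \<Rightarrow> nat struc \<Rightarrow> nat set set list \<Rightarrow> nat \<Rightarrow> nat list" where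
  "step_code \<sigma> n S Ps i =
     (let Z = the_elem (Ps ! i - Ps ! (i - 1));
          reds = red_neighbours \<sigma> S (Ps ! i) Z
      in sorted_list_of_set (part_name n Ps ` (Ps ! (i - 1) - Ps ! i)) @
         card reds # sorted_list_of_set (part_name n Ps ` reds))"

definition sequence_code ::
    "signature \<Rightarrow> nat \<Rightarrow> nat struc \<Rightarrow> nat set set list \<Rightarrow> nat list" where
  "sequence_code \<sigma> n S Ps = concat (map (step_code \<sigma> n S Ps) [1..<length Ps])"

definition input_code ::
    "signature \<Rightarrow> nat \<Rightarrow> nat struc \<Rightarrow> nat set set list \<Rightarrow> fm \<Rightarrow> nat list" where
  "input_code \<sigma> n S Ps \<phi> =
     [n, formula_length \<phi>, length (sequence_code \<sigma> n S Ps)] @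
     formula_code \<phi> @ sequence_code \<sigma> n S Ps @ structure_code \<sigma> n S"

end

theory Submission imports Defs "HOL-Library.Nat_Bijection" begin

text \<open>For every part of the current partition we maintain the type of rank \<open>l\<close> of its root: a tree that describes
the plays in which \<open>l\<close> elements are chosen, where the element chosen after \<open>i\<close> others must lie in a part at red
distance at most \<open>2 ^ (l - 1 - i)\<close> from an earlier one (the first in the root itself), or the move is skipped.
The tree records for each subtree whether it occurs and how often modulo the product of the moduli. Two elements whose parts
are distinct and not red-adjacent have an atomic type that depends on the parts only, so after a merge the types of the parts
at red distance at most \<open>2 ^ l\<close> from the new part are a shuffle of the old types of boundedly many parts, and all
other types persist. The type of the last part determines the truth of all prenex sentences of rank \<open>l\<close>. All functions
on types are primitive recursive, hence computed in a time that depends only on \<open>l\<close> and \<open>d\<close>.\<close>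

text \<open>The skip keeps components aligned. A play in the union of several parts becomes a play
  in each of them in which the moves made elsewhere are skipped, so a slot has the same number of
  remaining moves, and thus the same radius, in every component. Whether given component plays fit
  together to a play of the union is not visible in the recursion over the trees. It is tested only
  at the leaves, by comparing red distances between slots, and a failed test yields the invalid type
  0; a move that is legal inside one component but belongs to another one is caught there. Table
  entries of the structure are read at one representative per part, hence only boundedly many per
  merge. The matrix of the sentence is evaluated before the merges, once for every number that may
  code the pair information of a leaf; therefore the formula length is multiplied by a function of
  \<open>l\<close> and never meets \<open>n\<close>. The time bounds of the compiled functions are
  primitive recursive too, which makes the function in the theorem computable.\<close>

section \<open>Pairing and primitive recursive functions on the natural numbers\<close>

definition pfst :: "nat => nat" where "pfst x = fst (prod_decode x)"
definition psnd :: "nat => nat" where "psnd x = snd (prod_decode x)"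

lemma pfst_encode [simp]: "pfst (prod_encode (a, b)) = a"
 and psnd_encode [simp]: "psnd (prod_encode (a, b)) = b"
 by (simp_all add: pfst_def psnd_def)

lemma triangle_mono: "m <= n ==> triangle m <= triangle n"
 unfolding triangle_def by (intro div_le_mono mult_le_mono) auto

lemma prod_encode_mono: "a <= a' ==> b <= b' ==> prod_encode (a, b) <= prod_encode (a', b')"
 unfolding prod_encode_def by (auto intro!: add_mono triangle_mono)

lemma prod_encode_bound: "prod_encode (a, b) <= (a + b + 1) * (a + b + 1)"
proof -
 have "triangle (a + b) <= (a + b) * Suc (a + b)" unfolding triangle_def by (rule div_le_dividend)
 then show ?thesis unfolding prod_encode_def by (auto simp: algebra_simps)
qed

lemma add_le_prod_encode: "a + b <= prod_encode (a, b)"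
proof -
 have "n <= triangle n" for n by (induction n) auto
 from this[of "a + b"] show ?thesis unfolding prod_encode_def by simp
qed

text \<open>All functions are unary and receive tuples through the pairing function. The machine
  operations are among the basic functions, so that the pairing function itself belongs to the class
  (\<open>pr_pair\<close>).\<close>

inductive pr :: "(nat => nat) => bool" where
 const: "pr (%x. c)"
| id: "pr (%x. x)"
| fst: "pr pfst"
| snd: "pr psnd"
| op: "pr f ==> pr g ==> pr (%x. apply_op p (f x) (g x))"
| comp: "pr f ==> pr g ==> pr (%x. f (g x))"
| prec: "pr f ==> pr g ==> pr h ==>
  pr (%x. rec_nat (f x) (%i y. g (prod_encode (x, prod_encode (i, y)))) (h x))"

lemma pr_add: "pr f ==> pr g ==> pr (%x. f x + g x)"
 using pr.op[of f g Add] by simp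
lemma pr_mult: "pr f ==> pr g ==> pr (%x. f x * g x)"
 using pr.op[of f g Mul] by simp
lemma pr_div: "pr f ==> pr g ==> pr (%x. f x div g x)"
 using pr.op[of f g Div] by simp
lemma pr_pair: "pr f ==> pr g ==> pr (%x. prod_encode (f x, g x))"
 unfolding prod_encode_def triangle_def Suc_eq_plus1 split
 by (intro pr_add pr_div pr_mult pr.const)

section \<open>Time-bounded runs of the machine\<close>

text \<open>The time is only an upper bound. The rules below subtract the cost of each instruction
  from it, so that a proof follows the program text.\<close>

definition reaches :: "nat => prog => (nat => nat) \<times> (nat => nat) => nat =>
  ((nat => nat) \<times> (nat => nat) => bool) => bool" where
 "reaches W c s T Q \<longleftrightarrow> (\<exists>t s'. t <= T & exec W c s t s' & Q s')"

lemma reaches_mono: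
 "reaches W c s T Q ==> T <= T' ==> (!!s. Q s ==> Q' s) ==> reaches W c s T' Q'"
 unfolding reaches_def by (meson order_trans)

lemma reaches_Const: "v <= W ==> 1 <= T ==> Q (R(r := v), M) ==> reaches W (Const r v) (R, M) T Q"
 unfolding reaches_def using exec.Const by blast

lemma reaches_Oper: "apply_op f (R x) (R y) <= W ==> 1 <= T ==> Q (R(r := apply_op f (R x) (R y)), M) ==>
  reaches W (Oper f r x y) (R, M) T Q"
 unfolding reaches_def using exec.Oper by blast

lemma reaches_Load: "M (R a) <= W ==> 1 <= T ==> Q (R(r := M (R a)), M) ==>
  reaches W (Load r a) (R, M) T Q"
 unfolding reaches_def using exec.Load by blast

lemma reaches_Store: "1 <= T ==> Q (R, M(R a := R r)) ==>
  reaches W (Store a r) (R, M) T Q"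
 unfolding reaches_def using exec.Store by blast

lemma reaches_Skip: "1 <= T ==> Q s ==> reaches W Skip s T Q"
 unfolding reaches_def using exec.Skip by blast

lemma reaches_Seq: "reaches W c s T1 (%s'. reaches W c' s' (T - T1) Q) ==> T1 <= T ==>
  reaches W (Seq c c') s T Q"
 unfolding reaches_def
proof (elim exE conjE)
 fix t s' t' s''
 assume "T1 <= T" "t <= T1" "exec W c s t s'" "t' <= T - T1" "exec W c' s' t' s''" "Q s''"
 then show "\<exists>t s'. t <= T & exec W (Seq c c') s t s' & Q s'"
  by (intro exI[of _ "t + t'"] exI[of _ s'']) (auto intro: exec.Seq)
qed

lemma reaches_SConst: "v <= W ==> 1 <= T ==> reaches W c (R(r := v), M) (T - 1) Q ==>
  reaches W (Seq (Const r v) c) (R, M) T Q"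
 by (rule reaches_Seq[where ?T1.0=1]) (auto intro: reaches_Const)

lemma reaches_SOper: "apply_op f (R x) (R y) <= W ==> 1 <= T ==>
  reaches W c (R(r := apply_op f (R x) (R y)), M) (T - 1) Q ==>
  reaches W (Seq (Oper f r x y) c) (R, M) T Q"
 by (rule reaches_Seq[where ?T1.0=1]) (auto intro: reaches_Oper)

lemma reaches_If:
 assumes "1 <= T" "R x ~= 0 ==> reaches W c (R, M) (T - 1) Q"
  "R x = 0 ==> reaches W c' (R, M) (T - 1) Q"
 shows "reaches W (If x c c') (R, M) T Q"
proof (cases "R x = 0")
 case True
 then obtain t s' where "t <= T - 1" "exec W c' (R, M) t s'" "Q s'"
  using assms(3) unfolding reaches_def by blast
 then show ?thesis unfolding reaches_def using exec.IfFalse[of R x W c' M t s' c] True assms(1)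
  by (intro exI[of _ "Suc t"] exI[of _ s']) auto
next
 case False
 then obtain t s' where "t <= T - 1" "exec W c (R, M) t s'" "Q s'"
  using assms(2) unfolding reaches_def by blast
 then show ?thesis unfolding reaches_def using exec.IfTrue[of R x W c M t s' c'] False assms(1)
  by (intro exI[of _ "Suc t"] exI[of _ s']) auto
qed

text \<open>The measure bounds the number of iterations. Each costs at most \<open>T\<close> for the
  body and one unit for the test; the last unit pays for the failing test.\<close>

lemma reaches_While:
 assumes step: "!!s. I s ==> fst s x ~= 0 ==> reaches W c s T (%s'. I s' & m s' < m s)"
  and stop: "!!s. I s ==> fst s x = 0 ==> Q s"
  and init: "I s" and time: "m s * Suc T + 1 <= T'"
 shows "reaches W (While x c) s T' Q"
proof -
 have "\<exists>t s'. t <= m s * Suc T + 1 & exec W (While x c) s t s' & Q s'"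
  using init
 proof (induction "m s" arbitrary: s rule: less_induct)
  case less
  obtain R M where s: "s = (R, M)" by fastforce
  show ?case
  proof (cases "R x = 0")
   case True
   then have "exec W (While x c) s 1 s" "Q s" using stop[OF less.prems] exec.WhileFalse s by auto
   then show ?thesis by (intro exI[of _ 1] exI[of _ s]) auto
  next
   case False
   obtain t s' where 1: "t <= T" "exec W c (R, M) t s'" "I s'" "m s' < m s"
    using step[OF less.prems] False unfolding s reaches_def by auto
   obtain t' s'' where 2: "t' <= m s' * Suc T + 1" "exec W (While x c) s' t' s''" "Q s''"
    using less.hyps[OF 1(4) 1(3)] by blast
   have "Suc (m s') * Suc T <= m s * Suc T" using 1(4) by (intro mult_le_mono1) simp
   then have "Suc (t + t') <= m s * Suc T + 1" using 1(1) 2(1) by simp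
   then show ?thesis using 1 2 False exec.WhileTrue[of R x W c M t s' t' s''] unfolding s
    by blast
  qed
 qed
 then show ?thesis unfolding reaches_def using time by (meson order_trans)
qed

definition copy :: "nat => nat => prog" where
 "copy r x = Seq (Const r 0) (Oper Add r x r)"

lemma reaches_copy: "r ~= x ==> R x <= W ==> 2 <= T ==> Q (R(r := R x), M) ==> reaches W (copy r x) (R, M) T Q"
 unfolding copy_def by (rule reaches_SConst) (auto intro!: reaches_Oper)

lemma reaches_Scopy: "r ~= x ==> R x <= W ==> 2 <= T ==> reaches W c (R(r := R x), M) (T - 2) Q ==>
  reaches W (Seq (copy r x) c) (R, M) T Q"
 by (rule reaches_Seq[where ?T1.0=2]) (auto intro: reaches_copy)

text \<open>\<open>r\<close> receives the code of the pair in registers \<open>x\<close> and \<open>y\<close>; register \<open>Suc r\<close> is scratch.\<close>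

definition pair_prog :: "nat => nat => nat => prog" where
 "pair_prog r x y = Seq (Oper Add r x y) (Seq (Const (Suc r) 1) (Seq (Oper Add (Suc r) r (Suc r))
  (Seq (Oper Mul r r (Suc r)) (Seq (Const (Suc r) 2) (Seq (Oper Div r r (Suc r)) (Oper Add r r x))))))"

text \<open>The product \<open>(x + y) * (x + y + 1)\<close>, twice a triangular number, is formed
  before it is halved; hence the factor 2 in the word bound.\<close>

lemma reaches_pair_prog:
 assumes "x < r" "y < r" "2 * prod_encode (R x, R y) + 2 <= W" "7 <= T"
  "!!v. Q (R(r := prod_encode (R x, R y), Suc r := v), M)"
 shows "reaches W (pair_prog r x y) (R, M) T Q"
proof -
 have tri: "(R x + R y) * Suc (R x + R y) = 2 * triangle (R x + R y)"
  unfolding triangle_def by (rule dvd_mult_div_cancel[symmetric]) simp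
 have pe: "prod_encode (R x, R y) = triangle (R x + R y) + R x" by (simp add: prod_encode_def)
 have le: "R x + R y <= prod_encode (R x, R y)" by (rule add_le_prod_encode)
 have Q: "Q (R(r := triangle (R x + R y) + R x, Suc r := v), M)" for v
  using assms(5)[of v] unfolding pe .
 have "R(Suc r := 2, r := triangle (R x + R y) + R x) = R(r := triangle (R x + R y) + R x, Suc r := 2)"
  by (rule fun_upd_twist) simp
 then have Q': "Q (R(Suc r := 2, r := triangle (R x + R y) + R x), M)" using Q[of 2] by simp
 have upd: "f(r := a, Suc r := b, r := c, Suc r := d, r := e, r := g) = f(r := g, Suc r := d)"
  for f :: "nat => nat" and a b c d e g by auto
 show ?thesis unfolding pair_prog_def
  apply (rule reaches_SOper)
  using assms(1-4) le apply (simp, simp)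
  apply (rule reaches_SConst)
  using assms(1-4) le apply (simp, simp)
  apply (rule reaches_SOper)
  using assms(1-4) le apply (simp, simp)
  apply (rule reaches_SOper)
  using assms(1-4) le tri pe apply (simp, simp)
  apply (rule reaches_SConst)
  using assms(1-4) le apply (simp, simp)
  apply (rule reaches_SOper)
  using assms(1-4) le tri pe apply (simp, simp)
  apply (rule reaches_Oper)
  using assms(1-4) le tri pe Q[of 2] apply (simp, simp)
  using assms(1-4) tri Q' apply (simp add: upd)
  done
qed

lemma reaches_Spair_prog:
 assumes "x < r" "y < r" "2 * prod_encode (R x, R y) + 2 <= W" "7 <= T"
  "!!v. reaches W c (R(r := prod_encode (R x, R y), Suc r := v), M) (T - 7) Q"
 shows "reaches W (Seq (pair_prog r x y) c) (R, M) T Q"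
 by (rule reaches_Seq[where ?T1.0=7]) (use assms in \<open>auto intro: reaches_pair_prog\<close>)

section \<open>Compilation of primitive recursive functions\<close>

text \<open>One function \<open>b\<close> bounds the argument, the value, the words and the running
  time. It is monotone, so that an argument can be replaced by a bound for it, and itself primitive
  recursive, so that it can occur in later bounds and finally in the function of the theorem. The
  program preserves the registers below \<open>k\<close>, which allows compilations to be
  nested.\<close>

definition computes :: "(nat => nat) => (nat => nat) => bool" where
 "computes g b \<longleftrightarrow> pr b & mono b & (\<forall>x. x <= b x & g x <= b x) \<and>
  (\<forall>k. \<exists>c. \<forall>W R M. b (R k) <= W -->
   reaches W c (R, M) (b (R k)) (%(R', M'). M' = M & R' k = g (R k) & (\<forall>j<k. R' j = R j)))"

text \<open>This follows \<open>prod_decode_aux\<close>: the numbers 1, 2, 3, ... are subtracted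
  from the code until the remainder is at most the counter. The remainder is then the first
  component, and the counter is the sum of both.\<close>

definition unpair_prog :: "nat => prog" where
 "unpair_prog k = Seq (Const (k+1) 0) (Seq (copy (k+2) k) (Seq (Const (k+3) 1)
  (While (k+2) (Seq (Oper Add (k+1) (k+1) (k+3)) (Seq (Oper Sub k k (k+1)) (Oper Sub (k+2) k (k+1)))))))"

lemma reaches_unpair_prog:
 assumes "R k + 1 <= W" "4 * R k + 5 <= T"
  "!!R'. R' k = pfst (R k) ==> R' (k+1) = pfst (R k) + psnd (R k) ==> \<forall>j<k. R' j = R j ==> Q (R', M)"
 shows "reaches W (unpair_prog k) (R, M) T Q"
proof -
 \<comment> \<open>The last conjunct is preserved because an iteration subtracts at least as much as
   the counter grows. It keeps all values below the word bound.\<close>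
 let ?I = "%s. snd s = M & (\<forall>j<k. fst s j = R j) & fst s (k+3) = 1 & fst s (k+2) = fst s k - fst s (k+1) \<and>
  prod_decode_aux (fst s (k+1)) (fst s k) = prod_decode (R k) & fst s k + fst s (k+1) <= R k"
 have body: "reaches W (Seq (Oper Add (k+1) (k+1) (k+3)) (Seq (Oper Sub k k (k+1)) (Oper Sub (k+2) k (k+1)))) s 3
   (%s'. ?I s' & fst s' k < fst s k)" if "?I s" "fst s (k+2) ~= 0" for s
 proof -
  obtain R1 M1 where s: "s = (R1, M1)" by fastforce
  have gt: "R1 k > R1 (k+1)" using that s by auto
  have le: "R1 k + R1 (k+1) <= R k" and M1: "M1 = M" "R1 (k+3) = 1" "\<forall>j<k. R1 j = R j" using that s by auto
  have dec: "prod_decode_aux (Suc (R1 (k+1))) (R1 k - Suc (R1 (k+1))) = prod_decode (R k)"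
   using that s gt by (subst (asm) prod_decode_aux.simps) auto
  show ?thesis unfolding s
   apply (rule reaches_SOper)
   using M1 le assms(1) gt apply (simp, simp)
   apply (rule reaches_SOper)
   using M1 le assms(1) apply (simp, simp)
   apply (rule reaches_Oper)
   using M1 le assms(1) apply (simp, simp)
   using M1 le gt dec by auto
 qed
 have fin: "Q s" if "?I s" "fst s (k+2) = 0" for s
 proof -
  obtain R1 M1 where s: "s = (R1, M1)" by fastforce
  have "prod_decode (R k) = (R1 k, R1 (k+1) - R1 k)" using that s by (subst (asm) prod_decode_aux.simps) auto
  then show ?thesis using that s assms(3)[of R1] by (auto simp: pfst_def psnd_def)
 qed
 show ?thesis unfolding unpair_prog_def
  apply (rule reaches_SConst)
  using assms apply (simp, simp)
  apply (rule reaches_Scopy)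
  using assms apply (simp, simp, simp)
  apply (rule reaches_SConst)
  using assms apply (simp, simp)
  apply (rule reaches_While[where I="?I" and m="%s. fst s k" and T=3, OF body fin])
  using assms by (auto simp: prod_decode_def)
qed

lemma computesI:
 assumes "pr b" "mono b" "!!x. x <= b x" "!!x. g x <= b x"
  "!!k. \<exists>c. \<forall>W R M. b (R k) <= W -->
   reaches W c (R, M) (b (R k)) (%(R', M'). M' = M & R' k = g (R k) & (\<forall>j<k. R' j = R j))"
 shows "computes g b"
 using assms unfolding computes_def by blast

lemma computesE:
 assumes "computes g b"
 obtains c where "!!W R M T Q. b (R k) <= W ==> b (R k) <= T ==>
   (!!R'. R' k = g (R k) ==> \<forall>j<k. R' j = R j ==> Q (R', M)) ==> reaches W c (R, M) T Q"
proof -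
 from assms obtain c where c: "\<forall>W R M. b (R k) <= W -->
   reaches W c (R, M) (b (R k)) (%(R', M'). M' = M & R' k = g (R k) & (\<forall>j<k. R' j = R j))"
  unfolding computes_def by blast
 show ?thesis
  apply (rule that[of c])
  apply (rule reaches_mono[OF c[rule_format]])
  by auto
qed

lemma computesD: "computes g b ==> x <= b x" "computes g b ==> g x <= b x"
 "computes g b ==> mono b" "computes g b ==> pr b"
 unfolding computes_def by auto

lemma computes_const: "computes (%x. c) (%x. x + (c + 1))"
proof (rule computesI)
 show "pr (%x. x + (c + 1))" by (intro pr_add pr_mult pr.const pr.id)
 show "\<exists>p. \<forall>W R M. R k + (c + 1) <= W -->
   reaches W p (R, M) (R k + (c + 1)) (%(R', M'). M' = M & R' k = c & (\<forall>j<k. R' j = R j))" for k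
  by (rule exI[of _ "Const k c"]) (auto intro!: reaches_Const)
qed (auto intro: monoI)

lemma computes_id: "computes (%x. x) (%x. x + 1)"
proof (rule computesI)
 show "pr (%x. x + 1)" by (intro pr_add pr_mult pr.const pr.id)
 show "\<exists>p. \<forall>W R M. R k + 1 <= W -->
   reaches W p (R, M) (R k + 1) (%(R', M'). M' = M & R' k = R k & (\<forall>j<k. R' j = R j))" for k
  by (rule exI[of _ Skip]) (auto intro!: reaches_Skip)
qed (auto intro: monoI)

lemma pfst_le: "pfst x <= x" and psnd_le: "psnd x <= x"
 using le_prod_encode_1[of "pfst x" "psnd x"] le_prod_encode_2[of "psnd x" "pfst x"]
 by (simp_all add: pfst_def psnd_def)

lemma computes_fst: "computes pfst (%x. 4 * x + 5)"
proof (rule computesI)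
 show "pr (%x. 4 * x + 5)" by (intro pr_add pr_mult pr.const pr.id)
 show "\<exists>p. \<forall>W R M. 4 * R k + 5 <= W -->
   reaches W p (R, M) (4 * R k + 5) (%(R', M'). M' = M & R' k = pfst (R k) & (\<forall>j<k. R' j = R j))" for k
  by (rule exI[of _ "unpair_prog k"]) (auto intro!: reaches_unpair_prog)
qed (auto intro: monoI pfst_le[THEN order_trans])

lemma computes_snd: "computes psnd (%x. 4 * x + 6)"
proof (rule computesI)
 show "pr (%x. 4 * x + 6)" by (intro pr_add pr_mult pr.const pr.id)
 show "\<exists>p. \<forall>W R M. 4 * R k + 6 <= W -->
   reaches W p (R, M) (4 * R k + 6) (%(R', M'). M' = M & R' k = psnd (R k) & (\<forall>j<k. R' j = R j))" for k
  apply (rule exI[of _ "Seq (unpair_prog k) (Oper Sub k (k + 1) k)"])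
  apply clarify
  apply (rule reaches_Seq[where ?T1.0="4 * _ k + 5"])
  apply (rule reaches_unpair_prog)
   apply simp
   apply (rule order_refl)
  apply (rule reaches_Oper)
   apply (simp add: psnd_le[THEN order_trans])
   apply simp
  apply simp
  apply simp
  done
qed (auto intro: monoI psnd_le[THEN order_trans])

lemma computes_comp:
 assumes f: "computes f bf" and g: "computes g bg"
 shows "computes (%x. f (g x)) (%x. bg x + bf (bg x))"
proof (rule computesI)
 note f' = computesD[OF f] and g' = computesD[OF g]
 show "pr (%x. bg x + bf (bg x))" using f'(4) g'(4) by (intro pr_add) (auto intro: pr.comp)
 show "mono (%x. bg x + bf (bg x))" using f'(3) g'(3) by (auto intro!: monoI add_mono dest: monoD)
 show "x <= bg x + bf (bg x)" for x using g'(1)[of x] by simp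
 have m: "bf (g x) <= bf (bg x)" for x using f'(3) g'(2)[of x] by (rule monoD)
 show "f (g x) <= bg x + bf (bg x)" for x using f'(2)[of "g x"] m[of x] by simp
 fix k
 obtain cf where cf: "!!W R M T Q. bf (R k) <= W ==> bf (R k) <= T ==>
   (!!R'. R' k = f (R k) ==> \<forall>j<k. R' j = R j ==> Q (R', M)) ==> reaches W cf (R, M) T Q"
  using computesE[OF f, where k=k] by blast
 obtain cg where cg: "!!W R M T Q. bg (R k) <= W ==> bg (R k) <= T ==>
   (!!R'. R' k = g (R k) ==> \<forall>j<k. R' j = R j ==> Q (R', M)) ==> reaches W cg (R, M) T Q"
  using computesE[OF g, where k=k] by blast
 show "\<exists>c. \<forall>W R M. bg (R k) + bf (bg (R k)) <= W -->
   reaches W c (R, M) (bg (R k) + bf (bg (R k))) (%(R', M'). M' = M & R' k = f (g (R k)) & (\<forall>j<k. R' j = R j))"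
 proof (intro exI[of _ "Seq cg cf"] allI impI)
  fix W :: nat and R M :: "nat => nat" assume W: "bg (R k) + bf (bg (R k)) <= W"
  show "reaches W (Seq cg cf) (R, M) (bg (R k) + bf (bg (R k))) (%(R', M'). M' = M & R' k = f (g (R k)) & (\<forall>j<k. R' j = R j))"
   apply (rule reaches_Seq[where ?T1.0="bg (R k)"])
   apply (rule cg)
   using W m[of "R k"] by (auto intro!: cf)
 qed
qed

lemma apply_op_le: "apply_op p x y <= x + y + x * y"
 by (cases p) (auto intro: order_trans[OF div_le_dividend])

lemma computes_op:
 assumes f: "computes f bf" and g: "computes g bg"
 shows "computes (%x. apply_op p (f x) (g x)) (%x. (bf x + bg x) * (bf x + bg x) + bf x + bg x + 5)"
proof (rule computesI)
 note f' = computesD[OF f] and g' = computesD[OF g]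
 show "pr (%x. (bf x + bg x) * (bf x + bg x) + bf x + bg x + 5)"
  using f'(4) g'(4) by (intro pr_add pr_mult pr.const)
 show "mono (%x. (bf x + bg x) * (bf x + bg x) + bf x + bg x + 5)"
  using f'(3) g'(3) by (intro monoI add_mono mult_le_mono) (auto dest: monoD)
 show "x <= (bf x + bg x) * (bf x + bg x) + bf x + bg x + 5" for x using g'(1)[of x] by simp
 have le: "apply_op p (f x) (g x) <= (bf x + bg x) * (bf x + bg x) + bf x + bg x + 5" for x
 proof -
  have "f x * g x <= (bf x + bg x) * (bf x + bg x)"
   by (intro mult_le_mono) (use f'(2)[of x] g'(2)[of x] in auto)
  then show ?thesis using apply_op_le[of p "f x" "g x"] f'(2)[of x] g'(2)[of x] by linarith
 qed
 show "apply_op p (f x) (g x) <= (bf x + bg x) * (bf x + bg x) + bf x + bg x + 5" for x by (rule le)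
 fix k
 obtain cf where cf: "!!W R M T Q. bf (R (k+1)) <= W ==> bf (R (k+1)) <= T ==>
   (!!R'. R' (k+1) = f (R (k+1)) ==> \<forall>j<k+1. R' j = R j ==> Q (R', M)) ==> reaches W cf (R, M) T Q"
  using computesE[OF f, where k="k+1"] by blast
 obtain cg where cg: "!!W R M T Q. bg (R (k+2)) <= W ==> bg (R (k+2)) <= T ==>
   (!!R'. R' (k+2) = g (R (k+2)) ==> \<forall>j<k+2. R' j = R j ==> Q (R', M)) ==> reaches W cg (R, M) T Q"
  using computesE[OF g, where k="k+2"] by blast
 let ?c = "Seq (copy (k+1) k) (Seq cf (Seq (copy (k+2) k) (Seq cg (Oper p k (k+1) (k+2)))))"
 show "\<exists>c. \<forall>W R M. (bf (R k) + bg (R k)) * (bf (R k) + bg (R k)) + bf (R k) + bg (R k) + 5 <= W -->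
   reaches W c (R, M) ((bf (R k) + bg (R k)) * (bf (R k) + bg (R k)) + bf (R k) + bg (R k) + 5)
    (%(R', M'). M' = M & R' k = apply_op p (f (R k)) (g (R k)) & (\<forall>j<k. R' j = R j))"
 proof (intro exI[of _ ?c] allI impI)
  fix W :: nat and R M :: "nat => nat"
  assume W: "(bf (R k) + bg (R k)) * (bf (R k) + bg (R k)) + bf (R k) + bg (R k) + 5 <= W"
  have x: "R k <= W" "bf (R k) <= W" "bg (R k) <= W" using W f'(1)[of "R k"] by auto
  have v: "apply_op p (f (R k)) (g (R k)) <= W" using le[of "R k"] W by simp
  show "reaches W ?c (R, M) ((bf (R k) + bg (R k)) * (bf (R k) + bg (R k)) + bf (R k) + bg (R k) + 5)
    (%(R', M'). M' = M & R' k = apply_op p (f (R k)) (g (R k)) & (\<forall>j<k. R' j = R j))"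
   apply (rule reaches_Scopy)
    apply simp
    apply (rule x)
   apply simp
   apply (rule reaches_Seq[where ?T1.0="bf (R k)"])
   apply (rule cf)
    apply (simp add: x)
    apply simp
   apply (rule reaches_Scopy)
     apply simp
    apply (simp add: x)
    apply simp
   apply (rule reaches_Seq[where ?T1.0="bg (R k)"])
    apply (rule cg)
     apply (simp add: x)
    apply simp
    apply (rule reaches_Oper)
     apply (simp add: v)
    apply simp
    apply simp
   apply simp
   apply simp
   done
 qed
qed

text \<open>The number \<open>z x n\<close> dominates the parameter, the counter and the value after
  \<open>n\<close> rounds at the same time: it starts above all three bounds, and each step applies
  \<open>bg\<close> to a triple of equal dominating entries. Monotony of \<open>bg\<close> then
  bounds the cost of the next round by \<open>z x (Suc n)\<close>, and there are at most
  \<open>bh x\<close> rounds.\<close>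

lemma computes_prec:
 assumes f: "computes f bf" and g: "computes g bg" and h: "computes h bh"
 defines "z \<equiv> %x n. rec_nat (bf x + bh x + x) (%i y. bg (prod_encode (y, prod_encode (y, y)))) n"
 defines "b \<equiv> %x. (bh x + 5) * (2 * z x (bh x) + 2 * z x (Suc (bh x)) + 40)"
 shows "computes (%x. rec_nat (f x) (%i y. g (prod_encode (x, prod_encode (i, y)))) (h x)) b"
proof (rule computesI)
 note f' = computesD[OF f] and g' = computesD[OF g] and h' = computesD[OF h]
 have z0: "z x 0 = bf x + bh x + x" and zS: "z x (Suc n) = bg (prod_encode (z x n, prod_encode (z x n, z x n)))" for x n
  by (simp_all add: z_def)
 have pz: "pr n ==> pr (%x. z x (n x))" for n
 proof -
  assume n: "pr n"
  have s: "pr (%x. psnd (psnd x))" by (intro pr.comp[OF pr.snd pr.snd])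
  have "pr (%w. bg (prod_encode (psnd (psnd w), prod_encode (psnd (psnd w), psnd (psnd w)))))"
   by (intro pr.comp[OF g'(4)] pr_pair s)
  from pr.prec[OF pr_add[OF pr_add[OF f'(4) h'(4)] pr.id] this n]
  show ?thesis by (simp add: z_def)
 qed
 have "pr (%x. z x (Suc (bh x)))"
  using pz[OF pr_add[OF h'(4) pr.const[of 1]]] by simp
 moreover have "pr (%x. z x (bh x))" by (rule pz[OF h'(4)])
 ultimately show "pr b" unfolding b_def by (intro pr_add pr_mult pr.const h'(4))
 have zm: "x <= y ==> z x n <= z y n" for x y n
 proof (induction n)
  case 0 then show ?case using f'(3) h'(3) by (auto simp: z0 intro!: add_mono dest: monoD)
 next
  case (Suc n) then show ?case unfolding zS by (intro monoD[OF g'(3)] prod_encode_mono) auto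
 qed
 have zi: "z x n <= z x (Suc n)" for x n
  unfolding zS using g'(1) le_prod_encode_1 by (meson order_trans)
 have zi': "m <= n ==> z x m <= z x n" for x m n using zi by (rule lift_Suc_mono_le)
 have zm': "x <= y ==> m <= n ==> z x m <= z y n" for x y m n using zm zi' by (meson order_trans)
 show "mono b" unfolding b_def using h'(3)
  by (intro monoI mult_le_mono add_mono zm') (auto dest: monoD)
 have zb: "z x n <= b x" if "n <= Suc (bh x)" for x n
  unfolding b_def using zi'[OF that, of x] by (simp add: algebra_simps)
 show "x <= b x" for x using zb[of 0 x] by (simp add: z0)
 define y where "y = (%x n. rec_nat (f x) (%i y. g (prod_encode (x, prod_encode (i, y)))) n)"
 have y0: "y x 0 = f x" and yS: "y x (Suc n) = g (prod_encode (x, prod_encode (n, y x n)))" for x n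
  by (simp_all add: y_def)
 have xz: "x <= z x n" "bh x <= z x n" for x n using zi'[of 0 n x] by (auto simp: z0)
 have arg: "prod_encode (x, prod_encode (n, y x n)) <= prod_encode (z x n, prod_encode (z x n, z x n))"
  if "y x n <= z x n" "n <= bh x" for x n
  using that xz[of x n] by (intro prod_encode_mono) auto
 have yz: "n <= bh x ==> y x n <= z x n" for x n
 proof (induction n)
  case 0 then show ?case using f'(2)[of x] by (simp add: y0 z0)
 next
  case (Suc n)
  have "y x (Suc n) <= bg (prod_encode (x, prod_encode (n, y x n)))" unfolding yS by (rule g'(2))
  also have "\<dots> <= z x (Suc n)" unfolding zS using Suc by (intro monoD[OF g'(3)] arg) auto
  finally show ?case .
 qed
 have hb: "h x <= bh x" for x by (rule h'(2))
 show "rec_nat (f x) (%i y. g (prod_encode (x, prod_encode (i, y)))) (h x) <= b x" for x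
  by (rule order_trans[OF yz[OF hb, of x, unfolded y_def]], rule zb) (use hb[of x] in simp)
 fix k
 obtain ch where ch: "!!W R M T Q. bh (R (k+1)) <= W ==> bh (R (k+1)) <= T ==>
   (!!R'. R' (k+1) = h (R (k+1)) ==> \<forall>j<k+1. R' j = R j ==> Q (R', M)) ==> reaches W ch (R, M) T Q"
  using computesE[OF h, where k="k+1"] by blast
 obtain cf where cf: "!!W R M T Q. bf (R (k+3)) <= W ==> bf (R (k+3)) <= T ==>
   (!!R'. R' (k+3) = f (R (k+3)) ==> \<forall>j<k+3. R' j = R j ==> Q (R', M)) ==> reaches W cf (R, M) T Q"
  using computesE[OF f, where k="k+3"] by blast
 obtain cg where cg: "!!W R M T Q. bg (R (k+7)) <= W ==> bg (R (k+7)) <= T ==>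
   (!!R'. R' (k+7) = g (R (k+7)) ==> \<forall>j<k+7. R' j = R j ==> Q (R', M)) ==> reaches W cg (R, M) T Q"
  using computesE[OF g, where k="k+7"] by blast
 let ?body = "Seq (pair_prog (k+5) (k+2) (k+3)) (Seq (pair_prog (k+7) k (k+5)) (Seq cg (Seq (copy (k+3) (k+7))
  (Seq (Const (k+5) 1) (Seq (Oper Add (k+2) (k+2) (k+5)) (Oper Sub (k+4) (k+1) (k+2)))))))"
 let ?c = "Seq (copy (k+1) k) (Seq ch (Seq (Const (k+2) 0) (Seq (copy (k+3) k) (Seq cf (Seq (copy (k+4) (k+1))
  (Seq (While (k+4) ?body) (copy k (k+3))))))))"
 show "\<exists>c. \<forall>W R M. b (R k) <= W -->
   reaches W c (R, M) (b (R k)) (%(R', M'). M' = M \<and>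
    R' k = rec_nat (f (R k)) (%i y. g (prod_encode (R k, prod_encode (i, y)))) (h (R k)) & (\<forall>j<k. R' j = R j))"
 proof (intro exI[of _ ?c] allI impI)
  fix W :: nat and R M :: "nat => nat"
  assume W: "b (R k) <= W"
  define x where "x = R k"
  define N where "N = h x"
  define Z where "Z = z x (Suc (bh x))"
  have bW: "(bh x + 5) * (2 * z x (bh x) + 2 * Z + 40) <= W" and bx: "b x = (bh x + 5) * (2 * z x (bh x) + 2 * Z + 40)"
   using W by (simp_all add: b_def x_def Z_def)
  have Zz: "z x n <= Z" if "n <= Suc (bh x)" for n unfolding Z_def using zi'[OF that] .
  have xZ: "x <= Z" "bh x <= Z" "bf x <= Z" using Zz[of 0] by (simp_all add: z0)
  have NZ: "N <= bh x" unfolding N_def by (rule hb)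
  have ZW: "2 * Z + 40 <= W" using bW by (simp add: algebra_simps)
  have argZ: "bg (prod_encode (x, prod_encode (n, y x n))) <= Z" if "n <= bh x" for n
  proof -
   have "bg (prod_encode (x, prod_encode (n, y x n))) <= z x (Suc n)" unfolding zS
    by (rule monoD[OF g'(3)], rule arg[OF yz[OF that] that])
   also have "\<dots> <= Z" using that by (intro Zz) simp
   finally show ?thesis .
  qed
  have pZ: "prod_encode (x, prod_encode (n, y x n)) <= Z" if "n <= bh x" for n
   using g'(1) argZ[OF that] by (rule order_trans)
  have qZ: "prod_encode (n, y x n) <= Z" if "n <= bh x" for n
   using le_prod_encode_2 pZ[OF that] by (rule order_trans)
  let ?I = "%s. snd s = M & (\<forall>j<k. fst s j = R j) & fst s k = x & fst s (k+1) = N & fst s (k+2) <= N \<and>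
   fst s (k+3) = y x (fst s (k+2)) & fst s (k+4) = N - fst s (k+2)"
  have body: "reaches W ?body s (Z + 20) (%s'. ?I s' & fst s' (k+4) < fst s (k+4))" if "?I s" "fst s (k+4) ~= 0" for s
  proof -
   obtain R1 M1 where s: "s = (R1, M1)" by fastforce
   define n where "n = R1 (k+2)"
   have I: "M1 = M" "\<forall>j<k. R1 j = R j" "R1 k = x" "R1 (k+1) = N" "R1 (k+2) = n" "n < N" "R1 (k+3) = y x n" "R1 (k+4) = N - n"
    using that s by (auto simp: n_def)
   have nb: "n <= bh x" "Suc n <= bh x" using I(6) NZ by auto
   have ySn: "g (prod_encode (x, prod_encode (n, y x n))) = y x (Suc n)" by (simp add: yS)
   have yW: "y x (Suc n) <= W" using yz[OF nb(2)] Zz[of "Suc n"] nb ZW by simp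
   note F = I nb argZ[OF nb(1)] pZ[OF nb(1)] qZ[OF nb(1)] ZW yW NZ xZ
   show ?thesis unfolding s
    apply (rule reaches_Spair_prog)
      apply (simp, simp)
    using F apply (simp, simp)
    apply (rule reaches_Spair_prog)
      apply (simp, simp)
    using F apply (simp, simp)
    apply (rule reaches_Seq[where ?T1.0=Z])
    apply (rule cg)
    using F apply (simp, simp)
    apply (rule reaches_Scopy)
      apply simp
    using F apply (simp add: ySn)
     apply simp
    apply (rule reaches_SConst)
    using F apply (simp, simp)
    apply (rule reaches_SOper)
    using F apply (simp, simp)
    apply (rule reaches_Oper)
    using F apply (simp, simp)
    using F apply (simp add: yS)
    apply simp
    done
  qed
  have fin: "reaches W (copy k (k+3)) s 2 (%(R', M'). M' = M \<and>
    R' k = rec_nat (f (R k)) (%i y. g (prod_encode (R k, prod_encode (i, y)))) (h (R k)) & (\<forall>j<k. R' j = R j))"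
   if "?I s" "fst s (k+4) = 0" for s
  proof -
   obtain R1 M1 where s: "s = (R1, M1)" by fastforce
   have e: "R1 (k+2) = N" using that s by auto
   have yW: "y x N <= W" using yz[OF NZ] Zz[of N] NZ ZW by simp
   show ?thesis unfolding s
    apply (rule reaches_copy)
    using that s yW e by (auto simp: y_def x_def N_def)
  qed
  have le: "N * Suc (Z + 20) + 1 <= (bh x + 3) * (Z + 24)"
   using mult_le_mono[OF NZ, of "Suc (Z+20)" "Z + 24"] by (simp add: algebra_simps)
  have le2: "2 + (bh x + (1 + (2 + (bf x + (2 + ((N * Suc (Z + 20) + 1) + 2)))))) <= b x"
   using le xZ unfolding bx by (simp add: algebra_simps)
  show "reaches W ?c (R, M) (b (R k)) (%(R', M'). M' = M \<and>
    R' k = rec_nat (f (R k)) (%i y. g (prod_encode (R k, prod_encode (i, y)))) (h (R k)) & (\<forall>j<k. R' j = R j))"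
   apply (rule reaches_mono[where T="2 + (bh x + (1 + (2 + (bf x + (2 + ((N * Suc (Z + 20) + 1) + 2))))))"])
   apply (rule reaches_Scopy)
    apply simp
   using xZ ZW apply (simp add: x_def)
   apply simp
   apply (rule reaches_Seq[where ?T1.0="bh x"])
   apply (rule ch)
   using xZ ZW apply (simp add: x_def)
    apply (simp add: x_def)
   apply (rule reaches_SConst)
    apply (simp, simp)
   apply (rule reaches_Scopy)
     apply simp
   using xZ ZW apply (simp add: x_def)
    apply simp
   apply (rule reaches_Seq[where ?T1.0="bf x"])
    apply (rule cf)
   using xZ ZW apply (simp add: x_def)
    apply (simp add: x_def)
    apply (rule reaches_Scopy)
     apply simp
   using xZ ZW NZ apply (simp add: x_def N_def)
    apply simp
    apply (rule reaches_Seq[where ?T1.0="N * Suc (Z + 20) + 1"])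
    apply (rule reaches_While[where I="?I" and m="%s. fst s (k+4)" and T="Z + 20", OF body])
      apply assumption
     apply assumption
     apply (rule reaches_mono[OF fin])
      apply assumption
      apply assumption
     apply simp
     apply assumption
    apply (simp add: x_def N_def y0)
    apply (simp add: x_def N_def)
   apply simp
   apply simp
   apply simp
   using le2 apply (simp add: x_def)
   apply assumption
   done
 qed
qed

theorem pr_computes: "pr g ==> \<exists>b. computes g b"
 by (induction rule: pr.induct)
  (blast intro: computes_const computes_id computes_fst computes_snd computes_op computes_comp computes_prec)+

section \<open>Encoded data types and primitive recursive functions on them\<close>

class enc =
 fixes cd :: "'a => nat"
 assumes cd_inject: "cd x = cd y ==> x = y"

lemma cd_eq_iff [simp]: "cd x = cd y \<longleftrightarrow> x = y"
 using cd_inject by blast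

instantiation nat :: enc
begin
definition cd_nat :: "nat => nat" where [simp]: "cd_nat x = x"
instance by standard simp
end

instantiation bool :: enc
begin
definition cd_bool :: "bool => nat" where "cd_bool b = of_bool b"
instance by standard (auto simp: cd_bool_def of_bool_def split: if_splits)
end

instantiation prod :: (enc, enc) enc
begin
definition cd_prod :: "'a \<times> 'b => nat" where "cd_prod p = prod_encode (cd (fst p), cd (snd p))"
instance by standard (auto simp: cd_prod_def prod_eq_iff)
end

instantiation list :: (enc) enc
begin
definition cd_list :: "'a list => nat" where "cd_list xs = list_encode (map cd xs)"
instance
proof
 fix xs ys :: "'a list"
 assume "cd xs = cd ys"
 then have "map cd xs = map cd ys" by (simp add: cd_list_def list_encode_eq)
 moreover have "inj (cd :: 'a => nat)" by (rule injI) simp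
 ultimately show "xs = ys" by (metis map_injective)
qed
end

lemma cd_pair [simp]: "cd (a, b) = prod_encode (cd a, cd b)" by (simp add: cd_prod_def)
lemma cd_bools [simp]: "cd True = 1" "cd False = 0" by (simp_all add: cd_bool_def)
lemma cd_Nil [simp]: "cd [] = 0" by (simp add: cd_list_def)
lemma cd_Cons [simp]: "cd (x # xs) = Suc (prod_encode (cd x, cd xs))" by (simp add: cd_list_def)
lemma cd_nat_list: "cd (xs :: nat list) = list_encode xs" by (simp add: cd_list_def map_idI)

lemma length_le_cd: "length xs <= cd xs"
proof (induction xs)
 case (Cons x xs)
 then show ?case using le_prod_encode_2[of "cd xs" "cd x"] by simp
qed simp

definition PR :: "('a::enc => 'b::enc) => bool" where
 "PR f \<longleftrightarrow> (\<exists>g. pr g & (\<forall>x. g (cd x) = cd (f x)))"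

lemma PRI: "pr g ==> (!!x. g (cd x) = cd (f x)) ==> PR f"
 unfolding PR_def by blast

lemma PR_cong: "PR f ==> (!!x. f x = g x) ==> PR g"
 using ext[of f g] by simp

lemma PR_const: "PR (%x. c)"
 by (rule PRI[OF pr.const[of "cd c"]]) simp

lemma PR_id: "PR (%x. x)"
 by (rule PRI[OF pr.id]) simp

lemma PR_comp: "PR f ==> PR g ==> PR (%x. f (g x))"
 unfolding PR_def by (metis pr.comp)

lemma PR_fst: "PR f ==> PR (%x. fst (f x))"
 by (rule PR_comp[of fst], rule PRI[OF pr.fst]) (auto simp: cd_prod_def)

lemma PR_snd: "PR f ==> PR (%x. snd (f x))"
 by (rule PR_comp[of snd], rule PRI[OF pr.snd]) (auto simp: cd_prod_def)

lemma PR_Pair: assumes "PR f" "PR g" shows "PR (%x. (f x, g x))"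
proof -
 obtain f' g' where "pr f'" "pr g'" "\<forall>x. f' (cd x) = cd (f x)" "\<forall>x. g' (cd x) = cd (g x)"
  using assms unfolding PR_def by blast
 then show ?thesis by (intro PRI[OF pr_pair[of f' g']]) auto
qed

lemma PR_comp2: "PR (%p. F (fst p) (snd p)) ==> PR f ==> PR g ==> PR (%x. F (f x) (g x))"
 using PR_comp[of "%p. F (fst p) (snd p)" "%x. (f x, g x)"] PR_Pair[of f g] by simp

lemma PR_comp3: "PR (%p. F (fst p) (fst (snd p)) (snd (snd p))) ==> PR f ==> PR g ==> PR h ==>
  PR (%x. F (f x) (g x) (h x))"
 using PR_comp[of "%p. F (fst p) (fst (snd p)) (snd (snd p))" "%x. (f x, g x, h x)"]
  PR_Pair[of f "%x. (g x, h x)"] PR_Pair[of g h] by simp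

lemma PR_comp4: "PR (%p. F (fst p) (fst (snd p)) (fst (snd (snd p))) (snd (snd (snd p)))) ==>
  PR f ==> PR g ==> PR h ==> PR k ==> PR (%x. F (f x) (g x) (h x) (k x))"
 using PR_comp[of "%p. F (fst p) (fst (snd p)) (fst (snd (snd p))) (snd (snd (snd p)))"
   "%x. (f x, g x, h x, k x)"]
  PR_Pair[of f "%x. (g x, h x, k x)"] PR_Pair[of g "%x. (h x, k x)"] PR_Pair[of h k] by simp

lemma PR_op: assumes "PR f" "PR g" shows "PR (%x. apply_op p (f x) (g x))"
proof -
 obtain f' g' where "pr f'" "pr g'" "\<forall>x. f' (cd x) = cd (f x)" "\<forall>x. g' (cd x) = cd (g x)"
  using assms unfolding PR_def by blast
 then show ?thesis by (intro PRI[OF pr.op[of f' g' p]]) auto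
qed

lemma PR_add: "PR f ==> PR g ==> PR (%x. f x + g x :: nat)" using PR_op[of f g Add] by simp
lemma PR_mult: "PR f ==> PR g ==> PR (%x. f x * g x :: nat)" using PR_op[of f g Mul] by simp
lemma PR_diff: "PR f ==> PR g ==> PR (%x. f x - g x :: nat)" using PR_op[of f g Sub] by simp
lemma PR_div: "PR f ==> PR g ==> PR (%x. f x div g x :: nat)" using PR_op[of f g Div] by simp

lemma PR_mod: assumes "PR f" "PR g" shows "PR (%x. f x mod g x :: nat)"
proof -
 have "PR (%x. f x - f x div g x * g x)" by (intro PR_diff PR_mult PR_div assms)
 then show ?thesis by (simp add: minus_div_mult_eq_mod)
qed

lemma PR_Suc: "PR f ==> PR (%x. Suc (f x))" using PR_add[OF _ PR_const[of 1]] by simp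

lemma PR_cd: "PR f ==> PR (%x. cd (f x))"
 by (rule PR_comp[of cd], rule PRI[OF pr.id]) auto

text \<open>This reduces a function with values in an encoded type to a numeric one; conditionals,
  list constructors and folds thus become arithmetic on codes.\<close>

lemma PR_of_cd:
 assumes "!!x. cd (F x) = f x" "PR f" shows "PR F"
 using assms unfolding PR_def by auto

lemma PR_rec:
 assumes h: "PR (%p. h (fst p) (fst (snd p)) (snd (snd p)))" and f: "PR f" and n: "PR n"
 shows "PR (%x. rec_nat (f x) (%i y. h x i y) (n x))"
proof -
 obtain h' f' n' where p: "pr h'" "pr f'" "pr n'"
  and e: "\<forall>x. h' (cd x) = cd (h (fst x) (fst (snd x)) (snd (snd x)))" "\<forall>x. f' (cd x) = cd (f x)" "\<forall>x. n' (cd x) = cd (n x)"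
  using assms unfolding PR_def by blast
 have "rec_nat (f' (cd x)) (%i y. h' (prod_encode (cd x, prod_encode (i, y)))) m = cd (rec_nat (f x) (h x) m)" for x m
 proof (induction m)
  case (Suc m)
  then show ?case using e(1)[rule_format, of "(x, m, rec_nat (f x) (h x) m)"] by simp
 qed (use e in simp)
 then show ?thesis using e(3) by (intro PRI[OF pr.prec[OF p(2) p(1) p(3)]]) simp
qed

lemma PR_bool_code: "PR P ==> PR (%x. of_bool (P x) :: nat)"
 using PR_cd[of P] by (simp add: cd_bool_def)

lemma PR_If:
 assumes "PR P" "PR f" "PR g" shows "PR (%x. if P x then f x else g x)"
proof (rule PR_of_cd)
 have "PR (%x. of_bool (P x) * cd (f x) + (1 - of_bool (P x)) * cd (g x))"
  by (intro PR_add PR_mult PR_diff PR_bool_code PR_const PR_cd assms)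
 then show "PR (%x. if P x then cd (f x) else cd (g x))"
  by (rule PR_cong) auto
qed auto

lemma PR_not: "PR P ==> PR (%x. \<not> P x)"
 by (rule PR_cong[OF PR_If[of P "%x. False" "%x. True", OF _ PR_const PR_const]]) auto
lemma PR_conj: "PR P ==> PR Q ==> PR (%x. P x & Q x)"
 by (rule PR_cong[OF PR_If[of P Q "%x. False", OF _ _ PR_const]]) auto
lemma PR_disj: "PR P ==> PR Q ==> PR (%x. P x | Q x)"
 by (rule PR_cong[OF PR_If[of P "%x. True" Q, OF _ PR_const]]) auto
lemma PR_imp: "PR P ==> PR Q ==> PR (%x. P x --> Q x)"
 by (rule PR_cong[OF PR_disj[of "%x. \<not> P x" Q, OF PR_not]]) auto

lemma PR_le: assumes "PR f" "PR g" shows "PR (%x. (f x :: nat) <= g x)"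
proof -
 have "PR (%x. 1 - (f x - g x))" by (intro PR_diff PR_const assms)
 then show ?thesis by (rule PR_of_cd[rotated]) (auto simp: cd_bool_def)
qed

lemma PR_less: "PR f ==> PR g ==> PR (%x. (f x :: nat) < g x)"
 using PR_not[OF PR_le[of g f]] by (simp add: not_le)

lemma PR_eq: assumes "PR f" "PR g" shows "PR (%x. f x = g x)"
proof -
 have "PR (%x. cd (f x) <= cd (g x) & cd (g x) <= cd (f x))" by (intro PR_conj PR_le PR_cd assms)
 then show ?thesis by (rule PR_cong) (auto simp: order_eq_iff[symmetric])
qed

lemma PR_power: assumes "PR f" "PR g" shows "PR (%x. (f x :: nat) ^ g x)"
proof -
 have "PR (%x. rec_nat 1 (%i y. f x * y) (g x))"
  by (intro PR_rec PR_mult PR_comp[OF assms(1)] PR_fst PR_snd PR_id PR_const assms)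
 moreover have "rec_nat 1 (%i y. a * y) n = a ^ n" for a n :: nat by (induction n) auto
 ultimately show ?thesis by simp
qed

lemma PR_Cons: "PR f ==> PR g ==> PR (%x. f x # g x)"
 by (rule PR_of_cd[of _ "%x. Suc (cd (f x, g x))"]) (simp, intro PR_Suc PR_cd PR_Pair)

lemma PR_list_decode: "PR f ==> PR (%x. list_decode (f x))"
 by (rule PR_of_cd[of _ f]) (auto simp: cd_nat_list)

lemma PR_list_encode: "PR f ==> PR (%x. list_encode (f x))"
 using PR_cd[of f] by (auto simp: cd_nat_list)

text \<open>Folding over a list iterates over the code of the list, which is at least its length.\<close>

lemma PR_fold:
 assumes h: "PR (%p. h (fst p) (fst (snd p)) (snd (snd p)))" and L: "PR L" and s: "PR s"
 shows "PR (%x. fold (%a y. h x a y) (L x) (s x))"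
proof -
 obtain h' where p: "pr h'" and e: "h' (cd x) = cd (h (fst x) (fst (snd x)) (snd (snd x)))" for x
  using h unfolding PR_def by blast
 \<comment> \<open>The state consists of the codes of the remaining list and of the accumulator. A
   nonempty list has a positive code whose predecessor is the pair of head and tail. A state with
   empty list is left unchanged, so surplus iterations are harmless.\<close>
 let ?st = "%x i (p :: nat \<times> nat). if fst p = 0 then p
  else (psnd (fst p - 1), h' (prod_encode (cd x, prod_encode (pfst (fst p - 1), snd p))))"
 have ph': "PR h'" by (rule PRI[OF p]) simp
 have pf: "PR pfst" "PR psnd" by (rule PRI[OF pr.fst], simp) (rule PRI[OF pr.snd], simp)
 have pe: "PR f ==> PR g ==> PR (%x. prod_encode (f x, g x))" for f g :: "'z::enc => nat"
  using PR_cd[OF PR_Pair[of f g]] by simp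
 have "PR (%x. snd (rec_nat (cd (L x), cd (s x)) (?st x) (cd (L x))))"
  by (intro PR_snd PR_rec PR_If PR_eq PR_fst PR_id PR_const PR_Pair PR_comp[OF pf(2)] PR_diff
    PR_comp[OF ph'] pe PR_comp[OF pf(1)] PR_cd L s)
 moreover have "rec_nat (cd xs, cd y) (?st x) n = (cd (drop n xs), cd (fold (h x) (take n xs) y))" for x xs y n
 proof (induction n)
  case 0 then show ?case by simp
 next
  case (Suc n)
  show ?case
  proof (cases "length xs <= n")
   case True then show ?thesis using Suc by simp
  next
   case False
   then have d: "drop n xs = xs ! n # drop (Suc n) xs" and t: "take (Suc n) xs = take n xs @ [xs ! n]"
    by (simp_all add: Cons_nth_drop_Suc take_Suc_conv_app_nth)
   show ?thesis using Suc d t e[of "(x, xs ! n, fold (h x) (take n xs) y)"] by simp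
  qed
 qed
 ultimately have "PR (%x. cd (fold (h x) (L x) (s x)))" by (simp add: length_le_cd)
 then show ?thesis by (rule PR_of_cd[rotated]) simp
qed

text \<open>Total variants of \<open>hd\<close>, \<open>tl\<close> and \<open>nth\<close>.\<close>

definition hdd :: "'a => 'a list => 'a" where "hdd d xs = (if xs = [] then d else hd xs)"
definition nthd :: "'a => 'a list => nat => 'a" where "nthd d xs i = (if i < length xs then xs ! i else d)"

section \<open>Primitive recursive list functions\<close>

text \<open>Most list functions below are shown primitive recursive by writing them as folds; these
  equations identify the folds.\<close>

lemma fold_eq1: "fold (%a y. a # y) xs ys = rev xs @ ys"
 by (induction xs arbitrary: ys) auto

lemma fold_eq2: "fold (%a y. a # y) (rev xs) ys = xs @ ys"
 by (induction xs arbitrary: ys) auto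

lemma fold_eq3: "fold (%a y. g a # y) xs ys = rev (map g xs) @ ys"
 by (induction xs arbitrary: ys) auto

lemma fold_eq4: "fold (%a y. y @ a) xs ys = ys @ concat xs"
 by (induction xs arbitrary: ys) auto

lemma fold_eq5: "concat (map (%a. if g a then [a] else []) xs) = filter g xs"
 by (induction xs) auto

lemma fold_eq6: "fold (%a y. y + a) xs (y::nat) = y + sum_list xs"
 by (induction xs arbitrary: y) auto

lemma fold_eq7: "fold (%a y. y & g a) xs y = (y & (\<forall>a\<in>set xs. g a))"
 by (induction xs arbitrary: y) auto

lemma fold_eq8: "fold (%a y. a) (rev xs) d = hdd d xs"
 by (cases xs) (auto simp: hdd_def)

lemma fold_eq9: "fold (%a p. if fst p < m then (Suc (fst p), snd p) else (fst p, snd p @ [a])) xs (k, ys)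
  = (max k (min m (k + length xs)), ys @ drop (m - k) xs)"
 by (induction xs arbitrary: k ys) (auto simp: max_def min_def drop_Cons')

lemma fold_eq10: "hdd d (drop i xs) = nthd d xs i"
 by (auto simp: hdd_def nthd_def hd_drop_conv_nth)

lemma PR_rev: assumes "PR L" shows "PR (%x. rev (L x))"
proof -
 have "PR (%x. fold (%a y. a # y) (L x) [])"
  by (intro PR_fold PR_Cons PR_fst PR_snd PR_id PR_const assms)
 then show ?thesis by (simp add: fold_eq1)
qed

lemma PR_append: assumes "PR L" "PR K" shows "PR (%x. L x @ K x)"
proof -
 have "PR (%x. fold (%a y. a # y) (rev (L x)) (K x))"
  by (intro PR_fold PR_Cons PR_fst PR_snd PR_id PR_const PR_rev assms)
 then show ?thesis by (simp add: fold_eq2)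
qed

lemma PR_map:
 assumes h: "PR (%p. h (fst p) (snd p))" and L: "PR L"
 shows "PR (%x. map (%a. h x a) (L x))"
proof -
 have "PR (%x. rev (fold (%a y. h x a # y) (L x) []))"
  by (intro PR_rev PR_fold PR_Cons PR_comp2[OF h] PR_fst PR_snd PR_id PR_const assms)
 then show ?thesis by (simp add: fold_eq3)
qed

lemma PR_concat: assumes "PR L" shows "PR (%x. concat (L x))"
proof -
 have "PR (%x. fold (%a y. y @ a) (L x) [])"
  by (intro PR_fold PR_append PR_fst PR_snd PR_id PR_const assms)
 then show ?thesis by (simp add: fold_eq4)
qed

lemma PR_filter:
 assumes h: "PR (%p. h (fst p) (snd p))" and L: "PR L"
 shows "PR (%x. filter (%a. h x a) (L x))"
proof -
 have "PR (%x. concat (map (%a. if h x a then [a] else []) (L x)))"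
  by (intro PR_concat PR_map PR_If PR_comp2[OF h] PR_Cons PR_fst PR_snd PR_id PR_const assms)
 then show ?thesis by (simp add: fold_eq5)
qed

lemma PR_sum_list: assumes "PR L" shows "PR (%x. sum_list (L x) :: nat)"
proof -
 have "PR (%x. fold (%a y. y + a) (L x) 0)"
  by (intro PR_fold PR_add PR_fst PR_snd PR_id PR_const assms)
 then show ?thesis by (simp add: fold_eq6)
qed

lemma PR_length: assumes "PR L" shows "PR (%x. length (L x))"
proof -
 have "PR (%x. sum_list (map (%a. 1::nat) (L x)))" by (intro PR_sum_list PR_map PR_const assms)
 then show ?thesis by (simp add: sum_list_triv)
qed

lemma PR_upt: assumes "PR f" "PR g" shows "PR (%x. [f x..<g x])"
proof -
 have "PR (%x. rev (rec_nat [] (%i y. (f x + i) # y) (g x - f x)))"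
  by (intro PR_rev PR_rec PR_Cons PR_add PR_diff PR_comp[OF assms(1)] PR_fst PR_snd PR_id PR_const assms)
 moreover have "rev (rec_nat [] (%i y. (a + i) # y) n) = [a..<a + n]" for a n by (induction n) auto
 ultimately have "PR (%x. [f x..<f x + (g x - f x)])" by simp
 moreover have "[a..<a + (b - a)] = [a..<b]" for a b :: nat by (cases "a <= b") auto
 ultimately show ?thesis by simp
qed

lemma PR_ball:
 assumes h: "PR (%p. h (fst p) (snd p))" and L: "PR L"
 shows "PR (%x. \<forall>a\<in>set (L x). h x a)"
proof -
 have "PR (%x. fold (%a y. y & h x a) (L x) True)"
  by (intro PR_fold PR_conj PR_comp2[OF h] PR_fst PR_snd PR_id PR_const assms)
 then show ?thesis by (simp add: fold_eq7)
qed

lemma PR_bex: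
 assumes h: "PR (%p. h (fst p) (snd p))" and L: "PR L"
 shows "PR (%x. \<exists>a\<in>set (L x). h x a)"
 using PR_not[OF PR_ball[OF PR_not[OF h] L]] by simp

lemma PR_in_set: "PR f ==> PR L ==> PR (%x. f x \<in> set (L x))"
proof -
 assume f: "PR f" and L: "PR L"
 have "PR (%x. \<exists>a\<in>set (L x). a = f x)"
  by (intro PR_bex PR_eq PR_fst PR_snd PR_id PR_comp[OF f] L)
 then show ?thesis by simp
qed

lemma PR_hdd: assumes "PR d" "PR L" shows "PR (%x. hdd (d x) (L x))"
proof -
 have "PR (%x. fold (%a y. a) (rev (L x)) (d x))"
  by (intro PR_fold PR_rev PR_fst PR_snd PR_id assms)
 then show ?thesis by (simp add: fold_eq8)
qed

lemma PR_drop: assumes "PR n" "PR L" shows "PR (%x. drop (n x) (L x))"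
proof -
 have "PR (%x. snd (fold (%a p. if fst p < n x then (Suc (fst p), snd p) else (fst p, snd p @ [a])) (L x) (0, [])))"
  by (intro PR_snd PR_fold PR_If PR_less PR_Pair PR_Suc PR_append PR_Cons PR_fst PR_id PR_const PR_comp[OF assms(1)] assms)
 then show ?thesis by (simp add: fold_eq9)
qed

lemma PR_tl: "PR L ==> PR (%x. tl (L x))"
 using PR_drop[OF PR_const[of 1]] by (simp add: drop_Suc)

lemma PR_take: assumes "PR n" "PR L" shows "PR (%x. take (n x) (L x))"
proof -
 have "PR (%x. rev (drop (length (L x) - n x) (rev (L x))))"
  by (intro PR_rev PR_drop PR_diff PR_length assms)
 moreover have "take (length xs - (length xs - n)) xs = take n xs" for n and xs :: "'b list"
  by (cases "n <= length xs") auto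
 ultimately show ?thesis by (simp add: rev_drop)
qed

lemma PR_nthd: assumes "PR d" "PR L" "PR i" shows "PR (%x. nthd (d x) (L x) (i x))"
proof -
 have "PR (%x. hdd (d x) (drop (i x) (L x)))" by (intro PR_hdd PR_drop assms)
 then show ?thesis by (simp add: fold_eq10)
qed

lemma PR_replicate: assumes "PR n" "PR f" shows "PR (%x. replicate (n x) (f x))"
proof -
 have "PR (%x. map (%i. f x) [0..<n x])"
  by (intro PR_map PR_upt PR_comp[OF assms(2)] PR_fst PR_id PR_const assms)
 then show ?thesis by (simp add: map_replicate_trivial)
qed

lemmas PR_intros = PR_const PR_id PR_fst PR_snd PR_Pair PR_add PR_mult PR_diff PR_div PR_mod PR_Suc
 PR_cd PR_If PR_not PR_conj PR_disj PR_imp PR_le PR_less PR_eq PR_power PR_Cons PR_list_decode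
 PR_list_encode PR_rev PR_append PR_map PR_concat PR_filter PR_sum_list PR_length PR_upt PR_ball
 PR_bex PR_in_set PR_hdd PR_drop PR_take PR_nthd PR_tl PR_replicate PR_bool_code

section \<open>Recursion over finitely branching trees\<close>

text \<open>A recursion that branches over \<open>A x\<close> changes its parameter, so it is no
  direct instance of \<open>rec_nat\<close>. It is run on whole levels instead:
  \<open>levels\<close> unfolds the tree from the root downwards, and \<open>collapse\<close>
  evaluates one level from the results of the next, each node taking as many results from the front
  as it has children.\<close>

definition collapse :: "('a => 'a list) => ('a => 'b list => 'b) => 'a list => 'b list => 'b list" where
 "collapse A C ys rs = fst (fold (%y st. (fst st @ [C y (take (length (A y)) (snd st))], drop (length (A y)) (snd st)))
  ys ([], rs))"

definition levels :: "('a => 'a list) => 'a => nat => 'a list list" where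
 "levels A x n = rec_nat [[x]] (%i ls. concat (map A (hdd [] ls)) # ls) n"

lemma collapse_map:
 assumes "!!x. F (Suc n) x = C x (map (F n) (A x))"
 shows "collapse A C L (map (F n) (concat (map A L))) = map (F (Suc n)) L"
proof -
 have "fold (%y st. (fst st @ [C y (take (length (A y)) (snd st))], drop (length (A y)) (snd st)))
  L (acc, map (F n) (concat (map A L)) @ rest) = (acc @ map (F (Suc n)) L, rest)" for acc rest
  by (induction L arbitrary: acc) (auto simp: assms)
 from this[of "[]" "[]"] show ?thesis unfolding collapse_def by simp
qed

lemma levels_ne: "levels A x n ~= []" by (cases n) (auto simp: levels_def)

lemma fold_collapse_levels:
 assumes "!!n x. F (Suc n) x = C x (map (F n) (A x))"
 shows "fold (%ys rs. collapse A C ys rs) (tl (levels A x n)) (map (F m) (hd (levels A x n))) = [F (m + n) x]"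
proof (induction n arbitrary: m)
 case 0 then show ?case by (simp add: levels_def)
next
 case (Suc n)
 have l: "levels A x (Suc n) = concat (map A (hd (levels A x n))) # levels A x n"
  using levels_ne[of A x n] by (simp add: levels_def hdd_def)
 obtain D ls where D: "levels A x n = D # ls" using levels_ne by (meson neq_Nil_conv)
 show ?case using Suc[of "Suc m"] unfolding l D
  by (simp add: collapse_map[where F=F and n=m and C=C and A=A, OF assms])
qed

lemma PR_tree_rec:
 fixes F :: "nat => 'a::enc => 'b::enc"
 assumes A: "PR A" and C: "PR (%p. C (fst p) (snd p))" and g: "PR g"
  and F: "!!x. F 0 x = g x" "!!n x. F (Suc n) x = C x (map (F n) (A x))"
  and n: "PR n" and X: "PR X"
 shows "PR (%y. F (n y) (X y))"
proof -
 have col: "PR (%p. collapse A C (fst p) (snd p))" unfolding collapse_def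
  by (intro PR_intros PR_fold PR_comp2[OF C] PR_comp[OF A])
 have lev: "PR (%y. levels A (X y) (n y))" unfolding levels_def
  by (intro PR_intros PR_rec PR_comp[OF A] n X)
 have "PR (%y. hdd (g (X y)) (fold (%ys rs. collapse A C ys rs) (tl (levels A (X y) (n y)))
   (map g (hdd [] (levels A (X y) (n y))))))"
  by (intro PR_hdd PR_fold PR_comp2[OF col] PR_intros lev PR_comp[OF g] X)
 moreover have "map g L = map (F 0) L" for L by (simp add: F(1))
 moreover have "hdd [] (levels A x m) = hd (levels A x m)" for x m
  using levels_ne[of A x m] by (simp add: hdd_def)
 ultimately show ?thesis using fold_collapse_levels[where F=F and C=C and A=A and m=0, OF F(2)]
  by (simp add: hdd_def)
qed

text \<open>A bound and, below, a program are chosen once for each function, so that the compiler, a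
  function on syntax, can refer to them.\<close>

definition bnd :: "(nat => nat) => nat => nat" where "bnd g = (SOME b. computes g b)"

lemma computes_bnd: "pr g ==> computes g (bnd g)"
 unfolding bnd_def using pr_computes by (rule someI_ex)

definition pr_prog :: "(nat => nat) => nat => prog" where
 "pr_prog g k = (SOME c. \<forall>W R M T Q. bnd g (R k) <= W --> bnd g (R k) <= T -->
   (\<forall>R'. R' k = g (R k) --> (\<forall>j<k. R' j = R j) --> Q (R', M)) --> reaches W c (R, M) T Q)"

lemma reaches_pr_prog:
 assumes "pr g" "bnd g (R k) <= W" "bnd g (R k) <= T"
  "!!R'. R' k = g (R k) ==> \<forall>j<k. R' j = R j ==> Q (R', M)"
 shows "reaches W (pr_prog g k) (R, M) T Q"
proof -
 let ?P = "%c. \<forall>W R M T Q. bnd g (R k) <= W --> bnd g (R k) <= T -->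
   (\<forall>R'. R' k = g (R k) --> (\<forall>j<k. R' j = R j) --> Q (R', M)) --> reaches W c (R, M) T Q"
 obtain c where c: "!!W R M T Q. bnd g (R k) <= W ==> bnd g (R k) <= T ==>
   (!!R'. R' k = g (R k) ==> \<forall>j<k. R' j = R j ==> Q (R', M)) ==> reaches W c (R, M) T Q"
  using computesE[OF computes_bnd[OF assms(1)], where k=k] by blast
 then have "\<exists>c. ?P c" by blast
 then have "?P (pr_prog g k)" unfolding pr_prog_def by (rule someI_ex)
 then show ?thesis using assms by blast
qed

section \<open>A structured language and its compiler\<close>

text \<open>A structured language with expressions, bounded loops, read-only input cells and
 three-dimensional arrays. The entry \<open>(c, i, j)\<close> of the array is kept behind the input at the address given by
 the pairing function, so that no stride has to be known; register 1 holds the length of the input.\<close>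

datatype ex =
  Cst nat
 | Var nat
 | Bin operation ex ex
 | Pr ex ex
 | Ap "nat => nat" ex
 | Inp ex
 | Arr nat ex ex

datatype com =
  Nop
 | Asg nat ex
 | Sto nat ex ex ex
 | Sq com com
 | Cnd ex com com
 | For nat ex com

type_synonym state = "(nat => nat) \<times> (nat => nat => nat => nat)"

fun val :: "nat list => state => ex => nat" where
 "val xs s (Cst n) = n"
| "val xs s (Var r) = fst s r"
| "val xs s (Bin f a b) = apply_op f (val xs s a) (val xs s b)"
| "val xs s (Pr a b) = prod_encode (val xs s a, val xs s b)"
| "val xs s (Ap g a) = g (val xs s a)"
| "val xs s (Inp a) = xs ! val xs s a"
| "val xs s (Arr c a b) = snd s c (val xs s a) (val xs s b)"

text \<open>The number \<open>C\<close> bounds the cost of every call of a primitive recursive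
  function. An expression then takes at most \<open>esz e * Suc C\<close> steps
  (\<open>ecomp_correct\<close>), whatever the values of its variables are.\<close>

fun eok :: "nat list => nat => state => ex => bool" where
 "eok xs C s (Cst n) = True"
| "eok xs C s (Var r) = True"
| "eok xs C s (Bin f a b) = (eok xs C s a & eok xs C s b)"
| "eok xs C s (Pr a b) = (eok xs C s a & eok xs C s b)"
| "eok xs C s (Ap g a) = (eok xs C s a & pr g & bnd g (val xs s a) <= C)"
| "eok xs C s (Inp a) = (eok xs C s a & val xs s a < length xs)"
| "eok xs C s (Arr c a b) = (eok xs C s a & eok xs C s b)"

fun evars :: "ex => nat set" where
 "evars (Cst n) = {}"
| "evars (Var r) = {r}"
| "evars (Bin f a b) = evars a \<union> evars b"
| "evars (Pr a b) = evars a \<union> evars b"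
| "evars (Ap g a) = evars a"
| "evars (Inp a) = evars a"
| "evars (Arr c a b) = insert 1 (evars a \<union> evars b)"

fun esz :: "ex => nat" where
 "esz (Cst n) = 1"
| "esz (Var r) = 2"
| "esz (Bin f a b) = esz a + esz b + 1"
| "esz (Pr a b) = esz a + esz b + 9"
| "esz (Ap g a) = esz a + 1"
| "esz (Inp a) = esz a + 1"
| "esz (Arr c a b) = esz a + esz b + 17"

text \<open>This bounds the intermediate values when registers, array entries and input are at most
  \<open>B\<close>; a function value is at most \<open>C <= B\<close>. The bound is polynomial in
  \<open>B\<close> (\<open>emax_poly\<close>), which is why words of polynomial size
  suffice.\<close>

fun emax :: "nat => ex => nat" where
 "emax B (Cst n) = n + B"
| "emax B (Var r) = B"
| "emax B (Bin f a b) = emax B a * emax B b + emax B a + emax B b"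
| "emax B (Pr a b) = 2 * ((emax B a + emax B b + 1) * (emax B a + emax B b + 1)) + 2"
| "emax B (Ap g a) = B + emax B a"
| "emax B (Inp a) = B + emax B a"
| "emax B (Arr c a b) = (let p = (emax B a + emax B b + 1) * (emax B a + emax B b + 1) in
  2 * ((c + p + 1) * (c + p + 1)) + 2 + 2 * p + B + c)"

fun ecomp :: "ex => nat => prog" where
 "ecomp (Cst n) k = Const k n"
| "ecomp (Var r) k = copy k r"
| "ecomp (Bin f a b) k = Seq (ecomp a k) (Seq (ecomp b (k+1)) (Oper f k k (k+1)))"
| "ecomp (Pr a b) k = Seq (ecomp a k) (Seq (ecomp b (k+1)) (Seq (pair_prog (k+2) k (k+1)) (copy k (k+2))))"
| "ecomp (Ap g a) k = Seq (ecomp a k) (pr_prog g k)"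
| "ecomp (Inp a) k = Seq (ecomp a k) (Load k k)"
| "ecomp (Arr c a b) k = Seq (ecomp a k) (Seq (ecomp b (k+1)) (Seq (pair_prog (k+2) k (k+1))
  (Seq (Const (k+1) c) (Seq (pair_prog (k+3) (k+1) (k+2)) (Seq (Oper Add k (k+3) 1) (Load k k))))))"

definition addr :: "nat list => nat => nat => nat => nat" where
 "addr xs c i j = prod_encode (c, prod_encode (i, j)) + length xs"

definition mem :: "nat list => (nat => nat => nat => nat) => nat => nat" where
 "mem xs A a = (if a < length xs then xs ! a else
  (let p = prod_decode (a - length xs); q = prod_decode (snd p) in A (fst p) (fst q) (snd q)))"

lemma mem_addr [simp]: "mem xs A (addr xs c i j) = A c i j"
 by (simp add: mem_def addr_def)

lemma mem_Inp [simp]: "a < length xs ==> mem xs A a = xs ! a"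
 by (simp add: mem_def)

lemma mem_update: "(mem xs A)(addr xs c i j := v) = mem xs (A(c := (A c)(i := (A c i)(j := v))))"
proof (rule ext)
 fix a
 obtain c' q where 1: "prod_decode (a - length xs) = (c', q)" by fastforce
 obtain i' j' where 2: "prod_decode q = (i', j')" by fastforce
 have q: "q = prod_encode (i', j')" using 2 by (metis prod_decode_inverse)
 have "a - length xs = prod_encode (c', q)" using 1 by (metis prod_decode_inverse)
 then have "a < length xs | a = addr xs c' i' j'" unfolding addr_def q by linarith
 then show "((mem xs A)(addr xs c i j := v)) a = mem xs (A(c := (A c)(i := (A c i)(j := v)))) a"
 proof
  assume a: "a < length xs"
  then have "a ~= addr xs c i j" by (simp add: addr_def)
  then show ?thesis using a by simp
 next
  assume a: "a = addr xs c' i' j'"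
  have inj: "addr xs c i j = addr xs c' i' j' \<longleftrightarrow> c = c' & i = i' & j = j'" by (auto simp: addr_def)
  show ?thesis unfolding a using inj by auto
 qed
qed

text \<open>The bound \<open>B\<close> on all data is part of the relation, so that a triple may
  assume it (\<open>hl_small\<close>).\<close>

definition rep :: "nat list => nat => nat => state => (nat => nat) \<times> (nat => nat) => bool" where
 "rep xs K B s t \<longleftrightarrow> (\<forall>r<K. fst t r = fst s r & fst s r <= B) & snd t = mem xs (snd s) \<and>
  (\<forall>c i j. snd s c i j <= B) & (\<forall>x\<in>set xs. x <= B) & length xs <= B"

lemma rep_cong: "rep xs K B s (R, M) ==> \<forall>j<K. R' j = R j ==> rep xs K B s (R', M)"
 unfolding rep_def by auto

lemma pe_le: "a <= x ==> b <= y ==> prod_encode (a, b) <= (x + y + 1) * (x + y + 1)"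
 using prod_encode_bound[of a b] mult_le_mono[of "a+b+1" "x+y+1" "a+b+1" "x+y+1"] by linarith

lemma val_le_emax:
 assumes "rep xs K B s t" "eok xs C s e" "C <= B" "evars e \<subseteq> {..<K}"
 shows "val xs s e <= emax B e"
 using assms(2,4)
proof (induction e)
 case (Var r) then show ?case using assms(1) by (auto simp: rep_def)
next
 case (Bin f a b)
 then show ?case using apply_op_le[of f "val xs s a" "val xs s b"] mult_le_mono[of "val xs s a" "emax B a" "val xs s b" "emax B b"]
  by simp
next
 case (Pr a b)
 then show ?case using pe_le[of "val xs s a" "emax B a" "val xs s b" "emax B b"] by simp
next
 case (Ap g a)
 then show ?case using computesD(2)[OF computes_bnd, of g "val xs s a"] assms(3) by simp
next
 case (Inp a)
 then have "xs ! val xs s a \<in> set xs" by simp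
 then have "xs ! val xs s a <= B" using assms(1) unfolding rep_def by blast
 then show ?case by simp
next
 case (Arr c a b)
 have "snd s c (val xs s a) (val xs s b) <= B" using assms(1) by (auto simp: rep_def)
 then show ?case by (simp add: Let_def)
qed (use assms in auto)

lemma ecomp_correct:
 assumes rep: "rep xs K B s (R, M)" and ok: "eok xs C s e" and CB: "C <= B" and ev: "evars e \<subseteq> {..<K}"
  and R1: "1 \<in> evars e ==> fst s 1 = length xs" and W: "emax B e <= W" and k: "K <= k"
  and T: "esz e * Suc C <= T" and Q: "!!R'. R' k = val xs s e ==> \<forall>j<k. R' j = R j ==> Q (R', M)"
  and K: "1 < K"
 shows "reaches W (ecomp e k) (R, M) T Q"
 using rep ok ev R1 W k T Q
proof (induction e arbitrary: R k T Q)
 case (Cst n) then show ?case by (auto intro!: reaches_Const)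
next
 case (Var r)
 have "R r = fst s r & fst s r <= B" using Var.prems(1,3) by (auto simp: rep_def)
 then show ?case using Var by (auto intro!: reaches_copy)
next
 case (Bin f a b)
 have va: "val xs s a <= emax B a" "val xs s b <= emax B b" 
  using val_le_emax[OF Bin.prems(1) _ CB] Bin.prems by auto
 have r: "apply_op f (val xs s a) (val xs s b) <= W"
  using val_le_emax[OF Bin.prems(1,2) CB Bin.prems(3)] Bin.prems(5) by simp
 show ?case unfolding ecomp.simps
  apply (rule reaches_Seq[where ?T1.0="esz a * Suc C"])
  apply (rule Bin.IH(1))
  using Bin.prems apply (simp_all)[7]
  apply (rule reaches_Seq[where ?T1.0="esz b * Suc C"])
   apply (rule Bin.IH(2))
      apply (rule rep_cong[OF Bin.prems(1)])
  using Bin.prems K apply (simp_all add: algebra_simps)[7]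
   apply (rule reaches_Oper)
    apply (simp add: r)
  using Bin.prems apply (simp add: algebra_simps)
   apply simp
   apply (rule Bin.prems(8))
   apply simp
   apply simp
  using Bin.prems apply (simp_all add: algebra_simps)
  done
next
 case (Pr a b)
 have va: "val xs s a <= emax B a" "val xs s b <= emax B b" 
  using val_le_emax[OF Pr.prems(1) _ CB] Pr.prems by auto
 have r: "2 * prod_encode (val xs s a, val xs s b) + 2 <= W"
  using pe_le[OF va] Pr.prems(5) by simp
 show ?case unfolding ecomp.simps
  apply (rule reaches_Seq[where ?T1.0="esz a * Suc C"])
  apply (rule Pr.IH(1))
  using Pr.prems apply (simp_all)[7]
  apply (rule reaches_Seq[where ?T1.0="esz b * Suc C"])
   apply (rule Pr.IH(2))
      apply (rule rep_cong[OF Pr.prems(1)])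
  using Pr.prems K apply (simp_all add: algebra_simps)[7]
   apply (rule reaches_Spair_prog)
     apply simp
    apply simp
  using r apply simp
  using Pr.prems apply (simp add: algebra_simps)
   apply (rule reaches_copy)
    apply simp
  using r apply simp
  using Pr.prems apply (simp add: algebra_simps)
   apply simp
   apply (rule Pr.prems(8))
   apply simp
   apply simp
  using Pr.prems apply (simp_all add: algebra_simps)
  done
next
 case (Ap g a)
 show ?case unfolding ecomp.simps
  apply (rule reaches_Seq[where ?T1.0="esz a * Suc C"])
  apply (rule Ap.IH)
  using Ap.prems apply (simp_all)[7]
  apply (rule reaches_pr_prog)
  using Ap.prems apply simp
  using Ap.prems CB apply simp
  using Ap.prems apply (clarsimp, linarith)
  apply (rule Ap.prems(8))
   apply simp
  apply simp
  using Ap.prems apply simp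
  done
next
 case (Inp a)
 have "val xs s (Inp a) <= W" using val_le_emax[OF Inp.prems(1,2) CB Inp.prems(3)] Inp.prems(5) by simp
 moreover have "M (val xs s a) = val xs s (Inp a)" using Inp.prems(1,2) by (simp add: rep_def)
 ultimately show ?case unfolding ecomp.simps
  apply -
  apply (rule reaches_Seq[where ?T1.0="esz a * Suc C"])
  apply (rule Inp.IH)
  using Inp.prems apply (simp_all)[7]
  apply (rule reaches_Load)
   apply simp
  using Inp.prems apply simp
  apply simp
  apply (rule Inp.prems(8))
   apply simp
  apply simp
  using Inp.prems apply simp
  done
next
 case (Arr c a b)
 have va: "val xs s a <= emax B a" "val xs s b <= emax B b" 
  using val_le_emax[OF Arr.prems(1) _ CB] Arr.prems by auto
 define p where "p = prod_encode (val xs s a, val xs s b)"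
 have p: "p <= (emax B a + emax B b + 1) * (emax B a + emax B b + 1)" unfolding p_def by (rule pe_le[OF va])
 have r: "2 * p + 2 <= W" "c <= W" using p Arr.prems(5) by (simp_all add: Let_def)
 have r3: "2 * prod_encode (c, p) + 2 + length xs <= W"
  using pe_le[OF order_refl[of c] p] Arr.prems(5) Arr.prems(1) by (simp add: Let_def rep_def)
 have "val xs s (Arr c a b) <= W" using val_le_emax[OF Arr.prems(1,2) CB Arr.prems(3)] Arr.prems(5) by simp
 moreover have "M (prod_encode (c, p) + length xs) = val xs s (Arr c a b)"
  using Arr.prems(1) mem_addr[of xs "snd s" c] unfolding p_def addr_def by (simp add: rep_def)
 ultimately have ld: "M (prod_encode (c, p) + length xs) <= W" "M (prod_encode (c, p) + length xs) = val xs s (Arr c a b)"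
  by simp_all
 have R1: "R 1 = length xs" using Arr.prems(1,4) K by (auto simp: rep_def)
 have k: "1 < k" using K Arr.prems(6) by simp
 show ?case unfolding ecomp.simps
  apply (rule reaches_Seq[where ?T1.0="esz a * Suc C"])
  apply (rule Arr.IH(1))
  using Arr.prems apply (simp_all)[7]
  apply (rule reaches_Seq[where ?T1.0="esz b * Suc C"])
   apply (rule Arr.IH(2))
      apply (rule rep_cong[OF Arr.prems(1)])
  using Arr.prems K apply (simp_all add: algebra_simps Let_def)[7]
   apply (rule reaches_Spair_prog)
     apply simp
    apply simp
  using r apply (simp add: p_def)
  using Arr.prems apply (simp add: algebra_simps)
   apply (rule reaches_SConst)
  using r apply simp
  using Arr.prems apply (simp add: algebra_simps)
   apply (rule reaches_Spair_prog)
     apply simp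
    apply simp
  using r3 apply (simp add: p_def)
  using Arr.prems apply (simp add: algebra_simps)
   apply (rule reaches_SOper)
  using r3 R1 k apply (simp add: p_def)
  using Arr.prems apply (simp add: algebra_simps)
   apply (rule reaches_Load)
  using ld(1) R1 k apply (simp add: p_def)
  using Arr.prems apply (simp add: algebra_simps)
   apply (rule Arr.prems(8))
  using ld(2) R1 k apply (simp add: p_def)
   apply simp
  using Arr.prems apply (simp_all add: algebra_simps)
  done
qed

text \<open>A loop has no static cost: its time depends on the number of iterations and is stated by
  \<open>hl_For\<close>.\<close>

fun csz :: "com => nat" where
 "csz Nop = 1"
| "csz (Asg r e) = esz e + 2"
| "csz (Sto c e1 e2 e3) = esz e1 + esz e2 + esz e3 + 20"
| "csz (Sq a b) = csz a + csz b"
| "csz (Cnd e a b) = esz e + csz a + csz b + 1"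
| "csz (For r e b) = 0"

fun cvars :: "com => nat set" where
 "cvars Nop = {}"
| "cvars (Asg r e) = insert r (evars e)"
| "cvars (Sto c e1 e2 e3) = insert 1 (evars e1 \<union> evars e2 \<union> evars e3)"
| "cvars (Sq a b) = cvars a \<union> cvars b"
| "cvars (Cnd e a b) = evars e \<union> cvars a \<union> cvars b"
| "cvars (For r e b) = insert r (evars e \<union> cvars b)"

fun asgs :: "com => nat set" where
 "asgs (Asg r e) = {r}"
| "asgs (Sq a b) = asgs a \<union> asgs b"
| "asgs (Cnd e a b) = asgs a \<union> asgs b"
| "asgs (For r e b) = insert r (asgs b)"
| "asgs _ = {}"

fun cmax :: "nat => com => nat" where
 "cmax B Nop = 0"
| "cmax B (Asg r e) = emax B e"
| "cmax B (Sto c e1 e2 e3) = emax B (Arr c e1 e2) + emax B e1 + emax B e2 + emax B e3"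
| "cmax B (Sq a b) = cmax B a + cmax B b"
| "cmax B (Cnd e a b) = emax B e + cmax B a + cmax B b"
| "cmax B (For r e b) = emax B e + cmax B b + B + 1"

fun ccomp :: "com => nat => prog" where
 "ccomp Nop k = Skip"
| "ccomp (Asg r e) k = Seq (ecomp e k) (copy r k)"
| "ccomp (Sto c e1 e2 e3) k = Seq (ecomp e1 k) (Seq (ecomp e2 (k+1)) (Seq (pair_prog (k+2) k (k+1))
  (Seq (Const (k+1) c) (Seq (pair_prog (k+3) (k+1) (k+2)) (Seq (Oper Add k (k+3) 1)
  (Seq (ecomp e3 (k+1)) (Store k (k+1))))))))"
| "ccomp (Sq a b) k = Seq (ccomp a k) (ccomp b k)"
| "ccomp (Cnd e a b) k = Seq (ecomp e k) (If k (ccomp a k) (ccomp b k))"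
| "ccomp (For r e b) k = Seq (ecomp e k) (Seq (Const (k+1) 0) (Seq (copy (k+2) k) (While (k+2)
  (Seq (copy r (k+1)) (Seq (ccomp b (k+3)) (Seq (Const (k+2) 1) (Seq (Oper Add (k+1) (k+1) (k+2))
  (Oper Sub (k+2) k (k+1)))))))))"

text \<open>The level \<open>k\<close> is the first register that the code may use as scratch: the registers from
 \<open>K\<close> up to \<open>k\<close> hold the limits and counters of the enclosing loops.\<close>

definition hl_post :: "nat list => nat => nat => nat => (nat => nat) => (state => bool) =>
  (nat => nat) \<times> (nat => nat) => bool" where
 "hl_post xs K B k R Q t \<longleftrightarrow> (\<exists>s'. rep xs K B s' t & fst s' 1 = length xs & Q s') \<and>
  (\<forall>j. K <= j & j < k --> fst t j = R j)"

text \<open>The syntactic conditions are premises inside the triple, so that they are checked once,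
  for the whole program. The level is quantified because a loop runs its body at a higher
  level.\<close>

definition hl :: "nat list => nat => nat => nat => nat => com => nat => state => (state => bool) => bool" where
 "hl xs K W C B c \<tau> s Q \<longleftrightarrow> (cvars c \<subseteq> {..<K} --> 1 \<notin> asgs c --> cmax B c <= W --> 1 < K --> C <= B --> fst s 1 = length xs -->
  (\<forall>k\<ge>K. \<forall>R M. rep xs K B s (R, M) --> reaches W (ccomp c k) (R, M) \<tau> (hl_post xs K B k R Q)))"

lemma hl_mono: "hl xs K W C B c \<tau> s Q ==> \<tau> <= \<tau>' ==> (!!s. Q s ==> Q' s) ==> hl xs K W C B c \<tau>' s Q'"
proof -
 assume a: "hl xs K W C B c \<tau> s Q" "\<tau> <= \<tau>'" and q: "!!s. Q s ==> Q' s"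
 have p: "hl_post xs K B k R Q t ==> hl_post xs K B k R Q' t" for k R t
  unfolding hl_post_def using q by blast
 show ?thesis unfolding hl_def
  by (intro impI allI, rule reaches_mono[OF _ a(2) p]) (use a(1)[unfolded hl_def] in simp_all)
qed

lemma hl_Nop: "Q s ==> hl xs K W C B Nop (csz Nop * Suc C) s Q"
 unfolding hl_def hl_post_def by (cases s) (auto intro!: reaches_Skip)

lemma hl_Asg:
 assumes "eok xs C (R, A) e" "val xs (R, A) e <= B" "Q (R(r := val xs (R, A) e), A)"
 shows "hl xs K W C B (Asg r e) (csz (Asg r e) * Suc C) (R, A) Q"
 unfolding hl_def
proof (intro impI allI)
 fix k R0 M0
 assume h: "cvars (Asg r e) \<subseteq> {..<K}" "1 \<notin> asgs (Asg r e)" "cmax B (Asg r e) <= W" "1 < K" "C <= B"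
  "fst (R, A) 1 = length xs" "K <= k" "rep xs K B (R, A) (R0, M0)"
 have v: "val xs (R, A) e <= W" using val_le_emax[OF h(8) assms(1) h(5)] h(1,3) by simp
 have fin: "hl_post xs K B k R0 Q (R', M0)" if "R' r = val xs (R, A) e" "\<forall>j<k. j ~= r --> R' j = R0 j" for R'
  unfolding hl_post_def
  by (intro conjI exI[of _ "(R(r := val xs (R, A) e), A)"])
   (use h assms(2,3) that in \<open>auto simp: rep_def\<close>)
 show "reaches W (ccomp (Asg r e) k) (R0, M0) (csz (Asg r e) * Suc C) (hl_post xs K B k R0 Q)"
  unfolding ccomp.simps
  apply (rule reaches_Seq[where ?T1.0="esz e * Suc C"])
  apply (rule ecomp_correct[OF h(8) assms(1) h(5)])
  using h apply simp_all[5]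
   apply (rule reaches_copy)
  using h apply force
  using v apply simp
   apply (simp add: algebra_simps)
   apply (rule fin)
   apply simp
   apply simp
  using h apply simp_all
  done
qed

lemma hl_Sto:
 assumes "eok xs C (R, A) e1" "eok xs C (R, A) e2" "eok xs C (R, A) e3" "val xs (R, A) e3 <= B"
  "Q (R, A(c := (A c)(val xs (R, A) e1 := (A c (val xs (R, A) e1))(val xs (R, A) e2 := val xs (R, A) e3))))"
 shows "hl xs K W C B (Sto c e1 e2 e3) (csz (Sto c e1 e2 e3) * Suc C) (R, A) Q"
 unfolding hl_def
proof (intro impI allI)
 fix k R0 M0
 assume h: "cvars (Sto c e1 e2 e3) \<subseteq> {..<K}" "1 \<notin> asgs (Sto c e1 e2 e3)" "cmax B (Sto c e1 e2 e3) <= W" "1 < K" "C <= B"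
  "fst (R, A) 1 = length xs" "K <= k" and rep: "rep xs K B (R, A) (R0, M0)"
 define a where "a = val xs (R, A) e1"
 define b where "b = val xs (R, A) e2"
 define v where "v = val xs (R, A) e3"
 have e: "evars e1 \<subseteq> {..<K}" "evars e2 \<subseteq> {..<K}" "evars e3 \<subseteq> {..<K}" using h(1) by auto
 define p where "p = prod_encode (a, b)"
 have p: "p <= (emax B e1 + emax B e2 + 1) * (emax B e1 + emax B e2 + 1)" unfolding p_def a_def b_def
  by (intro pe_le val_le_emax[OF rep assms(1) h(5)] val_le_emax[OF rep assms(2) h(5)] e)
 have r: "2 * p + 2 <= W" "c <= W" using p h(3) by (simp_all add: Let_def)
 have r3: "2 * prod_encode (c, p) + 2 + length xs <= W"
  using pe_le[OF order_refl[of c] p] h(3) rep by (simp add: Let_def rep_def)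
 have em: "emax B e1 <= W" "emax B e2 <= W" "emax B e3 <= W" using h(3) by simp_all
 have R1: "R0 1 = length xs" using rep h(4,6) by (auto simp: rep_def)
 have k: "1 < k" using h by simp
 have M0: "M0 = mem xs A" using rep by (simp add: rep_def)
 define A' where "A' = A(c := (A c)(a := (A c a)(b := v)))"
 have M1: "M0(prod_encode (c, p) + length xs := v) = mem xs A'"
  using mem_update[of xs A c a b v] unfolding M0 A'_def p_def addr_def .
 have A': "A' c' i j <= B" for c' i j using rep assms(4) unfolding A'_def v_def rep_def by auto
 have QA: "Q (R, A')" using assms(5) unfolding A'_def a_def b_def v_def .
 have fin: "reaches W (Store k (k+1)) (R', M0) T (hl_post xs K B k R0 Q)"
  if "R' k = prod_encode (c, p) + length xs" "R' (k+1) = v" "\<forall>j<k. R' j = R0 j" "1 <= T" for R' T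
  apply (rule reaches_Store[OF that(4)])
  unfolding that(1,2) M1 hl_post_def
  by (intro conjI exI[of _ "(R, A')"]) (use that rep A' QA h(6,7) in \<open>auto simp: rep_def\<close>)
 show "reaches W (ccomp (Sto c e1 e2 e3) k) (R0, M0) (csz (Sto c e1 e2 e3) * Suc C) (hl_post xs K B k R0 Q)"
  unfolding ccomp.simps
  apply (rule reaches_Seq[where ?T1.0="esz e1 * Suc C"])
  apply (rule ecomp_correct[OF rep assms(1) h(5)])
  using h e em apply simp_all[5]
  apply (rule reaches_Seq[where ?T1.0="esz e2 * Suc C"])
   apply (rule ecomp_correct[OF rep_cong[OF rep] assms(2) h(5)])
  using h e em apply simp_all[6]
   apply (rule reaches_Spair_prog)
     apply simp
    apply simp
  using r apply (simp add: p_def a_def b_def)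
   apply (simp add: algebra_simps)
   apply (rule reaches_SConst)
  using r apply simp
   apply (simp add: algebra_simps)
   apply (rule reaches_Spair_prog)
     apply simp
    apply simp
  using r3 apply (simp add: p_def a_def b_def)
   apply (simp add: algebra_simps)
   apply (rule reaches_SOper)
  using r3 R1 k apply (simp add: p_def a_def b_def)
   apply (simp add: algebra_simps)
   apply (rule reaches_Seq[where ?T1.0="esz e3 * Suc C"])
   apply (rule ecomp_correct[OF rep_cong[OF rep] assms(3) h(5)])
  using h e em apply simp_all[6]
   apply (rule fin)
  using R1 k apply (simp add: p_def a_def b_def)
    apply (simp add: v_def)
    apply simp
   apply (simp add: algebra_simps)
  using h(4) apply simp
   apply (simp add: algebra_simps)
  using h(4) apply simp
  apply (simp add: algebra_simps)
  using h(4) apply simp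
  apply (simp add: algebra_simps)
  done
qed

lemma hl_Sq:
 assumes "hl xs K W C B c1 \<tau>1 s (%s'. hl xs K W C B c2 \<tau>2 s' Q)"
 shows "hl xs K W C B (Sq c1 c2) (\<tau>1 + \<tau>2) s Q"
 unfolding hl_def
proof (intro impI allI)
 fix k R0 M0
 assume h: "cvars (Sq c1 c2) \<subseteq> {..<K}" "1 \<notin> asgs (Sq c1 c2)" "cmax B (Sq c1 c2) <= W" "1 < K" "C <= B"
  "fst s 1 = length xs" "K <= k" and rep: "rep xs K B s (R0, M0)"
 have 2: "reaches W (ccomp c2 k) t \<tau>2 (hl_post xs K B k R0 Q)"
  if "hl_post xs K B k R0 (%s'. hl xs K W C B c2 \<tau>2 s' Q) t" for t
 proof -
  obtain R1 M1 where t: "t = (R1, M1)" by fastforce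
  from that obtain s' where s': "rep xs K B s' (R1, M1)" "fst s' 1 = length xs" "hl xs K W C B c2 \<tau>2 s' Q"
   "\<forall>j. K <= j & j < k --> R1 j = R0 j" unfolding hl_post_def t by auto
  have "reaches W (ccomp c2 k) (R1, M1) \<tau>2 (hl_post xs K B k R1 Q)"
   using s'(3) unfolding hl_def using h s'(1,2) by simp
  then show ?thesis unfolding t by (rule reaches_mono) (use s'(4) in \<open>auto simp: hl_post_def\<close>)
 qed
 have "reaches W (ccomp c1 k) (R0, M0) \<tau>1 (hl_post xs K B k R0 (%s'. hl xs K W C B c2 \<tau>2 s' Q))"
  using assms unfolding hl_def using h rep by auto
 then show "reaches W (ccomp (Sq c1 c2) k) (R0, M0) (\<tau>1 + \<tau>2) (hl_post xs K B k R0 Q)"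
  unfolding ccomp.simps
  by (intro reaches_Seq[where ?T1.0="\<tau>1"]) (auto elim!: reaches_mono intro: 2)
qed

lemma hl_SqC:
 assumes "hl xs K W C B c1 (csz c1 * Suc C) s (%s'. hl xs K W C B c2 (csz c2 * Suc C) s' Q)"
 shows "hl xs K W C B (Sq c1 c2) (csz (Sq c1 c2) * Suc C) s Q"
 using hl_Sq[OF assms] by (simp add: algebra_simps)

lemma hl_Cnd:
 assumes "eok xs C s e" "val xs s e ~= 0 ==> hl xs K W C B a \<tau> s Q" "val xs s e = 0 ==> hl xs K W C B b \<tau> s Q"
 shows "hl xs K W C B (Cnd e a b) (esz e * Suc C + \<tau> + 1) s Q"
 unfolding hl_def
proof (intro impI allI)
 fix k R0 M0
 assume h: "cvars (Cnd e a b) \<subseteq> {..<K}" "1 \<notin> asgs (Cnd e a b)" "cmax B (Cnd e a b) <= W" "1 < K" "C <= B"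
  "fst s 1 = length xs" "K <= k" and rep: "rep xs K B s (R0, M0)"
 have br: "reaches W (If k (ccomp a k) (ccomp b k)) (R', M0) (\<tau> + 1) (hl_post xs K B k R0 Q)"
  if v: "R' k = val xs s e" and R': "\<forall>j<k. R' j = R0 j" for R'
 proof -
  have r: "rep xs K B s (R', M0)" by (rule rep_cong[OF rep]) (use R' h in auto)
  have p: "hl_post xs K B k R' Q t ==> hl_post xs K B k R0 Q t" for t using R' by (auto simp: hl_post_def)
  have a: "reaches W (ccomp a k) (R', M0) \<tau> (hl_post xs K B k R' Q)" if "val xs s e ~= 0"
   using assms(2)[OF that] unfolding hl_def using h r by simp
  have b: "reaches W (ccomp b k) (R', M0) \<tau> (hl_post xs K B k R' Q)" if "val xs s e = 0"
   using assms(3)[OF that] unfolding hl_def using h r by simp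
  show ?thesis
   apply (rule reaches_If)
    apply simp
   apply (rule reaches_mono[OF a _ p])
   using v apply simp
   apply simp
   apply assumption
   apply (rule reaches_mono[OF b _ p])
   using v apply simp
   apply simp
   apply assumption
   done
 qed
 show "reaches W (ccomp (Cnd e a b) k) (R0, M0) (esz e * Suc C + \<tau> + 1) (hl_post xs K B k R0 Q)"
  unfolding ccomp.simps
  apply (rule reaches_Seq[where ?T1.0="esz e * Suc C"])
  apply (rule ecomp_correct[OF rep assms(1) h(5)])
  using h apply simp_all[5]
   apply (rule reaches_mono[OF br])
  using h by simp_all
qed

lemma hl_CndC:
 assumes "eok xs C s e" "val xs s e ~= 0 ==> hl xs K W C B a (csz a * Suc C) s Q"
  "val xs s e = 0 ==> hl xs K W C B b (csz b * Suc C) s Q"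
 shows "hl xs K W C B (Cnd e a b) (csz (Cnd e a b) * Suc C) s Q"
 by (rule hl_mono[OF hl_Cnd[where \<tau>="(csz a + csz b) * Suc C", OF assms(1) hl_mono[OF assms(2)] hl_mono[OF assms(3)]]])
  (auto simp: algebra_simps)

text \<open>The limit is evaluated once, before the loop. Three scratch registers hold limit,
  counter and remaining rounds, so the body is compiled at level \<open>k + 3\<close>. The visible
  variable \<open>r\<close> is copied from the counter in every round; the 6 extra units per round
  pay for this bookkeeping and the test.\<close>

lemma hl_For:
 assumes e: "eok xs C s e" "val xs s e = m" "m <= B" and I0: "I 0 s"
  and step: "!!i R A. i < m ==> I i (R, A) ==> hl xs K W C B b \<tau> (R(r := i), A) (I (Suc i))"
  and fin: "!!s. I m s ==> Q s"
 shows "hl xs K W C B (For r e b) (esz e * Suc C + m * (\<tau> + 6) + 4) s Q"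
 unfolding hl_def
proof (intro impI allI)
 fix k R0 M0
 assume h: "cvars (For r e b) \<subseteq> {..<K}" "1 \<notin> asgs (For r e b)" "cmax B (For r e b) <= W" "1 < K" "C <= B"
  "fst s 1 = length xs" "K <= k" and rep: "rep xs K B s (R0, M0)"
 let ?body = "Seq (copy r (k+1)) (Seq (ccomp b (k+3)) (Seq (Const (k+2) 1) (Seq (Oper Add (k+1) (k+1) (k+2))
  (Oper Sub (k+2) k (k+1)))))"
 let ?J = "%t. fst t (k+1) <= m & fst t k = m & fst t (k+2) = m - fst t (k+1) & (\<forall>j. K <= j & j < k --> fst t j = R0 j) \<and>
  (\<exists>s'. rep xs K B s' t & fst s' 1 = length xs & I (fst t (k+1)) s')"
 have W: "B + 1 <= W" using h(3) by simp
 have body: "reaches W ?body t (\<tau> + 5) (%t'. ?J t' & fst t' (k+2) < fst t (k+2))"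
  if J: "?J t" "fst t (k+2) ~= 0" for t
 proof -
  obtain R1 M1 where t: "t = (R1, M1)" by fastforce
  define i where "i = R1 (k+1)"
  have ik: "R1 (k+1) = i" "R1 (Suc k) = i" by (simp_all add: i_def)
  have i: "i < m" "R1 k = m" "R1 (k+2) = m - i" using J unfolding t i_def by auto
  obtain R A where s': "rep xs K B (R, A) (R1, M1)" "R 1 = length xs" "I i (R, A)"
   using J unfolding t i_def by auto
  have r: "rep xs K B (R(r := i), A) (R1(r := i), M1)"
   using s'(1) i(1) e(3) by (auto simp: rep_def)
  have r1: "r ~= 1" "r < K" using h by auto
  have post: "reaches W (Seq (Const (k+2) 1) (Seq (Oper Add (k+1) (k+1) (k+2)) (Oper Sub (k+2) k (k+1)))) t2 3
    (%t'. ?J t' & fst t' (k+2) < fst t (k+2))"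
   if post: "hl_post xs K B (k+3) (R1(r := i)) (I (Suc i)) t2" for t2
  proof -
   obtain R2 M2 where t2: "t2 = (R2, M2)" by fastforce
   obtain s2 where s2: "rep xs K B s2 (R2, M2)" "fst s2 1 = length xs" "I (Suc i) s2"
    and pr: "\<forall>j. K <= j & j < k + 3 --> R2 j = (R1(r := i)) j"
    using post unfolding hl_post_def t2 by auto
   have R2: "R2 k = m" "R2 (k+1) = i" "R2 (k+2) = m - i" "!!j. K <= j ==> j < k ==> R2 j = R0 j"
    using pr h(7) r1 i J(1) unfolding t i_def by auto
   have rep2: "rep xs K B s2 (R2(k+2 := x, k+1 := y, k+2 := z), M2)" for x y z
    by (rule rep_cong[OF s2(1)]) (use h(7) in auto)
   show ?thesis unfolding t2
    apply (rule reaches_SConst)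
    using W apply simp
    apply simp
    apply (rule reaches_SOper)
    using R2 W e(3) i apply simp
    apply simp
    apply (rule reaches_Oper)
    using R2 W e(3) i apply simp
    apply simp
    using R2 i s2 rep2 unfolding t
    apply (intro conjI exI[of _ s2])
       apply simp_all
    done
  qed
  have run: "reaches W (ccomp b (k + 3)) (R1(r := i), M1) \<tau> (hl_post xs K B (k + 3) (R1(r := i)) (I (Suc i)))"
   using step[OF i(1) s'(3)] unfolding hl_def using h r s'(2) r1 by simp
  show ?thesis unfolding t
   apply (rule reaches_Scopy)
   using r1 h(7) apply simp
   using i ik e(3) W apply simp
   apply simp
   apply (rule reaches_Seq[where ?T1.0=\<tau>])
   apply (unfold ik(1))
   apply (rule reaches_mono[OF run order_refl])
   apply (rule reaches_mono[OF post])
    apply assumption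
    apply simp
   apply (simp add: t)
   apply simp
   done
 qed
 have fin': "hl_post xs K B k R0 Q t" if J: "?J t" and z: "fst t (k+2) = 0" for t
 proof -
  have e: "fst t (k+1) = m" using J z by auto
  obtain s' where s': "rep xs K B s' t" "fst s' 1 = length xs" "I m s'" using J unfolding e by blast
  show ?thesis unfolding hl_post_def
   by (intro conjI exI[of _ s']) (use s' fin[of s'] J in auto)
 qed
 have m: "m <= W" using e(3) W by simp
 have init: "?J (R2, M0)" if R2: "R2 k = m" "R2 (k+1) = 0" "R2 (k+2) = m" "\<forall>j<k. R2 j = R0 j" for R2
 proof -
  have "rep xs K B s (R2, M0)" by (rule rep_cong[OF rep]) (use R2 h in auto)
  then show ?thesis using R2 h I0 by (intro conjI exI[of _ s]) auto
 qed
 show "reaches W (ccomp (For r e b) k) (R0, M0) (esz e * Suc C + m * (\<tau> + 6) + 4) (hl_post xs K B k R0 Q)"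
  unfolding ccomp.simps
  apply (rule reaches_Seq[where ?T1.0="esz e * Suc C"])
  apply (rule ecomp_correct[OF rep e(1) h(5)])
  using h apply simp_all[5]
   apply (rule reaches_SConst)
    apply simp
   apply simp
   apply (rule reaches_Scopy)
    apply simp
  using m e apply simp
   apply simp
   apply (rule reaches_While[where I="?J" and m="%t. fst t (k+2)" and T="\<tau>+5", OF body])
    apply assumption
    apply assumption
    apply (erule fin')
    apply assumption
   apply (rule init)
  using e apply simp_all[4]
  using e apply (simp add: algebra_simps)
  using h apply simp
  apply simp
  done
qed

text \<open>Restricting to \<open>B >= 2\<close> lets one further factor \<open>B\<close> absorb the
  constant 2.\<close>

lemma poly_bound_add:
 assumes "\<exists>k. \<forall>B\<ge>2. f B <= (B::nat) ^ k" "\<exists>k. \<forall>B\<ge>2. g B <= B ^ k"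
 shows "\<exists>k. \<forall>B\<ge>2. f B + g B <= B ^ k"
proof -
 obtain k l where k: "\<forall>B\<ge>2. f B <= B ^ k" "\<forall>B\<ge>2. g B <= B ^ l" using assms by blast
 have "f B + g B <= B ^ (k + l + 1)" if B: "B >= 2" for B
 proof -
  have "f B <= B ^ (k + l)" "g B <= B ^ (k + l)"
   using k B by (auto intro: order_trans[OF _ power_increasing])
  then have "f B + g B <= 2 * B ^ (k + l)" by simp
  also have "\<dots> <= B ^ (k + l + 1)" using B by simp
  finally show ?thesis .
 qed
 then show ?thesis by blast
qed

lemma poly_bound_mult:
 assumes "\<exists>k. \<forall>B\<ge>2. f B <= (B::nat) ^ k" "\<exists>k. \<forall>B\<ge>2. g B <= B ^ k"
 shows "\<exists>k. \<forall>B\<ge>2. f B * g B <= B ^ k"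
proof -
 obtain k l where k: "\<forall>B\<ge>2. f B <= B ^ k" "\<forall>B\<ge>2. g B <= B ^ l" using assms by blast
 have "f B * g B <= B ^ (k + l)" if B: "B >= 2" for B
  using k B mult_le_mono by (simp add: power_add)
 then show ?thesis by blast
qed

lemma poly_bound_const: "\<exists>k. \<forall>B\<ge>2. c <= (B::nat) ^ k"
proof -
 have "c <= B ^ c" if "B >= 2" for B :: nat
  by (rule order_trans[OF less_imp_le[OF less_exp] power_mono[OF that]]) simp
 then show ?thesis by blast
qed

lemma poly_bound_id: "\<exists>k. \<forall>B\<ge>2. (B::nat) <= B ^ k"
 by (rule exI[of _ 1]) simp

lemma emax_poly: "\<exists>k. \<forall>B\<ge>2. emax B e <= B ^ k"
 by (induction e; simp only: emax.simps Let_def;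
   intro poly_bound_add poly_bound_mult poly_bound_const poly_bound_id; assumption)

lemma cmax_poly: "\<exists>k. \<forall>B\<ge>2. cmax B c <= B ^ k"
 by (induction c; simp only: cmax.simps;
   intro poly_bound_add poly_bound_const poly_bound_id emax_poly; assumption)

lemma finite_evars: "finite (evars e)" by (induction e) auto

lemma finite_cvars: "finite (cvars c)" by (induction c) (auto simp: finite_evars)

text \<open>Register 1 must hold the input length before any array is accessed. The expression
  \<open>e\<close> computes it without mentioning this register, hence without arrays.\<close>

lemma outputs_within_hl:
 assumes hl: "hl xs K W C B c \<tau> ((%r. if r = 1 then length xs else 0), (%c i j. 0)) (%s. fst s 0 = y)"
  and le: "eok xs C ((%r. 0), (%c i j. 0)) e" "val xs ((%r. 0), (%c i j. 0)) e = length xs"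
   "evars e \<subseteq> {..<K}" "1 \<notin> evars e" "emax B e <= W"
  and c: "cvars c \<subseteq> {..<K}" "1 \<notin> asgs c" "cmax B c <= W" "1 < K" "C <= B"
  and xs: "\<forall>x\<in>set xs. x <= B" "length xs <= B" "B <= W" and T: "\<tau> + esz e * Suc C + 2 <= T"
 shows "outputs_within W T (Seq (ecomp e K) (Seq (copy 1 K) (ccomp c K))) xs y"
proof -
 let ?A = "%c i j. 0 :: nat"
 have M: "(%a. if a < length xs then xs ! a else 0) = mem xs ?A"
  by (auto simp: mem_def Let_def fun_eq_iff)
 have rep0: "rep xs K B ((%r. 0), ?A) ((%r. 0), mem xs ?A)" using xs by (auto simp: rep_def)
 have post: "reaches W (ccomp c K) (R, mem xs ?A) \<tau> (%t. fst t 0 = y)"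
  if R: "\<forall>j<K. R j = (if j = 1 then length xs else 0)" for R
 proof -
  have "rep xs K B ((%r. if r = 1 then length xs else 0), ?A) (R, mem xs ?A)"
   using xs R by (auto simp: rep_def)
  then have "reaches W (ccomp c K) (R, mem xs ?A) \<tau> (hl_post xs K B K R (%s. fst s 0 = y))"
   using hl unfolding hl_def using c by simp
  then show ?thesis
   by (rule reaches_mono) (use c in \<open>auto simp: hl_post_def rep_def\<close>)
 qed
 have "reaches W (Seq (ecomp e K) (Seq (copy 1 K) (ccomp c K))) ((%r. 0), mem xs ?A) T (%t. fst t 0 = y)"
  apply (rule reaches_mono[OF _ T])
  apply (rule reaches_Seq[where ?T1.0="esz e * Suc C"])
   apply (rule ecomp_correct[OF rep0 le(1) c(5) le(3)])
  using le c apply simp_all[4]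
   apply (rule reaches_Scopy)
  using c apply simp
  using le xs apply simp
    apply simp
   apply (rule reaches_mono[OF post])
  using le c apply simp
    apply simp
   apply assumption
  using c apply simp
  apply simp
  apply assumption
  done
 then show ?thesis unfolding reaches_def outputs_within_def initial_state_def M by auto
qed

section \<open>Numeric realisations of functions on encoded data\<close>

definition nf :: "('a::enc => 'b::enc) => nat => nat" where
 "nf F = (SOME g. pr g & (\<forall>x. g (cd x) = cd (F x)))"

lemma nf: assumes "PR F" shows "pr (nf F)" "nf F (cd x) = cd (F x)"
proof -
 have "pr (nf F) & (\<forall>x. nf F (cd x) = cd (F x))"
  unfolding nf_def using assms unfolding PR_def by (rule someI_ex)
 then show "pr (nf F)" "nf F (cd x) = cd (F x)" by auto
qed

lemma PR_bnd: assumes "pr g" "PR f" shows "PR (%x. bnd g (f x))"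
proof (rule PR_comp[OF _ assms(2)])
 show "PR (bnd g)" by (rule PRI[OF computesD(4)[OF computes_bnd[OF assms(1)]]]) simp
qed

lemma bnd_mono: "pr g ==> x <= y ==> bnd g x <= bnd g y"
 using computesD(3)[OF computes_bnd] monoD by blast

lemma le_bnd: "pr g ==> g x <= bnd g x" and self_le_bnd: "pr g ==> x <= bnd g x"
 using computesD(1,2)[OF computes_bnd] by blast+

lemma computable1_PR: assumes "PR f" shows "computable1 f"
proof -
 have "outputs_within (bnd (nf f) x) (bnd (nf f) x + 1) (Seq (Load 0 0) (pr_prog (nf f) 0)) [x] (f x)" for x
 proof -
  have "reaches (bnd (nf f) x) (Seq (Load 0 0) (pr_prog (nf f) 0)) (initial_state [x]) (bnd (nf f) x + 1) (%t. fst t 0 = f x)"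
   unfolding initial_state_def
   apply (rule reaches_Seq[where ?T1.0=1])
   apply (rule reaches_Load)
   using self_le_bnd[OF nf(1)[OF assms]] apply simp
    apply simp
   apply (rule reaches_pr_prog[OF nf(1)[OF assms]])
    apply simp
    apply simp
   using nf(2)[OF assms, of x] apply simp
   apply simp
   done
  then show ?thesis unfolding reaches_def outputs_within_def by auto
 qed
 then show ?thesis unfolding computable1_def by blast
qed

lemma computable2_PR: assumes "PR (%p. f (fst p) (snd p))" shows "computable2 f"
proof -
 let ?g = "nf (%p. f (fst p) (snd p))"
 let ?p = "Seq (Load 0 0) (Seq (Const 1 1) (Seq (Load 1 1) (Seq (pair_prog 2 0 1) (Seq (pr_prog ?g 2) (copy 0 2)))))"
 note g = nf(1)[OF assms]
 have "outputs_within (2 * bnd ?g (prod_encode (x, y)) + 2) (bnd ?g (prod_encode (x, y)) + 20) ?p [x, y] (f x y)" for x y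
 proof -
  define b where "b = bnd ?g (prod_encode (x, y))"
  have b: "prod_encode (x, y) <= b" "f x y <= b" unfolding b_def
   using self_le_bnd[OF g] le_bnd[OF g, of "prod_encode (x, y)"] nf(2)[OF assms, of "(x, y)"] by simp_all
  have xy: "x <= b" "y <= b" using b add_le_prod_encode[of x y] by auto
  have "reaches (2 * b + 2) ?p (initial_state [x, y]) (b + 20) (%t. fst t 0 = f x y)"
   unfolding initial_state_def
   apply (rule reaches_Seq[where ?T1.0=1])
   apply (rule reaches_Load)
   using xy apply simp
    apply simp
   apply (rule reaches_SConst)
    apply simp
    apply simp
   apply (rule reaches_Seq[where ?T1.0=1])
    apply (rule reaches_Load)
   using xy apply simp
    apply simp
    apply (rule reaches_Spair_prog)
      apply simp
     apply simp
   using b apply simp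
    apply simp
    apply (rule reaches_Seq[where ?T1.0=b])
    apply (rule reaches_pr_prog[OF g])
     apply (simp add: b_def)
     apply (simp add: b_def)
    apply (rule reaches_copy)
      apply simp
   using nf(2)[OF assms, of "(x, y)"] b apply simp
     apply simp
   using nf(2)[OF assms, of "(x, y)"] apply simp
    apply simp
   apply simp
   apply simp
   done
  then show ?thesis unfolding reaches_def outputs_within_def b_def by auto
 qed
 then show ?thesis unfolding computable2_def by blast
qed

section \<open>Capped counts, types of positions and their shuffle\<close>

text \<open>A positive count becomes its representative among 1, ..., \<open>M\<close>, and 0 stays
  0. The value keeps emptiness and residue (\<open>cap_eq_iff\<close>) and is itself a count with
  the same cap, so capped counts can be summed in place of the true ones
  (\<open>cap_sum_cong\<close>).\<close>

definition cap :: "nat => nat => nat" where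
 "cap M c = (if c = 0 then 0 else Suc ((c - 1) mod M))"

lemma cap_0 [simp]: "cap M 0 = 0" by (simp add: cap_def)
lemma cap_eq_0 [simp]: "cap M c = 0 \<longleftrightarrow> c = 0" by (simp add: cap_def)

lemma cap_le: "M > 0 ==> cap M c <= M"
 using mod_less_divisor[of M "c - 1"] by (simp add: cap_def Suc_le_eq)

lemma cap_mod: "cap M c mod M = c mod M"
 by (cases c) (simp_all add: cap_def mod_Suc_eq)

lemma cap_eq_iff: "M > 0 ==> cap M a = cap M b \<longleftrightarrow> (a = 0 \<longleftrightarrow> b = 0) & a mod M = b mod M"
proof
 assume "cap M a = cap M b"
 then show "(a = 0 \<longleftrightarrow> b = 0) & a mod M = b mod M" using cap_mod[of M a] cap_mod[of M b] cap_eq_0 by metis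
next
 assume M: "M > 0" and h: "(a = 0 \<longleftrightarrow> b = 0) & a mod M = b mod M"
 show "cap M a = cap M b"
 proof (cases "a = 0")
  case False
  then obtain a' b' where "a = Suc a'" "b = Suc b'" using h by (metis not0_implies_Suc)
  moreover from this have "a' mod M = b' mod M" using h
   by (auto simp: mod_Suc split: if_splits)
  ultimately show ?thesis by (simp add: cap_def)
 qed (use h in simp)
qed

lemma cap_cap [simp]: "M > 0 ==> cap M (cap M c) = cap M c"
 by (simp add: cap_eq_iff cap_mod)

lemma cap_sum_cong:
 assumes "M > 0" "finite I" "!!i. i \<in> I ==> cap M (f i) = cap M (g i)"
 shows "cap M (\<Sum>i\<in>I. f i) = cap M (\<Sum>i\<in>I. g i)"
proof -
 have z: "f i = 0 \<longleftrightarrow> g i = 0" and m: "f i mod M = g i mod M" if "i \<in> I" for i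
  using assms(3)[OF that] cap_eq_iff[OF assms(1)] by auto
 have "(\<Sum>i\<in>I. f i) mod M = (\<Sum>i\<in>I. f i mod M) mod M" by (simp add: mod_sum_eq)
 also have "(\<Sum>i\<in>I. f i mod M) = (\<Sum>i\<in>I. g i mod M)" using m by (rule sum.cong[OF refl])
 also have "\<dots> mod M = (\<Sum>i\<in>I. g i) mod M" by (simp add: mod_sum_eq)
 finally show ?thesis using z assms(2) by (simp add: cap_eq_iff[OF assms(1)])
qed

text \<open>Types of game positions are numbers: \<open>0\<close> is an invalid position, and the type of an inner node
 records the type of the child that skips the move and the capped number of children of each other
 type.\<close>

definition top_of :: "(nat => nat) => nat" where
 "top_of m = (LEAST N. \<forall>k\<ge>N. m k = 0)"

definition mcode :: "nat => (nat => nat) => nat list" where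
 "mcode M m = map (%k. cap M (m k)) [0..<top_of m]"

text \<open>The skipping child decides validity: skips add no element, so a position is invalid
  exactly if the leaf reached from it by skips alone is (\<open>ty_eq_0\<close>).\<close>

definition nd :: "nat => nat => (nat => nat) => nat" where
 "nd M s m = (if s = 0 then 0 else Suc (cd (s, mcode M m)))"

definition skp :: "nat => nat" where "skp \<theta> = pfst (\<theta> - 1)"
definition kids :: "nat => nat list" where "kids \<theta> = list_decode (psnd (\<theta> - 1))"

lemma prod_decode_0: "prod_decode 0 = (0, 0)"
 using prod_encode_inverse[of "(0, 0)"] by (simp add: prod_encode_def)

lemma skp_nd [simp]: "skp (nd M s m) = s"
 by (simp add: skp_def nd_def pfst_def prod_decode_0)

lemma kids_0 [simp]: "kids 0 = []" by (simp add: kids_def psnd_def prod_decode_0)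

lemma kids_nd: "s ~= 0 ==> kids (nd M s m) = mcode M m"
 by (simp add: kids_def nd_def cd_nat_list)

lemma nd_eq_0 [simp]: "nd M s m = 0 \<longleftrightarrow> s = 0" by (simp add: nd_def)

lemma top_of: "\<forall>k\<ge>N. m k = 0 ==> m k ~= 0 ==> k < top_of m"
 unfolding top_of_def using LeastI[of "%N. \<forall>k\<ge>N. m k = 0" N] by (meson not_le)

lemma mcode_cong:
 assumes "M > 0" "!!k. cap M (m k) = cap M (m' k)" shows "mcode M m = mcode M m'"
proof -
 have "m k = 0 \<longleftrightarrow> m' k = 0" for k using assms(2)[of k] cap_eq_0 by metis
 then have "top_of m = top_of m'" by (simp add: top_of_def)
 then show ?thesis using assms(2) by (simp add: mcode_def)
qed

fun ty :: "nat => nat set => (nat option list => nat) => nat => nat option list => nat" where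
 "ty M U lam 0 a = lam a"
| "ty M U lam (Suc k) a = nd M (ty M U lam k (None # a))
  (%\<kappa>. if \<kappa> = 0 then 0 else card {b \<in> U. ty M U lam k (Some b # a) = \<kappa>})"

lemma ty_eq_0: "ty M U lam k a = 0 \<longleftrightarrow> lam (replicate k None @ a) = 0"
 by (induction k arbitrary: a) (simp_all add: replicate_app_Cons_same)

text \<open>One move of the union is a move in one component \<open>j\<close> while all others skip,
  so the count of a child type is a sum over the components and over the children of their types.
  Which combinations of leaves are possible is decided by \<open>Lam\<close> alone.\<close>

fun Phi :: "nat => (nat list => nat) => nat => nat list => nat" where
 "Phi M Lam 0 ts = Lam ts"
| "Phi M Lam (Suc k) ts = nd M (Phi M Lam k (map skp ts))
  (%\<kappa>'. if \<kappa>' = 0 then 0 else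
    \<Sum>j<length ts. \<Sum>\<kappa><length (kids (ts ! j)). kids (ts ! j) ! \<kappa> * of_bool (Phi M Lam k ((map skp ts)[j := \<kappa>]) = \<kappa>'))"

lemma Phi_eq_0: "Phi M Lam k (map (%w. ty M U (lam w) k (d w)) A) = 0 \<longleftrightarrow>
  Lam (map (%w. lam w (replicate k None @ d w)) A) = 0"
proof (induction k arbitrary: d)
 case (Suc k)
 show ?case using Suc[of "%w. None # d w"] by (simp add: comp_def replicate_app_Cons_same)
qed simp

text \<open>The position \<open>a\<close> is split into its components \<open>rst w a\<close>; a new element \<open>b\<close> joins exactly one of
 them.\<close>

locale shuffle =
 fixes M l :: nat and U :: "nat set" and A :: "nat list"
  and lam :: "nat => nat option list => nat" and lam' :: "nat option list => nat"
  and Lam :: "nat list => nat" and rst :: "nat => nat option list => nat option list"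
  and joins :: "nat => nat option list => nat => bool" and good :: "nat option list => bool"
 assumes M: "M > 0" and U: "finite U" and A: "distinct A"
  and leaf: "length a = l ==> good a ==> Lam (map (%w. lam w (rst w a)) A) = lam' a"
  and rst_None: "rst w (None # a) = None # rst w a"
  and good_None: "good a ==> good (None # a)"
  and valid: "length a + k = l ==> good a ==> w \<in> set A ==> lam w (replicate k None @ rst w a) ~= 0"
  and rst_Some: "length a < l ==> good a ==> b \<in> U ==> joins w a b ==>
   rst w' (Some b # a) = (if w' = w then Some b else None) # rst w' a"
  and good_Some: "length a < l ==> good a ==> b \<in> U ==> w \<in> set A ==> joins w a b ==> good (Some b # a)"
  and invalid: "length a + Suc k = l ==> good a ==> b \<in> U ==> w \<in> set A ==> \<not> joins w a b ==>
   lam w (replicate k None @ Some b # rst w a) ~= 0 ==>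
   Lam (map (%w'. lam w' (replicate k None @ (if w' = w then Some b else None) # rst w' a)) A) = 0"
  and joins_unique: "length a < l ==> good a ==> b \<in> U ==> joins w a b ==> joins w' a b ==> w = w'"
  and joins_ex: "length a + Suc k = l ==> good a ==> b \<in> U ==> lam' (replicate k None @ Some b # a) ~= 0 ==>
   \<exists>w\<in>set A. joins w a b"
begin

lemma sum_card_eq:
 assumes "finite S" "!!b. b \<in> S ==> f b ~= 0 ==> f b < N"
 shows "(\<Sum>\<kappa><N. (if \<kappa> = 0 then 0 else card {b \<in> S. f b = \<kappa>}) * of_bool (P \<kappa>)) = card {b \<in> S. f b ~= (0::nat) & P (f b)}"
proof -
 have "(if \<kappa> = 0 then 0 else card {b \<in> S. f b = \<kappa>}) * of_bool (P \<kappa>) = card {b \<in> S. f b = \<kappa> & f b ~= 0 & P (f b)}" for \<kappa>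
 proof (cases "\<kappa> ~= 0 & P \<kappa>")
  case True
  then have "{b \<in> S. f b = \<kappa> & f b ~= 0 & P (f b)} = {b \<in> S. f b = \<kappa>}" by auto
  then show ?thesis using True by simp
 next
  case False
  then have "{b \<in> S. f b = \<kappa> & f b ~= 0 & P (f b)} = {}" by auto
  then show ?thesis using False by (auto simp del: Collect_empty_eq)
 qed
 then have "(\<Sum>\<kappa><N. (if \<kappa> = 0 then 0 else card {b \<in> S. f b = \<kappa>}) * of_bool (P \<kappa>))
  = (\<Sum>\<kappa><N. card {b \<in> S. f b = \<kappa> & f b ~= 0 & P (f b)})" by simp
 also have "\<dots> = card (\<Union>\<kappa>\<in>{..<N}. {b \<in> S. f b = \<kappa> & f b ~= 0 & P (f b)})"
  by (rule card_UN_disjoint[symmetric]) (use assms(1) in auto)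
 also have "(\<Union>\<kappa>\<in>{..<N}. {b \<in> S. f b = \<kappa> & f b ~= 0 & P (f b)}) = {b \<in> S. f b ~= 0 & P (f b)}"
  using assms(2) by auto
 finally show ?thesis .
qed

text \<open>Induction on the remaining moves. The elements of \<open>U\<close> are split by the
  component that they join (\<open>joins_unique\<close>, \<open>joins_ex\<close>), and within a
  component they are grouped by child type. The assumption \<open>invalid\<close> covers an element
  that is a legal move inside component \<open>w\<close> without joining it: the combined type is 0,
  so the element adds nothing to a proper child type.\<close>

theorem Phi_ty: "length a + k = l ==> good a ==>
  Phi M Lam k (map (%w. ty M U (lam w) k (rst w a)) A) = ty M U lam' k a"
proof (induction k arbitrary: a)
 case 0 then show ?case using leaf by simp
next
 case (Suc k)
 let ?t = "%w d. ty M U (lam w) k d"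
 let ?ts = "map (%w. ty M U (lam w) (Suc k) (rst w a)) A"
 have l: "length a < l" using Suc.prems by simp
 have skip: "map skp ?ts = map (%w. ?t w (rst w (None # a))) A" by (simp add: rst_None)
 have IHN: "Phi M Lam k (map (%w. ?t w (rst w (None # a))) A) = ty M U lam' k (None # a)"
  using Suc.IH[of "None # a"] Suc.prems good_None by simp
 have fin: "\<exists>N. \<forall>\<kappa>\<ge>N. (if \<kappa> = 0 then 0 else card {b \<in> U. g b = \<kappa>}) = 0" for g :: "nat => nat"
 proof (intro exI allI impI)
  fix \<kappa> assume "\<kappa> >= Suc (Max (g ` U))"
  then have e: "{b \<in> U. g b = \<kappa>} = {}" using Max_ge[of "g ` U"] U by fastforce
  show "(if \<kappa> = 0 then 0 else card {b \<in> U. g b = \<kappa>}) = 0" unfolding e by simp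
 qed
 show ?case
 proof (cases "ty M U lam' k (None # a) = 0")
  case True
  then show ?thesis unfolding Phi.simps skip IHN by (simp add: nd_def)
 next
  case False
  have "cap M (if \<kappa>' = 0 then 0 else
    \<Sum>j<length ?ts. \<Sum>\<kappa><length (kids (?ts ! j)). kids (?ts ! j) ! \<kappa> * of_bool (Phi M Lam k ((map skp ?ts)[j := \<kappa>]) = \<kappa>'))
   = cap M (if \<kappa>' = 0 then 0 else card {b \<in> U. ty M U lam' k (Some b # a) = \<kappa>'})" for \<kappa>'
  proof (cases "\<kappa>' = 0")
   case nz: False
   define S where "S = (%j. {b \<in> U. joins (A ! j) a b & ty M U lam' k (Some b # a) = \<kappa>'})"
   have inner: "cap M (\<Sum>\<kappa><length (kids (?ts ! j)). kids (?ts ! j) ! \<kappa> * of_bool (Phi M Lam k ((map skp ?ts)[j := \<kappa>]) = \<kappa>'))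
    = cap M (card (S j))" if j: "j < length A" for j
   proof -
    define w where "w = A ! j"
    have w: "w \<in> set A" using j by (simp add: w_def)
    define f where "f = (%b. ?t w (Some b # rst w a))"
    define m where "m = (%\<kappa>. if \<kappa> = 0 then 0 else card {b \<in> U. f b = \<kappa>})"
    have tj: "?ts ! j = nd M (?t w (None # rst w a)) m" using j unfolding m_def f_def w_def by simp
    have "?t w (None # rst w a) ~= 0" using valid[of a "Suc k" w] Suc.prems w
     by (simp add: ty_eq_0 replicate_app_Cons_same)
    then have kj: "kids (?ts ! j) = mcode M m" unfolding tj by (rule kids_nd)
    have lt: "f b < top_of m" if "b \<in> U" "f b ~= 0" for b
    proof -
     obtain N where N: "\<forall>\<kappa>\<ge>N. m \<kappa> = 0" using fin[of f] unfolding m_def by blast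
     have "m (f b) ~= 0" using that U by (auto simp: m_def card_eq_0_iff)
     then show ?thesis using top_of[OF N] by blast
    qed
    have Phib: "(f b ~= 0 & Phi M Lam k ((map skp ?ts)[j := f b]) = \<kappa>') \<longleftrightarrow> joins w a b & ty M U lam' k (Some b # a) = \<kappa>'"
     if b: "b \<in> U" for b
    proof -
     let ?d = "%w'. (if w' = w then Some b else None) # rst w' a"
     have upd: "(map skp ?ts)[j := f b] = map (%w'. ?t w' (?d w')) A"
      unfolding skip
     proof (rule nth_equalityI)
      fix i assume "i < length ((map (%w. ?t w (rst w (None # a))) A)[j := f b])"
      then have i: "i < length A" by simp
      show "(map (%w. ?t w (rst w (None # a))) A)[j := f b] ! i = map (%w'. ?t w' (?d w')) A ! i"
       using A i j by (auto simp: nth_list_update f_def w_def rst_None nth_eq_iff_index_eq)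
     qed simp
     show ?thesis
     proof (cases "joins w a b")
      case True
      have d: "?d w' = rst w' (Some b # a)" for w' using rst_Some[OF l Suc.prems(2) b True] by simp
      have "f b ~= 0"
       using valid[of "Some b # a" k w] good_Some[OF l Suc.prems(2) b w True] Suc.prems d[of w] w
       by (simp add: f_def ty_eq_0)
      moreover have "Phi M Lam k ((map skp ?ts)[j := f b]) = ty M U lam' k (Some b # a)"
       unfolding upd d using Suc.IH[of "Some b # a"] good_Some[OF l Suc.prems(2) b w True] Suc.prems by simp
      ultimately show ?thesis using True by simp
     next
      case False
      have "Phi M Lam k ((map skp ?ts)[j := f b]) = 0" if fb: "f b ~= 0"
       unfolding upd Phi_eq_0 using invalid[of a k b w] Suc.prems b w False fb by (simp add: f_def ty_eq_0)
      then show ?thesis using False nz by auto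
     qed
    qed
    \<comment> \<open>The node stores capped counts only, so the sums agree merely up to
      \<open>cap\<close>; this is all that \<open>mcode\<close> keeps of the new counts.\<close>
    have "cap M (\<Sum>\<kappa><length (kids (?ts ! j)). kids (?ts ! j) ! \<kappa> * of_bool (Phi M Lam k ((map skp ?ts)[j := \<kappa>]) = \<kappa>'))
     = cap M (\<Sum>\<kappa><top_of m. m \<kappa> * of_bool (Phi M Lam k ((map skp ?ts)[j := \<kappa>]) = \<kappa>'))"
     unfolding kj by (auto simp: mcode_def M intro!: cap_sum_cong[OF M])
    also have "(\<Sum>\<kappa><top_of m. m \<kappa> * of_bool (Phi M Lam k ((map skp ?ts)[j := \<kappa>]) = \<kappa>'))
     = card {b \<in> U. f b ~= 0 & Phi M Lam k ((map skp ?ts)[j := f b]) = \<kappa>'}"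
     unfolding m_def by (rule sum_card_eq[OF U]) (use lt in \<open>simp add: m_def\<close>)
    also have "{b \<in> U. f b ~= 0 & Phi M Lam k ((map skp ?ts)[j := f b]) = \<kappa>'} = S j"
     using Phib unfolding S_def w_def by blast
    finally show ?thesis .
   qed
   have "cap M (\<Sum>j<length ?ts. \<Sum>\<kappa><length (kids (?ts ! j)). kids (?ts ! j) ! \<kappa> * of_bool (Phi M Lam k ((map skp ?ts)[j := \<kappa>]) = \<kappa>'))
    = cap M (\<Sum>j<length A. card (S j))"
    unfolding length_map by (rule cap_sum_cong[OF M finite_lessThan], rule inner) simp
   also have "(\<Sum>j<length A. card (S j)) = card (\<Union>j\<in>{..<length A}. S j)"
   proof (rule card_UN_disjoint[symmetric])
    show "\<forall>i\<in>{..<length A}. \<forall>j\<in>{..<length A}. i ~= j --> S i \<inter> S j = {}"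
     using joins_unique[OF l Suc.prems(2)] A by (fastforce simp: S_def nth_eq_iff_index_eq)
   qed (use U in \<open>auto simp: S_def\<close>)
   also have "(\<Union>j\<in>{..<length A}. S j) = {b \<in> U. ty M U lam' k (Some b # a) = \<kappa>'}"
   proof -
    have "\<exists>j<length A. joins (A ! j) a b" if "b \<in> U" "ty M U lam' k (Some b # a) = \<kappa>'" for b
    proof -
     have "lam' (replicate k None @ Some b # a) ~= 0" using that nz ty_eq_0 by metis
     then show ?thesis using joins_ex[of a k b] Suc.prems that by (auto simp: in_set_conv_nth)
    qed
    then show ?thesis unfolding S_def by blast
   qed
   finally show ?thesis using nz by simp
  qed simp
  then have mc: "mcode M (%\<kappa>'. if \<kappa>' = 0 then 0 else
    \<Sum>j<length ?ts. \<Sum>\<kappa><length (kids (?ts ! j)). kids (?ts ! j) ! \<kappa> * of_bool (Phi M Lam k ((map skp ?ts)[j := \<kappa>]) = \<kappa>'))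
   = mcode M (%\<kappa>'. if \<kappa>' = 0 then 0 else card {b \<in> U. ty M U lam' k (Some b # a) = \<kappa>'})" (is "mcode M ?m = mcode M ?m'")
   by (rule mcode_cong[OF M])
  have "Phi M Lam (Suc k) ?ts = nd M (Phi M Lam k (map skp ?ts)) ?m" by (rule Phi.simps(2))
  also have "\<dots> = nd M (ty M U lam' k (None # a)) ?m" by (simp only: skip IHN)
  also have "\<dots> = nd M (ty M U lam' k (None # a)) ?m'" unfolding nd_def mc ..
  also have "\<dots> = ty M U lam' (Suc k) a" by (rule ty.simps(2)[symmetric])
  finally show ?thesis .
 qed
qed

end

section \<open>Distances in the red graph and components of positions\<close>

fun dle :: "(nat => nat => bool) => nat => nat => nat => bool" where
 "dle E 0 a b = (a = b)"
| "dle E (Suc k) a b = (dle E k a b | (\<exists>c. dle E k a c & E c b))"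

lemma dle_mono: "dle E j a b ==> j <= k ==> dle E k a b"
 by (induction k) (auto simp: le_Suc_eq)

lemma dle_refl [simp]: "dle E k a a"
 by (rule dle_mono[of E 0]) auto

lemma dle_trans: "dle E j a b ==> dle E k b c ==> dle E (j + k) a c"
 by (induction k arbitrary: c) auto

lemma dle_sym: assumes "!!x y. E x y ==> E y x" shows "dle E k a b ==> dle E k b a"
proof (induction k arbitrary: b)
 case (Suc k)
 then consider "dle E k a b" | c where "dle E k a c" "E c b" by auto
 then show ?case
 proof cases
  case 2
  have "dle E 1 b c" using assms[OF 2(2)] by auto
  then show ?thesis using dle_trans[of E 1 b c k a] Suc.IH[OF 2(1)] by simp
 qed (use Suc.IH in auto)
qed simp

definition els :: "nat option list => nat set" where "els a = {u. Some u \<in> set a}"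

lemma els_simps [simp]: "els [] = {}" "els (None # a) = els a" "els (Some b # a) = insert b (els a)"
 "els (a @ a') = els a \<union> els a'" "els (replicate k None) = {}"
 by (auto simp: els_def)

lemma els_nth: "x < length a ==> a ! x = Some u ==> u \<in> els a"
 unfolding els_def by (metis mem_Collect_eq nth_mem)

text \<open>Positions list their elements from the newest to the oldest. The element that follows \<open>i\<close> older
 entries is linked to an older one if their parts have distance at most \<open>2 ^ (l - 1 - i)\<close>. Since this radius
 halves with every move, a new element is never linked to two different components.\<close>

fun conn :: "nat => (nat => nat) => (nat => nat => bool) => nat => nat option list => bool" where
 "conn l p E w [] = True"
| "conn l p E w (None # a) = conn l p E w a"
| "conn l p E w (Some b # a) = (conn l p E w a \<and>
  (if els a = {} then p b = w else \<exists>u\<in>els a. dle E (2 ^ (l - 1 - length a)) (p u) (p b)))"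

lemma conn_replicate [simp]: "conn l p E w (replicate k None @ a) = conn l p E w a"
 by (induction k) auto

text \<open>Here \<open>a\<close> is the whole position and \<open>c\<close> its share in component
  \<open>w\<close>. An element linked to nothing older opens the component rooted at its own part.
  For connected \<open>c\<close> that component is still empty, since otherwise it would have an
  element in its root (\<open>conn_root\<close>), at distance 0.\<close>

fun joins :: "nat => (nat => nat) => (nat => nat => bool) => nat => nat option list => nat option list => nat => bool" where
 "joins l p E w c a b = (if \<exists>u\<in>els a. dle E (2 ^ (l - 1 - length a)) (p u) (p b)
  then \<exists>u\<in>els c. dle E (2 ^ (l - 1 - length a)) (p u) (p b) else p b = w)"

fun rst :: "nat => (nat => nat) => (nat => nat => bool) => nat => nat option list => nat option list" where
 "rst l p E w [] = []"
| "rst l p E w (None # a) = None # rst l p E w a"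
| "rst l p E w (Some b # a) = (if joins l p E w (rst l p E w a) a b then Some b else None) # rst l p E w a"

lemma length_rst [simp]: "length (rst l p E w a) = length a"
 by (induction a rule: rst.induct[of _ l p E w]) auto

lemma els_rst: "els (rst l p E w a) \<subseteq> els a"
proof (induction a)
 case (Cons x a) then show ?case by (cases x) auto
qed simp

lemma conn_root: "conn l p E w c ==> els c ~= {} ==> \<exists>u\<in>els c. p u = w"
proof (induction c)
 case (Cons x c) then show ?case by (cases x) (auto split: if_splits)
qed simp

lemma rst_drop: "drop n (rst l p E w a) = rst l p E w (drop n a)"
proof (induction a arbitrary: n)
 case (Cons x a) then show ?case by (cases n; cases x) auto
qed simp

text \<open>The element after \<open>i\<close> others lies within \<open>2 ^ (l - 1 - i)\<close> of
  an older one, and the sum of these radii telescopes.\<close>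

lemma conn_dle:
 assumes "conn l p E w c" "length c <= l" "u \<in> els c"
 shows "dle E (2 ^ l - 2 ^ (l - length c)) w (p u)"
 using assms
proof (induction c arbitrary: u)
 case (Cons x c)
 have le: "2 ^ l - 2 ^ (l - length c) <= (2::nat) ^ l - 2 ^ (l - length (x # c))"
  by (intro diff_le_mono2 power_increasing) auto
 have "(2::nat) ^ (l - length c) = 2 * 2 ^ (l - 1 - length c)"
  using Cons.prems(2) by (simp add: Suc_diff_Suc flip: power_Suc)
 moreover have "(2::nat) ^ (l - length c) <= 2 ^ l" by (intro power_increasing) auto
 ultimately have step: "(2::nat) ^ l - 2 ^ (l - length c) + 2 ^ (l - 1 - length c) = 2 ^ l - 2 ^ (l - length (x # c))" by simp
 show ?case
 proof (cases "u \<in> els c")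
  case True
  then show ?thesis using Cons.IH[of u] Cons.prems le by (cases x) (auto intro: dle_mono)
 next
  case False
  then have x: "x = Some u" using Cons.prems(3) by (cases x) auto
  show ?thesis
  proof (cases "els c = {}")
   case True then show ?thesis using Cons.prems(1) x by simp
  next
   case False
   then obtain v where v: "v \<in> els c" "dle E (2 ^ (l - 1 - length c)) (p v) (p u)"
    using Cons.prems(1) x by auto
   have "dle E (2 ^ l - 2 ^ (l - length c)) w (p v)" using Cons.IH[of v] Cons.prems x v by auto
   from dle_trans[OF this v(2)] show ?thesis unfolding step .
  qed
 qed
qed simp

lemma conn_dle': "conn l p E w c ==> length c <= l ==> u \<in> els c ==> dle E (2 ^ l) w (p u)"
 by (rule dle_mono[OF conn_dle]) auto

locale red_graph =
 fixes l :: nat and p :: "nat => nat" and E :: "nat => nat => bool"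
 assumes sym: "E x y ==> E y x"
begin

abbreviation "R w a \<equiv> rst l p E w a"
abbreviation "J w a b \<equiv> joins l p E w (rst l p E w a) a b"

lemma pow_split: "i < l ==> (2::nat) ^ (l - 1 - i) + 2 ^ (l - 1 - i) = 2 ^ (l - i)"
 by (simp add: Suc_diff_Suc flip: power_Suc mult_2)

lemma cov: "u \<in> els a ==> \<exists>w. u \<in> els (R w a)"
proof (induction a arbitrary: u)
 case (Cons x a)
 show ?case
 proof (cases x)
  case None then show ?thesis using Cons by auto
 next
  case (Some b)
  show ?thesis
  proof (cases "u \<in> els a")
   case True
   then obtain w where "u \<in> els (R w a)" using Cons.IH by blast
   then show ?thesis using Some by (intro exI[of _ w]) auto
  next
   case False
   then have u: "u = b" using Cons.prems Some by auto
   have "\<exists>w. J w a b" using Cons.IH by (auto; blast)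
   then obtain w where "J w a b" by blast
   then show ?thesis using Some u by (intro exI[of _ w]) (simp del: joins.simps)
  qed
 qed
qed simp

lemma cov_nth: "x < length a ==> a ! x = Some b ==> \<exists>w. R w a ! x = Some b"
proof (induction a arbitrary: x)
 case (Cons y a)
 show ?case
 proof (cases x)
  case 0
  then have y: "y = Some b" using Cons.prems by simp
  have "\<exists>w. J w a b" using cov by (auto; blast)
  then obtain w where "J w a b" by blast
  then show ?thesis using y 0 Cons.prems by (intro exI[of _ w]) (simp del: joins.simps)
 next
  case (Suc x')
  then obtain w where "R w a ! x' = Some b" using Cons by auto
  then show ?thesis using Suc by (intro exI[of _ w]) (cases y; simp)
 qed
qed simp

lemma rst_nth: "x < length a ==> R w a ! x = Some b ==> a ! x = Some b"
proof (induction a arbitrary: x)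
 case (Cons y a) then show ?case by (cases y; cases x) (auto split: if_splits)
qed simp

text \<open>The separation claimed after \<open>length a\<close> moves is twice the linking radius
  of the next move (\<open>pow_split\<close>). Two older elements within that radius of the new one
  are therefore in the same component, and the halved separation survives the move.\<close>

lemma separated:
 "length a <= l ==> u \<in> els (R w a) ==> v \<in> els (R w' a) ==> dle E (2 ^ (l - length a)) (p u) (p v) ==> w = w'"
proof (induction a arbitrary: u v w w')
 case (Cons x a)
 have IH: "u \<in> els (R w a) ==> v \<in> els (R w' a) ==> dle E (2 ^ (l - length a)) (p u) (p v) ==> w = w'" for u v w w'
  using Cons.IH[of u w v w'] Cons.prems(1) by simp
 have IHs: "u \<in> els (R w a) ==> v \<in> els (R w' a) ==> dle E (2 ^ (l - 1 - length a)) (p u) (p v) ==> w = w'" for u v w w'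
  using IH[of u w v w'] by (meson dle_mono diff_le_mono diff_le_self power_increasing one_le_numeral)
 let ?r = "2 ^ (l - 1 - length a)"
 have two: "w = w'" if "u \<in> els (R w a)" "v \<in> els (R w' a)" "dle E ?r (p u) b" "dle E ?r (p v) b" for u v w w' b
 proof (rule IH[OF that(1,2)])
  have "dle E (?r + ?r) (p u) (p v)" by (rule dle_trans[OF that(3) dle_sym[OF sym that(4)]])
  moreover have "length a < l" using Cons.prems(1) by simp
  ultimately show "dle E (2 ^ (l - length a)) (p u) (p v)" by (simp only: pow_split)
 qed
 show ?case
 proof (cases x)
  case None then show ?thesis using Cons.prems IHs[of u w v w'] by simp
 next
  case (Some b)
  have d: "dle E ?r (p u) (p v)" using Cons.prems(4) by simp
  \<comment> \<open>The component \<open>w1\<close> has an old element near the new one, and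
    \<open>w2\<close> is joined by the new one. As some older element is near, joining means
    nearness, so \<open>w2\<close> has a near element as well and \<open>two\<close>
    applies.\<close>
  have mix: "w1 = w2" if m: "u1 \<in> els (R w1 a)" "J w2 a b" "dle E ?r (p u1) (p b)" for u1 w1 w2
  proof -
   have "\<exists>u\<in>els a. dle E ?r (p u) (p b)" using m(1,3) els_rst by blast
   then obtain v where "v \<in> els (R w2 a)" "dle E ?r (p v) (p b)" using m(2) by auto
   then show ?thesis using two[OF m(1) _ m(3)] by blast
  qed
  have both: "w1 = w2" if bj: "J w1 a b" "J w2 a b" for w1 w2
  proof (cases "\<exists>u\<in>els a. dle E ?r (p u) (p b)")
   case True
   then obtain u where "u \<in> els (R w1 a)" "dle E ?r (p u) (p b)" using bj(1) by auto
   then show ?thesis using mix bj(2) by blast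
  next
   case False then show ?thesis using bj by auto
  qed
  have u: "u \<in> els (R w a) | u = b & J w a b" and v: "v \<in> els (R w' a) | v = b & J w' a b"
   using Cons.prems(2,3) Some by (auto simp del: joins.simps split: if_splits)
  show ?thesis using u v IHs[of u w v w', OF _ _ d] mix[of u w w'] mix[of v w' w] both[of w w'] d
   dle_sym[OF sym d] by metis
 qed
qed simp

lemma joins_unique:
 assumes "length a < l" "J w a b" "J w' a b" shows "w = w'"
proof (cases "\<exists>u\<in>els a. dle E (2 ^ (l - 1 - length a)) (p u) (p b)")
 case True
 then obtain u v where uv: "u \<in> els (R w a)" "v \<in> els (R w' a)"
  "dle E (2 ^ (l - 1 - length a)) (p u) (p b)" "dle E (2 ^ (l - 1 - length a)) (p v) (p b)" using assms(2,3) by auto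
 have "dle E (2 ^ (l - length a)) (p u) (p v)"
  using dle_trans[OF uv(3) dle_sym[OF sym uv(4)]] by (simp only: pow_split[OF assms(1)])
 then show ?thesis using separated[OF _ uv(1,2)] assms(1) by simp
next
 case False then show ?thesis using assms by auto
qed

lemma conn_rst: "length a <= l ==> conn l p E w (R w a)"
proof (induction a)
 case (Cons x a)
 show ?case
 proof (cases x)
  case (Some b)
  have c: "conn l p E w (R w a)" using Cons by simp
  show ?thesis
  proof (cases "J w a b & els (R w a) ~= {}")
   case True
   then obtain u where u: "u \<in> els (R w a)" "p u = w" using conn_root[OF c] by blast
   have "\<exists>u\<in>els (R w a). dle E (2 ^ (l - 1 - length a)) (p u) (p b)"
   proof (cases "p b = w")
    case True then show ?thesis using u by (intro bexI[of _ u]) auto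
   qed (use \<open>J w a b & els (R w a) ~= {}\<close> in \<open>auto split: if_splits\<close>)
   then show ?thesis using c Some True by simp
  next
   case False
   then show ?thesis using c Some by (auto split: if_splits)
  qed
 qed (use Cons in simp)
qed simp

lemma rst_disjoint:
 assumes "length a <= l" "x < length a" "R w a ! x = Some b" "R w' a ! x = Some b'"
 shows "w = w'"
proof -
 have "b' = b" using rst_nth[OF assms(2,3)] rst_nth[OF assms(2,4)] by simp
 moreover have "b \<in> els (R w a)" "b' \<in> els (R w' a)" using assms unfolding els_def by (auto intro: nth_mem[of x, THEN back_subst[where P="%y. y \<in> _"]] simp: in_set_conv_nth)
 ultimately show ?thesis using separated[OF assms(1), of b w b w'] by simp
qed

text \<open>The entry in slot \<open>x\<close> has \<open>l - 1 - x\<close> older ones. Dropping the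
  \<open>min x y\<close> newest entries leaves both elements in a position of length
  \<open>l - min x y\<close>, where \<open>separated\<close> gives the radius
  \<open>2 ^ min x y\<close>.\<close>

lemma rst_separated:
 assumes "length a = l" "x < l" "y < l" "R w a ! x = Some u" "R w' a ! y = Some v" "dle E (2 ^ min x y) (p u) (p v)"
 shows "w = w'"
proof -
 define n where "n = min x y"
 have n: "n <= x" "n <= y" "n < l" using assms(2,3) by (auto simp: n_def)
 have "R w (drop n a) ! (x - n) = Some u" "R w' (drop n a) ! (y - n) = Some v"
  using assms n by (simp_all add: rst_drop[symmetric])
 then have "u \<in> els (R w (drop n a))" "v \<in> els (R w' (drop n a))"
  using assms(1-3) n by (auto intro: els_nth[of "x - n"] els_nth[of "y - n"])
 moreover have "dle E (2 ^ (l - length (drop n a))) (p u) (p v)" using assms(1,6) n by (simp add: n_def[symmetric])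
 ultimately show ?thesis using separated[of "drop n a" u w v w'] assms(1) n by simp
qed

end

section \<open>Types of parts and their change under a merge\<close>

definition rk :: "nat => (nat => nat => bool) => nat => nat => nat" where
 "rk l E w v = card {v'. dle E (2 ^ l) w v' & v' < v}"

definition pinfo :: "(nat => nat => nat) => nat option => nat option => nat" where
 "pinfo ai x y = (case x of None => 0 | Some u => (case y of None => 0 | Some v => Suc (2 * ai u v + of_bool (u = v))))"

text \<open>A part is recorded by the rank of its name in the ball around the root: names themselves are not
 bounded in terms of \<open>l\<close> and \<open>d\<close>.\<close>

definition leaf :: "nat => (nat => nat => nat) => (nat => nat) => (nat => nat => bool) => nat => nat option list => nat" where
 "leaf l ai p E w a = Suc (cd (map (%x. case x of None => 0 | Some u => Suc (rk l E w (p u))) a,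
  concat (map (%x. map (%y. pinfo ai (a ! x) (a ! y)) [0..<l]) [0..<l])))"

definition lam :: "nat => (nat => nat => nat) => (nat => nat) => (nat => nat => bool) => nat => nat option list => nat" where
 "lam l ai p E w a = (if conn l p E w a then leaf l ai p E w a else 0)"

definition part_type :: "nat => nat => (nat => nat => nat) => nat set => (nat => nat) => (nat => nat => bool) => nat => nat" where
 "part_type M l ai U p E w = ty M U (lam l ai p E w) l []"

lemma leaf_neq_0 [simp]: "leaf l ai p E w a ~= 0" by (simp add: leaf_def)
lemma lam_eq_0 [simp]: "lam l ai p E w a = 0 \<longleftrightarrow> \<not> conn l p E w a" by (simp add: lam_def)

definition overlay :: "nat => nat set => (nat => nat option list) => nat option list => bool" where
 "overlay l A c a \<longleftrightarrow> length a = l & (\<forall>w\<in>A. length (c w) = l) \<and>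
  (\<forall>x<l. \<forall>b. a ! x = Some b \<longleftrightarrow> (\<exists>w\<in>A. c w ! x = Some b)) \<and>
  (\<forall>w\<in>A. \<forall>w'\<in>A. w ~= w' --> (\<forall>x<l. c w ! x = None | c w' ! x = None))"

text \<open>This is the separation that components have by \<open>rst_separated\<close>. A move
  played in a wrong component violates it and so is detected at the leaf.\<close>

definition crossfree :: "nat => (nat => nat) => (nat => nat => bool) => nat set => (nat => nat option list) => bool" where
 "crossfree l p E A c \<longleftrightarrow> (\<forall>w\<in>A. \<forall>w'\<in>A. w ~= w' --> (\<forall>x<l. \<forall>y<l. \<forall>u v. c w ! x = Some u --> c w' ! y = Some v -->
   \<not> dle E (2 ^ min x y) (p u) (p v)))"

text \<open>The old red graph \<open>E\<close> and the new one \<open>E'\<close> on names of parts;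
  \<open>im\<close> stands for the renaming caused by the merge. The last assumption says that
  distances do not grow under \<open>im\<close> (\<open>dle_im\<close>).\<close>

locale merge_graph = red_graph l p E for l p E +
 fixes p' :: "nat => nat" and E' :: "nat => nat => bool" and im :: "nat => nat" and U :: "nat set" and M :: nat
  and ai :: "nat => nat => nat"
 assumes sym': "E' x y ==> E' y x" and U: "finite U" and M: "M > 0"
  and p': "u \<in> U ==> p' u = im (p u)"
  and E': "E x y ==> im x = im y | E' (im x) (im y)"
begin

lemma dle_im: "dle E k a b ==> dle E' k (im a) (im b)"
proof (induction k arbitrary: b)
 case (Suc k)
 then consider "dle E k a b" | c where "dle E k a c" "E c b" by auto
 then show ?case
 proof cases
  case 2
  then show ?thesis using Suc.IH[OF 2(1)] E'[OF 2(2)] by auto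
 qed (use Suc.IH in auto)
qed simp

text \<open>The list \<open>A\<close> names the old roots whose images lie within
  \<open>2 ^ l\<close> of \<open>v\<close>; by \<open>conn_dle'\<close> every component of a
  position connected to \<open>v\<close> has such a root. Components are formed in the old graph,
  whereas connectedness of the whole position refers to the new one; this last test is left to
  \<open>Lam\<close>.\<close>

theorem Phi_part_type:
 assumes A: "distinct A" "set A = {w \<in> p ` U. dle E' (2 ^ l) v (im w)}"
  and Lam: "!!c a. overlay l (set A) c a ==> (!!w. w \<in> set A ==> conn l p E w (c w) & els (c w) \<subseteq> U) ==>
   Lam (map (%w. leaf l ai p E w (c w)) A) = (if crossfree l p E (set A) c then lam l ai p' E' v a else 0)"
 shows "Phi M Lam l (map (part_type M l ai U p E) A) = part_type M l ai U p' E' v"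
proof -
 let ?good = "%a. length a <= l & els a \<subseteq> U & (\<forall>w. els (R w a) ~= {} --> w \<in> set A)"
 \<comment> \<open>The assumption \<open>good_None\<close> has no length bound, hence the disjunct
   that admits all positions longer than \<open>l\<close>.\<close>
 interpret shuffle M l U A "lam l ai p E" "lam l ai p' E' v" Lam "rst l p E" "%w a b. J w a b" "%a. ?good a | \<not> length a <= l"
 proof
  fix a :: "nat option list" assume a: "length a = l" "?good a | \<not> length a <= l"
  have ov: "overlay l (set A) (%w. R w a) a" unfolding overlay_def
  proof (intro conjI allI ballI impI)
   fix x b assume x: "x < l"
   show "(a ! x = Some b) = (\<exists>w\<in>set A. R w a ! x = Some b)"
   proof
    assume "a ! x = Some b"
    then obtain w where w: "R w a ! x = Some b" using cov_nth x a by blast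
    then have "b \<in> els (R w a)" using x a by (auto simp: els_def in_set_conv_nth)
    then show "\<exists>w\<in>set A. R w a ! x = Some b" using w a by blast
   qed (use rst_nth x a in blast)
  next
   fix w w' x :: nat assume "w ~= w'" "x < l"
   then show "R w a ! x = None | R w' a ! x = None" using rst_disjoint[of a x w _ w'] a by (metis option.exhaust order_refl)
  qed (use a in auto)
  have "crossfree l p E (set A) (%w. R w a)" unfolding crossfree_def using rst_separated[OF a(1)] by blast
  then have "Lam (map (%w. leaf l ai p E w (R w a)) A) = lam l ai p' E' v a"
   using Lam[OF ov] conn_rst els_rst a by fastforce
  then show "Lam (map (%w. lam l ai p E w (R w a)) A) = lam l ai p' E' v a"
   using conn_rst[of a] a by (simp add: lam_def)
 next
  fix a :: "nat option list" and k w :: nat assume "length a + k = l"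
  then show "lam l ai p E w (replicate k None @ R w a) ~= 0" using conn_rst[of a] by simp
 next
  fix a :: "nat option list" and b w w' :: nat assume h: "length a < l" "J w a b"
  have "J w' a b \<longleftrightarrow> w' = w" using joins_unique[OF h, of w'] h(2) by blast
  then show "R w' (Some b # a) = (if w' = w then Some b else None) # R w' a" by (simp del: joins.simps)
 next
  fix a :: "nat option list" and b w :: nat
  assume h: "length a < l" "?good a | \<not> length a <= l" "b \<in> U" "w \<in> set A" "J w a b"
  have J: "J w' a b \<longleftrightarrow> w' = w" for w' using joins_unique[OF h(1,5), of w'] h(5) by blast
  have "w' \<in> set A" if "els (R w' (Some b # a)) ~= {}" for w'
   using that h(1,2,4) J[of w'] by (cases "w' = w") (simp_all del: joins.simps)
  then show "?good (Some b # a) | \<not> length (Some b # a) <= l" using h(1,2,3) by (simp del: joins.simps rst.simps)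
 next
  fix a :: "nat option list" and k b w :: nat assume h: "length a + Suc k = l" "?good a | \<not> length a <= l" "b \<in> U" "w \<in> set A" "\<not> J w a b"
   "lam l ai p E w (replicate k None @ Some b # R w a) ~= 0"
  let ?r = "2 ^ (l - 1 - length a)"
  let ?c = "%w'. replicate k None @ (if w' = w then Some b else None) # R w' a"
  have cw: "conn l p E w (Some b # R w a)" using h(6) by (simp del: conn.simps)
  \<comment> \<open>As \<open>b\<close> is legal in \<open>w\<close> without joining it, it is
    linked to an older element \<open>u\<close>. The component \<open>w'\<close> of \<open>u\<close>
    is not \<open>w\<close>, so \<open>b\<close> in slot \<open>k\<close> and \<open>u\<close> in an
    older slot violate \<open>crossfree\<close>: the radius there is \<open>2 ^ k\<close>.\<close>
  have "\<exists>u\<in>els a. dle E ?r (p u) (p b)"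
   using cw h(5) els_rst[of l p E w a] by (auto split: if_splits)
  then obtain u w' where u: "u \<in> els (R w' a)" "dle E ?r (p u) (p b)" using cov by blast
  have "\<exists>u\<in>els a. dle E ?r (p u) (p b)" using u els_rst by blast
  then have ww: "w' ~= w" using u h(5) by auto
  have w': "w' \<in> set A" using u h by auto
  have al: "length a <= l" using h by simp
  have ov: "overlay l (set A) ?c (replicate k None @ Some b # a)" unfolding overlay_def
  proof (intro conjI allI ballI impI)
   fix x b' assume x: "x < l"
   show "((replicate k None @ Some b # a) ! x = Some b') = (\<exists>w'\<in>set A. ?c w' ! x = Some b')"
   proof (cases "x <= k")
    case True then show ?thesis using h(4) by (auto simp: nth_append nth_Cons' split: if_splits)
   next
    case False
    define x' where "x' = x - Suc k"
    have x': "x = Suc k + x'" "x' < length a" using False x h(1) by (auto simp: x'_def)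
    have "(a ! x' = Some b') = (\<exists>w'\<in>set A. R w' a ! x' = Some b')"
    proof
     assume "a ! x' = Some b'"
     then obtain w where w: "R w a ! x' = Some b'" using cov_nth x' by blast
     then have "b' \<in> els (R w a)" using x' by (auto simp: els_def in_set_conv_nth)
     then show "\<exists>w\<in>set A. R w a ! x' = Some b'" using w h by auto
    qed (use rst_nth x' in blast)
    then show ?thesis using x' by (simp add: nth_append)
   qed
  next
   fix w1 w2 x :: nat assume hh: "w1 ~= w2" "x < l"
   show "?c w1 ! x = None | ?c w2 ! x = None"
   proof (cases "x <= k")
    case True then show ?thesis using hh by (auto simp: nth_append nth_Cons' split: if_splits)
   next
    case False
    define x' where "x' = x - Suc k"
    have x': "x = Suc k + x'" "x' < length a" using False hh h(1) by (auto simp: x'_def)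
    show ?thesis using rst_disjoint[OF al x'(2), of w1 _ w2] hh(1) x'(1)
     by (simp add: nth_append) (metis option.exhaust)
   qed
  qed (use h in auto)
  have cc: "conn l p E w1 (?c w1) & els (?c w1) \<subseteq> U" for w1
  proof (cases "w1 = w")
   case True then show ?thesis using cw h(2,3) al els_rst[of l p E w1 a] by (auto simp del: conn.simps)
  next
   case False then show ?thesis using conn_rst[OF al, of w1] h(2) al els_rst[of l p E w1 a] by auto
  qed
  obtain y where y: "y < length a" "R w' a ! y = Some u" using u(1) by (auto simp: els_def in_set_conv_nth)
  have "\<not> crossfree l p E (set A) ?c" unfolding crossfree_def
  proof -
   have k: "k < l" "Suc k + y < l" using y h(1) by auto
   have n: "?c w ! k = Some b" "?c w' ! (Suc k + y) = Some u" using y ww by (simp_all add: nth_append)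
   have "l - 1 - length a = k" using h(1) by simp
   then have d: "dle E (2 ^ min k (Suc k + y)) (p b) (p u)" using dle_sym[OF sym u(2)] by (simp add: min_def)
   show "\<not> (\<forall>w\<in>set A. \<forall>w'\<in>set A. w ~= w' --> (\<forall>x<l. \<forall>y<l. \<forall>u v. ?c w ! x = Some u --> ?c w' ! y = Some v -->
    \<not> dle E (2 ^ min x y) (p u) (p v)))"
   proof
    assume H: "\<forall>w\<in>set A. \<forall>w'\<in>set A. w ~= w' --> (\<forall>x<l. \<forall>y<l. \<forall>u v. ?c w ! x = Some u --> ?c w' ! y = Some v -->
     \<not> dle E (2 ^ min x y) (p u) (p v))"
    show False using H[rule_format, OF h(4) w' ww[symmetric] k n] d by simp
   qed
  qed
  then have "Lam (map (%w. leaf l ai p E w (?c w)) A) = 0" using Lam[OF ov cc] by simp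
  then show "Lam (map (%w'. lam l ai p E w' (?c w')) A) = 0" unfolding lam_def using cc by simp
 next
  fix a :: "nat option list" and b w w' :: nat assume "length a < l" "J w a b" "J w' a b"
  then show "w = w'" by (rule joins_unique)
 next
  fix a :: "nat option list" and k b :: nat assume h: "length a + Suc k = l" "?good a | \<not> length a <= l" "b \<in> U" "lam l ai p' E' v (replicate k None @ Some b # a) ~= 0"
  have cn: "conn l p' E' v (Some b # a)" using h(4) by (simp del: conn.simps)
  have near: "dle E' (2 ^ l) v (im (p u))" if "u \<in> els (Some b # a)" for u
   using conn_dle'[OF cn _ that] that h p'[of u] by auto
  have "\<exists>w. J w a b" using cov by (auto; blast)
  then obtain w where w: "J w a b" by blast
  \<comment> \<open>The component that \<open>b\<close> joins has an element in its root, and all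
    elements of the position are near \<open>v\<close> in the new graph. Hence the root belongs to
    \<open>A\<close>.\<close>
  have "\<exists>u\<in>els (Some b # a). p u = w"
  proof (cases "els (R w a) = {}")
   case True then show ?thesis using w by (auto split: if_splits)
  next
   case False
   then show ?thesis using conn_root[OF conn_rst[of a w]] h(1) els_rst[of l p E w a] by auto
  qed
  then have "w \<in> set A" unfolding A(2) using near h by auto
  then show "\<exists>w\<in>set A. J w a b" using w by blast
 qed (use U M A in auto)
 have "part_type M l ai U p E = (%w. ty M U (lam l ai p E w) l [])" by (simp add: part_type_def fun_eq_iff)
 then show ?thesis using Phi_ty[of "[]" l] by (simp add: part_type_def)
qed

end

context merge_graph
begin

text \<open>A part that is far from the merged part \<open>z\<close> keeps its type.\<close>

theorem part_type_far:
 assumes im: "!!x. im x = x | im x = z" "im v = v" and Ez: "!!x y. E' x y ==> x ~= z ==> y ~= z ==> E x y"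
  and far: "\<not> dle E' (2 ^ l) v z"
 shows "part_type M l ai U p E v = part_type M l ai U p' E' v"
proof -
 \<comment> \<open>The number \<open>j\<close> is the part of the radius already spent between
   \<open>v\<close> and \<open>c\<close>. The vertex \<open>z\<close> is too far away to lie on the
   path, so every edge of the path is an old one.\<close>
 have bwd: "dle E' j v c ==> dle E' k c x ==> j + k <= 2 ^ l ==> dle E k c x" for j k c x
 proof (induction k arbitrary: x)
  case (Suc k)
  then consider "dle E' k c x" | y where "dle E' k c y" "E' y x" by auto
  then show ?case
  proof cases
   case 2
   have "dle E' (2 ^ l) v y" by (rule dle_mono[OF dle_trans[OF Suc.prems(1) 2(1)]]) (use Suc.prems(3) in simp)
   moreover have "dle E' (2 ^ l) v x" by (rule dle_mono[OF dle_trans[OF Suc.prems(1,2)]]) (use Suc.prems(3) in simp)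
   ultimately have "E y x" using Ez[OF 2(2)] far by blast
   then show ?thesis using Suc.IH[OF Suc.prems(1) 2(1)] Suc.prems(3) by auto
  qed (use Suc in auto)
 qed simp
 have fwd: "dle E' k v x & im x = x" if "dle E k v x" "k <= 2 ^ l" for k x
 proof -
  have d: "dle E' k v (im x)" using dle_im[OF that(1)] im(2) by simp
  then have "im x ~= z" using far that(2) dle_mono by metis
  then show ?thesis using d im(1)[of x] by auto
 qed
 have dl: "dle E (2 ^ l) v x \<longleftrightarrow> dle E' (2 ^ l) v x" for x
  using fwd[of "2 ^ l" x] bwd[of 0 v "2 ^ l" x] by auto
 have same: "p' u = p u" if "u \<in> U" "dle E' (2 ^ l) v (p' u)" for u
 proof -
  have "im (p u) ~= z" using that far p' by auto
  then show ?thesis using im(1)[of "p u"] p'[OF that(1)] by auto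
 qed
 have cn: "conn l p E v a \<longleftrightarrow> conn l p' E' v a" if "els a \<subseteq> U" "length a <= l" for a
  using that
 proof (induction a)
  case (Cons x a)
  show ?case
  proof (cases x)
   case (Some b)
   have b: "b \<in> U" and IH: "conn l p E v a \<longleftrightarrow> conn l p' E' v a" using Cons Some by auto
   show ?thesis
   proof (cases "conn l p' E' v a")
    case True
    let ?r = "2 ^ (l - 1 - length a)"
    have "(?r::nat) + ?r = 2 ^ (l - length a)" using pow_split[of "length a"] Cons.prems by simp
    moreover have "(2::nat) ^ (l - length a) <= 2 ^ l" by (intro power_increasing) auto
    \<comment> \<open>The next link fits into what \<open>conn_dle\<close> leaves of the radius
      \<open>2 ^ l\<close>.\<close>
    ultimately have slack: "(2::nat) ^ l - 2 ^ (l - length a) + ?r <= 2 ^ l" by linarith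
    have pa: "p' u = p u" if "u \<in> els a" for u
     using same[of u] conn_dle'[OF True _ that] Cons.prems Some that by auto
    have lk: "dle E ?r (p u) (p b) \<longleftrightarrow> dle E' ?r (p' u) (p' b)" if u: "u \<in> els a" for u
    proof
     assume "dle E ?r (p u) (p b)"
     from dle_im[OF this] show "dle E' ?r (p' u) (p' b)" using p' b u Cons.prems Some by auto
    next
     assume d: "dle E' ?r (p' u) (p' b)"
     have du: "dle E' (2 ^ l - 2 ^ (l - length a)) v (p' u)" using conn_dle[OF True _ u] Cons.prems by simp
     have "dle E' (2 ^ l) v (p' b)" using dle_mono[OF dle_trans[OF du d] slack] .
     then have "p' b = p b" using same b by blast
     then show "dle E ?r (p u) (p b)" using bwd[OF du d slack] pa[OF u] by simp
    qed
    have "p b = v \<longleftrightarrow> p' b = v" using p'[OF b] im same[OF b] by (metis dle_refl)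
    then show ?thesis using Some IH True lk by auto
   qed (use Some IH in auto)
  qed (use Cons in auto)
 qed simp
 have lam_eq: "lam l ai p E v a = lam l ai p' E' v a" if a: "els a \<subseteq> U" "length a = l" for a
 proof (cases "conn l p' E' v a")
  case True
  have "p' u = p u" if "Some u \<in> set a" for u
   using same[of u] conn_dle'[OF True, of u] a that by (auto simp: els_def)
  then have "map (%x. case x of None => 0 | Some u => Suc (rk l E v (p u))) a
   = map (%x. case x of None => 0 | Some u => Suc (rk l E' v (p' u))) a"
   by (auto simp: rk_def dl split: option.split)
  then show ?thesis using cn[of a] a by (simp add: lam_def leaf_def)
 next
  case False then show ?thesis using cn[of a] a by (simp add: lam_def)
 qed
 have "els a \<subseteq> U ==> length a + k = l ==> ty M U (lam l ai p E v) k a = ty M U (lam l ai p' E' v) k a" for a k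
 proof (induction k arbitrary: a)
  case (Suc k)
  have "{b \<in> U. ty M U (lam l ai p E v) k (Some b # a) = \<kappa>} = {b \<in> U. ty M U (lam l ai p' E' v) k (Some b # a) = \<kappa>}" for \<kappa>
   using Suc.IH[of "Some b # a" for b] Suc.prems by auto
  then show ?case using Suc.IH[of "None # a"] Suc.prems by (simp cong: if_cong)
 qed (use lam_eq in simp)
 then show ?thesis by (simp add: part_type_def)
qed

end

section \<open>Evaluation of leaves from a finite picture of the neighbourhood\<close>

lemma conn_nth_aux:
 "length a <= l ==> conn l p E w a \<longleftrightarrow> (\<forall>x<length a. \<forall>b. a ! x = Some b -->
  (if \<forall>y<length a. x < y --> a ! y = None then p b = w
   else \<exists>y<length a. x < y & (\<exists>u. a ! y = Some u & dle E (2 ^ (x + (l - length a))) (p u) (p b))))"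
proof (induction a)
 case (Cons y a)
 let ?P = "%a k x b. (if \<forall>y<length a. x < y --> a ! y = None then p b = w
   else \<exists>y<length a. x < y & (\<exists>u. a ! y = Some u & dle E (2 ^ (x + k)) (p u) (p b)))"
 have l: "l - length a = Suc (l - length (y # a))" using Cons.prems by simp
 have sh: "?P (y # a) (l - length (y # a)) (Suc x) b \<longleftrightarrow> ?P a (l - length a) x b" for x b
 proof -
  have 1: "(\<forall>y'<length (y # a). Suc x < y' --> (y # a) ! y' = None) \<longleftrightarrow> (\<forall>y<length a. x < y --> a ! y = None)"
   by (simp add: All_less_Suc2)
  have 2: "(\<exists>y'<length (y # a). Suc x < y' & (\<exists>u. (y # a) ! y' = Some u & dle E (2 ^ (Suc x + (l - length (y # a)))) (p u) (p b)))
   \<longleftrightarrow> (\<exists>y<length a. x < y & (\<exists>u. a ! y = Some u & dle E (2 ^ (x + (l - length a))) (p u) (p b)))"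
   unfolding l by (simp add: Ex_less_Suc2)
  show ?thesis unfolding 1 2 ..
 qed
 have z: "?P (y # a) (l - length (y # a)) 0 b \<longleftrightarrow>
  (if els a = {} then p b = w else \<exists>u\<in>els a. dle E (2 ^ (l - 1 - length a)) (p u) (p b))" for b
 proof -
  have 1: "(\<forall>y'<length (y # a). 0 < y' --> (y # a) ! y' = None) \<longleftrightarrow> els a = {}"
   by (auto simp: All_less_Suc2 els_def in_set_conv_nth) (metis option.exhaust)
  have 2: "(\<exists>y'<length (y # a). 0 < y' & (\<exists>u. (y # a) ! y' = Some u & dle E (2 ^ (0 + (l - length (y # a)))) (p u) (p b)))
   \<longleftrightarrow> (\<exists>u\<in>els a. dle E (2 ^ (l - 1 - length a)) (p u) (p b))"
   by (auto simp: Ex_less_Suc2 els_def in_set_conv_nth; metis)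
  show ?thesis unfolding 1 2 ..
 qed
 have "(\<forall>x<length (y # a). \<forall>b. (y # a) ! x = Some b --> ?P (y # a) (l - length (y # a)) x b) \<longleftrightarrow>
  (\<forall>b. y = Some b --> ?P (y # a) (l - length (y # a)) 0 b) & (\<forall>x<length a. \<forall>b. a ! x = Some b --> ?P a (l - length a) x b)"
  using sh by (simp only: length_Cons All_less_Suc2 nth_Cons_0 nth_Cons_Suc)
 also have "\<dots> \<longleftrightarrow> conn l p E w (y # a)"
  unfolding z using Cons by (cases y) auto
 finally show ?case by blast
qed simp

text \<open>In a position of full length the radius of slot \<open>x\<close> is
  \<open>2 ^ x\<close>. This form without recursion is the one that \<open>gconn\<close>
  evaluates.\<close>

lemma conn_nth: "length a = l ==> conn l p E w a \<longleftrightarrow> (\<forall>x<l. \<forall>b. a ! x = Some b -->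
  (if \<forall>y<l. x < y --> a ! y = None then p b = w
   else \<exists>y<l. x < y & (\<exists>u. a ! y = Some u & dle E (2 ^ x) (p u) (p b))))"
 using conn_nth_aux[of a l p E w] by simp

text \<open>The neighbourhood of the merged part \<open>z\<close> is given by a list of parts, of which the first three are the
 two merged parts and \<open>z\<close>, and by one number for each pair of positions in this list.\<close>

definition ginfo :: "nat \<times> nat list => nat => nat => nat" where
 "ginfo G i j = nthd 0 (snd G) (i * fst G + j)"
text \<open>The number for a pair packs the order of the names, red adjacency and an atom code. The
  order is needed since leaves record parts by ranks, which have to be recomputed for the new
  root.\<close>

definition glt :: "nat \<times> nat list => nat => nat => bool" where
 "glt G i j \<longleftrightarrow> ginfo G i j mod 2 = 1"
definition gred :: "nat \<times> nat list => nat => nat => bool" where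
 "gred G i j \<longleftrightarrow> ginfo G i j div 2 mod 2 = 1"
definition gai :: "nat \<times> nat list => nat => nat => nat" where
 "gai G i j = ginfo G i j div 4"
definition gold :: "nat \<times> nat list => nat list" where "gold G = [0, 1] @ [3..<fst G]"
definition gnew :: "nat \<times> nat list => nat list" where "gnew G = [2..<fst G]"
definition gim :: "nat => nat" where "gim i = (if i < 2 then 2 else i)"

definition gball :: "nat \<times> nat list => nat list => nat => nat => nat list" where
 "gball G S k i = rec_nat [i] (%_ y. filter (%j. \<exists>c\<in>set y. c = j | gred G c j) S) k"

definition grk :: "nat => nat \<times> nat list => nat list => nat => nat => nat" where
 "grk l G S w i = length (filter (%j. j \<in> set (gball G S (2 ^ l) w) & glt G j i) S)"

definition lranks :: "nat => nat list" where "lranks t = list_decode (pfst (t - 1))"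
definition lpairs :: "nat => nat list" where "lpairs t = list_decode (psnd (t - 1))"

text \<open>A rank entry of a leaf is nonzero exactly in the slots that were played, so the
  component owning a slot can be found. Indices are shifted by one because 0 stands for a skipped
  slot.\<close>

definition owner :: "nat list => nat => nat" where
 "owner ts x = hdd 0 (map Suc (filter (%j. nthd 0 (lranks (nthd 0 ts j)) x ~= 0) [0..<length ts]))"

text \<open>This inverts the rank: it looks for the part in the ball around the root of the owner
  that has the recorded rank.\<close>

definition posn :: "nat => nat \<times> nat list => nat list => nat list => nat => nat" where
 "posn l G A ts x = hdd 0 (filter (%i. i \<in> set (gball G (gold G) (2 ^ l) (nthd 0 A (owner ts x - 1))) \<and>
   Suc (grk l G (gold G) (nthd 0 A (owner ts x - 1)) i) = nthd 0 (lranks (nthd 0 ts (owner ts x - 1))) x) (gold G))"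

text \<open>\<open>os\<close> lists the pairs of owner and position of the elements.\<close>

definition gcross :: "nat => nat \<times> nat list => (nat \<times> nat) list => bool" where
 "gcross l G os \<longleftrightarrow> (\<forall>x\<in>set [0..<l]. \<forall>y\<in>set [0..<l]. fst (nthd (0, 0) os x) ~= 0 & fst (nthd (0, 0) os y) ~= 0 \<and>
   fst (nthd (0, 0) os x) ~= fst (nthd (0, 0) os y) -->
   \<not> snd (nthd (0, 0) os y) \<in> set (gball G (gold G) (2 ^ (if x <= y then x else y)) (snd (nthd (0, 0) os x))))"

definition gconn :: "nat => nat \<times> nat list => nat => (nat \<times> nat) list => bool" where
 "gconn l G v os \<longleftrightarrow> (\<forall>x\<in>set [0..<l]. fst (nthd (0, 0) os x) ~= 0 -->
  (if \<forall>y\<in>set [0..<l]. x < y --> fst (nthd (0, 0) os y) = 0 then gim (snd (nthd (0, 0) os x)) = v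
   else \<exists>y\<in>set [0..<l]. x < y & fst (nthd (0, 0) os y) ~= 0 \<and>
    gim (snd (nthd (0, 0) os x)) \<in> set (gball G (gnew G) (2 ^ x) (gim (snd (nthd (0, 0) os y))))))"

text \<open>Within one component the entry is copied from its leaf. Elements of different components
  lie in distinct parts without red edge, so the parts determine the atom code and the equality bit
  is 0.\<close>

definition gpair :: "nat => nat \<times> nat list => nat list => (nat \<times> nat) list => nat => nat => nat" where
 "gpair l G ts os x y = (if fst (nthd (0, 0) os x) = 0 | fst (nthd (0, 0) os y) = 0 then 0
  else if fst (nthd (0, 0) os x) = fst (nthd (0, 0) os y) then nthd 0 (lpairs (nthd 0 ts (fst (nthd (0, 0) os x) - 1))) (x * l + y)
  else Suc (2 * gai G (snd (nthd (0, 0) os x)) (snd (nthd (0, 0) os y))))"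

definition gleaf :: "nat => nat \<times> nat list => nat => nat list => (nat \<times> nat) list => nat" where
 "gleaf l G v ts os = (if gcross l G os & gconn l G v os then
  Suc (cd (map (%x. if fst (nthd (0, 0) os x) = 0 then 0 else Suc (grk l G (gnew G) v (gim (snd (nthd (0, 0) os x))))) [0..<l],
   concat (map (%x. map (%y. gpair l G ts os x y) [0..<l]) [0..<l]))) else 0)"

definition gLam :: "nat => nat \<times> nat list => nat => nat list => nat list => nat" where
 "gLam l G v A ts = gleaf l G v ts (map (%x. (owner ts x, posn l G A ts x)) [0..<l])"

lemma gball_set:
 assumes "i \<in> set S" "inj_on q (set S)" "!!i j. i \<in> set S ==> j \<in> set S ==> gred G i j \<longleftrightarrow> E (q i) (q j)"
  and "!!c. dle E k (q i) c ==> c \<in> q ` set S"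
 shows "set (gball G S k i) = {j \<in> set S. dle E k (q i) (q j)}"
 using assms(4)
proof (induction k)
 case 0 then show ?case using assms(1,2) by (auto simp: gball_def inj_on_def)
next
 case (Suc k)
 have IH: "set (gball G S k i) = {j \<in> set S. dle E k (q i) (q j)}" using Suc by auto
 have "set (gball G S (Suc k) i) = {j \<in> set S. \<exists>c\<in>set (gball G S k i). c = j | gred G c j}"
  by (simp add: gball_def)
 also have "\<dots> = {j \<in> set S. dle E (Suc k) (q i) (q j)}"
 proof (intro Collect_cong conj_cong refl)
  fix j assume j: "j \<in> set S"
  show "(\<exists>c\<in>set (gball G S k i). c = j | gred G c j) = dle E (Suc k) (q i) (q j)"
  proof
   assume "dle E (Suc k) (q i) (q j)"
   then consider "dle E k (q i) (q j)" | c where "dle E k (q i) c" "E c (q j)" by auto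
   then show "\<exists>c\<in>set (gball G S k i). c = j | gred G c j"
   proof cases
    case 2
    then obtain c' where "c' \<in> set S" "c = q c'" using Suc.prems[of c] by auto
    then show ?thesis using 2 assms(3) j unfolding IH by auto
   qed (use j IH in auto)
  qed (use assms(3) j IH in auto)
 qed
 finally show ?case .
qed

text \<open>One adjacency bit serves both graphs: a pair of surviving parts has the same adjacency
  before and after the merge, and a pair with a merged part or with the new part belongs to at most
  one of the graphs.\<close>

locale region = merge_graph l p E p' E' im U M ai
 for l p E p' E' im U M ai +
 fixes q :: "nat list" and I :: "nat list"
 assumes q: "distinct q" "3 <= length q"
  and old: "i \<in> set (gold (length q, I)) ==> j \<in> set (gold (length q, I)) ==> gred (length q, I) i j \<longleftrightarrow> E (q ! i) (q ! j)"
  and new: "i \<in> set (gnew (length q, I)) ==> j \<in> set (gnew (length q, I)) ==> gred (length q, I) i j \<longleftrightarrow> E' (q ! i) (q ! j)"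
  and lt: "i < length q ==> j < length q ==> glt (length q, I) i j \<longleftrightarrow> q ! i < q ! j"
  and ai: "i \<in> set (gold (length q, I)) ==> j \<in> set (gold (length q, I)) ==> i ~= j ==> \<not> E (q ! i) (q ! j) ==>
   u \<in> U ==> v \<in> U ==> p u = q ! i ==> p v = q ! j ==> gai (length q, I) i j = ai u v"
  and im: "i \<in> set (gold (length q, I)) ==> im (q ! i) = q ! gim i"
begin

abbreviation "G \<equiv> (length q, I)"

lemma gold_lt: "i \<in> set (gold G) ==> i < length q" and gnew_lt: "i \<in> set (gnew G) ==> i < length q"
 using q(2) by (auto simp: gold_def gnew_def)

lemma gim_new: "i \<in> set (gold G) ==> gim i \<in> set (gnew G)"
 using q(2) by (auto simp: gold_def gnew_def gim_def)

lemma inj_q: "S \<subseteq> {..<length q} ==> inj_on ((!) q) S"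
 by (rule inj_on_nth[OF q(1)]) auto

lemma ball_old: "i \<in> set (gold G) ==> (!!c. dle E k (q ! i) c ==> c \<in> (!) q ` set (gold G)) ==>
  set (gball G (gold G) k i) = {j \<in> set (gold G). dle E k (q ! i) (q ! j)}"
 using old gold_lt by (intro gball_set inj_q) auto

lemma ball_new: "i \<in> set (gnew G) ==> (!!c. dle E' k (q ! i) c ==> c \<in> (!) q ` set (gnew G)) ==>
  set (gball G (gnew G) k i) = {j \<in> set (gnew G). dle E' k (q ! i) (q ! j)}"
 using new gnew_lt by (intro gball_set inj_q) auto

lemma grk_eq:
 assumes S: "distinct S" "set S \<subseteq> {..<length q}" "set (gball G S (2 ^ l) w) = {j \<in> set S. dle F (2 ^ l) (q ! w) (q ! j)}"
  and F: "!!c. dle F (2 ^ l) (q ! w) c ==> c \<in> (!) q ` set S" and i: "i < length q"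
 shows "grk l G S w i = rk l F (q ! w) (q ! i)"
proof -
 have "grk l G S w i = card (set (filter (%j. j \<in> set (gball G S (2 ^ l) w) & glt G j i) S))"
  unfolding grk_def by (rule distinct_card[symmetric]) (simp add: S(1))
 also have "\<dots> = card ((!) q ` set (filter (%j. j \<in> set (gball G S (2 ^ l) w) & glt G j i) S))"
  by (rule card_image[symmetric], rule inj_q) (use S(2) in auto)
 also have "(!) q ` set (filter (%j. j \<in> set (gball G S (2 ^ l) w) & glt G j i) S) = {v'. dle F (2 ^ l) (q ! w) v' & v' < q ! i}"
 proof (intro set_eqI iffI)
  fix v' assume "v' \<in> (!) q ` set (filter (%j. j \<in> set (gball G S (2 ^ l) w) & glt G j i) S)"
  then obtain j where j: "j \<in> set S" "j \<in> set (gball G S (2 ^ l) w)" "glt G j i" "v' = q ! j" by auto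
  have "j < length q" using S(2) j(1) by auto
  then show "v' \<in> {v'. dle F (2 ^ l) (q ! w) v' & v' < q ! i}" using j(2,3) lt[OF _ i, of j] unfolding S(3) j(4) by simp
 next
  fix v' assume v': "v' \<in> {v'. dle F (2 ^ l) (q ! w) v' & v' < q ! i}"
  then obtain j where j: "j \<in> set S" "v' = q ! j" using F by blast
  have "j < length q" using S(2) j(1) by auto
  then have "j \<in> set (filter (%j. j \<in> set (gball G S (2 ^ l) w) & glt G j i) S)" using v' j lt[OF _ i, of j] S(3) by simp
  then show "v' \<in> (!) q ` set (filter (%j. j \<in> set (gball G S (2 ^ l) w) & glt G j i) S)" using j(2) by blast
 qed
 finally show ?thesis by (simp add: rk_def)
qed

lemma distinct_gold: "distinct (gold G)" and distinct_gnew: "distinct (gnew G)"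
 by (auto simp: gold_def gnew_def)

text \<open>What the new leaf records is recovered from the component leaves: the owner of a slot,
  then its part through the rank, then all distances inside the region. The assumption
  \<open>inner\<close> places the balls that are consulted inside the region.\<close>

lemma gLam_correct:
 assumes A: "distinct A" "set A \<subseteq> set (gold G)" and v: "v \<in> set (gnew G)"
  and inner: "!!w x. w \<in> set A ==> dle E (2 ^ l) (q ! w) x ==>
   (\<forall>c. dle E (2 ^ l) x c --> c \<in> (!) q ` set (gold G)) & (\<forall>c. dle E' (2 ^ l) (im x) c --> c \<in> (!) q ` set (gnew G))"
  and innerv: "!!c. dle E' (2 ^ l) (q ! v) c ==> c \<in> (!) q ` set (gnew G)"
  and ov: "overlay l ((!) q ` set A) c a"
  and cc: "!!w. w \<in> (!) q ` set A ==> conn l p E w (c w) & els (c w) \<subseteq> U"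
 shows "gLam l G v A (map (%w. leaf l ai p E w (c w)) (map ((!) q) A)) =
  (if crossfree l p E ((!) q ` set A) c then lam l ai p' E' (q ! v) a else 0)"
proof -
 define ts where "ts = map (%w. leaf l ai p E w (c w)) (map ((!) q) A)"
 define os where "os = map (%x. (owner ts x, posn l G A ts x)) [0..<l]"
 define nm where "nm = (%j. q ! (A ! j))"
 have nmA: "nm j \<in> (!) q ` set A" if "j < length A" for j using that by (auto simp: nm_def)
 have Alt: "A ! j < length q" "A ! j \<in> set (gold G)" if "j < length A" for j using A(2) gold_lt that nth_mem by blast+
 have nm_inj: "nm i = nm j \<longleftrightarrow> i = j" if "i < length A" "j < length A" for i j
  using that Alt A(1) q(1) by (simp add: nm_def nth_eq_iff_index_eq)
 have lc: "length (c (nm j)) = l" if "j < length A" for j using ov nmA[OF that] by (auto simp: overlay_def)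
 have tsj: "nthd 0 ts j = leaf l ai p E (nm j) (c (nm j))" if "j < length A" for j
  using that by (simp add: nthd_def ts_def nm_def)
 have lts: "length ts = length A" by (simp add: ts_def)
 have rj: "nthd 0 (lranks (nthd 0 ts j)) x = (case c (nm j) ! x of None => 0 | Some u => Suc (rk l E (nm j) (p u)))"
  if "j < length A" "x < l" for j x
 proof -
  have lr: "lranks (nthd 0 ts j) = map (%x. case x of None => 0 | Some u => Suc (rk l E (nm j) (p u))) (c (nm j))"
   unfolding tsj[OF that(1)] leaf_def lranks_def by (simp add: cd_nat_list)
  show ?thesis unfolding lr using that lc[OF that(1)] by (simp add: nthd_def)
 qed
 have concat_nth: "concat (map (%x. map (f x) [0..<m]) [0..<n]) ! (x * m + y) = f x y \<and>
  x * m + y < length (concat (map (%x. map (f x) [0..<m]) [0..<n]))" if "x < n" "y < m" for f :: "nat => nat => nat" and x y n m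
  using that
 proof (induction n)
  case (Suc n)
  have len: "length (concat (map (%x. map (f x) [0..<m]) [0..<n])) = n * m" by (induction n) auto
  show ?case
  proof (cases "x = n")
   case True then show ?thesis using Suc.prems len by (simp add: nth_append)
  next
   case False
   then have IH: "concat (map (%x. map (f x) [0..<m]) [0..<n]) ! (x * m + y) = f x y" "x * m + y < n * m"
    using Suc len by auto
   then show ?thesis using len by (simp add: nth_append)
  qed
 qed simp
 have pj: "nthd 0 (lpairs (nthd 0 ts j)) (x * l + y) = pinfo ai (c (nm j) ! x) (c (nm j) ! y)"
  if "j < length A" "x < l" "y < l" for j x y
 proof -
  have lp: "lpairs (nthd 0 ts j) = concat (map (%x. map (%y. pinfo ai (c (nm j) ! x) (c (nm j) ! y)) [0..<l]) [0..<l])"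
   unfolding tsj[OF that(1)] leaf_def lpairs_def by (simp add: cd_nat_list)
  show ?thesis unfolding lp using concat_nth[OF that(2,3), of "%x y. pinfo ai (c (nm j) ! x) (c (nm j) ! y)"]
   by (simp add: nthd_def)
 qed
 have own0: "owner ts x = 0" if "x < l" "a ! x = None" for x
 proof -
  have "c (nm j) ! x = None" if "j < length A" for j
  proof (rule ccontr)
   assume "c (nm j) ! x ~= None"
   then obtain b where "c (nm j) ! x = Some b" by auto
   then have "a ! x = Some b" using ov nmA[OF that] \<open>x < l\<close> unfolding overlay_def by blast
   then show False using \<open>a ! x = None\<close> by simp
  qed
  then have "filter (%j. nthd 0 (lranks (nthd 0 ts j)) x ~= 0) [0..<length ts] = []"
   using rj that(1) by (auto simp: lts filter_empty_conv)
  then show ?thesis by (simp add: owner_def hdd_def)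
 qed
 have own1: "\<exists>j<length A. owner ts x = Suc j & c (nm j) ! x = Some b" if x: "x < l" "a ! x = Some b" for x b
 proof -
  obtain w where w: "w \<in> (!) q ` set A" "c w ! x = Some b" using ov x unfolding overlay_def by blast
  then obtain j where j: "j < length A" "c (nm j) ! x = Some b" by (auto simp: nm_def in_set_conv_nth)
  have "c (nm i) ! x = None" if "i < length A" "i ~= j" for i
  proof -
   have "nm i ~= nm j" using nm_inj that j(1) by simp
   then show ?thesis using ov nmA[OF that(1)] nmA[OF j(1)] x(1) j(2) unfolding overlay_def by fastforce
  qed
  then have "(%i. i < length A & nthd 0 (lranks (nthd 0 ts i)) x ~= 0) = (%i. i = j)"
   using rj j x(1) by (auto simp: fun_eq_iff split: option.splits) (metis option.distinct(1))+
  then have "filter (%i. nthd 0 (lranks (nthd 0 ts i)) x ~= 0) [0..<length ts] = filter (%i. i = j) [0..<length ts]"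
   unfolding lts by (intro filter_cong refl) (auto dest: fun_cong)
  moreover have "filter (%i. i = j) [0..<n] = (if j < n then [j] else [])" for n by (induction n) auto
  ultimately show ?thesis using j by (auto simp: owner_def hdd_def lts)
 qed
 have near: "dle E (2 ^ l) (nm j) (p b)" "b \<in> U" if "j < length A" "x < l" "c (nm j) ! x = Some b" for j x b
 proof -
  have "b \<in> els (c (nm j))" using that lc els_nth by metis
  then show "dle E (2 ^ l) (nm j) (p b)" "b \<in> U" using cc[OF nmA[OF that(1)]] lc[OF that(1)] conn_dle' by auto
 qed
 have inn: "!!c. dle E (2 ^ l) (p b) c ==> c \<in> (!) q ` set (gold G)" "!!c. dle E' (2 ^ l) (im (p b)) c ==> c \<in> (!) q ` set (gnew G)"
  "p b \<in> (!) q ` set (gold G)" if "j < length A" "x < l" "c (nm j) ! x = Some b" for j x b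
  using inner[of "A ! j" "p b"] near[OF that] that(1) dle_refl[of E "2 ^ l" "p b"] by (auto simp: nm_def)
 have innA: "!!c. dle E (2 ^ l) (nm j) c ==> c \<in> (!) q ` set (gold G)" if "j < length A" for j c
  using inner[of "A ! j" "nm j"] that by (auto simp: nm_def)
 have pos: "posn l G A ts x \<in> set (gold G) & q ! posn l G A ts x = p b" if x: "x < l" "a ! x = Some b" for x b
 proof -
  obtain j where j: "j < length A" "owner ts x = Suc j" "c (nm j) ! x = Some b" using own1[OF x] by blast
  let ?P = "%i. i \<in> set (gball G (gold G) (2 ^ l) (A ! j)) & Suc (grk l G (gold G) (A ! j) i) = Suc (rk l E (nm j) (p b))"
  have bl: "set (gball G (gold G) (2 ^ l) (A ! j)) = {i \<in> set (gold G). dle E (2 ^ l) (nm j) (q ! i)}"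
   unfolding nm_def using innA[OF j(1)] Alt[OF j(1)] by (intro ball_old) (auto simp: nm_def)
  have gr: "grk l G (gold G) (A ! j) i = rk l E (nm j) (q ! i)" if "i \<in> set (gold G)" for i
   unfolding nm_def by (rule grk_eq) (use bl innA[OF j(1)] gold_lt that distinct_gold in \<open>auto simp: nm_def\<close>)
  have finb: "finite {v'. dle E (2 ^ l) (nm j) v'}"
   by (rule finite_subset[of _ "(!) q ` set (gold G)"]) (use innA[OF j(1)] in auto)
  \<comment> \<open>Ranks increase strictly along a finite ball, so the rank determines the
    part.\<close>
  have inj: "v1 = v2" if "dle E (2 ^ l) (nm j) v1" "dle E (2 ^ l) (nm j) v2" "rk l E (nm j) v1 = rk l E (nm j) v2" for v1 v2
  proof -
   have "rk l E (nm j) v1 < rk l E (nm j) v2" if "dle E (2 ^ l) (nm j) v1" "v1 < v2" for v1 v2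
    unfolding rk_def by (rule psubset_card_mono) (use that finb in auto)
   from this[of v1 v2] this[of v2 v1] that show ?thesis by (metis less_irrefl linorder_neqE_nat)
  qed
  obtain i where i: "i \<in> set (gold G)" "q ! i = p b" using inn(3)[OF j(1) x(1) j(3)] by auto
  have Pi: "?P i" using i near(1)[OF j(1) x(1) j(3)] by (simp add: bl gr)
  have uniq: "q ! i' = p b" if "i' \<in> set (gold G)" "?P i'" for i'
  proof -
   have "rk l E (nm j) (q ! i') = rk l E (nm j) (p b)" "dle E (2 ^ l) (nm j) (q ! i')"
    using that gr[OF that(1)] bl by auto
   then show ?thesis using inj near(1)[OF j(1) x(1) j(3)] by blast
  qed
  have posn: "posn l G A ts x = hdd 0 (filter ?P (gold G))"
   unfolding posn_def j(2) using j(1,3) x(1) by (simp add: rj nthd_def[of 0 A])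
  have ne: "filter ?P (gold G) ~= []" using i(1) Pi by (auto simp: filter_empty_conv)
  have "posn l G A ts x = hd (filter ?P (gold G))" unfolding posn hdd_def using ne by (rule if_not_P)
  then have "posn l G A ts x \<in> set (filter ?P (gold G))" using hd_in_set[OF ne] by (simp only:)
  then show ?thesis using uniq by auto
 qed
 have osx: "nthd (0, 0) os x = (owner ts x, posn l G A ts x)" if "x < l" for x
  using that by (simp add: os_def nthd_def)
 have own_iff: "owner ts x = 0 \<longleftrightarrow> a ! x = None" if "x < l" for x
  using own0[OF that] own1[OF that] by (cases "a ! x") auto
 have pow: "(2::nat) ^ x <= 2 ^ l" if "x < l" for x using that by (intro power_increasing) auto
 have bo: "j' \<in> set (gball G (gold G) (2 ^ k) (posn l G A ts x)) \<longleftrightarrow> dle E (2 ^ k) (p b) (q ! j')"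
  if x: "x < l" "a ! x = Some b" "k < l" "j' \<in> set (gold G)" for x b k j'
 proof -
  obtain j where j: "j < length A" "c (nm j) ! x = Some b" using own1[OF x(1,2)] by blast
  have "set (gball G (gold G) (2 ^ k) (posn l G A ts x)) = {j \<in> set (gold G). dle E (2 ^ k) (q ! posn l G A ts x) (q ! j)}"
   using pos[OF x(1,2)] inn(1)[OF j(1) x(1) j(2)] dle_mono[OF _ pow[OF x(3)]] by (intro ball_old) auto
  then show ?thesis using pos[OF x(1,2)] x(4) by simp
 qed
 have cross: "gcross l G os \<longleftrightarrow> crossfree l p E ((!) q ` set A) c"
 proof
  assume g: "gcross l G os"
  show "crossfree l p E ((!) q ` set A) c" unfolding crossfree_def
  proof (intro ballI allI impI)
   fix w w' x y u v assume h: "w \<in> (!) q ` set A" "w' \<in> (!) q ` set A" "w ~= w'" "x < l" "y < l" "c w ! x = Some u" "c w' ! y = Some v"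
   have a: "a ! x = Some u" "a ! y = Some v" using ov h unfolding overlay_def by blast+
   obtain j j' where j: "j < length A" "owner ts x = Suc j" "c (nm j) ! x = Some u" "j' < length A" "owner ts y = Suc j'" "c (nm j') ! y = Some v"
    using own1[OF h(4) a(1)] own1[OF h(5) a(2)] by blast
   have "w = nm j" using ov h(1,4,6) nmA[OF j(1)] j(3) unfolding overlay_def by (metis option.distinct(1))
   moreover have "w' = nm j'" using ov h(2,5,7) nmA[OF j(4)] j(6) unfolding overlay_def by (metis option.distinct(1))
   ultimately have "j ~= j'" using h(3) by auto
   then have "posn l G A ts y \<notin> set (gball G (gold G) (2 ^ min x y) (posn l G A ts x))"
    using g h(4,5) j(2,5) unfolding gcross_def by (auto simp: osx min_def)
   then show "\<not> dle E (2 ^ min x y) (p u) (p v)"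
    using bo[OF h(4) a(1), of "min x y" "posn l G A ts y"] pos[OF h(5) a(2)] h(4,5) by simp
  qed
 next
  assume cf: "crossfree l p E ((!) q ` set A) c"
  show "gcross l G os" unfolding gcross_def
  proof (intro ballI impI)
   fix x y assume xy: "x \<in> set [0..<l]" "y \<in> set [0..<l]"
   then have xl: "x < l" "y < l" by auto
   assume "fst (nthd (0, 0) os x) ~= 0 & fst (nthd (0, 0) os y) ~= 0 & fst (nthd (0, 0) os x) ~= fst (nthd (0, 0) os y)"
   then have o: "owner ts x ~= 0" "owner ts y ~= 0" "owner ts x ~= owner ts y" using xl by (auto simp: osx)
   then obtain u v where a: "a ! x = Some u" "a ! y = Some v" using own_iff xl by fastforce
   obtain j j' where j: "j < length A" "owner ts x = Suc j" "c (nm j) ! x = Some u" "j' < length A" "owner ts y = Suc j'" "c (nm j') ! y = Some v"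
    using own1[OF xl(1) a(1)] own1[OF xl(2) a(2)] by blast
   have "nm j ~= nm j'" using nm_inj j o(3) by auto
   then have "\<not> dle E (2 ^ min x y) (p u) (p v)" using cf nmA[OF j(1)] nmA[OF j(4)] xl j(3,6) unfolding crossfree_def by blast
   then show "\<not> snd (nthd (0, 0) os y) \<in> set (gball G (gold G) (2 ^ (if x <= y then x else y)) (snd (nthd (0, 0) os x)))"
    using bo[OF xl(1) a(1), of "min x y" "posn l G A ts y"] pos[OF xl(2) a(2)] xl by (simp add: osx min_def)
  qed
 qed
 have la: "length a = l" using ov by (simp add: overlay_def)
 have imp: "gim (posn l G A ts x) \<in> set (gnew G) & q ! gim (posn l G A ts x) = p' b" if x: "x < l" "a ! x = Some b" for x b
 proof -
  obtain j where j: "j < length A" "c (nm j) ! x = Some b" using own1[OF x(1,2)] by blast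
  have "im (q ! posn l G A ts x) = q ! gim (posn l G A ts x)" by (rule im) (use pos[OF x] in blast)
  then show ?thesis using pos[OF x] gim_new p'[OF near(2)[OF j(1) x(1) j(2)]] by simp
 qed
 have bn: "j' \<in> set (gball G (gnew G) (2 ^ k) (gim (posn l G A ts x))) \<longleftrightarrow> dle E' (2 ^ k) (p' b) (q ! j')"
  if x: "x < l" "a ! x = Some b" "k < l" "j' \<in> set (gnew G)" for x b k j'
 proof -
  obtain j where j: "j < length A" "c (nm j) ! x = Some b" using own1[OF x(1,2)] by blast
  have pb: "p' b = im (p b)" using p' near(2)[OF j(1) x(1) j(2)] by simp
  have "set (gball G (gnew G) (2 ^ k) (gim (posn l G A ts x))) = {j \<in> set (gnew G). dle E' (2 ^ k) (q ! gim (posn l G A ts x)) (q ! j)}"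
   using imp[OF x(1,2)] inn(2)[OF j(1) x(1) j(2)] dle_mono[OF _ pow[OF x(3)]] pb by (intro ball_new) auto
  then show ?thesis using imp[OF x(1,2)] x(4) by simp
 qed
 have qv: "q ! i = q ! v \<longleftrightarrow> i = v" if "i \<in> set (gnew G)" for i
  using that v gnew_lt q(1) by (simp add: nth_eq_iff_index_eq)
 have con: "gconn l G v os \<longleftrightarrow> conn l p' E' (q ! v) a"
 proof -
  have 1: "(\<forall>y\<in>set [0..<l]. x < y --> fst (nthd (0, 0) os y) = 0) \<longleftrightarrow> (\<forall>y<l. x < y --> a ! y = None)" for x
   by (auto simp: osx own_iff)
  have 2: "gim (snd (nthd (0, 0) os x)) = v \<longleftrightarrow> p' b = q ! v" if "x < l" "a ! x = Some b" for x b
   using imp[OF that] qv[of "gim (posn l G A ts x)"] that by (auto simp: osx)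
  have 3: "(\<exists>y\<in>set [0..<l]. x < y & fst (nthd (0, 0) os y) ~= 0 \<and>
    gim (snd (nthd (0, 0) os x)) \<in> set (gball G (gnew G) (2 ^ x) (gim (snd (nthd (0, 0) os y))))) \<longleftrightarrow>
   (\<exists>y<l. x < y & (\<exists>u. a ! y = Some u & dle E' (2 ^ x) (p' u) (p' b)))" if x: "x < l" "a ! x = Some b" for x b
  proof -
   have "(fst (nthd (0, 0) os y) ~= 0 & gim (snd (nthd (0, 0) os x)) \<in> set (gball G (gnew G) (2 ^ x) (gim (snd (nthd (0, 0) os y))))) \<longleftrightarrow>
    (\<exists>u. a ! y = Some u & dle E' (2 ^ x) (p' u) (p' b))" if y: "y < l" for y
    using own_iff[OF y] bn[OF y _ x(1), of _ "gim (posn l G A ts x)"] imp[OF x] x y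
    by (cases "a ! y") (auto simp: osx)
   then show ?thesis by auto
  qed
  define B where "B = (%x. if \<forall>y\<in>set [0..<l]. x < y --> fst (nthd (0, 0) os y) = 0 then gim (snd (nthd (0, 0) os x)) = v
   else \<exists>y\<in>set [0..<l]. x < y & fst (nthd (0, 0) os y) ~= 0 \<and>
    gim (snd (nthd (0, 0) os x)) \<in> set (gball G (gnew G) (2 ^ x) (gim (snd (nthd (0, 0) os y)))))"
  have B: "B x \<longleftrightarrow> (if \<forall>y<l. x < y --> a ! y = None then p' b = q ! v
   else \<exists>y<l. x < y & (\<exists>u. a ! y = Some u & dle E' (2 ^ x) (p' u) (p' b)))" if "x < l" "a ! x = Some b" for x b
   unfolding B_def 1 2[OF that] 3[OF that] ..
  have "gconn l G v os \<longleftrightarrow> (\<forall>x\<in>set [0..<l]. fst (nthd (0, 0) os x) ~= 0 --> B x)" unfolding gconn_def B_def ..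
  also have "\<dots> \<longleftrightarrow> (\<forall>x<l. a ! x ~= None --> B x)" using own_iff by (auto simp: osx)
  also have "\<dots> \<longleftrightarrow> conn l p' E' (q ! v) a" unfolding conn_nth[OF la]
  proof (intro iffI allI impI)
   fix x b assume h: "\<forall>x<l. a ! x ~= None --> B x" "x < l" "a ! x = Some b"
   then have "B x" by simp
   then show "if \<forall>y<l. x < y --> a ! y = None then p' b = q ! v
    else \<exists>y<l. x < y & (\<exists>u. a ! y = Some u & dle E' (2 ^ x) (p' u) (p' b))" using B[OF h(2,3)] by blast
  next
   fix x assume h: "\<forall>x<l. \<forall>b. a ! x = Some b --> (if \<forall>y<l. x < y --> a ! y = None then p' b = q ! v
    else \<exists>y<l. x < y & (\<exists>u. a ! y = Some u & dle E' (2 ^ x) (p' u) (p' b)))" "x < l" "a ! x ~= None"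
   then obtain b where b: "a ! x = Some b" by auto
   show "B x" unfolding B[OF h(2) b] using h(1) h(2) b by blast
  qed
  finally show ?thesis .
 qed
 have "gLam l G v A ts = gleaf l G v ts os" by (simp add: gLam_def os_def)
 also have "\<dots> = (if crossfree l p E ((!) q ` set A) c then lam l ai p' E' (q ! v) a else 0)"
 proof (cases "crossfree l p E ((!) q ` set A) c & conn l p' E' (q ! v) a")
  case CC: True
  have 1: "map (%x. if fst (nthd (0, 0) os x) = 0 then 0 else Suc (grk l G (gnew G) v (gim (snd (nthd (0, 0) os x))))) [0..<l]
   = map (%x. case x of None => 0 | Some u => Suc (rk l E' (q ! v) (p' u))) a"
  proof (rule nth_equalityI)
   fix x assume "x < length (map (%x. if fst (nthd (0, 0) os x) = 0 then 0 else Suc (grk l G (gnew G) v (gim (snd (nthd (0, 0) os x))))) [0..<l])"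
   then have x: "x < l" by simp
   have gr: "grk l G (gnew G) v i = rk l E' (q ! v) (q ! i)" if "i \<in> set (gnew G)" for i
    by (rule grk_eq) (use ball_new[OF v innerv] innerv gnew_lt that distinct_gnew in auto)
   show "map (%x. if fst (nthd (0, 0) os x) = 0 then 0 else Suc (grk l G (gnew G) v (gim (snd (nthd (0, 0) os x))))) [0..<l] ! x
    = map (%x. case x of None => 0 | Some u => Suc (rk l E' (q ! v) (p' u))) a ! x"
    using x la own_iff[OF x] imp[OF x] gr by (cases "a ! x") (auto simp: osx)
  qed (simp add: la)
  have 2: "gpair l G ts os x y = pinfo ai (a ! x) (a ! y)" if xy: "x < l" "y < l" for x y
  proof (cases "a ! x = None | a ! y = None")
   case True
   then show ?thesis using own_iff xy by (auto simp: gpair_def osx pinfo_def split: option.splits)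
  next
   case False
   then obtain u v where a: "a ! x = Some u" "a ! y = Some v" by auto
   obtain j j' where j: "j < length A" "owner ts x = Suc j" "c (nm j) ! x = Some u" "j' < length A" "owner ts y = Suc j'" "c (nm j') ! y = Some v"
    using own1[OF xy(1) a(1)] own1[OF xy(2) a(2)] by blast
   show ?thesis
   proof (cases "j = j'")
    case True
    then show ?thesis using j a xy pj by (simp add: gpair_def osx)
   next
    case jj: False
    have nd: "\<not> dle E (2 ^ min x y) (p u) (p v)"
     using CC nmA[OF j(1)] nmA[OF j(4)] xy j(3,6) nm_inj[OF j(1,4)] jj
     unfolding crossfree_def by blast
    \<comment> \<open>Every radius \<open>2 ^ min x y\<close> is at least 1, so elements of
      different components are in distinct parts without red edge, as the assumption
      \<open>ai\<close> demands.\<close>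
    have "\<not> dle E 1 (p u) (p v)" using nd dle_mono[of E 1 "p u" "p v" "2 ^ min x y"] one_le_power[of 2 "min x y"] by (metis one_le_numeral)
    then have ne: "p u ~= p v" "\<not> E (p u) (p v)" by auto
    have "gai G (posn l G A ts x) (posn l G A ts y) = ai u v"
     using ne pos[OF xy(1) a(1)] pos[OF xy(2) a(2)] near(2)[OF j(1) xy(1) j(3)] near(2)[OF j(4) xy(2) j(6)]
     by (intro ai) auto
    then show ?thesis using j jj a xy ne by (auto simp: gpair_def osx pinfo_def)
   qed
  qed
  have "concat (map (%x. map (%y. gpair l G ts os x y) [0..<l]) [0..<l]) = concat (map (%x. map (%y. pinfo ai (a ! x) (a ! y)) [0..<l]) [0..<l])"
   using 2 by (intro arg_cong[where f=concat] map_cong refl) auto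
  then show ?thesis using CC cross con 1 unfolding gleaf_def lam_def leaf_def by simp
 next
  case False then show ?thesis using cross con by (auto simp: gleaf_def lam_def)
 qed
 finally show ?thesis unfolding ts_def .
qed

end

section \<open>Primitive recursiveness of the evaluation of leaves\<close>

lemma PR_comp5: "PR (%p. F (fst p) (fst (snd p)) (fst (snd (snd p))) (fst (snd (snd (snd p)))) (snd (snd (snd (snd p))))) ==>
  PR f ==> PR g ==> PR h ==> PR k ==> PR k' ==> PR (%x. F (f x) (g x) (h x) (k x) (k' x))"
 using PR_comp4[of "%a b c p. F a b c (fst p) (snd p)" f g h "%x. (k x, k' x)"] PR_Pair[of k k'] by simp

lemma PR_ginfo: "PR f ==> PR g ==> PR h ==> PR (%x. ginfo (f x) (g x) (h x))"
 unfolding ginfo_def by (intro PR_intros; assumption)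
lemma PR_glt: "PR f ==> PR g ==> PR h ==> PR (%x. glt (f x) (g x) (h x))"
 unfolding glt_def by (intro PR_intros PR_ginfo; assumption)
lemma PR_gred: "PR f ==> PR g ==> PR h ==> PR (%x. gred (f x) (g x) (h x))"
 unfolding gred_def by (intro PR_intros PR_ginfo; assumption)
lemma PR_gai: "PR f ==> PR g ==> PR h ==> PR (%x. gai (f x) (g x) (h x))"
 unfolding gai_def by (intro PR_intros PR_ginfo; assumption)
lemma PR_gold: "PR f ==> PR (%x. gold (f x))" unfolding gold_def by (intro PR_intros; assumption)
lemma PR_gnew: "PR f ==> PR (%x. gnew (f x))" unfolding gnew_def by (intro PR_intros; assumption)
lemma PR_gim: "PR f ==> PR (%x. gim (f x))" unfolding gim_def by (intro PR_intros; assumption)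

lemma PR_gball: "PR f ==> PR g ==> PR h ==> PR k ==> PR (%x. gball (f x) (g x) (h x) (k x))"
proof (rule PR_comp4[where F=gball])
 show "PR (%p. gball (fst p) (fst (snd p)) (fst (snd (snd p))) (snd (snd (snd p))))"
  unfolding gball_def by (intro PR_intros PR_rec PR_gred)
qed

lemma PR_grk: "PR f ==> PR g ==> PR h ==> PR k ==> PR k' ==> PR (%x. grk (f x) (g x) (h x) (k x) (k' x))"
proof (rule PR_comp5[where F=grk])
 show "PR (%p. grk (fst p) (fst (snd p)) (fst (snd (snd p))) (fst (snd (snd (snd p)))) (snd (snd (snd (snd p)))))"
  unfolding grk_def by (intro PR_intros PR_gball PR_glt)
qed

lemma PR_pfst: "PR f ==> PR (%x. pfst (f x))" by (rule PR_comp[of pfst], rule PRI[OF pr.fst]) auto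
lemma PR_psnd: "PR f ==> PR (%x. psnd (f x))" by (rule PR_comp[of psnd], rule PRI[OF pr.snd]) auto

lemma PR_lranks: "PR f ==> PR (%x. lranks (f x))" unfolding lranks_def by (intro PR_intros PR_pfst; assumption)
lemma PR_lpairs: "PR f ==> PR (%x. lpairs (f x))" unfolding lpairs_def by (intro PR_intros PR_psnd; assumption)
lemma PR_skp: "PR f ==> PR (%x. skp (f x))" unfolding skp_def by (intro PR_intros PR_pfst; assumption)
lemma PR_kids: "PR f ==> PR (%x. kids (f x))" unfolding kids_def by (intro PR_intros PR_psnd; assumption)

lemma PR_owner: "PR f ==> PR g ==> PR (%x. owner (f x) (g x))"
proof (rule PR_comp2[where F=owner])
 show "PR (%p. owner (fst p) (snd p))" unfolding owner_def by (intro PR_intros PR_lranks)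
qed

lemma PR_posn: "PR f ==> PR g ==> PR h ==> PR k ==> PR k' ==> PR (%x. posn (f x) (g x) (h x) (k x) (k' x))"
proof (rule PR_comp5[where F=posn])
 show "PR (%p. posn (fst p) (fst (snd p)) (fst (snd (snd p))) (fst (snd (snd (snd p)))) (snd (snd (snd (snd p)))))"
  unfolding posn_def by (intro PR_intros PR_gball PR_grk PR_gold PR_owner PR_lranks)
qed

lemma PR_gcross: "PR f ==> PR g ==> PR h ==> PR (%x. gcross (f x) (g x) (h x))"
proof (rule PR_comp3[where F=gcross])
 show "PR (%p. gcross (fst p) (fst (snd p)) (snd (snd p)))"
  unfolding gcross_def by (intro PR_intros PR_gball PR_gold)
qed

lemma PR_gconn: "PR f ==> PR g ==> PR h ==> PR k ==> PR (%x. gconn (f x) (g x) (h x) (k x))"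
proof (rule PR_comp4[where F=gconn])
 show "PR (%p. gconn (fst p) (fst (snd p)) (fst (snd (snd p))) (snd (snd (snd p))))"
  unfolding gconn_def by (intro PR_intros PR_gball PR_gnew PR_gim)
qed

lemma PR_gpair: "PR f ==> PR g ==> PR h ==> PR k ==> PR k' ==> PR k'' ==> PR (%x. gpair (f x) (g x) (h x) (k x) (k' x) (k'' x))"
 unfolding gpair_def by (intro PR_intros PR_gai PR_lpairs; assumption)

lemma PR_gleaf: "PR f ==> PR g ==> PR h ==> PR k ==> PR k' ==> PR (%x. gleaf (f x) (g x) (h x) (k x) (k' x))"
proof (rule PR_comp5[where F=gleaf])
 show "PR (%p. gleaf (fst p) (fst (snd p)) (fst (snd (snd p))) (fst (snd (snd (snd p)))) (snd (snd (snd (snd p)))))"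
  unfolding gleaf_def by (intro PR_intros PR_gcross PR_gconn PR_grk PR_gnew PR_gim PR_gpair)
qed

lemma PR_gLam: "PR f ==> PR g ==> PR h ==> PR k ==> PR k' ==> PR (%x. gLam (f x) (g x) (h x) (k x) (k' x))"
proof (rule PR_comp5[where F=gLam])
 show "PR (%p. gLam (fst p) (fst (snd p)) (fst (snd (snd p))) (fst (snd (snd (snd p)))) (snd (snd (snd (snd p)))))"
  unfolding gLam_def by (intro PR_intros PR_gleaf PR_owner PR_posn)
qed

section \<open>Computation of the type update\<close>

text \<open>A search below \<open>N\<close> that replaces the unbounded \<open>LEAST\<close> in
  \<open>top_of\<close>.\<close>

definition top_below :: "nat => (nat => nat) => nat" where
 "top_below N m = rec_nat 0 (%i y. if m i ~= 0 then Suc i else y) N"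

lemma top_below_eq: assumes "\<forall>k\<ge>N. m k = 0" shows "top_of m = top_below N m"
proof -
 have tb: "top_below K m <= K & (\<forall>k<K. k >= top_below K m --> m k = 0) & (top_below K m = 0 | m (top_below K m - 1) ~= 0)" for K
  by (induction K) (auto simp: top_below_def less_Suc_eq)
 show ?thesis unfolding top_of_def
 proof (rule Least_equality)
  show "\<forall>k\<ge>top_below N m. m k = 0" using tb[of N] assms by (meson not_le)
  fix K assume "\<forall>k\<ge>K. m k = 0"
  then show "top_below N m <= K" using tb[of N] by (metis One_nat_def Suc_pred le_0_eq not_gr_zero not_less_eq_eq zero_le)
 qed
qed

definition ndl :: "nat => nat => nat => (nat => nat) => nat" where
 "ndl M s N m = (if s = 0 then 0 else Suc (cd (s, map (%k. cap M (m k)) [0..<top_below N m])))"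

lemma ndl_eq: "\<forall>k\<ge>N. m k = 0 ==> ndl M s N m = nd M s m"
 by (simp add: ndl_def nd_def mcode_def top_below_eq)

lemma PR_cap: "PR f ==> PR (%x. cap M (f x))"
 unfolding cap_def by (intro PR_intros; assumption)

lemma PR_ndl:
 assumes "PR s" "PR N" "PR (%p. m (fst p) (snd p))" shows "PR (%x. ndl M (s x) (N x) (m x))"
proof -
 have 1: "PR (%x. top_below (N x) (m x))" unfolding top_below_def
  by (intro PR_rec PR_intros PR_comp2[OF assms(3)] assms)
 show ?thesis unfolding ndl_def by (intro PR_intros PR_cap PR_comp2[OF assms(3)] 1 assms)
qed

definition items :: "nat list => (nat \<times> nat) list" where
 "items ts = concat (map (%j. map (%\<kappa>. (j, \<kappa>)) [0..<length (kids (nthd 0 ts j))]) [0..<length ts])"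

definition set_nth :: "nat list => nat => nat => nat list" where
 "set_nth ts j x = map (%i. if i = j then x else nthd 0 ts i) [0..<length ts]"

lemma set_nth: "set_nth ts j x = ts[j := x]"
 by (rule nth_equalityI) (auto simp: set_nth_def nthd_def nth_list_update)

definition phi_args :: "'a \<times> nat list => ('a \<times> nat list) list" where
 "phi_args x = (fst x, map skp (snd x)) # map (%jk. (fst x, set_nth (map skp (snd x)) (fst jk) (snd jk))) (items (snd x))"

text \<open>The first result belongs to the skipping child. No result exceeds the sum of all
  results, so the sum bounds the search for the largest child type that occurs.\<close>

definition phi_comb :: "nat => 'a \<times> nat list => nat list => nat" where
 "phi_comb M x rs = ndl M (nthd 0 rs 0) (Suc (sum_list rs))
  (%\<kappa>'. if \<kappa>' = 0 then 0 else sum_list (map (%i. if nthd 0 rs (Suc i) = \<kappa>' then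
    nthd 0 (kids (nthd 0 (snd x) (fst (nthd (0, 0) (items (snd x)) i)))) (snd (nthd (0, 0) (items (snd x)) i)) else 0)
    [0..<length (items (snd x))]))"

lemma sum_items: "sum_list (map (%jk. h (fst jk) (snd jk)) (items ts)) = (\<Sum>j<length ts. \<Sum>\<kappa><length (kids (ts ! j)). h j \<kappa> :: nat)"
proof -
 have "sum_list (map (%jk. h (fst jk) (snd jk)) (concat (map (%j. map (%\<kappa>. (j, \<kappa>)) [0..<f j]) [0..<n]))) = (\<Sum>j<n. \<Sum>\<kappa><f j. h j \<kappa>)" for f n
  by (induction n) (simp_all add: comp_def interv_sum_list_conv_sum_set_nat atLeast0LessThan)
 then show ?thesis by (auto simp: items_def nthd_def intro!: sum.cong)
qed

lemma Phi_rec: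
 assumes "!!ts. F 0 (y, ts) = Lam y ts" "!!n x. F (Suc n) x = phi_comb M x (map (F n) (phi_args x))"
 shows "F n (y, ts) = Phi M (Lam y) n ts"
proof (induction n arbitrary: ts)
 case (Suc n)
 let ?rs = "map (F n) (phi_args (y, ts))"
 have rs: "?rs = Phi M (Lam y) n (map skp ts) # map (%jk. Phi M (Lam y) n ((map skp ts)[fst jk := snd jk])) (items ts)"
  by (simp add: phi_args_def Suc set_nth comp_def)
 define r where "r = (%jk. Phi M (Lam y) n ((map skp ts)[fst jk := snd jk]))"
 define m where "m = (%\<kappa>'. if \<kappa>' = 0 then 0 else
    \<Sum>j<length ts. \<Sum>\<kappa><length (kids (ts ! j)). kids (ts ! j) ! \<kappa> * of_bool (Phi M (Lam y) n ((map skp ts)[j := \<kappa>]) = \<kappa>'))"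
 have it: "fst jk < length ts & snd jk < length (kids (ts ! fst jk))" if "jk \<in> set (items ts)" for jk
  using that by (auto simp: items_def nthd_def)
 have m: "(if \<kappa>' = 0 then 0 else sum_list (map (%i. if nthd 0 ?rs (Suc i) = \<kappa>' then
    nthd 0 (kids (nthd 0 ts (fst (nthd (0, 0) (items ts) i)))) (snd (nthd (0, 0) (items ts) i)) else 0)
    [0..<length (items ts)])) = m \<kappa>'" for \<kappa>'
 proof (cases "\<kappa>' = 0")
  case False
  have "map (%i. if nthd 0 ?rs (Suc i) = \<kappa>' then
    nthd 0 (kids (nthd 0 ts (fst (nthd (0, 0) (items ts) i)))) (snd (nthd (0, 0) (items ts) i)) else 0) [0..<length (items ts)]
   = map (%jk. kids (ts ! fst jk) ! snd jk * of_bool (r (fst jk, snd jk) = \<kappa>')) (items ts)"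
  proof (rule nth_equalityI)
   fix i assume "i < length (map (%i. if nthd 0 ?rs (Suc i) = \<kappa>' then
    nthd 0 (kids (nthd 0 ts (fst (nthd (0, 0) (items ts) i)))) (snd (nthd (0, 0) (items ts) i)) else 0) [0..<length (items ts)])"
   then have i: "i < length (items ts)" by simp
   have n1: "nthd 0 ?rs (Suc i) = r (items ts ! i)" unfolding rs using i by (simp add: nthd_def r_def)
   have n2: "nthd (0, 0) (items ts) i = items ts ! i" using i by (simp add: nthd_def)
   have n3: "nthd 0 ts (fst (items ts ! i)) = ts ! fst (items ts ! i)"
    "nthd 0 (kids (ts ! fst (items ts ! i))) (snd (items ts ! i)) = kids (ts ! fst (items ts ! i)) ! snd (items ts ! i)"
    using it[OF nth_mem[OF i]] by (simp_all add: nthd_def)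
   show "map (%i. if nthd 0 ?rs (Suc i) = \<kappa>' then
    nthd 0 (kids (nthd 0 ts (fst (nthd (0, 0) (items ts) i)))) (snd (nthd (0, 0) (items ts) i)) else 0) [0..<length (items ts)] ! i
    = map (%jk. kids (ts ! fst jk) ! snd jk * of_bool (r (fst jk, snd jk) = \<kappa>')) (items ts) ! i"
    using i by (simp add: n1 n2 n3)
  qed simp
  then show ?thesis using False sum_items[of "%j \<kappa>. kids (ts ! j) ! \<kappa> * of_bool (r (j, \<kappa>) = \<kappa>')" ts]
   by (simp add: m_def r_def)
 qed (simp add: m_def)
 have bd: "\<forall>k\<ge>Suc (sum_list ?rs). m k = 0"
 proof (intro allI impI)
  fix k assume k: "k >= Suc (sum_list ?rs)"
  have "Phi M (Lam y) n ((map skp ts)[j := \<kappa>]) ~= k" if "j < length ts" "\<kappa> < length (kids (ts ! j))" for j \<kappa>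
  proof -
   have "(j, \<kappa>) \<in> set (items ts)" using that by (force simp: items_def nthd_def)
   then have "Phi M (Lam y) n ((map skp ts)[j := \<kappa>]) \<in> set ?rs" unfolding rs by force
   then show ?thesis using member_le_sum_list[of _ ?rs] k by fastforce
  qed
  then show "m k = 0" by (simp add: m_def)
 qed
 have "F (Suc n) (y, ts) = ndl M (Phi M (Lam y) n (map skp ts)) (Suc (sum_list ?rs)) m"
  unfolding assms(2) phi_comb_def snd_conv m by (simp add: rs nthd_def)
 also have "\<dots> = nd M (Phi M (Lam y) n (map skp ts)) m" by (rule ndl_eq[OF bd])
 finally show ?case by (simp add: m_def)
qed (simp add: assms(1))

fun phi_fun :: "nat => nat => (nat \<times> (nat \<times> nat list) \<times> nat \<times> nat list) \<times> nat list => nat" where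
 "phi_fun M 0 x = gLam (fst (fst x)) (fst (snd (fst x))) (fst (snd (snd (fst x)))) (snd (snd (snd (fst x)))) (snd x)"
| "phi_fun M (Suc n) x = phi_comb M x (map (phi_fun M n) (phi_args x))"

lemma phi_fun_eq: "phi_fun M n ((l, G, v, A), ts) = Phi M (gLam l G v A) n ts"
 by (rule Phi_rec[where Lam="%y. gLam (fst y) (fst (snd y)) (fst (snd (snd y))) (snd (snd (snd y)))" and F="phi_fun M" and y="(l, G, v, A)", simplified]) auto

lemma PR_items: "PR f ==> PR (%x. items (f x))"
proof (rule PR_comp[of items])
 show "PR items" unfolding items_def by (intro PR_intros PR_kids)
qed

lemma PR_phi_fun: "PR n ==> PR x ==> PR (%y. phi_fun M (n y) (x y))"
proof (rule PR_tree_rec[where F="phi_fun M" and A=phi_args and C="phi_comb M"])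
 show "PR (phi_args :: (nat \<times> (nat \<times> nat list) \<times> nat \<times> nat list) \<times> nat list => _)"
  unfolding phi_args_def set_nth_def by (intro PR_intros PR_items PR_skp)
 show "PR (%p. phi_comb M (fst p :: (nat \<times> (nat \<times> nat list) \<times> nat \<times> nat list) \<times> nat list) (snd p))"
  unfolding phi_comb_def by (intro PR_ndl PR_intros PR_items PR_kids)
 show "PR (%x. gLam (fst (fst x)) (fst (snd (fst x))) (fst (snd (snd (fst x)))) (snd (snd (snd (fst x)))) (snd x))"
  by (intro PR_gLam PR_intros)
qed auto

definition gA :: "nat => nat \<times> nat list => nat => nat list" where
 "gA l G v = filter (%i. gim i \<in> set (gball G (gnew G) (2 ^ l) v)) (gold G)"

definition upd :: "nat => nat => nat \<times> nat list => nat list => nat => nat" where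
 "upd M l G ts v = (if v \<in> set (gnew G) & v \<in> set (gball G (gnew G) (2 ^ l) 2)
  then phi_fun M l ((l, G, v, gA l G v), map (nthd 0 ts) (gA l G v)) else nthd 0 ts v)"

lemma PR_upd: "PR f ==> PR g ==> PR h ==> PR k ==> PR (%x. upd M (f x) (g x) (h x) (k x))"
proof (rule PR_comp4[where F="upd M"])
 have A: "PR (%p :: nat \<times> (nat \<times> nat list) \<times> nat list \<times> nat. gA (fst p) (fst (snd p)) (snd (snd (snd p))))"
  unfolding gA_def by (intro PR_intros PR_gold PR_gnew PR_gim PR_gball)
 show "PR (%p. upd M (fst p) (fst (snd p)) (fst (snd (snd p))) (snd (snd (snd p))))"
  unfolding upd_def by (intro PR_intros PR_phi_fun PR_gnew PR_gball A)
qed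

context region
begin

theorem upd_correct:
 assumes cover: "!!c. dle E' (2 ^ (l + 2)) (q ! 2) c ==> c \<in> (!) q ` set (gnew G)"
  and live: "!!i. i \<in> set (gold G) ==> q ! i \<in> p ` U"
  and imd: "!!w. im w = (if w = q ! 0 | w = q ! 1 then q ! 2 else w)"
  and fresh: "!!x y. E x y ==> y ~= q ! 2" "q ! 2 \<notin> p ` U"
  and Ez: "!!x y. E' x y ==> x ~= q ! 2 ==> y ~= q ! 2 ==> E x y"
  and ts: "!!i. i \<in> set (gold G) ==> nthd 0 ts i = part_type M l ai U p E (q ! i)"
  and v: "v \<in> set (gnew G)"
 shows "upd M l G ts v = part_type M l ai U p' E' (q ! v)"
proof -
 have g2: "2 \<in> set (gnew G)" using q(2) by (auto simp: gnew_def)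
 \<comment> \<open>Four radii of \<open>2 ^ l\<close> add up below: from the new part to
   \<open>v\<close>, from \<open>v\<close> to the image of an old root, from that root to the part
   of one of its elements, and the ball around this part in which distances are tested.\<close>
 have rad: "(2::nat) ^ (l + 2) = 2 ^ l + 2 ^ l + 2 ^ l + 2 ^ l" by (simp add: power_add)
 have c1: "dle E' (2 ^ l) (q ! 2) c ==> c \<in> (!) q ` set (gnew G)" for c
  by (rule cover[OF dle_mono]) (auto simp: rad)
 have b2: "set (gball G (gnew G) (2 ^ l) 2) = {j \<in> set (gnew G). dle E' (2 ^ l) (q ! 2) (q ! j)}"
  by (rule ball_new[OF g2]) (rule c1)
 show ?thesis
 proof (cases "dle E' (2 ^ l) (q ! 2) (q ! v)")
  case False
  have v2: "q ! v ~= q ! 2" using False by auto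
  then have "v ~= 2" by auto
  then have vo: "v \<in> set (gold G)" using v q(2) by (auto simp: gold_def gnew_def)
  then have imv: "im (q ! v) = q ! v" using im[OF vo] v by (auto simp: gim_def gnew_def)
  have far: "\<not> dle E' (2 ^ l) (q ! v) (q ! 2)" using False dle_sym[where E=E' and k="2 ^ l" and a="q ! v" and b="q ! 2"] sym' by blast
  have "part_type M l ai U p E (q ! v) = part_type M l ai U p' E' (q ! v)"
  proof (rule part_type_far[where z="q ! 2", OF _ imv _ far])
   show "im x = x | im x = q ! 2" for x by (simp add: imd)
  qed (rule Ez)
  then show ?thesis using False ts[OF vo] v by (simp add: upd_def b2)
 next
  case True
  let ?A = "gA l G v"
  have cv: "c \<in> (!) q ` set (gnew G)" if "dle E' (2 ^ l) (q ! v) c" for c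
   by (rule cover[OF dle_mono[OF dle_trans[OF True that]]]) (simp add: rad)
  have bv: "set (gball G (gnew G) (2 ^ l) v) = {j \<in> set (gnew G). dle E' (2 ^ l) (q ! v) (q ! j)}"
   by (rule ball_new[OF v cv])
  have setA: "set ?A = {i \<in> set (gold G). dle E' (2 ^ l) (q ! v) (im (q ! i))}"
   using gim_new im by (auto simp: gA_def bv)
  have dA: "distinct ?A" unfolding gA_def using distinct_gold by (rule distinct_filter)
  have sub: "set ?A \<subseteq> set (gold G)" unfolding setA by auto
  have nA: "distinct (map ((!) q) ?A)" using dA inj_q[of "set ?A"] sub gold_lt by (auto simp: distinct_map)
  \<comment> \<open>An old part with image in the region has a position itself: the merged parts at
    0 and 1, any other part because it equals its image.\<close>
  have back_old: "c \<in> (!) q ` set (gold G)" if c: "im c \<in> (!) q ` set (gnew G)" "c ~= q ! 2" for c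
  proof (cases "c = q ! 0 | c = q ! 1")
   case True then show ?thesis using q(2) by (auto simp: gold_def)
  next
   case False
   then obtain i where i: "c = q ! i" "i \<in> set (gnew G)" using c(1) imd by auto
   then have "i ~= 2" using c(2) by auto
   then show ?thesis using i by (auto simp: gold_def gnew_def)
  qed
  have Enz: "dle E k w c ==> w ~= q ! 2 ==> c ~= q ! 2" for k w c
   by (induction k arbitrary: c) (use fresh(1) in auto)
  have live_nz: "w ~= q ! 2" if "w \<in> p ` U" for w using fresh(2) that by metis
  have setA': "set (map ((!) q) ?A) = {w \<in> p ` U. dle E' (2 ^ l) (q ! v) (im w)}"
  proof (intro set_eqI iffI)
   fix w assume "w \<in> {w \<in> p ` U. dle E' (2 ^ l) (q ! v) (im w)}"
   then have w: "w \<in> p ` U" "dle E' (2 ^ l) (q ! v) (im w)" by auto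
   have "w \<in> (!) q ` set (gold G)" using back_old[OF cv[OF w(2)] live_nz[OF w(1)]] .
   then show "w \<in> set (map ((!) q) ?A)" using w(2) by (auto simp: setA)
  qed (use live setA in auto)
  have inner: "(\<forall>c. dle E (2 ^ l) x c --> c \<in> (!) q ` set (gold G)) & (\<forall>c. dle E' (2 ^ l) (im x) c --> c \<in> (!) q ` set (gnew G))"
   if w: "w \<in> set ?A" "dle E (2 ^ l) (q ! w) x" for w x
  proof -
   have wd: "dle E' (2 ^ l) (q ! v) (im (q ! w))" and wg: "w \<in> set (gold G)" using w(1) setA by auto
   have 3: "dle E' (2 ^ l + 2 ^ l + 2 ^ l) (q ! 2) (im x)"
    by (rule dle_trans[OF dle_trans[OF True wd] dle_im[OF w(2)]])
   have 4: "c \<in> (!) q ` set (gnew G)" if "dle E' (2 ^ l) (im x) c" for c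
    by (rule cover[OF dle_mono[OF dle_trans[OF 3 that]]]) (simp add: rad)
   have wz: "q ! w ~= q ! 2" using live_nz[OF live[OF wg]] .
   have "c \<in> (!) q ` set (gold G)" if c: "dle E (2 ^ l) x c" for c
    using back_old[OF 4[OF dle_im[OF c]]] Enz[OF c] Enz[OF w(2) wz] by blast
   then show ?thesis using 4 by blast
  qed
  have "Phi M (gLam l G v ?A) l (map (part_type M l ai U p E) (map ((!) q) ?A)) = part_type M l ai U p' E' (q ! v)"
  proof (rule Phi_part_type[OF nA setA'])
   fix c a assume "overlay l (set (map ((!) q) ?A)) c a"
    "!!w. w \<in> set (map ((!) q) ?A) ==> conn l p E w (c w) & els (c w) \<subseteq> U"
   then show "gLam l G v ?A (map (%w. leaf l ai p E w (c w)) (map ((!) q) ?A))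
    = (if crossfree l p E (set (map ((!) q) ?A)) c then lam l ai p' E' (q ! v) a else 0)"
    using gLam_correct[OF dA sub v inner cv, where c=c and a=a] by simp
  qed
  moreover have e: "map (nthd 0 ts) ?A = map (part_type M l ai U p E) (map ((!) q) ?A)"
   using ts sub by auto
  moreover have "upd M l G ts v = Phi M (gLam l G v ?A) l (map (nthd 0 ts) ?A)"
   using True v by (simp add: upd_def b2 phi_fun_eq)
  ultimately show ?thesis by (simp only:)
 qed
qed

end

section \<open>Initial types of the singletons\<close>

definition init_args :: "(nat \<times> nat) \<times> nat list => ((nat \<times> nat) \<times> nat list) list" where
 "init_args x = [(fst x, 0 # snd x), (fst x, 1 # snd x)]"

definition init_comb :: "nat => (nat \<times> nat) \<times> nat list => nat list => nat" where
 "init_comb M x rs = ndl M (nthd 0 rs 0) (Suc (nthd 0 rs 1)) (%\<kappa>. if \<kappa> = nthd 0 rs 1 & \<kappa> ~= 0 then 1 else 0)"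

definition init_leaf :: "(nat \<times> nat) \<times> nat list => nat" where
 "init_leaf x = Suc (cd (snd x, concat (map (%a. map (%b.
  if nthd 0 (snd x) a = 1 & nthd 0 (snd x) b = 1 then Suc (2 * snd (fst x) + 1) else 0) [0..<fst (fst x)]) [0..<fst (fst x)])))"

fun init_fun :: "nat => nat => (nat \<times> nat) \<times> nat list => nat" where
 "init_fun M 0 x = init_leaf x"
| "init_fun M (Suc n) x = init_comb M x (map (init_fun M n) (init_args x))"

lemma PR_init_fun: "PR n ==> PR x ==> PR (%y. init_fun M (n y) (x y))"
proof (rule PR_tree_rec[where F="init_fun M" and A=init_args and C="init_comb M"])
 show "PR init_args" unfolding init_args_def by (intro PR_intros)
 show "PR (%p. init_comb M (fst p) (snd p))" unfolding init_comb_def by (intro PR_ndl PR_intros)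
 show "PR init_leaf" unfolding init_leaf_def by (intro PR_intros)
qed auto

lemma dle_empty: "dle (%_ _. False) k a b \<longleftrightarrow> a = b"
 by (induction k) auto

text \<open>Without red edges the valid moves are the skip and \<open>w\<close> itself, so there is
  one proper child type, with count 1. The 0/1 list of played slots coincides with the list of
  recorded ranks: the ball around \<open>w\<close> contains only \<open>w\<close>, whose rank 0 is
  stored as 1.\<close>

lemma init_fun_correct:
 assumes U: "finite U" "w \<in> U" and p: "!!u. u \<in> U ==> p u = u"
 shows "init_fun M l ((l, ai w w), []) = part_type M l ai U p (%_ _. False) w"
proof -
 let ?E = "%_ _. False"
 define mask where "mask = map (%x. case x of None => (0::nat) | Some (u::nat) => 1)"
 have mask: "mask [] = []" "mask (None # a) = 0 # mask a" "mask (Some b # a) = 1 # mask a" for a b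
  by (simp_all add: mask_def)
 have cn: "els a \<subseteq> {w} ==> conn l p ?E w a" for a
 proof (induction a)
  case (Cons x a) then show ?case using p[OF U(2)] subset_singletonD[of "els a" w] by (cases x) (auto simp: dle_empty)
 qed simp
 have ncn: "\<not> conn l p ?E w (Some b # a)" if "els a \<subseteq> {w}" "b \<in> U" "b ~= w" for a b
  using that p U subset_singletonD[OF that(1)] by (auto simp: dle_empty)
 have "els a \<subseteq> {w} ==> length a + k = l ==> init_fun M k ((l, ai w w), mask a) = ty M U (lam l ai p ?E w) k a" for a k
 proof (induction k arbitrary: a)
  case 0
  have rk: "rk l ?E w (p u) = 0" if "u \<in> els a" for u
  proof -
   have "{v'. dle ?E (2 ^ l) w v' & v' < p u} = {}" using that 0 p U by (auto simp: dle_empty)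
   then show ?thesis unfolding rk_def by simp
  qed
  have 1: "map (%x. case x of None => 0 | Some u => Suc (rk l ?E w (p u))) a = mask a"
   using rk by (auto simp: els_def mask_def split: option.split)
  have 2: "(if nthd 0 (mask a) x = 1 & nthd 0 (mask a) y = 1 then Suc (2 * ai w w + 1) else 0) = pinfo ai (a ! x) (a ! y)"
   if "x < l" "y < l" for x y
   using that 0 els_nth[of x a] els_nth[of y a] by (auto simp: nthd_def pinfo_def mask_def split: option.split)
  have 3: "concat (map (%x. map (%y. if nthd 0 (mask a) x = 1 & nthd 0 (mask a) y = 1 then Suc (2 * ai w w + 1) else 0) [0..<l]) [0..<l])
   = concat (map (%x. map (%y. pinfo ai (a ! x) (a ! y)) [0..<l]) [0..<l])"
   using 2 by (intro arg_cong[where f=concat] map_cong refl) auto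
  have "init_fun M 0 ((l, ai w w), mask a) = leaf l ai p ?E w a"
   unfolding init_fun.simps init_leaf_def fst_conv snd_conv 3 leaf_def 1 ..
  moreover have "ty M U (lam l ai p ?E w) 0 a = leaf l ai p ?E w a" using cn[OF 0(1)] by (simp add: lam_def)
  ultimately show ?case by (simp only:)
 next
  case (Suc k)
  define t where "t = (%b. ty M U (lam l ai p ?E w) k (Some b # a))"
  have t0: "t b = 0" if "b \<in> U" "b ~= w" for b
   using ncn[OF Suc.prems(1) that] unfolding t_def by (simp add: ty_eq_0 del: conn.simps)
  have c: "(if \<kappa> = 0 then 0 else card {b \<in> U. t b = \<kappa>}) = (if \<kappa> = t w & \<kappa> ~= 0 then 1 else 0)" for \<kappa>
  proof (cases "\<kappa> = 0")
   case False
   then have h: "b = w" if "b \<in> U" "t b = \<kappa>" for b using that t0 by metis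
   have "{b \<in> U. t b = \<kappa>} = (if \<kappa> = t w then {w} else {})"
   proof (cases "\<kappa> = t w")
    case True
    have "{b \<in> U. t b = \<kappa>} = {w}" using h U True by blast
    then show ?thesis using True by simp
   next
    case nt: False
    have "{b \<in> U. t b = \<kappa>} = {}" using h nt by blast
    then show ?thesis using nt by simp
   qed
   then show ?thesis using False by simp
  qed simp
  have IH: "init_fun M k ((l, ai w w), 0 # mask a) = ty M U (lam l ai p ?E w) k (None # a)"
   "init_fun M k ((l, ai w w), 1 # mask a) = t w"
   using Suc.IH[of "None # a"] Suc.IH[of "Some w # a"] Suc.prems unfolding mask t_def by simp_all
  have "init_fun M (Suc k) ((l, ai w w), mask a) = ndl M (ty M U (lam l ai p ?E w) k (None # a)) (Suc (t w)) (%\<kappa>. if \<kappa> = t w & \<kappa> ~= 0 then 1 else 0)"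
   unfolding init_fun.simps init_args_def init_comb_def fst_conv snd_conv list.map IH by (simp add: nthd_def)
  also have "\<dots> = nd M (ty M U (lam l ai p ?E w) k (None # a)) (%\<kappa>. if \<kappa> = t w & \<kappa> ~= 0 then 1 else 0)"
   by (rule ndl_eq) auto
  also have "\<dots> = ty M U (lam l ai p ?E w) (Suc k) a"
   unfolding ty.simps using c unfolding t_def by (simp only:)
  finally show ?case .
 qed
 from this[of "[]" l] show ?thesis by (simp add: part_type_def mask)
qed

section \<open>Evaluation of prenex sentences on the type of the last part\<close>

fun qprefix :: "fm => (nat \<times> nat \<times> nat) list" where
 "qprefix (Exists \<phi>) = (6, 0, 0) # qprefix \<phi>"
| "qprefix (Forall \<phi>) = (7, 0, 0) # qprefix \<phi>"
| "qprefix (ExistsMod i p \<phi>) = (8, i, p) # qprefix \<phi>"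
| "qprefix _ = []"

fun matrix :: "fm => fm" where
 "matrix (Exists \<phi>) = matrix \<phi>"
| "matrix (Forall \<phi>) = matrix \<phi>"
| "matrix (ExistsMod i p \<phi>) = matrix \<phi>"
| "matrix \<phi> = \<phi>"

lemma length_qprefix: "prenex \<phi> ==> length (qprefix \<phi>) = quantifier_rank \<phi>"
 by (induction \<phi>) (auto simp: quantifier_free_def)

definition ev_args :: "nat list \<times> (nat \<times> nat \<times> nat) list \<times> nat => (nat list \<times> (nat \<times> nat \<times> nat) list \<times> nat) list" where
 "ev_args x = map (%\<kappa>. (fst x, tl (fst (snd x)), \<kappa>)) [0..<length (kids (snd (snd x)))]"

text \<open>The numbers 6, 7 and 8 are the codes of the quantifiers. A universal quantifier is
  tested by counting counterexamples, since capped counts show emptiness but not totality.\<close>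

definition ev_comb :: "nat list \<times> (nat \<times> nat \<times> nat) list \<times> nat => nat list => nat" where
 "ev_comb x rs = of_bool (
  if fst (hdd (0, 0, 0) (fst (snd x))) = 6 then sum_list (map (%i. nthd 0 (kids (snd (snd x))) i * nthd 0 rs i) [0..<length (kids (snd (snd x)))]) ~= 0
  else if fst (hdd (0, 0, 0) (fst (snd x))) = 7 then sum_list (map (%i. nthd 0 (kids (snd (snd x))) i * (1 - nthd 0 rs i)) [0..<length (kids (snd (snd x)))]) = 0
  else sum_list (map (%i. nthd 0 (kids (snd (snd x))) i * nthd 0 rs i) [0..<length (kids (snd (snd x)))]) mod snd (snd (hdd (0, 0, 0) (fst (snd x))))
   = fst (snd (hdd (0, 0, 0) (fst (snd x)))) mod snd (snd (hdd (0, 0, 0) (fst (snd x)))))"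

text \<open>At a leaf the truth value of the matrix comes from a table, indexed by the code of the
  pair information.\<close>

fun ev_fun :: "nat => nat list \<times> (nat \<times> nat \<times> nat) list \<times> nat => nat" where
 "ev_fun 0 x = nthd 0 (fst x) (psnd (snd (snd x) - 1))"
| "ev_fun (Suc n) x = ev_comb x (map (ev_fun n) (ev_args x))"

lemma PR_ev_fun: "PR n ==> PR x ==> PR (%y. ev_fun (n y) (x y))"
proof (rule PR_tree_rec[where F="ev_fun" and A=ev_args and C=ev_comb])
 show "PR ev_args" unfolding ev_args_def by (intro PR_intros PR_kids)
 show "PR (%p. ev_comb (fst p) (snd p))" unfolding ev_comb_def by (intro PR_intros PR_kids)
 show "PR (%x :: nat list \<times> (nat \<times> nat \<times> nat) list \<times> nat. nthd 0 (fst x) (psnd (snd (snd x) - 1)))"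
  by (intro PR_intros PR_psnd)
qed auto

lemma sum_fibres:
 assumes "finite S" "!!b. b \<in> S ==> f b < N"
 shows "(\<Sum>\<kappa><N. card {b \<in> S. f b = \<kappa>} * of_bool (P \<kappa>)) = card {b \<in> S. P (f b :: nat)}"
proof -
 have "card {b \<in> S. f b = \<kappa>} * of_bool (P \<kappa>) = card {b \<in> S. f b = \<kappa> & P (f b)}" for \<kappa>
 proof (cases "P \<kappa>")
  case True
  then have "{b \<in> S. f b = \<kappa> & P (f b)} = {b \<in> S. f b = \<kappa>}" by auto
  then show ?thesis using True by simp
 next
  case False
  then have e: "{b \<in> S. f b = \<kappa> & P (f b)} = {}" by auto
  show ?thesis unfolding e using False by simp
 qed
 then have "(\<Sum>\<kappa><N. card {b \<in> S. f b = \<kappa>} * of_bool (P \<kappa>)) = (\<Sum>\<kappa><N. card {b \<in> S. f b = \<kappa> & P (f b)})" by simp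
 also have "\<dots> = card (\<Union>\<kappa>\<in>{..<N}. {b \<in> S. f b = \<kappa> & P (f b)})"
  by (rule card_UN_disjoint[symmetric]) (use assms(1) in auto)
 also have "(\<Union>\<kappa>\<in>{..<N}. {b \<in> S. f b = \<kappa> & P (f b)}) = {b \<in> S. P (f b)}"
  using assms(2) by auto
 finally show ?thesis .
qed

text \<open>With a single part all distances are 0, so every position is connected and the type
  describes plays without restriction.\<close>

lemma conn_const:
 assumes "!!u. u \<in> U ==> p u = r" "els a \<subseteq> U" shows "conn l p E r a"
 using assms(2)
proof (induction a)
 case (Cons x a)
 show ?case
 proof (cases x)
  case (Some b)
  have "\<exists>u\<in>els a. dle E (2 ^ (l - 1 - length a)) (p u) (p b)" if ne: "els a ~= {}"
  proof -
   obtain u where "u \<in> els a" using ne by blast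
   then show ?thesis using Cons.prems Some assms(1) by (intro bexI[of _ u]) auto
  qed
  then show ?thesis using Cons Some assms(1) by auto
 qed (use Cons in simp)
qed simp

lemma els_map_Some [simp]: "els (map Some e) = set e"
 by (auto simp: els_def)

text \<open>A sum of capped counts agrees with the true count in emptiness and modulo
  \<open>M\<close>. The former settles the ordinary quantifiers, the latter the modular ones, since
  every modulus divides \<open>M\<close>.\<close>

lemma ev_fun_correct:
 assumes M: "M > 0" and U: "finite U" "univ S = U" and p: "!!u. u \<in> U ==> p u = r"
  and Mods: "!!m. m \<in> Mods ==> m dvd M"
  and bits: "!!e. length e = l ==> set e \<subseteq> U ==> nthd 0 bits (psnd (leaf l ai p E r (map Some e) - 1)) = of_bool (sat S e \<psi>)"
 shows "prenex \<phi> ==> formula \<sigma> Mods m \<phi> ==> matrix \<phi> = \<psi> ==> set e \<subseteq> U ==> length e + quantifier_rank \<phi> = l ==>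
  ev_fun (quantifier_rank \<phi>) (bits, qprefix \<phi>, ty M U (lam l ai p E r) (quantifier_rank \<phi>) (map Some e)) = of_bool (sat S e \<phi>)"
proof (induction \<phi> arbitrary: m e)
 let ?lam = "lam l ai p E r"
 have leafc: "ev_fun 0 (bits, qs, ty M U ?lam 0 (map Some e)) = of_bool (sat S e \<psi>)" if "length e = l" "set e \<subseteq> U" for e qs
  using that bits conn_const[of U p r "map Some e" l E] p by (simp add: lam_def)
 {
  case Falsum then show ?case using leafc by auto
 next
  case Rel then show ?case using leafc by auto
 next
  case Equal then show ?case using leafc by auto
 next
  case (Neg \<phi>)
  have z: "quantifier_rank (Neg \<phi>) = 0" using Neg.prems(1) by (simp add: quantifier_free_def)
  have e: "\<psi> = Neg \<phi>" using Neg.prems by simp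
  have "length e = l" using Neg.prems(5) unfolding z by simp
  then show ?case unfolding z using leafc[of e "[]"] Neg.prems(4) by (simp add: e del: quantifier_rank.simps ty.simps)
 next
  case (Conj \<phi>1 \<phi>2)
  have z: "quantifier_rank (Conj \<phi>1 \<phi>2) = 0" using Conj.prems(1) by (simp add: quantifier_free_def)
  have e: "\<psi> = Conj \<phi>1 \<phi>2" using Conj.prems by simp
  have "length e = l" using Conj.prems(5) unfolding z by simp
  then show ?case unfolding z using leafc[of e "[]"] Conj.prems(4) by (simp add: e del: quantifier_rank.simps ty.simps)
 next
  case (Disj \<phi>1 \<phi>2)
  have z: "quantifier_rank (Disj \<phi>1 \<phi>2) = 0" using Disj.prems(1) by (simp add: quantifier_free_def)
  have e: "\<psi> = Disj \<phi>1 \<phi>2" using Disj.prems by simp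
  have "length e = l" using Disj.prems(5) unfolding z by simp
  then show ?case unfolding z using leafc[of e "[]"] Disj.prems(4) by (simp add: e del: quantifier_rank.simps ty.simps)
 }
 \<comment> \<open>Up to \<open>cap\<close>, \<open>c\<close> counts the witnesses and
   \<open>d\<close> the counterexamples; the statement serves all three quantifiers.\<close>
 have step: "\<exists>c d rs. map (ev_fun k) (ev_args (bits, (q # qs), ty M U ?lam (Suc k) (map Some e))) = rs \<and>
   ev_comb (bits, q # qs, ty M U ?lam (Suc k) (map Some e)) rs = of_bool (
    if fst q = 6 then c ~= 0 else if fst q = 7 then d = 0 else c mod snd (snd q) = fst (snd q) mod snd (snd q)) \<and>
   cap M c = cap M (card {b \<in> U. P b}) & cap M d = cap M (card {b \<in> U. \<not> P b})"
  if IH: "!!b. b \<in> U ==> ev_fun k (bits, qs, ty M U ?lam k (map Some (b # e))) = of_bool (P b)"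
   and e: "set e \<subseteq> U" for k q qs e P
 proof -
  define t where "t = (%b. ty M U ?lam k (Some b # map Some e))"
  define m where "m = (%\<kappa>. if \<kappa> = 0 then 0 else card {b \<in> U. t b = \<kappa>})"
  have ne: "ty M U ?lam k (None # map Some e) ~= 0"
   using conn_const[of U p r "map Some e" l E] p e by (simp add: ty_eq_0)
  have kd: "kids (ty M U ?lam (Suc k) (map Some e)) = mcode M m"
   unfolding ty.simps m_def t_def by (rule kids_nd[OF ne])
  have t0: "t b ~= 0" if "b \<in> U" for b
   unfolding t_def using conn_const[of U p r "Some b # map Some e" l E] p e that by (simp add: ty_eq_0 del: conn.simps)
  define N where "N = top_of m"
  have lt: "t b < N" if "b \<in> U" for b
  proof -
   have "\<forall>\<kappa>\<ge>Suc (Max (t ` U)). m \<kappa> = 0"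
   proof (intro allI impI)
    fix \<kappa> assume "\<kappa> >= Suc (Max (t ` U))"
    then have e: "{b \<in> U. t b = \<kappa>} = {}" using Max_ge[of "t ` U"] U by fastforce
    show "m \<kappa> = 0" unfolding m_def e by simp
   qed
   moreover have "m (t b) ~= 0" using t0[OF that] that U by (auto simp: m_def card_eq_0_iff)
   ultimately show ?thesis unfolding N_def by (rule top_of)
  qed
  define rs where "rs = map (%\<kappa>. ev_fun k (bits, qs, \<kappa>)) [0..<N]"
  have mt: "m \<kappa> = card {b \<in> U. t b = \<kappa>}" for \<kappa>
   using t0 by (auto simp: m_def card_eq_0_iff U)
  have rt: "ev_fun k (bits, qs, t b) = of_bool (P b)" if "b \<in> U" for b using IH[OF that] by (simp add: t_def)
  have cnt: "cap M (\<Sum>\<kappa><N. cap M (m \<kappa>) * of_bool (Q \<kappa>)) = cap M (card {b \<in> U. Q (t b)})" for Q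
  proof -
   have "cap M (\<Sum>\<kappa><N. cap M (m \<kappa>) * of_bool (Q \<kappa>)) = cap M (\<Sum>\<kappa><N. card {b \<in> U. t b = \<kappa>} * of_bool (Q \<kappa>))"
    by (rule cap_sum_cong[OF M]) (auto simp: mt M)
   also have "(\<Sum>\<kappa><N. card {b \<in> U. t b = \<kappa>} * of_bool (Q \<kappa>)) = card {b \<in> U. Q (t b)}"
    by (rule sum_fibres[OF U(1) lt])
   finally show ?thesis .
  qed
  let ?c = "\<Sum>\<kappa><N. cap M (m \<kappa>) * ev_fun k (bits, qs, \<kappa>)"
  let ?d = "\<Sum>\<kappa><N. cap M (m \<kappa>) * (1 - ev_fun k (bits, qs, \<kappa>))"
  have z: "cap M (m \<kappa>) * g (ev_fun k (bits, qs, \<kappa>)) = cap M (m \<kappa>) * of_bool (g (ev_fun k (bits, qs, \<kappa>)) = 1)"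
   if "g 0 = 0 & g 1 = 1 | g 0 = 1 & g 1 = 0" for g :: "nat => nat" and \<kappa>
  proof (cases "m \<kappa> = 0")
   case False
   then obtain b where "b \<in> U" "t b = \<kappa>" by (auto simp: mt card_eq_0_iff)
   then show ?thesis using rt[of b] that by (cases "P b") auto
  qed simp
  have c: "cap M ?c = cap M (card {b \<in> U. P b})"
  proof -
   have "?c = (\<Sum>\<kappa><N. cap M (m \<kappa>) * of_bool (ev_fun k (bits, qs, \<kappa>) = 1))" by (rule sum.cong[OF refl], rule z[of "%x. x"]) simp
   also have "cap M \<dots> = cap M (card {b \<in> U. P b})" unfolding cnt
    by (rule arg_cong[where f="%S. cap M (card S)"]) (use rt in \<open>auto simp: of_bool_def split: if_splits\<close>)
   finally show ?thesis .
  qed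
  have d: "cap M ?d = cap M (card {b \<in> U. \<not> P b})"
  proof -
   have "?d = (\<Sum>\<kappa><N. cap M (m \<kappa>) * of_bool (1 - ev_fun k (bits, qs, \<kappa>) = 1))"
    by (rule sum.cong[OF refl], rule z[of "%x. 1 - x"]) simp
   also have "cap M \<dots> = cap M (card {b \<in> U. \<not> P b})" unfolding cnt
    by (rule arg_cong[where f="%S. cap M (card S)"]) (use rt in \<open>auto simp: of_bool_def split: if_splits\<close>)
   finally show ?thesis .
  qed
  have len: "length (mcode M m) = N" by (simp add: mcode_def N_def)
  have args: "map (ev_fun k) (ev_args (bits, (q # qs), ty M U ?lam (Suc k) (map Some e))) = rs"
   unfolding ev_args_def fst_conv snd_conv kd len by (simp add: rs_def comp_def)
  have sl: "sum_list (map (%i. nthd 0 (mcode M m) i * g (nthd 0 rs i)) [0..<N]) = (\<Sum>\<kappa><N. cap M (m \<kappa>) * g (ev_fun k (bits, qs, \<kappa>)))" for g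
   by (auto simp: interv_sum_list_conv_sum_set_nat atLeast0LessThan nthd_def mcode_def N_def rs_def intro!: sum.cong)
  have "ev_comb (bits, q # qs, ty M U ?lam (Suc k) (map Some e)) rs = of_bool (
    if fst q = 6 then ?c ~= 0 else if fst q = 7 then ?d = 0 else ?c mod snd (snd q) = fst (snd q) mod snd (snd q))"
   unfolding ev_comb_def fst_conv snd_conv kd len sl[of "%x. x"] sl[of "%x. 1 - x"] by (simp add: hdd_def)
  then show ?thesis using args c d by blast
 qed
 {
  case (Exists \<phi>)
  have IH: "ev_fun (quantifier_rank \<phi>) (bits, qprefix \<phi>, ty M U ?lam (quantifier_rank \<phi>) (map Some (b # e))) = of_bool (sat S (b # e) \<phi>)"
   if "b \<in> U" for b using Exists.IH[of "Suc m" "b # e"] Exists.prems that by simp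
  obtain c d rs where h: "map (ev_fun (quantifier_rank \<phi>)) (ev_args (bits, (6, 0, 0) # qprefix \<phi>, ty M U ?lam (Suc (quantifier_rank \<phi>)) (map Some e))) = rs"
   "ev_comb (bits, (6, 0, 0) # qprefix \<phi>, ty M U ?lam (Suc (quantifier_rank \<phi>)) (map Some e)) rs = of_bool (c ~= 0)"
   "cap M c = cap M (card {b \<in> U. sat S (b # e) \<phi>})"
   using step[of "quantifier_rank \<phi>" "qprefix \<phi>" e "%b. sat S (b # e) \<phi>" "(6, 0, 0)", OF IH Exists.prems(4)] by auto
  have "c ~= 0 \<longleftrightarrow> sat S e (Exists \<phi>)" using h(3) M U by (auto simp: cap_eq_iff)
  then show ?case using h(1,2) by (simp del: ty.simps sat.simps)
 next
  case (Forall \<phi>)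
  have IH: "ev_fun (quantifier_rank \<phi>) (bits, qprefix \<phi>, ty M U ?lam (quantifier_rank \<phi>) (map Some (b # e))) = of_bool (sat S (b # e) \<phi>)"
   if "b \<in> U" for b using Forall.IH[of "Suc m" "b # e"] Forall.prems that by simp
  obtain c d rs where h: "map (ev_fun (quantifier_rank \<phi>)) (ev_args (bits, (7, 0, 0) # qprefix \<phi>, ty M U ?lam (Suc (quantifier_rank \<phi>)) (map Some e))) = rs"
   "ev_comb (bits, (7, 0, 0) # qprefix \<phi>, ty M U ?lam (Suc (quantifier_rank \<phi>)) (map Some e)) rs = of_bool (d = 0)"
   "cap M d = cap M (card {b \<in> U. \<not> sat S (b # e) \<phi>})"
   using step[of "quantifier_rank \<phi>" "qprefix \<phi>" e "%b. sat S (b # e) \<phi>" "(7, 0, 0)", OF IH Forall.prems(4)] by auto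
  have "d = 0 \<longleftrightarrow> sat S e (Forall \<phi>)" using h(3) M U by (auto simp: cap_eq_iff)
  then show ?case using h(1,2) by (simp del: ty.simps sat.simps)
 next
  case (ExistsMod i r' \<phi>)
  have IH: "ev_fun (quantifier_rank \<phi>) (bits, qprefix \<phi>, ty M U ?lam (quantifier_rank \<phi>) (map Some (b # e))) = of_bool (sat S (b # e) \<phi>)"
   if "b \<in> U" for b using ExistsMod.IH[of "Suc m" "b # e"] ExistsMod.prems that by simp
  obtain c d rs where h: "map (ev_fun (quantifier_rank \<phi>)) (ev_args (bits, (8, i, r') # qprefix \<phi>, ty M U ?lam (Suc (quantifier_rank \<phi>)) (map Some e))) = rs"
   "ev_comb (bits, (8, i, r') # qprefix \<phi>, ty M U ?lam (Suc (quantifier_rank \<phi>)) (map Some e)) rs = of_bool (c mod r' = i mod r')"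
   "cap M c = cap M (card {b \<in> U. sat S (b # e) \<phi>})"
   using step[of "quantifier_rank \<phi>" "qprefix \<phi>" e "%b. sat S (b # e) \<phi>" "(8, i, r')", OF IH ExistsMod.prems(4)] by auto
  have "r' dvd M" using Mods ExistsMod.prems(2) by simp
  then have "c mod r' = card {b \<in> U. sat S (b # e) \<phi>} mod r'" using h(3) M by (metis cap_eq_iff mod_mod_cancel)
  then have "c mod r' = i mod r' \<longleftrightarrow> sat S e (ExistsMod i r' \<phi>)" using U by simp
  then show ?case using h(1,2) by (simp del: ty.simps sat.simps)
 }
qed

section \<open>Tokens of the formula and evaluation of the matrix\<close>

fun toks :: "fm => nat list list" where
 "toks Falsum = [[0]]"
| "toks (Rel k xs) = [1 # k # xs]"
| "toks (Equal x y) = [[2, x, y]]"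
| "toks (Neg \<phi>) = [3] # toks \<phi>"
| "toks (Conj \<phi> \<psi>) = [4] # toks \<phi> @ toks \<psi>"
| "toks (Disj \<phi> \<psi>) = [5] # toks \<phi> @ toks \<psi>"
| "toks (Exists \<phi>) = [6] # toks \<phi>"
| "toks (Forall \<phi>) = [7] # toks \<phi>"
| "toks (ExistsMod i p \<phi>) = [8, i, p] # toks \<phi>"

lemma formula_code_toks: "formula_code \<phi> = concat (toks \<phi>)"
 by (induction \<phi>) auto

definition qtok :: "nat \<times> nat \<times> nat => nat list" where
 "qtok q = (if fst q = 8 then [8, fst (snd q), snd (snd q)] else [fst q])"

lemma toks_prenex: "toks \<phi> = map qtok (qprefix \<phi>) @ toks (matrix \<phi>)"
 by (induction \<phi>) (auto simp: qtok_def)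

text \<open>In Polish notation the operands follow the connective, so the tokens are processed from
  right to left, with a stack of truth values 0 and 1.\<close>

definition tstep :: "(nat list => nat) => nat list => nat list => nat list" where
 "tstep f t st = (if hd t <= 2 then f t # st
  else if hd t = 3 then (1 - st ! 0) # tl st
  else if hd t = 4 then (st ! 0 * st ! 1) # drop 2 st
  else (1 - (1 - st ! 0) * (1 - st ! 1)) # drop 2 st)"

lemma foldr_tstep:
 assumes f: "f [0] = 0" "!!k ys. formula \<sigma> Mods m (Rel k ys) ==> f (1 # k # ys) = of_bool (sat S e (Rel k ys))"
  "!!x y. x < m ==> y < m ==> f [2, x, y] = of_bool (e ! x = e ! y)"
 shows "quantifier_rank \<psi> = 0 ==> formula \<sigma> Mods m \<psi> ==> foldr (tstep f) (toks \<psi>) st = of_bool (sat S e \<psi>) # st"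
proof (induction \<psi> arbitrary: st)
 case (Rel k ys) then show ?case using f(2)[of k ys] by (simp add: tstep_def)
next
 case (Equal x y) then show ?case using f(3)[of x y] by (simp add: tstep_def)
qed (auto simp: tstep_def f(1))

text \<open>Bit \<open>k\<close> belongs to symbol \<open>k\<close>. Unary symbols are asked for the
  first element and binary ones for \<open>[u, v]\<close>; the other half of the atomic type is in
  the code of \<open>(v, u)\<close>, hence the second claim of \<open>atom_code_eq\<close>.\<close>

definition atom_code :: "signature => 'a struc => 'a => 'a => nat" where
 "atom_code \<sigma> S u v = (\<Sum>k<length \<sigma>. 2 ^ k * of_bool (\<sigma> ! k = 1 & [u] \<in> rel S k | \<sigma> ! k = 2 & [u, v] \<in> rel S k))"

definition nul_code :: "signature => 'a struc => nat" where
 "nul_code \<sigma> S = (\<Sum>k<length \<sigma>. 2 ^ k * of_bool (\<sigma> ! k = 0 & [] \<in> rel S k))"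

lemma binary_sum_lt: "(\<Sum>k<n. 2 ^ k * of_bool (b k)) < (2::nat) ^ n"
 by (induction n) (auto intro: add_strict_mono)

lemma binary_sum_digit: "j < n ==> (\<Sum>k<n. 2 ^ k * of_bool (b k)) div 2 ^ j mod (2::nat) = of_bool (b j)"
proof (induction n)
 case (Suc n)
 show ?case
 proof (cases "j = n")
  case True
  then show ?thesis using binary_sum_lt[of b n] by (simp add: div_add_self2)
 next
  case False
  then have "(2::nat) ^ n = 2 ^ j * (2 * 2 ^ (n - j - 1))" using Suc.prems by (simp flip: power_Suc power_add)
  then have "((\<Sum>k<n. 2 ^ k * of_bool (b k)) + 2 ^ n * of_bool (b n)) div 2 ^ j =
   (\<Sum>k<n. 2 ^ k * of_bool (b k)) div (2::nat) ^ j + 2 * (2 ^ (n - j - 1) * of_bool (b n))"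
   by (simp add: mult.assoc)
  then show ?thesis using Suc False by simp
 qed
qed simp

lemma atom_code_eq:
 assumes "atomic_type \<sigma> S u v = atomic_type \<sigma> S u' v'"
 shows "atom_code \<sigma> S u v = atom_code \<sigma> S u' v'" "atom_code \<sigma> S v u = atom_code \<sigma> S v' u'"
proof -
 have "(\<sigma> ! k = 1 & [u] \<in> rel S k) = (\<sigma> ! k = 1 & [u'] \<in> rel S k)" "(\<sigma> ! k = 1 & [v] \<in> rel S k) = (\<sigma> ! k = 1 & [v'] \<in> rel S k)"
  "(\<sigma> ! k = 2 & [u, v] \<in> rel S k) = (\<sigma> ! k = 2 & [u', v'] \<in> rel S k)" "(\<sigma> ! k = 2 & [v, u] \<in> rel S k) = (\<sigma> ! k = 2 & [v', u'] \<in> rel S k)"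
  if "k < length \<sigma>" for k using assms that unfolding atomic_type_def by blast+
 then show "atom_code \<sigma> S u v = atom_code \<sigma> S u' v'" "atom_code \<sigma> S v u = atom_code \<sigma> S v' u'"
  unfolding atom_code_def by (auto intro!: sum.cong)
qed

text \<open>The value of an atomic formula with operation code \<open>fst t\<close>, relation symbol and variables
 \<open>snd t\<close> when the pairs of elements have the codes in \<open>fst a\<close> and the nullary symbols \<open>snd a\<close>.\<close>

definition atom_val :: "signature => nat => nat list \<times> nat => nat \<times> nat \<times> nat \<times> nat => nat" where
 "atom_val \<sigma> l a t = (if fst t = 1 then
   (if nthd 0 \<sigma> (fst (snd t)) = 0 then snd a div 2 ^ fst (snd t) mod 2
   else if nthd 0 \<sigma> (fst (snd t)) = 1 then (nthd 0 (fst a) (fst (snd (snd t)) * l + fst (snd (snd t))) - 1) div 2 div 2 ^ fst (snd t) mod 2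
   else (nthd 0 (fst a) (fst (snd (snd t)) * l + snd (snd (snd t))) - 1) div 2 div 2 ^ fst (snd t) mod 2)
  else if fst t = 2 then (nthd 0 (fst a) (fst (snd (snd t)) * l + snd (snd (snd t))) - 1) mod 2 else 0)"

lemma PR_atom_val: "PR f ==> PR g ==> PR h ==> PR (%x. atom_val \<sigma> (f x) (g x) (h x))"
 unfolding atom_val_def by (intro PR_intros; assumption)

definition tok_args :: "nat list => nat \<times> nat \<times> nat \<times> nat" where
 "tok_args t = (if hd t = 1 then (1, t ! 1, nthd 0 t 2, nthd 0 t 3) else if hd t = 2 then (2, 0, t ! 1, t ! 2) else (hd t, 0, 0, 0))"

lemma leaf_pairs: "psnd (leaf l ai p E w a - 1) = list_encode (concat (map (%x. map (%y. pinfo ai (a ! x) (a ! y)) [0..<l]) [0..<l]))"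
 by (simp add: leaf_def cd_nat_list)

lemma concat_nth_square:
 assumes "x < n" "y < m"
 shows "concat (map (%x. map (f x) [0..<m]) [0..<n]) ! (x * m + y) = f x y \<and>
  x * m + y < length (concat (map (%x. map (f x) [0..<m]) [0..<n]))"
 using assms
proof (induction n)
 case (Suc n)
 have len: "length (concat (map (%x. map (f x) [0..<m]) [0..<n])) = n * m" by (induction n) auto
 show ?case
 proof (cases "x = n")
  case True then show ?thesis using Suc.prems len by (simp add: nth_append)
 next
  case False
  then have "concat (map (%x. map (f x) [0..<m]) [0..<n]) ! (x * m + y) = f x y" "x * m + y < n * m"
   using Suc len by auto
  then show ?thesis using len by (simp add: nth_append)
 qed
qed simp

lemma matrix_eval:
 assumes \<sigma>: "binary_signature \<sigma>" and \<psi>: "quantifier_rank \<psi> = 0" "formula \<sigma> Mods l \<psi>" and e: "length e = l"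
 shows "foldr (tstep (%t. atom_val \<sigma> l (concat (map (%x. map (%y. pinfo (atom_code \<sigma> S) (map Some e ! x) (map Some e ! y)) [0..<l]) [0..<l]), nul_code \<sigma> S)
  (tok_args t))) (toks \<psi>) st = of_bool (sat S e \<psi>) # st"
proof (rule foldr_tstep[OF _ _ _ \<psi>])
 let ?a = "concat (map (%x. map (%y. pinfo (atom_code \<sigma> S) (map Some e ! x) (map Some e ! y)) [0..<l]) [0..<l])"
 have at: "nthd 0 ?a (x * l + y) = Suc (2 * atom_code \<sigma> S (e ! x) (e ! y) + of_bool (e ! x = e ! y))" if "x < l" "y < l" for x y
  using concat_nth_square[OF that, of "%x y. pinfo (atom_code \<sigma> S) (map Some e ! x) (map Some e ! y)"] that e
  by (simp add: nthd_def pinfo_def)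
 have half: "(2 * c + of_bool b) div 2 = c" "(2 * c + of_bool b) mod 2 = of_bool b" for c :: nat and b by (cases b; simp)+
 show "atom_val \<sigma> l (?a, nul_code \<sigma> S) (tok_args [0]) = 0" by (simp add: atom_val_def tok_args_def)
 show "atom_val \<sigma> l (?a, nul_code \<sigma> S) (tok_args [2, x, y]) = of_bool (e ! x = e ! y)" if "x < l" "y < l" for x y
  using that by (simp add: atom_val_def tok_args_def at half)
 fix k ys assume h: "formula \<sigma> Mods l (Rel k ys)"
 have "\<sigma> ! k <= 2" using \<sigma> h by (auto simp: binary_signature_def)
 then consider "\<sigma> ! k = 0" | "\<sigma> ! k = 1" | "\<sigma> ! k = 2" by linarith
 then show "atom_val \<sigma> l (?a, nul_code \<sigma> S) (tok_args (1 # k # ys)) = of_bool (sat S e (Rel k ys))"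
 proof cases
  case 1
  then have "ys = []" using h by simp
  then show ?thesis using 1 h binary_sum_digit[of k "length \<sigma>" "%k. \<sigma> ! k = 0 & [] \<in> rel S k"]
   by (simp add: atom_val_def tok_args_def nthd_def[of 0 \<sigma>] nul_code_def)
 next
  case 2
  then obtain x where ys: "ys = [x]" "x < l" using h by (auto simp: length_Suc_conv)
  then show ?thesis using 2 h at[of x x] half binary_sum_digit[of k "length \<sigma>" "%k. \<sigma> ! k = 1 & [e ! x] \<in> rel S k | \<sigma> ! k = 2 & [e ! x, e ! x] \<in> rel S k"]
   by (simp add: atom_val_def tok_args_def nthd_def[of 0 \<sigma>] nthd_def[of 0 "_ # _"] atom_code_def)
 next
  case 3
  then obtain x y where ys: "ys = [x, y]" "x < l" "y < l" using h by (auto simp: length_Suc_conv numeral_2_eq_2)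
  then show ?thesis using 3 h at[of x y] half binary_sum_digit[of k "length \<sigma>" "%k. \<sigma> ! k = 1 & [e ! x] \<in> rel S k | \<sigma> ! k = 2 & [e ! x, e ! y] \<in> rel S k"]
   by (simp add: atom_val_def tok_args_def nthd_def[of 0 \<sigma>] nthd_def[of 0 "_ # _"] atom_code_def)
 qed
qed

section \<open>Contraction sequences and their red graphs\<close>

lemma atomic_type_swap: "atomic_type \<sigma> S u v = atomic_type \<sigma> S u' v' \<longleftrightarrow> atomic_type \<sigma> S v u = atomic_type \<sigma> S v' u'"
 unfolding atomic_type_def prod.inject by argo

lemma red_adjacent_sym: "red_adjacent \<sigma> S X Y ==> red_adjacent \<sigma> S Y X"
 unfolding red_adjacent_def using atomic_type_swap by metis

locale contraction =
 fixes \<sigma> :: signature and S :: "nat struc" and n d :: nat and Ps :: "nat set set list"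
 assumes U: "univ S = {..<n}" and seq: "d_sequence \<sigma> S d Ps"
begin

lemma ne: "Ps ~= []" and P0: "Ps ! 0 = (%u. {u}) ` {..<n}" and Plast: "Ps ! (length Ps - 1) = {{..<n}}"
 and step: "Suc i < length Ps ==> merge_step (Ps ! i) (Ps ! Suc i)"
 using seq U unfolding d_sequence_def contraction_sequence_def by (auto simp: hd_conv_nth last_conv_nth)

text \<open>Each merge removes one part, which gives the count at the end of the claim; it forces
  the sequence to consist of exactly \<open>n\<close> partitions (\<open>len\<close>).\<close>

lemma partition:
 "i < length Ps ==> (\<forall>A\<in>Ps ! i. A ~= {}) & (\<forall>A\<in>Ps ! i. \<forall>B\<in>Ps ! i. A ~= B --> A \<inter> B = {}) & \<Union> (Ps ! i) = {..<n} \<and>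
  finite (Ps ! i) & card (Ps ! i) + i = n"
proof (induction i)
 case 0 show ?case by (auto simp: P0 card_image inj_on_def)
next
 case (Suc i)
 then have i: "i < length Ps" by simp
 have IH: "\<forall>A\<in>Ps ! i. A ~= {}" "\<forall>A\<in>Ps ! i. \<forall>B\<in>Ps ! i. A ~= B --> A \<inter> B = {}" "\<Union> (Ps ! i) = {..<n}" "finite (Ps ! i)"
  "card (Ps ! i) + i = n" using Suc.IH[OF i] by - (elim conjE, assumption)+
 obtain X Y where XY: "X \<in> Ps ! i" "Y \<in> Ps ! i" "X ~= Y" "Ps ! Suc i = insert (X \<union> Y) (Ps ! i - {X, Y})"
  using step[OF Suc.prems] unfolding merge_step_def by blast
 \<comment> \<open>If the union were an old part, it would meet both merged parts and hence equal
   both of them.\<close>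
 have new: "X \<union> Y \<notin> Ps ! i"
 proof
  assume h: "X \<union> Y \<in> Ps ! i"
  have "X \<inter> (X \<union> Y) ~= {}" "Y \<inter> (X \<union> Y) ~= {}" using IH(1) XY(1,2) by auto
  then have "X = X \<union> Y" "Y = X \<union> Y" using IH(2) XY(1,2) h by metis+
  then show False using XY(3) by simp
 qed
 have "card (Ps ! Suc i) = Suc (card (Ps ! i - {X, Y}))" unfolding XY(4) using new IH(4) by simp
 also have "card (Ps ! i - {X, Y}) = card (Ps ! i) - 2" using XY(1-3) IH(4) by (simp add: card_Diff_subset)
 finally have "card (Ps ! Suc i) + Suc i = n"
  using IH(5) card_mono[OF IH(4), of "{X, Y}"] XY(1-3) by simp
 moreover have "\<forall>A\<in>Ps ! Suc i. A ~= {}" using IH(1) XY by auto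
 moreover have "\<forall>A\<in>Ps ! Suc i. \<forall>B\<in>Ps ! Suc i. A ~= B --> A \<inter> B = {}"
 proof (intro ballI impI equals0I)
  have dj: "A = B" if "A \<in> Ps ! i" "B \<in> Ps ! i" "x \<in> A" "x \<in> B" for A B x using IH(2) that by blast
  fix A B x assume h: "A \<in> Ps ! Suc i" "B \<in> Ps ! Suc i" "A ~= B" "x \<in> A \<inter> B"
  have "A = X \<union> Y | A \<in> Ps ! i & A ~= X & A ~= Y" "B = X \<union> Y | B \<in> Ps ! i & B ~= X & B ~= Y"
   using h(1,2) unfolding XY(4) by auto
  then show False using h(3,4) dj[of A B x] dj[of A X x] dj[of A Y x] dj[of X B x] dj[of Y B x] XY(1,2) by auto
 qed
 moreover have "\<Union> (Ps ! Suc i) = \<Union> (Ps ! i)" unfolding XY(4) using XY(1,2) by auto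
 then have "\<Union> (Ps ! Suc i) = {..<n}" using IH(3) by simp
 moreover have "finite (Ps ! Suc i)" using IH(4) XY(4) by simp
 ultimately show ?case by - (intro conjI; assumption)
qed

lemma len: "length Ps = n" and n: "n >= 1"
proof -
 have "length Ps - 1 < length Ps" using ne by (cases Ps) auto
 then have "1 + (length Ps - 1) = n" using partition[of "length Ps - 1"] Plast by simp
 then show "length Ps = n" "n >= 1" using ne by (cases Ps; simp)+
qed

abbreviation "nm \<equiv> part_name n Ps"

lemma coarser: "j <= i ==> i < length Ps ==> A \<in> Ps ! j ==> \<exists>B\<in>Ps ! i. A \<subseteq> B"
proof (induction i)
 case (Suc i)
 show ?case
 proof (cases "j = Suc i")
  case False
  then obtain B where B: "B \<in> Ps ! i" "A \<subseteq> B" using Suc by auto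
  obtain X Y where "Ps ! Suc i = insert (X \<union> Y) (Ps ! i - {X, Y})"
   using step[OF Suc.prems(2)] unfolding merge_step_def by blast
  then show ?thesis using B by (cases "B = X | B = Y") auto
 qed (use Suc in auto)
qed auto

text \<open>The two parts are chosen as one pair, so that \<open>mA\<close> and \<open>mB\<close>
  belong to the same choice.\<close>

definition mA :: "nat => nat set" where
 "mA i = fst (SOME p. fst p \<in> Ps ! i & snd p \<in> Ps ! i & fst p ~= snd p & Ps ! Suc i = insert (fst p \<union> snd p) (Ps ! i - {fst p, snd p}))"

definition mB :: "nat => nat set" where
 "mB i = snd (SOME p. fst p \<in> Ps ! i & snd p \<in> Ps ! i & fst p ~= snd p & Ps ! Suc i = insert (fst p \<union> snd p) (Ps ! i - {fst p, snd p}))"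

lemma merged: assumes "Suc i < n"
 shows "mA i \<in> Ps ! i" "mB i \<in> Ps ! i" "mA i ~= mB i" "Ps ! Suc i = insert (mA i \<union> mB i) (Ps ! i - {mA i, mB i})"
proof -
 let ?P = "%p. fst p \<in> Ps ! i & snd p \<in> Ps ! i & fst p ~= snd p & Ps ! Suc i = insert (fst p \<union> snd p) (Ps ! i - {fst p, snd p})"
 obtain X Y where "?P (X, Y)" using step[of i] assms len unfolding merge_step_def by auto
 then have "?P (SOME p. ?P p)" by (rule someI)
 then show "mA i \<in> Ps ! i" "mB i \<in> Ps ! i" "mA i ~= mB i" "Ps ! Suc i = insert (mA i \<union> mB i) (Ps ! i - {mA i, mB i})"
  unfolding mA_def mB_def by auto
qed

abbreviation "mZ i \<equiv> mA i \<union> mB i"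

text \<open>A part of an earlier partition lies inside a single part of \<open>Ps ! i\<close>
  (\<open>coarser\<close>), whereas the new part meets two of them. This determines the
  \<open>LEAST\<close> in \<open>part_name\<close>.\<close>

lemma new_part: assumes "Suc i < n" "j <= i" shows "mZ i \<notin> Ps ! j"
proof
 assume "mZ i \<in> Ps ! j"
 moreover have "i < length Ps" using assms(1) len by simp
 ultimately have "\<exists>B\<in>Ps ! i. mZ i \<subseteq> B" using coarser[OF assms(2)] by blast
 then obtain B where B: "B \<in> Ps ! i" "mZ i \<subseteq> B" by blast
 have p: "\<forall>A\<in>Ps ! i. A ~= {}" "\<forall>A\<in>Ps ! i. \<forall>B\<in>Ps ! i. A ~= B --> A \<inter> B = {}" using partition[of i] assms len by auto
 have "mA i \<inter> B ~= {}" "mB i \<inter> B ~= {}" using p(1) merged(1,2)[OF assms(1)] B(2) by blast+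
 then have "mA i = B" "mB i = B" using p(2) merged(1,2)[OF assms(1)] B(1) by metis+
 then show False using merged(3)[OF assms(1)] by simp
qed

lemma nm_new: assumes "Suc i < n" shows "nm (mZ i) = n + i"
proof -
 have "mZ i \<in> Ps ! Suc i" using merged(4)[OF assms] by auto
 then have "(LEAST j. j < length Ps & mZ i \<in> Ps ! j) = Suc i"
  using new_part[OF assms] assms len by (intro Least_equality) (auto simp: not_less_eq_eq[symmetric])
 then show ?thesis using new_part[OF assms, of 0] by (simp add: part_name_def)
qed

lemma nm_inj: "i < n ==> inj_on nm (Ps ! i) & nm ` (Ps ! i) \<subseteq> {..<n + i}"
proof (induction i)
 case 0
 have "nm {u} = u" if "u < n" for u using that by (auto simp: part_name_def P0)
 then show ?case by (auto simp: P0 inj_on_def)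
next
 case (Suc i)
 then have IH: "inj_on nm (Ps ! i)" "nm ` (Ps ! i) \<subseteq> {..<n + i}" by auto
 have "inj_on nm (Ps ! i - {mA i, mB i})" "nm (mZ i) \<notin> nm ` (Ps ! i - {mA i, mB i})" "nm (mZ i) < n + Suc i"
  using IH nm_new[OF Suc.prems] by (auto simp: inj_on_diff)
 then show ?case unfolding merged(4)[OF Suc.prems] using IH(2) by (auto simp: inj_on_insert)
qed

definition part :: "nat => nat => nat set" where "part i u = (THE A. A \<in> Ps ! i & u \<in> A)"
definition pn :: "nat => nat => nat" where "pn i u = nm (part i u)"
definition rE :: "nat => nat => nat => bool" where
 "rE i a b \<longleftrightarrow> (\<exists>A\<in>Ps ! i. \<exists>B\<in>Ps ! i. a = nm A & b = nm B & red_adjacent \<sigma> S A B)"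
text \<open>The input lists the names of the merged parts in increasing order; \<open>xn\<close> and
  \<open>yn\<close> are these two numbers.\<close>

definition xn :: "nat => nat" where "xn i = min (nm (mA i)) (nm (mB i))"
definition yn :: "nat => nat" where "yn i = max (nm (mA i)) (nm (mB i))"
definition im :: "nat => nat => nat" where "im i w = (if w = xn i | w = yn i then n + i else w)"

lemma part_eq: assumes "i < n" "A \<in> Ps ! i" "u \<in> A" shows "part i u = A"
proof -
 have "\<forall>A\<in>Ps ! i. \<forall>B\<in>Ps ! i. A ~= B --> A \<inter> B = {}" using partition[of i] assms(1) len by simp
 then have "B = A" if "B \<in> Ps ! i" "u \<in> B" for B using that assms(2,3) by blast
 then show ?thesis unfolding part_def using assms(2,3) by (intro the_equality) blast+
qed

lemma part: assumes "i < n" "u < n" shows "part i u \<in> Ps ! i" "u \<in> part i u"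
proof -
 have "u \<in> \<Union> (Ps ! i)" using partition[of i] assms len by simp
 then obtain A where "A \<in> Ps ! i" "u \<in> A" by blast
 then show "part i u \<in> Ps ! i" "u \<in> part i u" using part_eq[OF assms(1)] by auto
qed

lemma nm_eq: "i < n ==> A \<in> Ps ! i ==> B \<in> Ps ! i ==> nm A = nm B \<longleftrightarrow> A = B"
 using nm_inj[of i] by (auto simp: inj_on_def)

lemma pn_image: assumes "i < n" shows "pn i ` {..<n} = nm ` (Ps ! i)"
proof (intro set_eqI iffI)
 fix x assume "x \<in> nm ` (Ps ! i)"
 then obtain A where A: "A \<in> Ps ! i" "x = nm A" by blast
 have p: "A ~= {}" "\<Union> (Ps ! i) = {..<n}" using partition[of i] assms len A(1) by simp_all
 then obtain u where u: "u \<in> A" by blast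
 then have "u < n" using p(2) A(1) by blast
 then show "x \<in> pn i ` {..<n}" using part_eq[OF assms A(1) u] A(2) by (auto simp: pn_def)
qed (use part assms in \<open>auto simp: pn_def\<close>)

lemma pn_lt: "i < n ==> u < n ==> pn i u < n + i"
 using nm_inj[of i] part(1)[of i u] by (auto simp: pn_def)

lemma pn_0: "u < n ==> pn 0 u = u"
proof -
 assume u: "u < n"
 have "part 0 u = {u}" by (rule part_eq) (use u in \<open>auto simp: P0\<close>)
 then show ?thesis using u by (auto simp: pn_def part_name_def P0)
qed

lemma rE_0: "\<not> rE 0 a b"
 unfolding rE_def red_adjacent_def using P0 by auto

lemma im_nm: assumes "Suc i < n" "A \<in> Ps ! i"
 shows "im i (nm A) = nm (if A = mA i | A = mB i then mZ i else A)"
proof -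
 have "i < n" using assms by simp
 then have "nm A = xn i | nm A = yn i \<longleftrightarrow> A = mA i | A = mB i"
  using nm_eq[of i A "mA i"] nm_eq[of i A "mB i"] merged[OF assms(1)] assms(2)
  by (auto simp: xn_def yn_def min_def max_def)
 then show ?thesis using nm_new[OF assms(1)] by (simp add: im_def)
qed

lemma img_in: assumes "Suc i < n" "A \<in> Ps ! i"
 shows "(if A = mA i | A = mB i then mZ i else A) \<in> Ps ! Suc i" "A \<subseteq> (if A = mA i | A = mB i then mZ i else A)"
 using merged(4)[OF assms(1)] assms(2) by auto

lemma pn_Suc: assumes "Suc i < n" "u < n" shows "pn (Suc i) u = im i (pn i u)"
proof -
 let ?A = "part i u"
 have A: "?A \<in> Ps ! i" "u \<in> ?A" using part[of i u] assms by auto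
 have "part (Suc i) u = (if ?A = mA i | ?A = mB i then mZ i else ?A)"
  using img_in[OF assms(1) A(1)] A(2) by (intro part_eq assms(1)) auto
 then show ?thesis unfolding pn_def im_nm[OF assms(1) A(1)] by simp
qed

lemma xy_live: assumes "Suc i < n" shows "xn i \<in> pn i ` {..<n}" "yn i \<in> pn i ` {..<n}" "xn i < yn i"
proof -
 have "nm (mA i) ~= nm (mB i)" using nm_eq[of i] merged[OF assms] assms by auto
 then show "xn i \<in> pn i ` {..<n}" "yn i \<in> pn i ` {..<n}" "xn i < yn i"
  using pn_image[of i] merged[OF assms] assms by (auto simp: xn_def yn_def min_def max_def)
qed

lemma rE_sym: "rE i a b ==> rE i b a"
 unfolding rE_def using red_adjacent_sym by blast

lemma rE_live: "i < n ==> rE i a b ==> b \<in> pn i ` {..<n}"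
 unfolding rE_def using pn_image by blast

text \<open>Pairs of different atomic types remain in larger parts, so a red edge disappears only
  when its two ends are merged.\<close>

lemma rE_Suc: assumes "Suc i < n" "rE i a b" shows "im i a = im i b | rE (Suc i) (im i a) (im i b)"
proof -
 obtain A B where AB: "A \<in> Ps ! i" "B \<in> Ps ! i" "a = nm A" "b = nm B" "red_adjacent \<sigma> S A B"
  using assms(2) unfolding rE_def by blast
 let ?A = "if A = mA i | A = mB i then mZ i else A" and ?B = "if B = mA i | B = mB i then mZ i else B"
 show ?thesis
 proof (cases "?A = ?B")
  case True then show ?thesis using im_nm[OF assms(1)] AB by simp
 next
  case False
  have mono: "red_adjacent \<sigma> S A' B'" if "A \<subseteq> A'" "B \<subseteq> B'" "A' ~= B'" for A' B'
   using AB(5) that unfolding red_adjacent_def by blast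
  have "red_adjacent \<sigma> S ?A ?B" by (rule mono[OF img_in(2)[OF assms(1) AB(1)] img_in(2)[OF assms(1) AB(2)] False])
  then have "rE (Suc i) (nm ?A) (nm ?B)" using img_in(1)[OF assms(1) AB(1)] img_in(1)[OF assms(1) AB(2)] unfolding rE_def by blast
  then show ?thesis unfolding AB(3,4) im_nm[OF assms(1) AB(1)] im_nm[OF assms(1) AB(2)] ..
 qed
qed

lemma rE_pred: assumes "Suc i < n" "rE (Suc i) a b" "a ~= n + i" "b ~= n + i" shows "rE i a b"
proof -
 obtain A B where AB: "A \<in> Ps ! Suc i" "B \<in> Ps ! Suc i" "a = nm A" "b = nm B" "red_adjacent \<sigma> S A B"
  using assms(2) unfolding rE_def by blast
 then have "A \<in> Ps ! i" "B \<in> Ps ! i" using merged(4)[OF assms(1)] nm_new[OF assms(1)] assms(3,4) by auto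
 then show ?thesis using AB unfolding rE_def by blast
qed

text \<open>Without a red edge the atomic type is constant between two distinct parts, so
  representatives may stand for all pairs.\<close>

lemma homogeneous:
 assumes "i < n" "u < n" "v < n" "u' < n" "v' < n" "pn i u = pn i u'" "pn i v = pn i v'" "pn i u ~= pn i v" "\<not> rE i (pn i u) (pn i v)"
 shows "atom_code \<sigma> S u v = atom_code \<sigma> S u' v'"
proof -
 have e: "part i u = part i u'" "part i v = part i v'"
  using assms nm_eq[OF assms(1)] part(1)[OF assms(1)] unfolding pn_def by metis+
 have "\<not> red_adjacent \<sigma> S (part i u) (part i v)"
  using assms(1-3,9) part(1)[OF assms(1)] unfolding rE_def pn_def by blast
 moreover have "part i u ~= part i v" using assms(8) by (auto simp: pn_def)
 ultimately have "atomic_type \<sigma> S u v = atomic_type \<sigma> S u' v'"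
  using part(2)[OF assms(1)] assms(2-5) e unfolding red_adjacent_def by metis
 then show ?thesis by (rule atom_code_eq)
qed

lemma rE_neighbours: assumes "i < n" "A \<in> Ps ! i" shows "{b. rE i (nm A) b} = nm ` red_neighbours \<sigma> S (Ps ! i) A"
 unfolding rE_def red_neighbours_def using assms nm_eq[OF assms(1)] by auto

lemma card_nm: assumes "i < n" shows "card (nm ` red_neighbours \<sigma> S (Ps ! i) A) = card (red_neighbours \<sigma> S (Ps ! i) A)"
 by (rule card_image, rule inj_on_subset[of _ "Ps ! i"]) (use nm_inj[OF assms] in \<open>auto simp: red_neighbours_def\<close>)

lemma degree: assumes "i < n" shows "finite {b. rE i a b} & card {b. rE i a b} <= d"
proof (cases "\<exists>A\<in>Ps ! i. a = nm A")
 case True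
 then obtain A where A: "A \<in> Ps ! i" "a = nm A" by blast
 have "card (red_neighbours \<sigma> S (Ps ! i) A) <= d"
 proof -
  have "Ps ! i \<in> set Ps" using assms len by simp
  then show ?thesis using seq A(1) unfolding d_sequence_def by blast
 qed
 moreover have "finite (red_neighbours \<sigma> S (Ps ! i) A)"
 proof (rule finite_subset[of _ "Ps ! i"])
  show "finite (Ps ! i)" using partition[of i] assms len by simp
 qed (auto simp: red_neighbours_def)
 ultimately show ?thesis using rE_neighbours[OF assms A(1)] card_nm[OF assms, of A] A(2) by simp
next
 case False
 then have "{b. rE i a b} = {}" by (auto simp: rE_def)
 then show ?thesis by simp
qed

lemma sequence_code_eq:
 "sequence_code \<sigma> n S Ps = concat (map (%i. [xn i, yn i, card {b. rE (Suc i) (n + i) b}] @ sorted_list_of_set {b. rE (Suc i) (n + i) b}) [0..<n - 1])"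
proof -
 have st: "step_code \<sigma> n S Ps (Suc i) = [xn i, yn i, card {b. rE (Suc i) (n + i) b}] @ sorted_list_of_set {b. rE (Suc i) (n + i) b}"
  if i: "Suc i < n" for i
 proof -
  have 1: "Ps ! Suc i - Ps ! i = {mZ i}" using merged(4)[OF i] new_part[OF i, of i] by auto
  have zz: "mZ i ~= mA i" "mZ i ~= mB i" using new_part[OF i, of i] merged(1,2)[OF i] by auto
  have aux: "P - insert Z (P - {A, B}) = {A, B}" if "A \<in> P" "B \<in> P" "Z ~= A" "Z ~= B" for P and Z A B :: "nat set"
   using that by blast
  have 2: "Ps ! i - Ps ! Suc i = {mA i, mB i}"
   unfolding merged(4)[OF i] by (rule aux[OF merged(1,2)[OF i] zz])
  have Zin: "mZ i \<in> Ps ! Suc i" using merged(4)[OF i] by auto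
  have 3: "nm ` red_neighbours \<sigma> S (Ps ! Suc i) (mZ i) = {b. rE (Suc i) (n + i) b}"
   using rE_neighbours[OF i Zin] nm_new[OF i] by simp
  have "nm ` {mA i, mB i} = {xn i, yn i}" by (auto simp: xn_def yn_def min_def max_def)
  then have 4: "sorted_list_of_set (nm ` {mA i, mB i}) = [xn i, yn i]" using xy_live(3)[OF i] by simp
  have "card (red_neighbours \<sigma> S (Ps ! Suc i) (mZ i)) = card {b. rE (Suc i) (n + i) b}"
   using card_nm[OF i, of "mZ i"] 3 by simp
  then show ?thesis unfolding step_code_def Let_def diff_Suc_1 1 2 the_elem_eq 4 3 by simp
 qed
 have "map (step_code \<sigma> n S Ps) [1..<n] = map (%i. step_code \<sigma> n S Ps (Suc i)) [0..<n - 1]"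
  by (rule nth_equalityI) auto
 also have "\<dots> = map (%i. [xn i, yn i, card {b. rE (Suc i) (n + i) b}] @ sorted_list_of_set {b. rE (Suc i) (n + i) b}) [0..<n - 1]"
  using st by (intro map_cong refl) auto
 finally show ?thesis unfolding sequence_code_def len by simp
qed

text \<open>The last part is created by merge \<open>n - 2\<close> and so is named
  \<open>n + (n - 2)\<close>. For \<open>n = 1\<close> there is no merge and the part is the
  singleton 0.\<close>

lemma pn_last: "u < n ==> pn (n - 1) u = (if n = 1 then 0 else 2 * n - 2)"
proof -
 assume u: "u < n"
 show ?thesis
 proof (cases "n = 1")
  case True then show ?thesis using pn_0 u by simp
 next
  case False
  then have i: "Suc (n - 2) < n" "Suc (n - 2) = n - 1" using n by auto
  have "mZ (n - 2) \<in> Ps ! (n - 1)" using merged(4)[OF i(1)] i(2) by auto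
  then have "mZ (n - 2) = {..<n}" using Plast len by auto
  moreover have "part (n - 1) u = {..<n}" using Plast len n u by (intro part_eq) auto
  ultimately have "pn (n - 1) u = n + (n - 2)" using nm_new[OF i(1)] by (simp add: pn_def)
  then show ?thesis using False n by simp
 qed
qed

end

section \<open>Weakest preconditions and the layout of the input\<close>

definition aup :: "(nat => nat => nat => nat) => nat => nat => nat => nat => nat => nat => nat => nat" where
 "aup A c i j v = A(c := (A c)(i := (A c i)(j := v)))"

lemma aup [simp]: "aup A c i j v c' i' j' = (if c' = c & i' = i & j' = j then v else A c' i' j')"
 by (simp add: aup_def)

text \<open>Verification conditions for code without loops; loops get \<open>False\<close> and are
  treated by \<open>hl_For\<close>.\<close>

fun wpc :: "nat list => nat => nat => com => (state => bool) => state => bool" where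
 "wpc xs C B Nop Q s = Q s"
| "wpc xs C B (Asg r e) Q s = (eok xs C s e & val xs s e <= B & Q ((fst s)(r := val xs s e), snd s))"
| "wpc xs C B (Sto c e1 e2 e3) Q s = (eok xs C s e1 & eok xs C s e2 & eok xs C s e3 & val xs s e3 <= B \<and>
  Q (fst s, aup (snd s) c (val xs s e1) (val xs s e2) (val xs s e3)))"
| "wpc xs C B (Sq a b) Q s = wpc xs C B a (%s'. wpc xs C B b Q s') s"
| "wpc xs C B (Cnd e a b) Q s = (eok xs C s e & (val xs s e ~= 0 --> wpc xs C B a Q s) & (val xs s e = 0 --> wpc xs C B b Q s))"
| "wpc xs C B (For r e b) Q s = False"

lemma hl_wpc: "wpc xs C B c Q s ==> hl xs K W C B c (csz c * Suc C) s Q"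
proof (induction c arbitrary: Q s)
 case Nop then show ?case by (intro hl_Nop) simp
next
 case (Asg r e) then show ?case by (cases s) (auto intro!: hl_Asg simp del: csz.simps mult_Suc_right)
next
 case (Sto c e1 e2 e3) then show ?case by (cases s) (auto intro!: hl_Sto simp: aup_def simp del: csz.simps mult_Suc_right)
next
 case (Sq a b)
 show ?case by (rule hl_SqC, rule hl_mono[OF Sq.IH(1)[OF Sq.prems[unfolded wpc.simps]] order_refl], rule Sq.IH(2))
next
 case (Cnd e a b)
 show ?case by (rule hl_CndC) (use Cnd in \<open>auto simp del: csz.simps\<close>)
qed simp

text \<open>In \<open>hl\<close> the number \<open>C\<close> occurs only in the premise
  \<open>C <= B\<close>. So code timed with the smaller constant of the formula phase combines with
  code timed with the larger one.\<close>

lemma hl_change_C: "hl xs K W C1 B c \<tau> s Q ==> C1 <= B ==> hl xs K W C B c \<tau> s Q"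
 unfolding hl_def by blast

lemma hl_Sq_le:
 assumes "hl xs K W C B c1 \<tau>1 s P" "!!s'. P s' ==> hl xs K W C B c2 \<tau>2 s' Q"
 shows "hl xs K W C B (Sq c1 c2) (\<tau>1 + \<tau>2) s Q"
 by (rule hl_Sq, rule hl_mono[OF assms(1)]) (use assms(2) in auto)

lemma sum_list_map_upt: "sum_list (map f [0..<k]) = (\<Sum>j<k. f j :: nat)"
 by (simp add: interv_sum_list_conv_sum_set_nat atLeast0LessThan)

lemma concat_map_nth:
 assumes "k < m" "i < length (f k)"
 shows "concat (map f [0..<m]) ! ((\<Sum>j<k. length (f j)) + i) = f k ! i \<and>
  (\<Sum>j<k. length (f j)) + i < length (concat (map f [0..<m]))"
 using assms
proof (induction m)
 case (Suc m)
 have len: "length (concat (map f [0..<m])) = (\<Sum>j<m. length (f j))"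
  by (simp add: length_concat comp_def sum_list_map_upt)
 show ?case
 proof (cases "k = m")
  case True then show ?thesis using Suc.prems len by (simp add: nth_append)
 next
  case False
  then show ?thesis using Suc by (simp add: nth_append)
 qed
qed simp

lemma n_lists_2: "u < n ==> v < n ==> List.n_lists 2 [0..<n] ! (u + n * v) = [u, v] & u + n * v < length (List.n_lists 2 [0..<n])"
proof -
 assume uv: "u < n" "v < n"
 have 1: "List.n_lists 1 [0..<n] = map (%v. [v]) [0..<n]" by simp
 have "List.n_lists 2 [0..<n] = concat (map (%v. map (%u. [u, v]) [0..<n]) [0..<n])"
  using 1 by (simp add: numeral_2_eq_2 comp_def del: upt_Suc)
 then show ?thesis using concat_map_nth[OF uv(2), of u "%v. map (%u. [u, v]) [0..<n]"] uv
  by (simp add: ac_simps)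
qed

lemma relation_table_bit:
 "relation_table n 0 T ! 0 = of_bool ([] \<in> T)"
 "u < n ==> relation_table n 1 T ! u = of_bool ([u] \<in> T)"
 "u < n ==> v < n ==> relation_table n 2 T ! (u + n * v) = of_bool ([u, v] \<in> T)"
 using n_lists_2[of u n v] by (simp_all add: relation_table_def comp_def)

lemma length_relation_table [simp]: "length (relation_table n a T) = n ^ a"
 by (simp add: relation_table_def length_n_lists)

lemma structure_code_nth:
 assumes "k < length \<sigma>" "i < n ^ (\<sigma> ! k)"
 shows "structure_code \<sigma> n S ! (sum_list (map (%a. n ^ a) (take k \<sigma>)) + i) = relation_table n (\<sigma> ! k) (rel S k) ! i \<and>
  sum_list (map (%a. n ^ a) (take k \<sigma>)) + i < length (structure_code \<sigma> n S)"
proof -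
 have "take k \<sigma> = map ((!) \<sigma>) [0..<k]" using assms(1) by (intro nth_equalityI) auto
 then have "sum_list (map (%a. n ^ a) (take k \<sigma>)) = (\<Sum>j<k. length (relation_table n (\<sigma> ! j) (rel S j)))"
  by (simp add: comp_def sum_list_map_upt)
 then show ?thesis unfolding structure_code_def
  using concat_map_nth[OF assms(1), of i "%k. relation_table n (\<sigma> ! k) (rel S k)"] assms(2) by simp
qed

definition plus :: "ex => ex => ex" where "plus a b = Bin Add a b"
definition times :: "ex => ex => ex" where "times a b = Bin Mul a b"
definition neq :: "ex => ex => ex" where "neq a b = Bin Add (Bin Sub a b) (Bin Sub b a)"
definition less :: "ex => ex => ex" where "less a b = Bin Sub b a"
definition push :: "ex => ex => ex" where "push a b = Bin Add (Cst 1) (Pr a b)"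

lemma val_ops [simp]:
 "val xs s (plus a b) = val xs s a + val xs s b" "val xs s (times a b) = val xs s a * val xs s b"
 "val xs s (neq a b) = 0 \<longleftrightarrow> val xs s a = val xs s b" "val xs s (less a b) = 0 \<longleftrightarrow> \<not> val xs s a < val xs s b"
 "val xs s (push a b) = Suc (prod_encode (val xs s a, val xs s b))"
 by (auto simp: plus_def times_def neq_def less_def push_def)

lemma eok_ops [simp]:
 "eok xs C s (plus a b) = (eok xs C s a & eok xs C s b)" "eok xs C s (times a b) = (eok xs C s a & eok xs C s b)"
 "eok xs C s (neq a b) = (eok xs C s a & eok xs C s b)" "eok xs C s (less a b) = (eok xs C s a & eok xs C s b)"
 "eok xs C s (push a b) = (eok xs C s a & eok xs C s b)"
 by (auto simp: plus_def times_def neq_def less_def push_def)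

text \<open>Register 2 holds \<open>n\<close>, and 3 and 4 the lengths of the codes of formula and contraction sequence.\<close>

definition powx :: "nat => ex" where
 "powx a = (if a = 0 then Cst 1 else if a = 1 then Var 2 else times (Var 2) (Var 2))"

definition structx :: "signature => nat => ex => ex" where
 "structx \<sigma> k e = Inp (plus (plus (Cst 3) (plus (Var 3) (Var 4))) (plus (foldr (%a b. plus (powx a) b) (take k \<sigma>) (Cst 0)) e))"

text \<open>The sum in \<open>atom_code\<close> is unrolled over the fixed signature into one
  expression, whose size does not depend on the structure.\<close>

fun atomx :: "signature => ex => ex => nat => ex" where
 "atomx \<sigma> u v 0 = Cst 0"
| "atomx \<sigma> u v (Suc k) = plus (atomx \<sigma> u v k) (times (Cst (2 ^ k)) (
  if \<sigma> ! k = 1 then structx \<sigma> k u else if \<sigma> ! k = 2 then structx \<sigma> k (plus u (times (Var 2) v)) else Cst 0))"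

fun nulx :: "signature => nat => ex" where
 "nulx \<sigma> 0 = Cst 0"
| "nulx \<sigma> (Suc k) = plus (nulx \<sigma> k) (times (Cst (2 ^ k)) (if \<sigma> ! k = 0 then structx \<sigma> k (Cst 0) else Cst 0))"

text \<open>This reads the header of the input directly, because it is evaluated before any register
  is set.\<close>

definition lenx :: "signature => ex" where
 "lenx \<sigma> = plus (plus (Cst 3) (plus (Inp (Cst 1)) (Inp (Cst 2))))
  (foldr (%a b. plus (if a = 0 then Cst 1 else if a = 1 then Inp (Cst 0) else times (Inp (Cst 0)) (Inp (Cst 0))) b) \<sigma> (Cst 0))"

locale input = contraction \<sigma> S n d Ps for \<sigma> S n d Ps +
 fixes \<phi> :: fm
 assumes bin: "binary_signature \<sigma>"
begin

definition xs :: "nat list" where "xs = input_code \<sigma> n S Ps \<phi>"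
abbreviation fl :: nat where "fl \<equiv> length (formula_code \<phi>)"
abbreviation sl :: nat where "sl \<equiv> length (sequence_code \<sigma> n S Ps)"

lemma xs_hd [simp]: "xs ! 0 = n" "xs ! Suc 0 = fl" "xs ! 2 = sl" "length xs = 3 + fl + sl + length (structure_code \<sigma> n S)"
 by (simp_all add: xs_def input_code_def formula_length_def numeral_2_eq_2)

lemma xs_formula: "i < fl ==> xs ! (3 + i) = formula_code \<phi> ! i"
 and xs_sequence: "i < sl ==> xs ! (3 + fl + i) = sequence_code \<sigma> n S Ps ! i"
 and xs_structure: "i < length (structure_code \<sigma> n S) ==> xs ! (3 + fl + sl + i) = structure_code \<sigma> n S ! i"
 by (simp_all add: xs_def input_code_def formula_length_def nth_append)

lemma sig_le: "a \<in> set \<sigma> ==> a <= 2" using bin by (simp add: binary_signature_def)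

lemma powx: "a <= 2 ==> R 2 = n ==> val xs (R, A) (powx a) = n ^ a & eok xs C (R, A) (powx a)"
proof -
 assume "a <= 2" "R 2 = n"
 then consider "a = 0" | "a = 1" | "a = 2" by linarith
 then show ?thesis using \<open>R 2 = n\<close> by cases (auto simp: powx_def power2_eq_square)
qed

lemma foldr_powx: "set as \<subseteq> set \<sigma> ==> R 2 = n ==> val xs (R, A) (foldr (%a b. plus (powx a) b) as (Cst 0)) = sum_list (map (%a. n ^ a) as) \<and>
  eok xs C (R, A) (foldr (%a b. plus (powx a) b) as (Cst 0))"
 using powx sig_le by (induction as) auto

lemma structx:
 assumes "R 2 = n" "R 3 = fl" "R 4 = sl" "k < length \<sigma>" "eok xs C (R, A) e" "val xs (R, A) e < n ^ (\<sigma> ! k)"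
 shows "val xs (R, A) (structx \<sigma> k e) = relation_table n (\<sigma> ! k) (rel S k) ! val xs (R, A) e" "eok xs C (R, A) (structx \<sigma> k e)"
proof -
 have f: "val xs (R, A) (foldr (%a b. plus (powx a) b) (take k \<sigma>) (Cst 0)) = sum_list (map (%a. n ^ a) (take k \<sigma>))"
  "eok xs C (R, A) (foldr (%a b. plus (powx a) b) (take k \<sigma>) (Cst 0))"
  using foldr_powx[of "take k \<sigma>" R A C] assms(1) set_take_subset[of k \<sigma>] by auto
 let ?o = "sum_list (map (%a. n ^ a) (take k \<sigma>)) + val xs (R, A) e"
 have s: "structure_code \<sigma> n S ! ?o = relation_table n (\<sigma> ! k) (rel S k) ! val xs (R, A) e" "?o < length (structure_code \<sigma> n S)"
  using structure_code_nth[OF assms(4,6), of S] by auto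
 show "val xs (R, A) (structx \<sigma> k e) = relation_table n (\<sigma> ! k) (rel S k) ! val xs (R, A) e"
  using xs_structure[OF s(2)] s(1) f assms by (simp add: structx_def add.assoc)
 show "eok xs C (R, A) (structx \<sigma> k e)" using s f assms by (simp add: structx_def)
qed

lemma atomx:
 assumes "R 2 = n" "R 3 = fl" "R 4 = sl" "eok xs C (R, A) u" "eok xs C (R, A) v" "val xs (R, A) u < n" "val xs (R, A) v < n"
 shows "val xs (R, A) (atomx \<sigma> u v (length \<sigma>)) = atom_code \<sigma> S (val xs (R, A) u) (val xs (R, A) v)" "eok xs C (R, A) (atomx \<sigma> u v (length \<sigma>))"
proof -
 let ?u = "val xs (R, A) u" and ?v = "val xs (R, A) v"
 have "m <= length \<sigma> ==> val xs (R, A) (atomx \<sigma> u v m) = (\<Sum>k<m. 2 ^ k * of_bool (\<sigma> ! k = 1 & [?u] \<in> rel S k | \<sigma> ! k = 2 & [?u, ?v] \<in> rel S k)) \<and>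
   eok xs C (R, A) (atomx \<sigma> u v m)" for m
 proof (induction m)
  case (Suc m)
  then have m: "m < length \<sigma>" by simp
  have b: "?u + n * ?v < n ^ 2"
  proof -
   have "?u + n * ?v < n + n * ?v" using assms(6) by simp
   also have "\<dots> = n * Suc ?v" by simp
   also have "\<dots> <= n * n" using assms(7) by (intro mult_le_mono2) simp
   finally show ?thesis by (simp add: power2_eq_square)
  qed
  show ?case using Suc m structx[OF assms(1-3) m, of C A u] structx[OF assms(1-3) m, of C A "plus u (times (Var 2) v)"] b assms
   relation_table_bit(2)[of ?u n "rel S m"] relation_table_bit(3)[of ?u n ?v "rel S m"]
   by (auto simp: mult.commute)
 qed simp
 from this[of "length \<sigma>"] show "val xs (R, A) (atomx \<sigma> u v (length \<sigma>)) = atom_code \<sigma> S ?u ?v" "eok xs C (R, A) (atomx \<sigma> u v (length \<sigma>))"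
  by (auto simp: atom_code_def)
qed

lemma nulx:
 assumes "R 2 = n" "R 3 = fl" "R 4 = sl"
 shows "val xs (R, A) (nulx \<sigma> (length \<sigma>)) = nul_code \<sigma> S" "eok xs C (R, A) (nulx \<sigma> (length \<sigma>))"
proof -
 have "m <= length \<sigma> ==> val xs (R, A) (nulx \<sigma> m) = (\<Sum>k<m. 2 ^ k * of_bool (\<sigma> ! k = 0 & [] \<in> rel S k)) \<and>
   eok xs C (R, A) (nulx \<sigma> m)" for m
 proof (induction m)
  case (Suc m)
  then have m: "m < length \<sigma>" by simp
  show ?case using Suc m structx[OF assms(1-3) m, of C A "Cst 0"] relation_table_bit(1)[of n "rel S m"] by (auto simp: mult.commute)
 qed simp
 from this[of "length \<sigma>"] show "val xs (R, A) (nulx \<sigma> (length \<sigma>)) = nul_code \<sigma> S" "eok xs C (R, A) (nulx \<sigma> (length \<sigma>))"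
  by (auto simp: nul_code_def)
qed

lemma length_structure_code: "length (structure_code \<sigma> n S) = sum_list (map (%a. n ^ a) \<sigma>)"
proof -
 have "\<sigma> = map ((!) \<sigma>) [0..<length \<sigma>]" by (rule nth_equalityI) auto
 then have "sum_list (map (%a. n ^ a) \<sigma>) = sum_list (map (%k. n ^ (\<sigma> ! k)) [0..<length \<sigma>])"
  by (metis (no_types, lifting) comp_apply map_eq_conv map_map)
 then show ?thesis by (simp add: structure_code_def length_concat comp_def)
qed

lemma lenx: "val xs (R, A) (lenx \<sigma>) = length xs" "eok xs C (R, A) (lenx \<sigma>)"
proof -
 have "set as \<subseteq> set \<sigma> ==> val xs (R, A) (foldr (%a b. plus (if a = 0 then Cst 1 else if a = 1 then Inp (Cst 0) else times (Inp (Cst 0)) (Inp (Cst 0))) b) as (Cst 0))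
  = sum_list (map (%a. n ^ a) as) \<and>
  eok xs C (R, A) (foldr (%a b. plus (if a = 0 then Cst 1 else if a = 1 then Inp (Cst 0) else times (Inp (Cst 0)) (Inp (Cst 0))) b) as (Cst 0))" for as
 proof (induction as)
  case (Cons a as)
  then have "a = 0 | a = 1 | a = 2" using sig_le[of a] by auto
  then show ?case using Cons by (auto simp: power2_eq_square)
 qed simp
 from this[of \<sigma>] show "val xs (R, A) (lenx \<sigma>) = length xs" "eok xs C (R, A) (lenx \<sigma>)"
  by (simp_all add: lenx_def length_structure_code)
qed

end

text \<open>If some value exceeds \<open>B\<close>, no machine state represents \<open>s\<close>,
  and the triple holds vacuously.\<close>

lemma hl_small:
 assumes "(!!c i j. snd s c i j <= B) ==> (!!r. r < K ==> fst s r <= B) ==> hl xs K W C B c \<tau> s Q"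
 shows "hl xs K W C B c \<tau> s Q"
proof (cases "(\<forall>c i j. snd s c i j <= B) & (\<forall>r<K. fst s r <= B)")
 case True then show ?thesis using assms by blast
next
 case False then show ?thesis unfolding hl_def rep_def by blast
qed

section \<open>Updating the red graph after a merge\<close>

definition eqx :: "nat set => (nat => nat) => (nat => nat) => bool" where
 "eqx D R R0 \<longleftrightarrow> (\<forall>r. r \<notin> D --> R r = R0 r)"

lemma eqx_refl [simp]: "eqx D R R" by (simp add: eqx_def)
lemma eqx_upd [simp]: "r \<in> D ==> eqx D (R(r := v)) R0 \<longleftrightarrow> eqx D R R0" by (auto simp: eqx_def)
lemma eqxD: "eqx D R R0 ==> r \<notin> D ==> R r = R0 r" by (simp add: eqx_def)
lemma eqx_mono: "eqx D R R0 ==> D \<subseteq> D' ==> eqx D' R R0" by (auto simp: eqx_def)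
lemma eqx_trans: "eqx D R R1 ==> eqx D R1 R0 ==> eqx D R R0" by (auto simp: eqx_def)

text \<open>Use of the arrays: 0 holds a representative of each part, 1 the number of its red
  neighbours, 2 its type, 3 its search mark, 4 its list of neighbours, 5 the red adjacency matrix, 6
  the search queue, 7 the positions of tokens and 8 the evaluation stack.\<close>

definition row :: "(nat => nat => nat => nat) => nat => nat list" where
 "row A a = map (A 4 a) [0..<A 1 a 0]"

lemma row_eqI: "length ys = A 1 a 0 ==> (!!j. j < length ys ==> A 4 a j = ys ! j) ==> row A a = ys"
 unfolding row_def by (rule nth_equalityI) auto

definition c_filter :: com where
 "c_filter = Sq (Asg 18 (Arr 4 (Var 16) (Var 32))) (Cnd (neq (Var 18) (Var 13)) (Cnd (neq (Var 18) (Var 14))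
  (Sq (Sto 4 (Var 16) (Var 17) (Var 18)) (Asg 17 (plus (Var 17) (Cst 1)))) Nop) Nop)"

text \<open>The list is compacted in place. The write position, the length of the filtered prefix,
  never exceeds the read position, so entries are read before they are overwritten.\<close>

lemma hl_filter:
 assumes "40 <= K"
 shows "hl xs K W C B (For 32 (Arr 1 (Var 16) (Cst 0)) c_filter)
  (esz (Arr 1 (Var 16) (Cst 0)) * Suc C + A0 1 (R0 16) 0 * (csz c_filter * Suc C + 6) + 4) (R0(17 := 0), A0)
  (%s. eqx {17, 18, 32} (fst s) R0 & fst s 17 = length (filter (%v. v ~= R0 13 & v ~= R0 14) (row A0 (R0 16))) \<and>
    (\<forall>j<fst s 17. snd s 4 (R0 16) j = filter (%v. v ~= R0 13 & v ~= R0 14) (row A0 (R0 16)) ! j) \<and>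
    (\<forall>c i j. c ~= 4 | i ~= R0 16 --> snd s c i j = A0 c i j))"
proof (rule hl_small)
 assume A0: "!!c i j. snd (R0(17 := 0), A0) c i j <= B"
 define w where "w = R0 16"
 define f where "f = (%h. filter (%v. v ~= R0 13 & v ~= R0 14) (map (A0 4 w) [0..<h]))"
 have lf: "length (f h) <= h" for h unfolding f_def using length_filter_le[of _ "map (A0 4 w) [0..<h]"] by simp
 let ?I = "%h s. eqx {17, 18, 32} (fst s) R0 & fst s 17 = length (f h) & (\<forall>j<length (f h). snd s 4 w j = f h ! j) \<and>
  (\<forall>j\<ge>h. snd s 4 w j = A0 4 w j) & (\<forall>c i j. c ~= 4 | i ~= w --> snd s c i j = A0 c i j)"
 show ?thesis
 proof (rule hl_For[where m="A0 1 (R0 16) 0" and I="?I"])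
  show "A0 1 (R0 16) 0 <= B" using A0 by simp
  fix h R A assume h: "h < A0 1 (R0 16) 0" and I: "?I h (R, A)"
  note e = eqxD[OF I[THEN conjunct1], simplified]
  show "hl xs K W C B c_filter (csz c_filter * Suc C) (R(32 := h), A) (?I (Suc h))"
  proof (rule hl_small, rule hl_wpc)
   assume sm: "!!c i j. snd (R(32 := h), A) c i j <= B" "!!r. r < K ==> fst (R(32 := h), A) r <= B"
   have v: "A 4 w h = A0 4 w h" using I by auto
   have r: "R 16 = w" "R 13 = R0 13" "R 14 = R0 14" using e by (simp_all add: w_def)
   have fS: "f (Suc h) = f h @ (if A0 4 w h ~= R0 13 & A0 4 w h ~= R0 14 then [A0 4 w h] else [])" by (simp add: f_def)
   have hB: "Suc h <= B" using h A0[of 1 "R0 16" 0] by simp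
   have k: "R 17 = length (f h)" "length (f h) <= h" using I lf by auto
   have A4: "A 4 w h <= B" using sm(1) by simp
   show "wpc xs C B c_filter (?I (Suc h)) (R(32 := h), A)"
    using I k hB A4 v r lf[of h] by (auto simp: c_filter_def fS nth_append less_Suc_eq)
  qed
 qed (use A0 in \<open>auto simp: f_def w_def row_def\<close>)
qed

definition c_red :: com where
 "c_red = Sq (Sq (Asg 16 (Inp (plus (plus (Var 11) (Cst 3)) (Var 31)))) (Sq (Sto 4 (Var 12) (Var 31) (Var 16))
  (Sq (Sto 5 (Var 12) (Var 16) (Cst 1)) (Sq (Sto 5 (Var 16) (Var 12) (Cst 1)) (Asg 17 (Cst 0))))))
  (Sq (For 32 (Arr 1 (Var 16) (Cst 0)) c_filter)
  (Sq (Sto 4 (Var 16) (Var 17) (Var 12)) (Sto 1 (Var 16) (Cst 0) (plus (Var 17) (Cst 1)))))"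

definition t_red :: "nat => nat => nat" where
 "t_red C d = 200 * Suc C + (esz (Arr 1 (Var 16) (Cst 0)) * Suc C + d * (csz c_filter * Suc C + 6) + 4)"

text \<open>It suffices to change the listed neighbours of the new part, since a red edge to a
  merged part becomes one to the new part (\<open>rE_new\<close>). The lists of the merged parts are
  kept, as the search starts from these parts too.\<close>

lemma hl_red:
 assumes K: "40 <= K" and z: "z = R0 12" "x = R0 13" "y = R0 14" "p = R0 11"
  and c: "R0 15 = length ns" "A0 1 z 0 = length ns"
  and ns: "distinct ns" "z \<notin> set ns" "!!j. j < length ns ==> p + 3 + j < length xs & xs ! (p + 3 + j) = ns ! j"
  and d: "!!w. w \<in> set ns ==> A0 1 w 0 <= d" "Suc d <= B" "length ns <= B" "1 <= B" "!!w. w \<in> set ns ==> w <= B" "z <= B"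
 shows "hl xs K W C B (For 31 (Var 15) c_red) (esz (Var 15) * Suc C + length ns * (t_red C d + 6) + 4) (R0, A0)
  (%s. eqx {16, 17, 18, 31, 32} (fst s) R0 \<and>
   row (snd s) z = ns & (\<forall>w. w ~= z --> row (snd s) w = (if w \<in> set ns then filter (%v. v ~= x & v ~= y) (row A0 w) @ [z] else row A0 w)) \<and>
   (\<forall>a b. snd s 5 a b = (if a = z & b \<in> set ns | b = z & a \<in> set ns then 1 else A0 5 a b)) \<and>
   (\<forall>c i j. c ~= 1 & c ~= 4 & c ~= 5 --> snd s c i j = A0 c i j))"
proof -
 let ?S = "%j. set (take j ns)"
 let ?I = "%j s. eqx {16, 17, 18, 31, 32} (fst s) R0 & snd s 1 z 0 = length ns & (\<forall>i<j. snd s 4 z i = ns ! i) \<and>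
   (\<forall>w. w ~= z --> (if w \<in> ?S j then row (snd s) w = filter (%v. v ~= x & v ~= y) (row A0 w) @ [z]
     else snd s 1 w 0 = A0 1 w 0 & (\<forall>i. snd s 4 w i = A0 4 w i))) \<and>
   (\<forall>a b. snd s 5 a b = (if a = z & b \<in> ?S j | b = z & a \<in> ?S j then 1 else A0 5 a b)) \<and>
   (\<forall>c i j. c ~= 1 & c ~= 4 & c ~= 5 --> snd s c i j = A0 c i j)"
 show ?thesis
 proof (rule hl_For[where m="length ns" and I="?I"])
  show "?I 0 (R0, A0)" using c by simp
  fix j R A assume j: "j < length ns" and I: "?I j (R, A)"
  define w where "w = ns ! j"
  have w: "w \<in> set ns" "w ~= z" "w \<notin> ?S j" "?S (Suc j) = insert w (?S j)"
   using j ns(1,2) by (auto simp: w_def take_Suc_conv_app_nth in_set_conv_nth nth_eq_iff_index_eq)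
  note e = eqxD[OF I[THEN conjunct1], simplified]
  have r: "R 11 = p" "R 12 = z" "R 13 = x" "R 14 = y" using e z by simp_all
  have dw: "A 1 w 0 = A0 1 w 0" "!!i. A 4 w i = A0 4 w i" using I w(2,3) by auto
  have roww: "row A w = row A0 w" using dw by (simp add: row_def)
  define F where "F = filter (%v. v ~= x & v ~= y) (row A0 w)"
  have lF: "length F <= d" proof -
   have "length F <= length (row A0 w)" unfolding F_def by (rule length_filter_le)
   then show ?thesis using d(1)[OF w(1)] by (simp add: row_def)
  qed
  define A1 where "A1 = aup (aup (aup A 4 z j w) 5 z w 1) 5 w z 1"
  define R1 where "R1 = R(31 := j, 16 := w)"
  have A1w: "A1 1 w 0 = A0 1 w 0" "row A1 w = row A0 w" using dw w(2) roww by (simp_all add: A1_def row_def)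
  let ?P1 = "%s. fst s = R1(17 := 0) & snd s = A1"
  let ?P2 = "%s. eqx {17, 18, 32} (fst s) R1 & fst s 17 = length F & (\<forall>j<length F. snd s 4 w j = F ! j) \<and>
    (\<forall>c i j. c ~= 4 | i ~= w --> snd s c i j = A1 c i j)"
  have b1: "hl xs K W C B (Sq (Asg 16 (Inp (plus (plus (Var 11) (Cst 3)) (Var 31)))) (Sq (Sto 4 (Var 12) (Var 31) (Var 16))
  (Sq (Sto 5 (Var 12) (Var 16) (Cst 1)) (Sq (Sto 5 (Var 16) (Var 12) (Cst 1)) (Asg 17 (Cst 0)))))) (120 * Suc C) (R(31 := j), A) ?P1"
  proof (rule hl_mono[OF hl_wpc[where Q="?P1"]])
   have "ns ! j <= B" using d(5) j by simp
   then show "wpc xs C B (Sq (Asg 16 (Inp (plus (plus (Var 11) (Cst 3)) (Var 31)))) (Sq (Sto 4 (Var 12) (Var 31) (Var 16))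
  (Sq (Sto 5 (Var 12) (Var 16) (Cst 1)) (Sq (Sto 5 (Var 16) (Var 12) (Cst 1)) (Asg 17 (Cst 0)))))) ?P1 (R(31 := j), A)"
    using r ns(3)[OF j] j d(4) by (auto simp: A1_def R1_def w_def)
  qed (auto simp: plus_def)
  have b2: "hl xs K W C B (For 32 (Arr 1 (Var 16) (Cst 0)) c_filter)
   (esz (Arr 1 (Var 16) (Cst 0)) * Suc C + d * (csz c_filter * Suc C + 6) + 4) s ?P2" if "?P1 s" for s
  proof -
   have s: "s = (R1(17 := 0), A1)" using that by (cases s) auto
   have R1: "R1 16 = w" "R1 13 = x" "R1 14 = y" using r by (simp_all add: R1_def)
   show ?thesis unfolding s
    by (rule hl_mono[OF hl_filter[OF K, of xs W C B A1 R1]])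
     (use R1 A1w d(1)[OF w(1)] in \<open>auto simp: F_def\<close>)
  qed
  have b3: "hl xs K W C B (Sq (Sto 4 (Var 16) (Var 17) (Var 12)) (Sto 1 (Var 16) (Cst 0) (plus (Var 17) (Cst 1)))) (80 * Suc C) s (?I (Suc j))"
   if P2: "?P2 s" for s
  proof (rule hl_mono[OF hl_wpc[where Q="?I (Suc j)"]], cases s)
   define Q where "Q = ?I (Suc j)"
   fix R2 A2 assume s: "s = (R2, A2)"
   note e2 = eqxD[OF P2[THEN conjunct1], simplified]
   have r2: "R2 16 = w" "R2 12 = z" "R2 17 = length F" "eqx {16, 17, 18, 31, 32} R2 R0"
   proof -
    show "R2 16 = w" "R2 12 = z" "R2 17 = length F" using e2 P2 r s by (simp_all add: R1_def)
    have "eqx {16, 17, 18, 31, 32} R2 R1" using P2 s by (auto intro: eqx_mono)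
    moreover have "eqx {16, 17, 18, 31, 32} R1 R0" using I by (simp add: R1_def)
    ultimately show "eqx {16, 17, 18, 31, 32} R2 R0" by (rule eqx_trans)
   qed
   define A3 where "A3 = aup (aup A2 4 w (length F) z) 1 w 0 (length F + 1)"
   have A2: "A2 c i j = A1 c i j" if "c ~= 4 | i ~= w" for c i j using P2 s that by auto
   have A2w: "A2 4 w j = F ! j" if "j < length F" for j using P2 s that by auto
   have roww3: "row A3 w = F @ [z]" by (rule row_eqI) (use A2w in \<open>auto simp: A3_def nth_append\<close>)
   have A3o: "A3 c i j = A1 c i j" if "i ~= w" for c i j using A2 that by (simp add: A3_def)
   have A3c: "A3 c i j = A1 c i j" if "c ~= 1" "c ~= 4" for c i j using A2 that by (simp add: A3_def)
   have rowo: "row A3 u = row A u" if "u ~= w" "u ~= z" for u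
    using A3o that by (simp add: row_def A1_def)
   have "?I (Suc j) (R2, A3)"
   proof (intro conjI)
    show "snd (R2, A3) 1 z 0 = length ns" using A3o w(2) I by (simp add: A1_def)
    show "\<forall>i<Suc j. snd (R2, A3) 4 z i = ns ! i" using A3o w(2) I by (auto simp: A1_def w_def less_Suc_eq)
    show "\<forall>u. u ~= z --> (if u \<in> ?S (Suc j) then row (snd (R2, A3)) u = filter (%v. v ~= x & v ~= y) (row A0 u) @ [z]
     else snd (R2, A3) 1 u 0 = A0 1 u 0 & (\<forall>i. snd (R2, A3) 4 u i = A0 4 u i))"
    proof (intro allI impI)
     fix u assume u: "u ~= z"
     show "if u \<in> ?S (Suc j) then row (snd (R2, A3)) u = filter (%v. v ~= x & v ~= y) (row A0 u) @ [z]
     else snd (R2, A3) 1 u 0 = A0 1 u 0 & (\<forall>i. snd (R2, A3) 4 u i = A0 4 u i)"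
     proof (cases "u = w")
      case True then show ?thesis using roww3 w(4) by (simp add: F_def)
     next
      case False then show ?thesis using rowo[OF False u] A3o[OF False] I u w(4) by (auto simp: A1_def)
     qed
    qed
    show "\<forall>a b. snd (R2, A3) 5 a b = (if a = z & b \<in> ?S (Suc j) | b = z & a \<in> ?S (Suc j) then 1 else A0 5 a b)"
     using A3c[of 5] I w(4) by (auto simp: A1_def)
    show "\<forall>c i j. c ~= 1 & c ~= 4 & c ~= 5 --> snd (R2, A3) c i j = A0 c i j"
     using A3c I by (simp add: A1_def)
    show "eqx {16, 17, 18, 31, 32} (fst (R2, A3)) R0" using r2(4) by simp
   qed
   then have QI: "Q (R2, A3)" unfolding Q_def .
   show "wpc xs C B (Sq (Sto 4 (Var 16) (Var 17) (Var 12)) (Sto 1 (Var 16) (Cst 0) (plus (Var 17) (Cst 1)))) (?I (Suc j)) s"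
    unfolding s Q_def[symmetric] using QI r2 lF d(2,6) by (simp add: A3_def)
  qed (auto simp: plus_def)
  show "hl xs K W C B c_red (t_red C d) (R(31 := j), A) (?I (Suc j))"
  proof -
   have "hl xs K W C B c_red (120 * Suc C + ((esz (Arr 1 (Var 16) (Cst 0)) * Suc C + d * (csz c_filter * Suc C + 6) + 4) + 80 * Suc C)) (R(31 := j), A) (?I (Suc j))"
    unfolding c_red_def by (rule hl_Sq_le[OF b1], rule hl_Sq_le[OF b2 b3]) assumption+
   then show ?thesis by (rule hl_mono) (auto simp: t_red_def)
  qed
 next
  fix s assume I: "?I (length ns) s"
  have rz: "row (snd s) z = ns" by (rule row_eqI) (use I in auto)
  have "row (snd s) w = row A0 w" if "w ~= z" "w \<notin> set ns" for w
   using I[THEN conjunct2, THEN conjunct2, THEN conjunct2, THEN conjunct1, rule_format, OF that(1)] that(2) by (simp add: row_def)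
  then show "eqx {16, 17, 18, 31, 32} (fst s) R0 \<and>
   row (snd s) z = ns & (\<forall>w. w ~= z --> row (snd s) w = (if w \<in> set ns then filter (%v. v ~= x & v ~= y) (row A0 w) @ [z] else row A0 w)) \<and>
   (\<forall>a b. snd s 5 a b = (if a = z & b \<in> set ns | b = z & a \<in> set ns then 1 else A0 5 a b)) \<and>
   (\<forall>c i j. c ~= 1 & c ~= 4 & c ~= 5 --> snd s c i j = A0 c i j)" using I rz by simp
 qed (use c d in auto)
qed

section \<open>Breadth-first search around the new part\<close>

text \<open>A visited part is marked by the name of the new part. Names increase from step to step,
  so the marks of earlier searches need not be erased.\<close>

definition c_ext :: com where
 "c_ext = Sq (Asg 18 (Arr 4 (Var 16) (Var 33))) (Cnd (neq (Arr 3 (Var 18) (Cst 0)) (Var 12))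
  (Sq (Sto 3 (Var 18) (Cst 0) (Var 12)) (Sq (Sto 6 (Cst 0) (Var 19) (Var 18)) (Asg 19 (plus (Var 19) (Cst 1))))) Nop)"

text \<open>The loop limit is the queue length at its start, so a round scans everything found so
  far. Each scanned part adds at most \<open>d\<close> new ones, hence a factor \<open>Suc d\<close>
  per round.\<close>

definition c_round :: com where
 "c_round = Sq (Asg 16 (Arr 6 (Cst 0) (Var 32))) (For 33 (Arr 1 (Var 16) (Cst 0)) c_ext)"

text \<open>The queue \<open>q\<close> holds each part once; the marks of its parts are \<open>z\<close>.\<close>

definition queue :: "nat => nat list => state => bool" where
 "queue z q s \<longleftrightarrow> distinct q & fst s 19 = length q & (\<forall>j<length q. snd s 6 0 j = q ! j) & (\<forall>v. snd s 3 v 0 = z \<longleftrightarrow> v \<in> set q)"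

definition bfs_frame :: "nat set => (nat => nat) => (nat => nat => nat => nat) => state => bool" where
 "bfs_frame NM R0 A0 s \<longleftrightarrow> eqx {16, 18, 19, 31, 32, 33} (fst s) R0 & (\<forall>c i j. c ~= 3 & c ~= 6 --> snd s c i j = A0 c i j) \<and>
  (\<forall>v. snd s 3 v 0 = A0 3 v 0 | snd s 3 v 0 = R0 12)"

lemma hl_ext:
 assumes K: "40 <= K" and z: "z = R0 12" and q0: "queue z q0 (R1, A1)" "set q0 \<subseteq> NM" and fr: "bfs_frame NM R0 A0 (R1, A1)"
  and w: "R1 16 = w" "set (row A0 w) \<subseteq> NM" "A0 1 w 0 <= d" and B: "length q0 + d <= B"
 shows "hl xs K W C B (For 33 (Arr 1 (Var 16) (Cst 0)) c_ext)
  (esz (Arr 1 (Var 16) (Cst 0)) * Suc C + d * (csz c_ext * Suc C + 6) + 4) (R1, A1)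
  (%s. bfs_frame NM R0 A0 s & (\<exists>q. queue z q s & set q \<subseteq> NM & take (length q0) q = q0 & length q <= length q0 + d & set (row A0 w) \<subseteq> set q))"
proof -
 have A1: "A1 1 w 0 = A0 1 w 0" "A1 4 w j = A0 4 w j" for j using fr by (auto simp: bfs_frame_def)
 let ?I = "%f s. bfs_frame NM R0 A0 s & fst s 16 = w & (\<exists>q. queue z q s & set q \<subseteq> NM & take (length q0) q = q0 & length q <= length q0 + f \<and>
   (\<forall>f'<f. A0 4 w f' \<in> set q))"
 have "hl xs K W C B (For 33 (Arr 1 (Var 16) (Cst 0)) c_ext)
  (esz (Arr 1 (Var 16) (Cst 0)) * Suc C + A0 1 w 0 * (csz c_ext * Suc C + 6) + 4) (R1, A1)
  (%s. bfs_frame NM R0 A0 s & (\<exists>q. queue z q s & set q \<subseteq> NM & take (length q0) q = q0 & length q <= length q0 + d & set (row A0 w) \<subseteq> set q))"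
 proof (rule hl_For[where m="A0 1 w 0" and I="?I"])
  show "?I 0 (R1, A1)" using q0 fr w(1) by auto
  fix f R A assume f: "f < A0 1 w 0" and I: "?I f (R, A)"
  then obtain q where q: "queue z q (R, A)" "set q \<subseteq> NM" "take (length q0) q = q0" "length q <= length q0 + f" "\<forall>f'<f. A0 4 w f' \<in> set q"
   by blast
  have fr': "bfs_frame NM R0 A0 (R, A)" using I by blast
  have rz: "R 12 = z" "R 16 = w" using fr' z I by (auto simp: bfs_frame_def eqx_def)
  have v: "A 4 w f = A0 4 w f" using fr' by (auto simp: bfs_frame_def)
  have vNM: "A0 4 w f \<in> NM" using w(2) f by (auto simp: row_def)
  show "hl xs K W C B c_ext (csz c_ext * Suc C) (R(33 := f), A) (?I (Suc f))"
  proof (rule hl_small, rule hl_wpc)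
   assume sm: "!!c i j. snd (R(33 := f), A) c i j <= B" "!!r. r < K ==> fst (R(33 := f), A) r <= B"
   have zB: "z <= B" using sm(2)[of 12] K rz by simp
   have vB: "A0 4 w f <= B" using sm(1)[of 4 w f] v by simp
   have lq: "Suc (length q) <= B" using q(4) f w(3) B by simp
   show "wpc xs C B c_ext (?I (Suc f)) (R(33 := f), A)"
   proof (cases "A0 4 w f \<in> set q")
    case True
    then have m: "A 3 (A0 4 w f) 0 = z" using q(1) by (simp add: queue_def)
    have "?I (Suc f) (R(33 := f, 18 := A0 4 w f), A)"
     using fr' rz q True by (auto simp: bfs_frame_def queue_def less_Suc_eq intro!: exI[of _ q])
    then show ?thesis using rz v vB m by (simp add: c_ext_def)
   next
    case False
    then have m: "A 3 (A0 4 w f) 0 ~= z" using q(1) by (simp add: queue_def)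
    have lq0: "length q0 <= length q" using q(3) by (metis length_take min.cobounded1)
    define q' where "q' = q @ [A0 4 w f]"
    have l: "R 19 = length q" using q(1) by (simp add: queue_def)
    let ?s = "(R(33 := f, 18 := A0 4 w f, 19 := Suc (length q)), aup (aup A 3 (A0 4 w f) 0 z) 6 0 (length q) (A0 4 w f))"
    have "queue z q' ?s" using q(1) False by (auto simp: queue_def q'_def nth_append less_Suc_eq)
    moreover have "set q' \<subseteq> NM" "take (length q0) q' = q0" "length q' <= length q0 + Suc f" "\<forall>f'<Suc f. A0 4 w f' \<in> set q'"
     using q vNM lq0 by (auto simp: q'_def less_Suc_eq)
    moreover have "bfs_frame NM R0 A0 ?s" using fr' z by (auto simp: bfs_frame_def)
    ultimately have "?I (Suc f) ?s" using rz by auto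
    then show ?thesis using rz v vB m l lq zB by (simp add: c_ext_def)
   qed
  qed
 next
  show "A0 1 w 0 <= B" using w(3) B by simp
  fix s assume I: "?I (A0 1 w 0) s"
  then obtain q where q: "queue z q s" "set q \<subseteq> NM" "take (length q0) q = q0" "length q <= length q0 + A0 1 w 0" "\<forall>f'<A0 1 w 0. A0 4 w f' \<in> set q" by blast
  have "set (row A0 w) \<subseteq> set q" using q(5) by (auto simp: row_def)
  then show "bfs_frame NM R0 A0 s & (\<exists>q. queue z q s & set q \<subseteq> NM & take (length q0) q = q0 & length q <= length q0 + d & set (row A0 w) \<subseteq> set q)"
   using q I w(3) by (intro conjI exI[of _ q]) auto
 qed (use w A1 in auto)
 then show ?thesis by (rule hl_mono) (use w(3) in auto)
qed

definition t_round :: "nat => nat => nat" where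
 "t_round C d = 40 * Suc C + (esz (Arr 1 (Var 16) (Cst 0)) * Suc C + d * (csz c_ext * Suc C + 6) + 4)"

text \<open>The set \<open>NM\<close> is closed under neighbour lists, so the degree bound applies
  to every part that enters the queue. The queue grows only at its end, so the entries scanned in
  this round stay in place.\<close>

lemma hl_round:
 assumes K: "40 <= K" and z: "z = R0 12" and q0: "queue z q0 (R1, A1)" "set q0 \<subseteq> NM" and fr: "bfs_frame NM R0 A0 (R1, A1)"
  and NM: "!!w. w \<in> NM ==> set (row A0 w) \<subseteq> NM & A0 1 w 0 <= d" and B: "length q0 * Suc d <= B" 
 shows "hl xs K W C B (For 32 (Var 19) c_round) (esz (Var 19) * Suc C + length q0 * (t_round C d + 6) + 4) (R1, A1)
  (%s. bfs_frame NM R0 A0 s & (\<exists>q. queue z q s & set q \<subseteq> NM & take (length q0) q = q0 & length q <= length q0 * Suc d & (\<forall>w\<in>set q0. set (row A0 w) \<subseteq> set q)))"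
proof -
 let ?I = "%h s. bfs_frame NM R0 A0 s & (\<exists>q. queue z q s & set q \<subseteq> NM & take (length q0) q = q0 & length q <= length q0 + h * d \<and>
   (\<forall>h'<h. set (row A0 (q0 ! h')) \<subseteq> set q))"
 show ?thesis
 proof (rule hl_For[where m="length q0" and I="?I"])
  show "?I 0 (R1, A1)" using q0 fr by auto
  fix h R A assume h: "h < length q0" and I: "?I h (R, A)"
  then obtain q where q: "queue z q (R, A)" "set q \<subseteq> NM" "take (length q0) q = q0" "length q <= length q0 + h * d"
   "\<forall>h'<h. set (row A0 (q0 ! h')) \<subseteq> set q" by blast
  have lq: "length q0 <= length q" using q(3) by (metis length_take min.cobounded1)
  have qh: "q ! h = q0 ! h" using q(3) h by (metis nth_take)
  define w where "w = q0 ! h"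
  have w: "w \<in> NM" using q0(2) h by (auto simp: w_def)
  have A6: "A 6 0 h = w" using q(1) qh h lq by (simp add: queue_def w_def)
  have fr': "bfs_frame NM R0 A0 (R, A)" using I by blast
  have hd: "h * d + d <= length q0 * d" using mult_le_mono1[of "Suc h" "length q0" d] h by simp
  have B': "length q + d <= B" using q(4) hd B by simp
  have s1: "hl xs K W C B (Asg 16 (Arr 6 (Cst 0) (Var 32))) (40 * Suc C) (R(32 := h), A) (%s. s = (R(32 := h, 16 := w), A))"
  proof (rule hl_small, rule hl_mono[OF hl_wpc[where Q="%s. s = (R(32 := h, 16 := w), A)"]])
   assume sm: "!!c i j. snd (R(32 := h), A) c i j <= B"
   show "wpc xs C B (Asg 16 (Arr 6 (Cst 0) (Var 32))) (%s. s = (R(32 := h, 16 := w), A)) (R(32 := h), A)"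
    using A6 sm[of 6 0 h] by simp
  qed auto
  have s2: "hl xs K W C B (For 33 (Arr 1 (Var 16) (Cst 0)) c_ext)
   (esz (Arr 1 (Var 16) (Cst 0)) * Suc C + d * (csz c_ext * Suc C + 6) + 4) (R(32 := h, 16 := w), A) (?I (Suc h))"
  proof (rule hl_mono[OF hl_ext[where ?R0.0=R0 and z=z and ?q0.0=q and NM=NM and ?A0.0=A0 and w=w and d=d, OF K z]])
   show "queue z q (R(32 := h, 16 := w), A)" using q(1) by (simp add: queue_def)
   show "bfs_frame NM R0 A0 (R(32 := h, 16 := w), A)" using fr' by (simp add: bfs_frame_def)
   fix s assume "bfs_frame NM R0 A0 s & (\<exists>q'. queue z q' s & set q' \<subseteq> NM & take (length q) q' = q & length q' <= length q + d & set (row A0 w) \<subseteq> set q')"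
   then obtain q' where q': "bfs_frame NM R0 A0 s" "queue z q' s" "set q' \<subseteq> NM" "take (length q) q' = q" "length q' <= length q + d" "set (row A0 w) \<subseteq> set q'"
    by blast
   have "take (length q0) q' = take (length q0) (take (length q) q')" using lq by (simp add: min_def)
   then have t: "take (length q0) q' = q0" using q'(4) q(3) by simp
   have "set q \<subseteq> set q'" using q'(4) set_take_subset by metis
   then have "\<forall>h'<Suc h. set (row A0 (q0 ! h')) \<subseteq> set q'" using q(5) q'(6) unfolding w_def by (metis less_Suc_eq subset_trans)
   moreover have "length q' <= length q0 + Suc h * d" using q'(5) q(4) by simp
   ultimately show "?I (Suc h) s" using q' t by blast
  qed (use q w NM[OF w] B' in auto)
  have "hl xs K W C B c_round (40 * Suc C + (esz (Arr 1 (Var 16) (Cst 0)) * Suc C + d * (csz c_ext * Suc C + 6) + 4)) (R(32 := h), A) (?I (Suc h))"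
   unfolding c_round_def by (rule hl_Sq_le[OF s1]) (use s2 in simp)
  then show "hl xs K W C B c_round (t_round C d) (R(32 := h), A) (?I (Suc h))" unfolding t_round_def .
 next
  have "length q0 <= length q0 * Suc d" by simp
  then show "length q0 <= B" using B by linarith
  fix s assume I: "?I (length q0) s"
  then obtain q where q: "queue z q s" "set q \<subseteq> NM" "take (length q0) q = q0" "length q <= length q0 + length q0 * d"
   "\<forall>h'<length q0. set (row A0 (q0 ! h')) \<subseteq> set q" by blast
  have "\<forall>w\<in>set q0. set (row A0 w) \<subseteq> set q"
  proof
   fix w assume "w \<in> set q0"
   then obtain h where "h < length q0" "w = q0 ! h" by (auto simp: in_set_conv_nth)
   then show "set (row A0 w) \<subseteq> set q" using q(5) by simp
  qed
  then show "bfs_frame NM R0 A0 s & (\<exists>q. queue z q s & set q \<subseteq> NM & take (length q0) q = q0 & length q <= length q0 * Suc d & (\<forall>w\<in>set q0. set (row A0 w) \<subseteq> set q))"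
   using q I by (intro conjI exI[of _ q]) auto
 qed (use q0 in \<open>auto simp: queue_def\<close>)
qed

definition t_bfs :: "nat => nat => nat => nat" where
 "t_bfs C d r = 3 * Suc C + r * ((3 * Suc C + (3 * Suc d ^ r) * (t_round C d + 6) + 4) + 6) + 4"

text \<open>The first three entries of the queue never change; they will be the positions 0, 1 and 2
  of \<open>region\<close>. The assumption \<open>E\<close> asks for complete lists only at parts
  reachable from \<open>v0\<close>, because the lists of the merged parts describe the old
  graph.\<close>

lemma hl_bfs:
 assumes K: "40 <= K" and z: "z = R0 12" and q0: "queue z q0 (R0, A0)" "set q0 \<subseteq> NM" "length q0 = 3" "v0 \<in> set q0"
  and NM: "!!w. w \<in> NM ==> set (row A0 w) \<subseteq> NM & A0 1 w 0 <= d" and B: "3 * Suc d ^ r <= B" "r <= B" and r: "R0 10 = r"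
  and E: "!!k w u. dle E k v0 w ==> E w u ==> u \<in> set (row A0 w)"
 shows "hl xs K W C B (For 31 (Var 10) (For 32 (Var 19) c_round)) (t_bfs C d r) (R0, A0)
  (%s. bfs_frame NM R0 A0 s & (\<exists>q. queue z q s & set q \<subseteq> NM & take 3 q = q0 & length q <= 3 * Suc d ^ r & {v. dle E r v0 v} \<subseteq> set q))"
proof -
 let ?I = "%k s. bfs_frame NM R0 A0 s & (\<exists>q. queue z q s & set q \<subseteq> NM & take 3 q = q0 & length q <= 3 * Suc d ^ k & {v. dle E k v0 v} \<subseteq> set q)"
 have "hl xs K W C B (For 31 (Var 10) (For 32 (Var 19) c_round)) (esz (Var 10) * Suc C + r * ((3 * Suc C + (3 * Suc d ^ r) * (t_round C d + 6) + 4) + 6) + 4) (R0, A0) (?I r)"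
 proof (rule hl_For[where m=r and I="?I"])
  show "?I 0 (R0, A0)" using q0 by (auto simp: bfs_frame_def intro!: exI[of _ q0])
  fix k R A assume k: "k < r" and I: "?I k (R, A)"
  then obtain q where q: "queue z q (R, A)" "set q \<subseteq> NM" "take 3 q = q0" "length q <= 3 * Suc d ^ k" "{v. dle E k v0 v} \<subseteq> set q" by blast
  have pk: "3 * Suc d ^ k * Suc d <= 3 * Suc d ^ r"
  proof -
   have "Suc d ^ Suc k <= Suc d ^ r" using k by (intro power_increasing) auto
   then show ?thesis by (simp add: algebra_simps)
  qed
  have lq: "length q * Suc d <= 3 * Suc d ^ Suc k" using mult_le_mono1[OF q(4), of "Suc d"] by (simp add: algebra_simps)
  have pk0: "3 * Suc d ^ k <= 3 * Suc d ^ k * Suc d" by simp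
  have lr: "length q <= 3 * Suc d ^ r" using q(4) pk pk0 by linarith
  show "hl xs K W C B (For 32 (Var 19) c_round) (3 * Suc C + (3 * Suc d ^ r) * (t_round C d + 6) + 4) (R(31 := k), A) (?I (Suc k))"
  proof (rule hl_mono[OF hl_round[where ?R0.0=R0 and z=z and ?q0.0=q and NM=NM and ?A0.0=A0 and d=d, OF K z]])
   show "queue z q (R(31 := k), A)" using q(1) by (simp add: queue_def)
   show "bfs_frame NM R0 A0 (R(31 := k), A)" using I by (simp add: bfs_frame_def)
   show "length q * Suc d <= B" using lq pk B(1) by (simp add: algebra_simps)
   show "esz (Var 19) * Suc C + length q * (t_round C d + 6) + 4 <= 3 * Suc C + 3 * Suc d ^ r * (t_round C d + 6) + 4"
    proof -
    have "esz (Var 19) * Suc C <= 3 * Suc C" by simp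
    then show ?thesis using mult_le_mono1[OF lr, of "t_round C d + 6"] by linarith
   qed
   fix s assume "bfs_frame NM R0 A0 s & (\<exists>q'. queue z q' s & set q' \<subseteq> NM & take (length q) q' = q & length q' <= length q * Suc d & (\<forall>w\<in>set q. set (row A0 w) \<subseteq> set q'))"
   then obtain q' where q': "bfs_frame NM R0 A0 s" "queue z q' s" "set q' \<subseteq> NM" "take (length q) q' = q" "length q' <= length q * Suc d" "\<forall>w\<in>set q. set (row A0 w) \<subseteq> set q'"
    by blast
   have "3 <= length q" using q(3) q0(3) by (metis length_take min.cobounded1)
   then have t: "take 3 q' = q0" using q'(4) q(3) by (metis min.absorb1 take_take)
   have ss: "set q \<subseteq> set q'" using q'(4) set_take_subset by metis
   have "v \<in> set q'" if "dle E (Suc k) v0 v" for v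
   proof -
    consider "dle E k v0 v" | w where "dle E k v0 w" "E w v" using \<open>dle E (Suc k) v0 v\<close> by auto
    then show ?thesis
    proof cases
     case 1 then show ?thesis using q(5) ss by blast
    next
     case 2 then show ?thesis using q(5) q'(6) E[OF 2] by blast
    qed
   qed
   then show "?I (Suc k) s" using q' t lq by (intro conjI exI[of _ q']) auto
  qed (use q NM in auto)
 qed (use r B in auto)
 then show ?thesis by (rule hl_mono) (auto simp: t_bfs_def)
qed

section \<open>Red edges of the new partition\<close>

context contraction
begin

lemma rE_irrefl: assumes "i < n" "rE i a b" shows "a ~= b"
proof -
 obtain A B where "A \<in> Ps ! i" "B \<in> Ps ! i" "a = nm A" "b = nm B" "red_adjacent \<sigma> S A B"
  using assms(2) unfolding rE_def by blast
 then show ?thesis using nm_eq[OF assms(1), of A B] by (auto simp: red_adjacent_def)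
qed

abbreviation live :: "nat => nat set" where "live i \<equiv> pn i ` {..<n}"

lemma live_lt: "i < n ==> a \<in> live i ==> a < n + i" using pn_lt by auto

lemma live_Suc: assumes "Suc i < n" shows "live (Suc i) = insert (n + i) (live i - {xn i, yn i})"
proof -
 have "live (Suc i) = im i ` live i" unfolding image_image by (intro image_cong refl) (simp add: pn_Suc[OF assms])
 then show ?thesis using xy_live[OF assms] by (auto simp: im_def)
qed

text \<open>A red edge to a merged part becomes one to the union. Hence a part without red edge to
  the union had none to the merged parts either, and its neighbourhood is unchanged.\<close>

lemma rE_new:
 assumes i: "Suc i < n" and a: "a \<in> live (Suc i)" "a ~= n + i"
 shows "{b. rE (Suc i) a b} = (if rE (Suc i) (n + i) a then insert (n + i) ({b. rE i a b} - {xn i, yn i}) else {b. rE i a b})"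
proof -
 have i': "i < n" using i by simp
 have al: "a \<in> live i" "a ~= xn i" "a ~= yn i" using a live_Suc[OF i] by auto
 have ima: "im i a = a" using al by (simp add: im_def)
 have 1: "rE i a b & b ~= xn i & b ~= yn i" if "rE (Suc i) a b" "b ~= n + i" for b
  using rE_pred[OF i that(1) a(2) that(2)] rE_live[OF i that(1)] live_Suc[OF i] that(2) xy_live[OF i] live_lt[OF i'] by auto
 have 2: "rE (Suc i) a b" if "rE i a b" "b ~= xn i" "b ~= yn i" for b
  using rE_Suc[OF i that(1)] that(2,3) ima rE_irrefl[OF i' that(1)] by (simp add: im_def)
 have 3: "rE (Suc i) (n + i) a" if "rE i a b" "b = xn i | b = yn i" for b
 proof (rule rE_sym)
  show "rE (Suc i) a (n + i)" using rE_Suc[OF i that(1)] that(2) ima a(2) by (auto simp: im_def)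
 qed
 have 4: "rE i a b ==> b ~= n + i" for b using rE_live[OF i'] live_lt[OF i'] by blast
 show ?thesis
 proof (cases "rE (Suc i) (n + i) a")
  case True
  then have "rE (Suc i) a (n + i)" by (rule rE_sym)
  then have "{b. rE (Suc i) a b} = insert (n + i) ({b. rE i a b} - {xn i, yn i})" using 1 2 by blast
  then show ?thesis using True by simp
 next
  case False
  then have "\<not> rE (Suc i) a (n + i)" using rE_sym by blast
  then have "{b. rE (Suc i) a b} = {b. rE i a b}" using 1 2 3 False by blast
  then show ?thesis using False by simp
 qed
qed

end

section \<open>Collecting a neighbourhood and recomputing its types\<close>

text \<open>Values are pushed onto a list code, so the register holds the reversed list;
  \<open>F_upd\<close> and \<open>F_ev\<close> reverse it again.\<close>

lemma hl_collect:
 assumes ct: "c ~= t" and cnt: "eok xs C (R0, A) e0" "val xs (R0, A) e0 = m" "m <= B" and t0: "R0 t = list_encode (rev ys0)"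
  and e: "!!R i. i < m ==> eqx {c, t} R R0 ==> R c = i ==> eok xs C (R, A) e & val xs (R, A) e = f i"
  and le: "!!i. i <= m ==> list_encode (rev (ys0 @ map f [0..<i])) <= B"
 shows "hl xs K W C B (For c e0 (Asg t (push e (Var t)))) (esz e0 * Suc C + m * (csz (Asg t (push e (Var t))) * Suc C + 6) + 4) (R0, A)
  (%s. snd s = A & eqx {c, t} (fst s) R0 & fst s t = list_encode (rev (ys0 @ map f [0..<m])))"
proof (rule hl_For[where m=m and I="%i s. snd s = A & eqx {c, t} (fst s) R0 & fst s t = list_encode (rev (ys0 @ map f [0..<i]))"])
 fix i R A' assume i: "i < m" and I: "snd (R, A') = A & eqx {c, t} (fst (R, A')) R0 & fst (R, A') t = list_encode (rev (ys0 @ map f [0..<i]))"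
 show "hl xs K W C B (Asg t (push e (Var t))) (csz (Asg t (push e (Var t))) * Suc C) (R(c := i), A')
  (%s. snd s = A & eqx {c, t} (fst s) R0 & fst s t = list_encode (rev (ys0 @ map f [0..<Suc i])))"
 proof (rule hl_wpc)
  have e': "eok xs C (R(c := i), A) e" "val xs (R(c := i), A) e = f i" using e[of i "R(c := i)"] i I by auto
  have v: "list_encode (rev (ys0 @ map f [0..<Suc i])) = Suc (prod_encode (f i, R t))" using I by simp
  have "Suc (prod_encode (f i, R t)) <= B" using le[of "Suc i"] i v by simp
  then show "wpc xs C B (Asg t (push e (Var t))) (%s. snd s = A & eqx {c, t} (fst s) R0 & fst s t = list_encode (rev (ys0 @ map f [0..<Suc i]))) (R(c := i), A')"
   unfolding v using I e' ct by simp
 qed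
qed (use cnt t0 in auto)

text \<open>In truncated subtraction \<open>1 - (1 - (b - a))\<close> is 1 if \<open>a < b\<close>
  and 0 otherwise.\<close>

definition infx :: "signature => ex" where
 "infx \<sigma> = (let a = Arr 6 (Cst 0) (Var 31); b = Arr 6 (Cst 0) (Var 32) in
  plus (plus (Bin Sub (Cst 1) (Bin Sub (Cst 1) (Bin Sub b a))) (times (Cst 2) (Arr 5 a b)))
   (times (Cst 4) (atomx \<sigma> (Arr 0 a (Cst 0)) (Arr 0 b (Cst 0)) (length \<sigma>))))"

definition c_ts :: com where
 "c_ts = For 31 (Var 19) (Asg 20 (push (Arr 2 (Arr 6 (Cst 0) (Var 31)) (Cst 0)) (Var 20)))"
definition b_inf :: "signature => com" where "b_inf \<sigma> = Asg 21 (push (infx \<sigma>) (Var 21))"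
definition c_inf :: "signature => com" where
 "c_inf \<sigma> = For 31 (Var 19) (For 32 (Var 19) (b_inf \<sigma>))"

definition F_upd :: "nat => nat \<times> nat \<times> nat list \<times> nat list \<times> nat => nat" where
 "F_upd M p = upd M (fst p) (fst (snd p), rev (fst (snd (snd p)))) (rev (fst (snd (snd (snd p))))) (snd (snd (snd (snd p))))"

lemma PR_F_upd: "PR (F_upd M)"
 unfolding F_upd_def by (intro PR_upd PR_rev PR_intros)

definition b_upd :: "nat => com" where
 "b_upd M = Sto 2 (Arr 6 (Cst 0) (Var 31)) (Cst 0) (Ap (nf (F_upd M)) (Pr (Var 6) (Pr (Var 19) (Pr (Var 21) (Pr (Var 20) (Var 31))))))"

definition c_gather :: "signature => nat => com" where
 "c_gather \<sigma> M = Sq (Sq (Asg 20 (Cst 0)) (Asg 21 (Cst 0))) (Sq c_ts (Sq (c_inf \<sigma>) (For 31 (Var 19) (b_upd M))))"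

definition t_gather :: "signature => nat => nat => nat => nat" where
 "t_gather \<sigma> M C Q = 10 * Suc C + ((3 * Suc C + Q * (csz (Asg 20 (push (Arr 2 (Arr 6 (Cst 0) (Var 31)) (Cst 0)) (Var 20))) * Suc C + 6) + 4) +
  ((3 * Suc C + Q * ((3 * Suc C + Q * (csz (b_inf \<sigma>) * Suc C + 6) + 4) + 6) + 4) +
   (3 * Suc C + Q * (csz (b_upd M) * Suc C + 6) + 4)))"

text \<open>\<open>mx\<close> bounds types and pair numbers, \<open>Q\<close> the size of the
  neighbourhood, \<open>X\<close> the codes of lists of at most \<open>Q * Q\<close> such numbers,
  and \<open>C\<close> the cost of the update on them. These four will be functions of
  \<open>l\<close> and \<open>d\<close>; only \<open>B\<close> grows with \<open>n\<close>.\<close>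

locale machine = input \<sigma> S n d Ps \<phi> for \<sigma> S n d Ps \<phi> +
 fixes l M K W C B mx X Q :: nat
 assumes M: "M > 0" and K: "40 <= K"
  and tb: "!!i a. i < n ==> part_type M l (atom_code \<sigma> S) {..<n} (pn i) (rE i) a <= mx"
  and mx: "3 + 4 * 2 ^ length \<sigma> <= mx" "mx <= B"
  and Q: "Q = 3 * Suc d ^ (2 ^ (l + 2))" "Q <= B"
  and lists: "!!ys. length ys <= Q * Q ==> (!!y. y \<in> set ys ==> y <= mx) ==> list_encode ys <= X" and X: "X <= B"
  and CU: "bnd (nf (F_upd M)) (prod_encode (l, prod_encode (Q, prod_encode (X, prod_encode (X, Q))))) <= C"
  and B: "4 * n + 4 <= B" "length xs <= B" "!!x. x \<in> set xs ==> x <= B" "2 ^ (l + 2) <= B"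
begin

abbreviation "alf \<equiv> atom_code \<sigma> S"
abbreviation "T_at i \<equiv> part_type M l alf {..<n} (pn i) (rE i)"

text \<open>All old types are collected in register 20 before the first new one is stored, so the
  last loop may overwrite array 2 in place.\<close>

lemma gather:
 assumes R: "R0 2 = n" "R0 3 = fl" "R0 4 = sl" "R0 6 = l" "R0 19 = length q" and q: "distinct q" "!!j. j < length q ==> A0 6 0 j = q ! j"
  and lq: "length q <= Q" and rp: "!!j. j < length q ==> A0 0 (q ! j) 0 < n" and bit: "!!j k. j < length q ==> k < length q ==> A0 5 (q ! j) (q ! k) <= 1"
  and T: "!!j. j < length q ==> A0 2 (q ! j) 0 <= mx"
  and g: "!!j k. g j k = of_bool (q ! j < q ! k) + 2 * A0 5 (q ! j) (q ! k) + 4 * alf (A0 0 (q ! j) 0) (A0 0 (q ! k) 0)"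
  and ifo: "ifo = concat (map (%j. map (g j) [0..<length q]) [0..<length q])" and ts: "ts = map (%j. A0 2 (q ! j) 0) [0..<length q]"
  and up: "!!j. j < length q ==> upd M l (length q, ifo) ts j <= B"
 shows "hl xs K W C B (c_gather \<sigma> M) (t_gather \<sigma> M C Q) (R0, A0)
  (%s. eqx {20, 21, 31, 32} (fst s) R0 & (\<forall>j<length q. snd s 2 (q ! j) 0 = upd M l (length q, ifo) ts j) \<and>
    (\<forall>c a b. c ~= 2 | a \<notin> set q --> snd s c a b = A0 c a b))"
proof -
 let ?N = "length q"
 have NB: "?N <= B" using lq Q(2) by simp
 have al: "alf u v < 2 ^ length \<sigma>" for u v unfolding atom_code_def by (rule binary_sum_lt)
 have gb: "g j k <= mx" if "j < ?N" "k < ?N" for j k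
 proof -
  have "of_bool (q ! j < q ! k) <= (1 :: nat)" by simp
  then have "g j k <= 1 + 2 * 1 + 4 * 2 ^ length \<sigma>" unfolding g using bit[OF that] al[of "A0 0 (q ! j) 0" "A0 0 (q ! k) 0"] by linarith
  then show ?thesis using mx(1) by linarith
 qed
 have NQ: "?N <= Q * Q" "?N * ?N <= Q * Q"
 proof -
  show "?N * ?N <= Q * Q" using lq by (intro mult_le_mono)
  then show "?N <= Q * Q" using le_square[of ?N] by linarith
 qed
 have 1: "hl xs K W C B (Sq (Asg 20 (Cst 0)) (Asg 21 (Cst 0))) (10 * Suc C) (R0, A0) (%s. s = (R0(20 := 0, 21 := 0), A0))"
  by (rule hl_mono[OF hl_wpc[where Q="%s. s = (R0(20 := 0, 21 := 0), A0)"]]) auto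
 have 2: "hl xs K W C B c_ts (3 * Suc C + Q * (csz (Asg 20 (push (Arr 2 (Arr 6 (Cst 0) (Var 31)) (Cst 0)) (Var 20))) * Suc C + 6) + 4) (R0(20 := 0, 21 := 0), A0)
  (%s. snd s = A0 & eqx {31, 20} (fst s) (R0(20 := 0, 21 := 0)) & fst s 20 = list_encode (rev ts))"
  unfolding c_ts_def
 proof (rule hl_mono[OF hl_collect[where ?ys0.0="[]" and m="?N" and f="%j. A0 2 (q ! j) 0"]])
  fix i :: nat assume i: "i <= ?N"
  have "list_encode (rev ([] @ map (%j. A0 2 (q ! j) 0) [0..<i])) <= X" by (rule lists) (use i NQ T in auto)
  then show "list_encode (rev ([] @ map (%j. A0 2 (q ! j) 0) [0..<i])) <= B" using X by linarith
 next
  let ?b = "csz (Asg 20 (push (Arr 2 (Arr 6 (Cst 0) (Var 31)) (Cst 0)) (Var 20))) * Suc C + 6"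
  have "esz (Var 19) * Suc C <= 3 * Suc C" by simp
  then show "esz (Var 19) * Suc C + ?N * ?b + 4 <= 3 * Suc C + Q * ?b + 4" using mult_le_mono1[OF lq, of ?b] by linarith
 qed (use R q(2) NB in \<open>auto simp: ts eqx_def\<close>)
 have 3: "hl xs K W C B (c_inf \<sigma>) (3 * Suc C + Q * ((3 * Suc C + Q * (csz (b_inf \<sigma>) * Suc C + 6) + 4) + 6) + 4) s
  (%s. snd s = A0 & eqx {20, 21, 31, 32} (fst s) R0 & fst s 20 = list_encode (rev ts) & fst s 21 = list_encode (rev ifo))"
  if s: "snd s = A0 & eqx {31, 20} (fst s) (R0(20 := 0, 21 := 0)) & fst s 20 = list_encode (rev ts)" for s
 proof -
  define G where "G = (%j. concat (map (%j. map (g j) [0..<?N]) [0..<j]))"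
  define \<tau> where "\<tau> = 3 * Suc C + Q * (csz (b_inf \<sigma>) * Suc C + 6) + 4"
  let ?I = "%j s. snd s = A0 & eqx {20, 21, 31, 32} (fst s) R0 & fst s 20 = list_encode (rev ts) & fst s 21 = list_encode (rev (G j))"
  have R1: "eqx {20, 21, 31, 32} (fst s) R0" "fst s 21 = 0" "fst s 19 = ?N" using s R(5) by (auto simp: eqx_def)
  have "hl xs K W C B (c_inf \<sigma>) (esz (Var 19) * Suc C + ?N * (\<tau> + 6) + 4) s (%s. snd s = A0 & eqx {20, 21, 31, 32} (fst s) R0 & fst s 20 = list_encode (rev ts) & fst s 21 = list_encode (rev ifo))"
   unfolding c_inf_def
  proof (rule hl_For[where m="?N" and I="?I"])
   fix j R A assume j: "j < ?N" and I: "?I j (R, A)"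
   have A: "A = A0" using I by simp
   note e = eqxD[OF I[THEN conjunct2, THEN conjunct1], simplified]
   show "hl xs K W C B (For 32 (Var 19) (b_inf \<sigma>)) \<tau> (R(31 := j), A) (?I (Suc j))"
    unfolding A b_inf_def
   proof (rule hl_mono[OF hl_collect[where ?ys0.0="G j" and m="?N" and f="g j"]])
    show "(R(31 := j)) 21 = list_encode (rev (G j))" using I by simp
    fix i :: nat assume i: "i <= ?N"
    have lG: "length (G j) = j * ?N" unfolding G_def by (induction j) auto
    have "length (G j) + i <= Suc j * ?N" using lG i by simp
    also have "\<dots> <= ?N * ?N" using j by (intro mult_le_mono1) simp
    finally have len: "length (G j) + i <= Q * Q" using NQ(2) by linarith
    have "list_encode (rev (G j @ map (g j) [0..<i])) <= X"
    proof (rule lists)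
     show "length (rev (G j @ map (g j) [0..<i])) <= Q * Q" using len by simp
     fix y assume "y \<in> set (rev (G j @ map (g j) [0..<i]))"
     then consider (a) j' k where "j' < j" "k < ?N" "y = g j' k" | (b) k where "k < i" "y = g j k" unfolding G_def by auto
     then show "y <= mx"
     proof cases
      case a then show ?thesis using gb[of j' k] j by simp
     next
      case b then show ?thesis using gb[of j k] i j by simp
     qed
    qed
    then show "list_encode (rev (G j @ map (g j) [0..<i])) <= B" using X by linarith
   next
    fix R2 i assume i: "i < ?N" and eq: "eqx {32, 21} R2 (R(31 := j))" and c: "R2 32 = i"
    have r: "R2 31 = j" "R2 2 = n" "R2 3 = fl" "R2 4 = sl" using eqxD[OF eq, simplified] e R by simp_all
    let ?u = "Arr 0 (Arr 6 (Cst 0) (Var 31)) (Cst 0)" and ?v = "Arr 0 (Arr 6 (Cst 0) (Var 32)) (Cst 0)"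
    have uv: "val xs (R2, A0) ?u = A0 0 (q ! j) 0" "val xs (R2, A0) ?v = A0 0 (q ! i) 0" "eok xs C (R2, A0) ?u" "eok xs C (R2, A0) ?v"
     using r c q(2) i j by simp_all
    have at: "val xs (R2, A0) (atomx \<sigma> ?u ?v (length \<sigma>)) = alf (A0 0 (q ! j) 0) (A0 0 (q ! i) 0)" "eok xs C (R2, A0) (atomx \<sigma> ?u ?v (length \<sigma>))"
     using atomx[OF r(2-4) uv(3,4), unfolded uv(1,2)] rp i j by auto
    have lt: "Suc 0 - (Suc 0 - (b - a)) = of_bool (a < b)" for a b :: nat by simp
    show "eok xs C (R2, A0) (infx \<sigma>) & val xs (R2, A0) (infx \<sigma>) = g j i"
     using at r c q(2) i j by (simp add: infx_def Let_def g lt)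
   next
    let ?b = "csz (b_inf \<sigma>) * Suc C + 6"
    have "esz (Var 19) * Suc C <= 3 * Suc C" by simp
    then show "esz (Var 19) * Suc C + ?N * (csz (Asg 21 (push (infx \<sigma>) (Var 21))) * Suc C + 6) + 4 <= \<tau>"
     using mult_le_mono1[OF lq, of ?b] unfolding \<tau>_def b_inf_def[symmetric] by linarith
   next
    fix s assume h: "snd s = A0 & eqx {32, 21} (fst s) (R(31 := j)) & fst s 21 = list_encode (rev (G j @ map (g j) [0..<?N]))"
    have "eqx {20, 21, 31, 32} (fst s) (R(31 := j))" using h by (auto intro: eqx_mono)
    moreover have "eqx {20, 21, 31, 32} (R(31 := j)) R0" using I by simp
    ultimately have "eqx {20, 21, 31, 32} (fst s) R0" by (rule eqx_trans)
    moreover have "fst s 20 = R 20" using eqxD[OF h[THEN conjunct2, THEN conjunct1], of 20] by simp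
    ultimately show "?I (Suc j) s" using h I by (simp add: G_def)
   qed (use e R(5) NB in auto)
  qed (use s R1 NB in \<open>auto simp: G_def ifo\<close>)
  moreover have "esz (Var 19) * Suc C <= 3 * Suc C" by simp
  ultimately show ?thesis using mult_le_mono1[OF lq, of "\<tau> + 6"] unfolding \<tau>_def by (elim hl_mono) (linarith, assumption)
 qed
 have 4: "hl xs K W C B (For 31 (Var 19) (b_upd M)) (3 * Suc C + Q * (csz (b_upd M) * Suc C + 6) + 4) s
  (%s. eqx {20, 21, 31, 32} (fst s) R0 & (\<forall>j<length q. snd s 2 (q ! j) 0 = upd M l (length q, ifo) ts j) \<and>
    (\<forall>c a b. c ~= 2 | a \<notin> set q --> snd s c a b = A0 c a b))"
  if s: "snd s = A0 & eqx {20, 21, 31, 32} (fst s) R0 & fst s 20 = list_encode (rev ts) & fst s 21 = list_encode (rev ifo)" for s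
 proof -
  let ?I = "%j s. eqx {20, 21, 31, 32} (fst s) R0 & fst s 20 = list_encode (rev ts) & fst s 21 = list_encode (rev ifo) \<and>
   (\<forall>h<j. snd s 2 (q ! h) 0 = upd M l (length q, ifo) ts h) & (\<forall>c a b. c ~= 2 | a \<notin> set q --> snd s c a b = A0 c a b)"
  have lts: "list_encode (rev ts) <= X" by (rule lists) (use NQ T in \<open>auto simp: ts\<close>)
  have linf: "list_encode (rev ifo) <= X"
  proof (rule lists)
   have "length (concat (map (%j. map (g j) [0..<?N]) [0..<k])) = k * ?N" for k by (induction k) auto
   then show "length (rev ifo) <= Q * Q" using NQ(2) by (simp add: ifo)
   fix y assume "y \<in> set (rev ifo)"
   then show "y <= mx" using gb by (auto simp: ifo)
  qed
  have "hl xs K W C B (For 31 (Var 19) (b_upd M)) (esz (Var 19) * Suc C + ?N * (csz (b_upd M) * Suc C + 6) + 4) s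
  (%s. eqx {20, 21, 31, 32} (fst s) R0 & (\<forall>j<length q. snd s 2 (q ! j) 0 = upd M l (length q, ifo) ts j) \<and>
    (\<forall>c a b. c ~= 2 | a \<notin> set q --> snd s c a b = A0 c a b))"
  proof (rule hl_For[where m="?N" and I="?I"])
   show "val xs s (Var 19) = ?N" using s R(5) by (auto simp: eqx_def)
   fix j R A assume j: "j < ?N" and I: "?I j (R, A)"
   note e = eqxD[OF I[THEN conjunct1], simplified]
   have A6: "A 6 0 j = q ! j" using I q(2) j by auto
   let ?v = "prod_encode (l, prod_encode (?N, prod_encode (list_encode (rev ifo), prod_encode (list_encode (rev ts), j))))"
   have "nf (F_upd M) ?v = upd M l (?N, ifo) ts j"
    using nf(2)[OF PR_F_upd[of M], of "(l, ?N, rev ifo, rev ts, j)"] by (simp add: F_upd_def cd_nat_list cd_nat_def)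
   moreover have "bnd (nf (F_upd M)) ?v <= C"
   proof -
    have "?v <= prod_encode (l, prod_encode (Q, prod_encode (X, prod_encode (X, Q))))"
     by (intro prod_encode_mono order_refl) (use lq lts linf j in auto)
    then show ?thesis using bnd_mono[OF nf(1)[OF PR_F_upd]] CU le_trans by blast
   qed
   moreover have "A(2 := (A 2)(q ! j := (A 2 (q ! j))(0 := v))) = aup A 2 (q ! j) 0 v" for v by (simp add: aup_def)
   moreover have "q ! h = q ! j \<longleftrightarrow> h = j" if "h < ?N" for h using q(1) j that by (simp add: nth_eq_iff_index_eq)
   moreover have "q ! j \<in> set q" using j by simp
   ultimately show "hl xs K W C B (b_upd M) (csz (b_upd M) * Suc C) (R(31 := j), A) (?I (Suc j))"
    using I e R A6 up[OF j] nf(1)[OF PR_F_upd] j by (intro hl_wpc) (auto simp: b_upd_def less_Suc_eq)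
  qed (use s NB in auto)
  moreover have "esz (Var 19) * Suc C <= 3 * Suc C" by simp
  ultimately show ?thesis using mult_le_mono1[OF lq, of "csz (b_upd M) * Suc C + 6"] by (elim hl_mono) (linarith, assumption)
 qed
 show ?thesis unfolding c_gather_def t_gather_def
 proof (rule hl_Sq_le[OF 1], rule hl_Sq_le[OF _ hl_Sq_le[OF 3 4]])
  fix s' assume "s' = (R0(20 := 0, 21 := 0), A0)"
  then show "hl xs K W C B c_ts (3 * Suc C + Q * (csz (Asg 20 (push (Arr 2 (Arr 6 (Cst 0) (Var 31)) (Cst 0)) (Var 20))) * Suc C + 6) + 4) s'
  (%s. snd s = A0 & eqx {31, 20} (fst s) (R0(20 := 0, 21 := 0)) & fst s 20 = list_encode (rev ts))" using 2 by simp
 qed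
qed

end

lemma info_dec: assumes "b <= (1::nat)"
 shows "(of_bool p + 2 * b + 4 * c) mod 2 = (of_bool p :: nat)" "(of_bool p + 2 * b + 4 * c) div 2 mod 2 = b" "(of_bool p + 2 * b + 4 * c) div 4 = c"
proof -
 have "b = 0 | b = 1" using assms by linarith
 then show "(of_bool p + 2 * b + 4 * c) mod 2 = (of_bool p :: nat)" "(of_bool p + 2 * b + 4 * c) div 2 mod 2 = b" "(of_bool p + 2 * b + 4 * c) div 4 = c"
  by (cases p; elim disjE; simp only: of_bool_eq; presburger)+
qed

context contraction
begin

lemma dle_live: "i < n ==> dle (rE i) k a c ==> a \<in> live i ==> c \<in> live i"
 by (induction k arbitrary: c) (use rE_live in auto)

lemma dle_rev: "dle (rE i) k a b ==> dle (rE i) k b a"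
proof (induction k arbitrary: b)
 case (Suc k)
 show ?case
 proof (cases "dle (rE i) k a b")
  case True then show ?thesis using Suc.IH by simp
 next
  case False
  then obtain c where c: "dle (rE i) k a c" "rE i c b" using Suc.prems by auto
  have "dle (rE i) 1 b c" using rE_sym[OF c(2)] by auto
  from dle_trans[OF this Suc.IH[OF c(1)]] show ?thesis by simp
 qed
qed simp

end

section \<open>One step of the contraction sequence\<close>

context input
begin

abbreviation nbs :: "nat => nat set" where "nbs i \<equiv> {b. rE (Suc i) (n + i) b}"
definition pos :: "nat => nat" where "pos i = 3 + fl + (\<Sum>j<i. 3 + card (nbs j))"

lemma seq_read:
 assumes "Suc i < n"
 shows "xs ! pos i = xn i" "xs ! Suc (pos i) = yn i" "xs ! (pos i + 2) = card (nbs i)"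
  "j < card (nbs i) ==> xs ! (pos i + 3 + j) = sorted_list_of_set (nbs i) ! j & pos i + 3 + j < length xs" "pos i + 2 < length xs"
proof -
 let ?f = "%i. [xn i, yn i, card (nbs i)] @ sorted_list_of_set (nbs i)"
 have lf: "length (?f j) = 3 + card (nbs j)" for j by simp
 have rd: "xs ! (pos i + t) = ?f i ! t & pos i + t < length xs" if t: "t < 3 + card (nbs i)" for t
 proof -
  have i: "i < n - 1" using assms by simp
  have "sequence_code \<sigma> n S Ps ! ((\<Sum>j<i. length (?f j)) + t) = ?f i ! t & (\<Sum>j<i. length (?f j)) + t < sl"
   unfolding sequence_code_eq by (rule concat_map_nth[OF i]) (use t in simp)
  then have 1: "sequence_code \<sigma> n S Ps ! ((\<Sum>j<i. 3 + card (nbs j)) + t) = ?f i ! t & (\<Sum>j<i. 3 + card (nbs j)) + t < sl" unfolding lf .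
  then have "xs ! (3 + fl + ((\<Sum>j<i. 3 + card (nbs j)) + t)) = ?f i ! t" using xs_sequence by metis
  moreover have "pos i + t < length xs" using 1 unfolding pos_def xs_hd by linarith
  ultimately show ?thesis unfolding pos_def by (simp only: add.assoc)
 qed
 show "xs ! pos i = xn i" "xs ! Suc (pos i) = yn i" "xs ! (pos i + 2) = card (nbs i)" "pos i + 2 < length xs"
  using rd[of 0] rd[of 1] rd[of 2] by simp_all
 show "xs ! (pos i + 3 + j) = sorted_list_of_set (nbs i) ! j & pos i + 3 + j < length xs" if "j < card (nbs i)"
  using rd[of "3 + j"] that by (simp add: numeral_3_eq_3)
qed

end

text \<open>Register 11 is the reading position in the contraction sequence, 12 the new part, 13 and
  14 the merged parts and 15 the number of red neighbours of the new part. The new part inherits the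
  representative of the first merged one.\<close>

definition c_s1 :: com where
 "c_s1 = Sq (Asg 12 (plus (Var 2) (Var 30))) (Sq (Asg 13 (Inp (Var 11))) (Sq (Asg 14 (Inp (plus (Var 11) (Cst 1)))) (Sq (Asg 15 (Inp (plus (Var 11) (Cst 2))))
  (Sq (Sto 0 (Var 12) (Cst 0) (Arr 0 (Var 13) (Cst 0))) (Sto 1 (Var 12) (Cst 0) (Var 15))))))"
definition c_s3 :: com where
 "c_s3 = Sq (Asg 11 (plus (plus (Var 11) (Cst 3)) (Var 15))) (Sq (Asg 19 (Cst 3)) (Sq (Sto 6 (Cst 0) (Cst 0) (Var 13)) (Sq (Sto 6 (Cst 0) (Cst 1) (Var 14)) (Sq (Sto 6 (Cst 0) (Cst 2) (Var 12))
  (Sq (Sto 3 (Var 13) (Cst 0) (Var 12)) (Sq (Sto 3 (Var 14) (Cst 0) (Var 12)) (Sto 3 (Var 12) (Cst 0) (Var 12))))))))"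
definition c_step :: "signature => nat => com" where
 "c_step \<sigma> M = Sq c_s1 (Sq (For 31 (Var 15) c_red) (Sq c_s3 (Sq (For 31 (Var 10) (For 32 (Var 19) c_round)) (c_gather \<sigma> M))))"
definition t_step :: "signature => nat => nat => nat => nat => nat" where
 "t_step \<sigma> M C d r = csz c_s1 * Suc C + ((3 * Suc C + d * (t_red C d + 6) + 4) + (csz c_s3 * Suc C + (t_bfs C d r + t_gather \<sigma> M C (3 * Suc d ^ r))))"

context machine
begin

text \<open>The last three conditions prepare the names that are not in use yet: their matrix
  entries and types are 0, and no mark equals the next name \<open>n + i\<close>.\<close>

definition inv :: "(nat => nat) => nat => state => bool" where
 "inv Rb i s \<longleftrightarrow> eqx ({11..21} \<union> {30..33}) (fst s) Rb & fst s 11 = pos i & fst s 12 = (if i = 0 then 0 else n + i - 1) \<and>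
  (\<forall>a\<in>live i. snd s 0 a 0 < n & pn i (snd s 0 a 0) = a & distinct (row (snd s) a) & set (row (snd s) a) = {b. rE i a b} & snd s 2 a 0 = T_at i a) \<and>
  (\<forall>a\<in>live i. \<forall>b\<in>live i. snd s 5 a b = of_bool (rE i a b)) & (\<forall>a b. n + i <= a | n + i <= b --> snd s 5 a b = 0) \<and>
  (\<forall>a\<ge>n + i. snd s 2 a 0 = 0) & (\<forall>v. snd s 3 v 0 < n + i)"

text \<open>The contents of the arrays are cast into a \<open>region\<close>, with atom codes
  justified by \<open>homogeneous\<close>. A live part outside the queue is farther than
  \<open>2 ^ (l + 2)\<close>, in particular farther than \<open>2 ^ l\<close>, from the new part and
  is covered by \<open>part_type_far\<close>.\<close>

lemma types_after_step:
 assumes i: "Suc i < n" and q: "distinct q" "take 3 q = [xn i, yn i, n + i]" "set q \<subseteq> insert (n + i) (live i)" "{v. dle (rE (Suc i)) (2 ^ (l + 2)) (n + i) v} \<subseteq> set q"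
  and rp: "!!a. a \<in> live i ==> rp a < n & pn i (rp a) = a" "rp (n + i) < n"
  and ra: "!!a b. a \<in> live i ==> b \<in> live i ==> ra a b = of_bool (rE i a b)"
   "!!a b. a \<in> live (Suc i) ==> b \<in> live (Suc i) ==> ra a b = of_bool (rE (Suc i) a b)" "!!a b. a \<in> set q ==> b \<in> set q ==> ra a b <= 1"
  and T: "!!a. a \<in> live i ==> T a = T_at i a"
  and g: "!!j k. g j k = of_bool (q ! j < q ! k) + 2 * ra (q ! j) (q ! k) + 4 * alf (rp (q ! j)) (rp (q ! k))"
  and ifo: "ifo = concat (map (%j. map (g j) [0..<length q]) [0..<length q])" and ts: "ts = map (%j. T (q ! j)) [0..<length q]"
 shows "j < length q ==> q ! j \<in> live (Suc i) ==> upd M l (length q, ifo) ts j = T_at (Suc i) (q ! j)"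
  and "j < length q ==> upd M l (length q, ifo) ts j <= mx"
  and "a \<in> live (Suc i) ==> a \<notin> set q ==> T a = T_at (Suc i) a"
proof -
 have i': "i < n" using i by simp
 let ?N = "length q"
 have "length (take 3 q) = 3" using q(2) by simp
 then have N: "3 <= ?N" by simp
 have qne: "q ~= []" using N by auto
 have q012: "q ! 0 = xn i" "q ! 1 = yn i" "q ! 2 = n + i"
  using nth_take[of 0 3 q] nth_take[of 1 3 q] nth_take[of 2 3 q] q(2) by simp_all
 have neq: "q ! j ~= q ! k" if "j < ?N" "k < ?N" "j ~= k" for j k using q(1) that by (simp add: nth_eq_iff_index_eq)
 have zl: "n + i \<notin> live i" using live_lt[OF i'] by blast
 have ql: "q ! j \<in> live i" if "j < ?N" "j ~= 2" for j
 proof -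
  have "q ! j \<in> insert (n + i) (live i)" using q(3) nth_mem[OF that(1)] by blast
  moreover have "q ! j ~= n + i" using neq[of j 2] that N q012(3) by simp
  ultimately show ?thesis by blast
 qed
 have qn: "q ! j \<in> live (Suc i)" if "j < ?N" "2 <= j" for j
  using ql[of j] neq[of j 0] neq[of j 1] that N qne q012 live_Suc[OF i] by (cases "j = 2") auto
 have nq: "2 <= j" if "j < ?N" "q ! j \<in> live (Suc i)" for j
 proof (rule ccontr)
  assume "\<not> 2 <= j"
  then have "j = 0 | j = 1" by linarith
  then have "q ! j = xn i | q ! j = yn i" using q012 by auto
  moreover have "xn i < n + i" "yn i < n + i" using live_lt[OF i'] xy_live[OF i] by blast+
  then have "xn i \<notin> live (Suc i)" "yn i \<notin> live (Suc i)" unfolding live_Suc[OF i] by simp_all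
  ultimately show False using that(2) by metis
 qed
 have gi: "ginfo (?N, ifo) j k = g j k" if "j < ?N" "k < ?N" for j k
  using concat_nth_square[OF that, of g] by (simp add: ginfo_def ifo nthd_def)
 have r1: "ra (q ! j) (q ! k) <= 1" if "j < ?N" "k < ?N" for j k using ra(3) that by simp
 have go: "j < ?N & j ~= 2" if "j \<in> set (gold (?N, ifo))" for j using that N by (auto simp: gold_def)
 have gn: "j < ?N & 2 <= j" if "j \<in> set (gnew (?N, ifo))" for j using that by (auto simp: gnew_def)
 have imd: "im i w = (if w = q ! 0 | w = q ! 1 then q ! 2 else w)" for w using q012 by (simp add: im_def)
 have regn: "region (pn i) (rE i) (pn (Suc i)) (rE (Suc i)) (im i) {..<n} M alf q ifo"
 proof unfold_locales
  fix j assume "j \<in> set (gold (?N, ifo))"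
  then have j: "j < ?N" "j ~= 2" using go by auto
  show "im i (q ! j) = q ! gim j" using j neq[of j 0] neq[of j 1] N qne
   by (cases "j = 0 | j = 1") (auto simp: imd gim_def)
 next
  fix j k assume "j \<in> set (gold (?N, ifo))" "k \<in> set (gold (?N, ifo))"
  then have jk: "j < ?N" "k < ?N" "j ~= 2" "k ~= 2" using go by auto
  show gr: "gred (?N, ifo) j k \<longleftrightarrow> rE i (q ! j) (q ! k)"
   unfolding gred_def gi[OF jk(1,2)] g info_dec(2)[OF r1[OF jk(1,2)]] using ra(1)[OF ql[OF jk(1,3)] ql[OF jk(2,4)]] by simp
  fix u v assume h: "j ~= k" "\<not> rE i (q ! j) (q ! k)" "u \<in> {..<n}" "v \<in> {..<n}" "pn i u = q ! j" "pn i v = q ! k"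
  show "gai (?N, ifo) j k = alf u v"
   unfolding gai_def gi[OF jk(1,2)] g info_dec(3)[OF r1[OF jk(1,2)]]
   by (rule homogeneous[OF i']) (use h rp(1)[OF ql[OF jk(1,3)]] rp(1)[OF ql[OF jk(2,4)]] neq[OF jk(1,2)] in auto)
 next
  fix j k assume "j \<in> set (gnew (?N, ifo))" "k \<in> set (gnew (?N, ifo))"
  then have jk: "j < ?N" "k < ?N" "2 <= j" "2 <= k" using gn by auto
  show "gred (?N, ifo) j k \<longleftrightarrow> rE (Suc i) (q ! j) (q ! k)"
   unfolding gred_def gi[OF jk(1,2)] g info_dec(2)[OF r1[OF jk(1,2)]] using ra(2)[OF qn[OF jk(1,3)] qn[OF jk(2,4)]] by simp
 next
  fix j k assume jk: "j < ?N" "k < ?N"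
  show "glt (?N, ifo) j k \<longleftrightarrow> q ! j < q ! k" unfolding glt_def gi[OF jk] g info_dec(1)[OF r1[OF jk]] by simp
 next
  show "rE i y x" if "rE i x y" for x y using that by (rule rE_sym)
  show "rE (Suc i) y x" if "rE (Suc i) x y" for x y using that by (rule rE_sym)
 qed (use q(1) N M pn_Suc[OF i] rE_Suc[OF i] in auto)
 have upc: "upd M l (?N, ifo) ts j = T_at (Suc i) (q ! j)" if j: "j < ?N" "2 <= j" for j
 proof (rule region.upd_correct[OF regn])
  fix c assume c: "dle (rE (Suc i)) (2 ^ (l + 2)) (q ! 2) c"
  have "c \<in> set q" using q(4) c q012 by auto
  then obtain k where k: "k < ?N" "c = q ! k" by (auto simp: in_set_conv_nth)
  have "c \<in> live (Suc i)" using dle_live[OF i c] q012 live_Suc[OF i] by simp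
  then have "2 <= k" using nq k by simp
  then show "c \<in> (!) q ` set (gnew (?N, ifo))" using k by (auto simp: gnew_def)
 next
  show "q ! k \<in> live i" if "k \<in> set (gold (?N, ifo))" for k using go[OF that] ql by blast
  show "nthd 0 ts k = T_at i (q ! k)" if "k \<in> set (gold (?N, ifo))" for k
   using go[OF that] ql[of k] T by (simp add: ts nthd_def)
  show "y ~= q ! 2" if "rE i x y" for x y using rE_live[OF i' that] zl q012(3) by metis
  show "q ! 2 \<notin> live i" using zl q012 by simp
  show "rE i x y" if "rE (Suc i) x y" "x ~= q ! 2" "y ~= q ! 2" for x y using rE_pred[OF i] that q012 by simp
  show "j \<in> set (gnew (?N, ifo))" using j by (simp add: gnew_def)
 qed (rule imd)
 show "upd M l (?N, ifo) ts j = T_at (Suc i) (q ! j)" if "j < ?N" "q ! j \<in> live (Suc i)" for j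
  using upc[OF that(1) nq[OF that]] .
 show "upd M l (?N, ifo) ts j <= mx" if j: "j < ?N" for j
 proof (cases "2 <= j")
  case True then show ?thesis using upc[OF j] tb[OF i] by simp
 next
  case False
  then have "upd M l (?N, ifo) ts j = T (q ! j)" using j by (simp add: upd_def gnew_def ts nthd_def)
  then show ?thesis using T[OF ql[OF j]] False tb[OF i'] by simp
 qed
 show "T a = T_at (Suc i) a" if a: "a \<in> live (Suc i)" "a \<notin> set q"
 proof -
  have z: "n + i \<in> set q" using q012(3) N nth_mem[of 2 q] by simp
  have al: "a \<in> live i" "im i a = a" using a z live_Suc[OF i] by (auto simp: im_def)
  have "\<not> dle (rE (Suc i)) (2 ^ l) a (n + i)"
  proof
   assume "dle (rE (Suc i)) (2 ^ l) a (n + i)"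
   then have "dle (rE (Suc i)) (2 ^ (l + 2)) (n + i) a" using dle_mono[OF dle_rev, of "Suc i" "2 ^ l"] by (auto intro: power_increasing)
   then show False using q(4) a(2) by auto
  qed
  then have "T_at i a = T_at (Suc i) a"
   by (intro merge_graph.part_type_far[where im="im i" and z="n + i", OF region.axioms(1)[OF regn]]) (use al rE_pred[OF i] in \<open>auto simp: im_def\<close>)
  then show ?thesis using T[OF al(1)] by simp
 qed
qed

end

section \<open>Parsing the formula and tabulating its matrix\<close>

lemma qprefix_cases: "q \<in> set (qprefix \<phi>) ==> q = (6, 0, 0) | q = (7, 0, 0) | (\<exists>i p. q = (8, i, p))"
 by (induction \<phi>) auto

lemma qf_tokens:
 "quantifier_rank \<psi> = 0 ==> formula \<sigma> Mods m \<psi> ==> t \<in> set (toks \<psi>) ==>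
  t = [0] | t = [3] | t = [4] | t = [5] | (\<exists>x y. t = [2, x, y] & x < m & y < m) \<or>
  (\<exists>k ys. t = 1 # k # ys & k < length \<sigma> & length ys = \<sigma> ! k & (\<forall>x\<in>set ys. x < m))"
 by (induction \<psi>) auto

lemma matrix_formula: "prenex \<phi> ==> formula \<sigma> Mods m \<phi> ==> quantifier_rank (matrix \<phi>) = 0 & formula \<sigma> Mods (m + quantifier_rank \<phi>) (matrix \<phi>)"
proof (induction \<phi> arbitrary: m)
 case (Exists \<phi>) then show ?case using Exists.IH[of "Suc m"] by simp
next
 case (Forall \<phi>) then show ?case using Forall.IH[of "Suc m"] by simp
next
 case (ExistsMod i p \<phi>) then show ?case using ExistsMod.IH[of "Suc m"] by simp
qed (auto simp: quantifier_free_def)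

lemma nth_concat_take:
 assumes "j < length ts" "t < length (ts ! j)"
 shows "concat ts ! (length (concat (take j ts)) + t) = ts ! j ! t" "length (concat (take j ts)) + t < length (concat ts)"
proof -
 have "ts = take j ts @ ts ! j # drop (Suc j) ts" using assms(1) by (rule id_take_nth_drop)
 then have e: "concat ts = concat (take j ts) @ ts ! j @ concat (drop (Suc j) ts)" by (metis concat.simps(2) concat_append)
 then have "concat ts ! (length (concat (take j ts)) + t) = (ts ! j @ concat (drop (Suc j) ts)) ! t" by (metis nth_append_length_plus)
 then show "concat ts ! (length (concat (take j ts)) + t) = ts ! j ! t" using assms(2) by (simp add: nth_append)
 have "length (concat ts) = length (concat (take j ts)) + length (ts ! j) + length (concat (drop (Suc j) ts))" using arg_cong[OF e, of length] by simp
 then show "length (concat (take j ts)) + t < length (concat ts)" using assms(2) by linarith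
qed

lemma length_tokens: "(!!t. t \<in> set ts ==> t ~= []) ==> length ts <= length (concat ts)"
proof (induction ts)
 case (Cons t ts) then show ?case by (cases t) auto
qed simp

definition f_ar :: "signature => nat => nat" where "f_ar \<sigma> = nf (%k :: nat. nthd 0 \<sigma> k)"

lemma PR_arity: "PR (%k :: nat. nthd 0 \<sigma> k)" by (intro PR_intros)

lemma f_ar: "pr (f_ar \<sigma>)" "k < length \<sigma> ==> f_ar \<sigma> k = \<sigma> ! k"
 using nf[OF PR_arity[of \<sigma>]] by (auto simp: f_ar_def cd_nat_def nthd_def)

text \<open>In a prenex formula the tokens above 5 are exactly the prefix; they are counted in
  register 6 and pushed onto register 7. Of a matrix token only the starting position is stored. The
  surrounding loop runs once per symbol of the code, and the outer test stops the parsing when the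
  tokens are exhausted.\<close>

definition b_parse :: "signature => com" where
 "b_parse \<sigma> = Cnd (less (Var 5) (plus (Cst 3) (Var 3))) (Sq (Asg 9 (Inp (Var 5))) (Cnd (less (Cst 5) (Var 9))
  (Sq (Asg 6 (plus (Var 6) (Cst 1))) (Cnd (less (Cst 7) (Var 9))
    (Sq (Asg 7 (push (Pr (Var 9) (Pr (Inp (plus (Var 5) (Cst 1))) (Inp (plus (Var 5) (Cst 2))))) (Var 7))) (Asg 5 (plus (Var 5) (Cst 3))))
    (Sq (Asg 7 (push (Pr (Var 9) (Pr (Cst 0) (Cst 0))) (Var 7))) (Asg 5 (plus (Var 5) (Cst 1))))))
  (Sq (Sto 7 (Cst 0) (Var 8) (Var 5)) (Sq (Asg 8 (plus (Var 8) (Cst 1)))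
    (Cnd (neq (Var 9) (Cst 1)) (Cnd (neq (Var 9) (Cst 2)) (Asg 5 (plus (Var 5) (Cst 1))) (Asg 5 (plus (Var 5) (Cst 3))))
     (Asg 5 (plus (Var 5) (plus (Cst 2) (Ap (f_ar \<sigma>) (Inp (plus (Var 5) (Cst 1))))))))))) ) Nop"

definition F_val :: "signature => nat \<times> (nat list \<times> nat) \<times> nat \<times> nat \<times> nat \<times> nat => nat" where
 "F_val \<sigma> p = atom_val \<sigma> (fst p) (fst (snd p)) (snd (snd p))"

lemma PR_F_val: "PR (F_val \<sigma>)" unfolding F_val_def by (intro PR_atom_val PR_intros)

lemma atom_val_le: "atom_val \<sigma> l a t <= 1"
proof -
 have "m mod 2 <= (1::nat)" for m by presburger
 then show ?thesis unfolding atom_val_def by auto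
qed

text \<open>Missing variables of atoms of arity 0 or 1 are set to 0, the default used in
  \<open>tok_args\<close>.\<close>

definition c_atom :: "signature => com" where
 "c_atom \<sigma> = Sq (Cnd (Var 9) (Cnd (less (Cst 1) (Var 9))
   (Sq (Asg 26 (Cst 0)) (Sq (Asg 27 (Inp (plus (Var 16) (Cst 1)))) (Asg 28 (Inp (plus (Var 16) (Cst 2))))))
   (Sq (Asg 26 (Inp (plus (Var 16) (Cst 1)))) (Sq (Cnd (Ap (f_ar \<sigma>) (Var 26)) (Asg 27 (Inp (plus (Var 16) (Cst 2)))) (Asg 27 (Cst 0)))
     (Cnd (less (Cst 1) (Ap (f_ar \<sigma>) (Var 26))) (Asg 28 (Inp (plus (Var 16) (Cst 3)))) (Asg 28 (Cst 0))))))
   (Sq (Asg 26 (Cst 0)) (Sq (Asg 27 (Cst 0)) (Asg 28 (Cst 0)))))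
  (Sq (Sto 8 (Cst 0) (Var 25) (Ap (nf (F_val \<sigma>)) (Pr (Var 6) (Pr (Pr (Var 31) (Var 22)) (Pr (Var 9) (Pr (Var 26) (Pr (Var 27) (Var 28))))))))
    (Asg 25 (plus (Var 25) (Cst 1))))"

abbreviation st1 :: ex where "st1 \<equiv> Arr 8 (Cst 0) (Bin Sub (Var 25) (Cst 1))"
abbreviation st2 :: ex where "st2 \<equiv> Arr 8 (Cst 0) (Bin Sub (Var 25) (Cst 2))"

definition c_conn :: com where
 "c_conn = Cnd (neq (Var 9) (Cst 3)) (Sq (Cnd (neq (Var 9) (Cst 4))
   (Sto 8 (Cst 0) (Bin Sub (Var 25) (Cst 2)) (Bin Sub (Cst 1) (times (Bin Sub (Cst 1) st1) (Bin Sub (Cst 1) st2))))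
   (Sto 8 (Cst 0) (Bin Sub (Var 25) (Cst 2)) (times st1 st2))) (Asg 25 (Bin Sub (Var 25) (Cst 1))))
  (Sto 8 (Cst 0) (Bin Sub (Var 25) (Cst 1)) (Bin Sub (Cst 1) st1))"

definition b_tok :: "signature => com" where
 "b_tok \<sigma> = Sq (Asg 16 (Arr 7 (Cst 0) (Bin Sub (Bin Sub (Var 8) (Cst 1)) (Var 32)))) (Sq (Asg 9 (Inp (Var 16)))
  (Cnd (less (Cst 2) (Var 9)) c_conn (c_atom \<sigma>)))"

text \<open>All cells are at most 1, even above the top. This allows a new stack to be placed over
  the remains of the previous one.\<close>

definition stk :: "nat list => state => bool" where
 "stk st s \<longleftrightarrow> fst s 25 = length st & (\<forall>j<length st. snd s 8 0 (length st - Suc j) = st ! j) & (\<forall>j. snd s 8 0 j <= 1)"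

locale formula_machine = input \<sigma> S n d Ps \<phi> for \<sigma> S n d Ps \<phi> +
 fixes Mods :: "nat set" and l K W C B NA :: nat
 assumes K: "40 <= K" and \<phi>: "prenex \<phi>" "formula \<sigma> Mods 0 \<phi>" "quantifier_rank \<phi> = l"
  and B: "length xs + 4 <= B" "!!x. x \<in> set xs ==> x <= B" "4 * fl + 4 <= B" "2 ^ length \<sigma> <= B"
  and CA: "bnd (f_ar \<sigma>) (length \<sigma>) <= C"
  and CV: "bnd (nf (F_val \<sigma>)) (prod_encode (l, prod_encode (prod_encode (NA, 2 ^ length \<sigma>), prod_encode (2, prod_encode (length \<sigma>, prod_encode (l, l)))))) <= C"
  and qB: "!!j. list_encode (rev (map cd (take j (qprefix \<phi>)))) <= B"
begin

abbreviation "qs \<equiv> qprefix \<phi>"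
abbreviation "mt \<equiv> toks (matrix \<phi>)"
abbreviation "tks \<equiv> toks \<phi>"
definition tp :: "nat => nat" where "tp j = 3 + length (concat (take j tks))"

lemma lq: "length qs = l" using length_qprefix[OF \<phi>(1)] \<phi>(3) by simp
lemma mf: "quantifier_rank (matrix \<phi>) = 0" "formula \<sigma> Mods l (matrix \<phi>)" using matrix_formula[OF \<phi>(1,2)] \<phi>(3) by simp_all
lemma tks: "tks = map qtok qs @ mt" by (rule toks_prenex)
lemma tks_nth: "j < l ==> tks ! j = qtok (qs ! j)" "tks ! (l + h) = mt ! h" "length tks = l + length mt"
 using lq by (simp_all add: tks nth_append)
lemma ar2: "k < length \<sigma> ==> \<sigma> ! k <= 2" using sig_le by simp

lemma tok_ne: "t \<in> set tks ==> t ~= []"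
 using qf_tokens[OF mf] by (auto simp: tks qtok_def)

lemma tok_count: "length tks <= fl" using length_tokens[OF tok_ne] by (simp add: formula_code_toks)

lemma read:
 assumes "j < length tks" "t < length (tks ! j)"
 shows "xs ! (tp j + t) = tks ! j ! t" "tp j + t < length xs" "tp j + t < 3 + fl"
proof -
 note r = nth_concat_take[OF assms, folded formula_code_toks]
 show "xs ! (tp j + t) = tks ! j ! t" using xs_formula[OF r(2)] r(1) by (simp add: tp_def add.assoc)
 show "tp j + t < 3 + fl" using r(2) by (simp add: tp_def)
 then show "tp j + t < length xs" by simp
qed

lemma tp_Suc: "j < length tks ==> tp (Suc j) = tp j + length (tks ! j)"
 by (simp add: tp_def take_Suc_conv_app_nth)

lemma tp_end: "length tks <= j ==> tp j = 3 + fl" by (simp add: tp_def formula_code_toks)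

definition pinv :: "(nat => nat) => nat => state => bool" where
 "pinv R0 j s \<longleftrightarrow> eqx {5, 6, 7, 8, 9, 30} (fst s) R0 & fst s 5 = tp j & fst s 6 = min j l & fst s 7 = list_encode (rev (map cd (take j qs))) \<and>
  fst s 8 = min j (length tks) - l & (\<forall>h. l + h < j & h < length mt --> snd s 7 0 h = tp (l + h)) & (\<forall>c i j. c ~= 7 --> snd s c i j = 0)"

lemma xB: "i < length xs ==> xs ! i <= B" using B(2) nth_mem by blast

lemma parse_step:
 assumes R0: "R0 3 = fl" and I: "pinv R0 j (R, A)"
 shows "hl xs K W C B (b_parse \<sigma>) (csz (b_parse \<sigma>) * Suc C) (R(30 := j), A) (pinv R0 (Suc j))"
proof (rule hl_wpc)
 have r: "R 5 = tp j" "R 3 = fl" "R 6 = min j l" "R 7 = list_encode (rev (map cd (take j qs)))" "R 8 = min j (length tks) - l"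
  using I R0 by (auto simp: pinv_def eqx_def)
 show "wpc xs C B (b_parse \<sigma>) (pinv R0 (Suc j)) (R(30 := j), A)"
 proof (cases "j < length tks")
  case False
  have "pinv R0 (Suc j) (R(30 := j), A)" using I False tks_nth(3) lq by (auto simp: pinv_def tp_end)
  then show ?thesis using r False by (simp add: b_parse_def tp_end)
 next
  case True
  note rd = read[OF True]
  have t0: "tks ! j ~= []" using tok_ne True by simp
  have tpS: "tp (Suc j) <= B"
  proof -
   have "tp (Suc j) - 1 < 3 + fl" using rd(3)[of "length (tks ! j) - 1"] t0 by (simp add: tp_Suc[OF True])
   then show ?thesis using B(3) by linarith
  qed
  have x0: "xs ! tp j = tks ! j ! 0" "tp j < length xs" "tp j < 3 + fl" using rd[of 0] t0 by simp_all
  have x0B: "tks ! j ! 0 <= B" using xB[OF x0(2)] x0(1) by simp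
  show ?thesis
  proof (cases "j < l")
   case jl: True
   have t: "tks ! j = qtok (qs ! j)" using jl by (rule tks_nth)
   have qin: "qs ! j \<in> set qs" using jl lq by simp
   have S: "take (Suc j) qs = take j qs @ [qs ! j]" using jl lq by (simp add: take_Suc_conv_app_nth)
   have enc: "list_encode (rev (map cd (take (Suc j) qs))) = Suc (prod_encode (cd (qs ! j), R 7))" by (simp add: S r)
   have encB: "Suc (prod_encode (cd (qs ! j), R 7)) <= B" using qB[of "Suc j"] enc by simp
   have lB: "Suc j <= B" using jl tks_nth(3) tok_count B(3) by linarith
   from qprefix_cases[OF qin] consider (a) w where "qs ! j = (w, 0, 0)" "w = 6 | w = 7" | (b) i p where "qs ! j = (8, i, p)" by blast
   then show ?thesis
   proof cases
    case a
    have t': "tks ! j = [w]" using a t by (auto simp: qtok_def)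
    have tpS': "tp (Suc j) = tp j + 1" using tp_Suc[OF True] t' by simp
    have cdq: "cd (qs ! j) = prod_encode (w, prod_encode (0, 0))" by (simp add: a cd_nat_def)
    have P: "pinv R0 (Suc j) (R(30 := j, 9 := w, 6 := Suc j, 7 := Suc (prod_encode (cd (qs ! j), R 7)), 5 := tp j + 1), A)"
     using I jl enc tpS' tks_nth(3) unfolding pinv_def by (auto simp: min_def)
    then show ?thesis using r x0 t' a(2) encB lB tpS tpS' jl x0B unfolding cdq by (auto simp: b_parse_def min_def)
   next
    case b
    have t': "tks ! j = [8, i, p]" using b t by (auto simp: qtok_def)
    have tpS': "tp (Suc j) = tp j + 3" using tp_Suc[OF True] t' by simp
    have x12: "xs ! (tp j + 1) = i" "xs ! (tp j + 2) = p" "tp j + 1 < length xs" "tp j + 2 < length xs" using rd[of 1] rd[of 2] t' by simp_all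
    have cdq: "cd (qs ! j) = prod_encode (8, prod_encode (i, p))" by (simp add: b cd_nat_def)
    have P: "pinv R0 (Suc j) (R(30 := j, 9 := 8, 6 := Suc j, 7 := Suc (prod_encode (cd (qs ! j), R 7)), 5 := tp j + 3), A)"
     using I jl enc tpS' tks_nth(3) unfolding pinv_def by (auto simp: min_def)
    then show ?thesis using r x0 x12 t' encB lB tpS tpS' jl x0B unfolding cdq by (auto simp: b_parse_def min_def)
   qed
  next
   case jl: False
   define h where "h = j - l"
   have h: "j = l + h" "h < length mt" using jl True tks_nth(3) by (auto simp: h_def)
   have t: "tks ! j = mt ! h" using h tks_nth(2) by simp
   have r8: "R 8 = h" using r(5) True h by simp
   have hB: "Suc h <= B" "tp j <= B" using h(2) tks_nth(3) tok_count B(3) x0(3) by linarith+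
   have P: "pinv R0 (Suc j) (R(30 := j, 9 := w, 8 := Suc h, 5 := tp (Suc j)), aup A 7 0 h (tp j))" for w
   proof -
    have "take (Suc j) qs = take j qs" using h lq by simp
    then show ?thesis using I h tks_nth(3) unfolding pinv_def by (auto simp: less_Suc_eq)
   qed
   have tin: "mt ! h \<in> set mt" using h by simp
   from qf_tokens[OF mf tin] consider (a) w where "mt ! h = [w]" "w = 0 | w = 3 | w = 4 | w = 5" | (b) x y where "mt ! h = [2, x, y]" "x < l" "y < l"
    | (c) k ys where "mt ! h = 1 # k # ys" "k < length \<sigma>" "length ys = \<sigma> ! k" by blast
   then show ?thesis
   proof cases
    case a
    have tpS': "tp (Suc j) = tp j + 1" using tp_Suc[OF True] t a by simp
    then show ?thesis using r r8 x0 t a hB tpS P x0B by (auto simp: b_parse_def)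
   next
    case b
    have tpS': "tp (Suc j) = tp j + 3" using tp_Suc[OF True] t b by simp
    then show ?thesis using r r8 x0 t b hB tpS P x0B by (auto simp: b_parse_def)
   next
    case c
    have tpS': "tp (Suc j) = tp j + (2 + \<sigma> ! k)" using tp_Suc[OF True] t c by simp
    have x1: "xs ! (tp j + 1) = k" "tp j + 1 < length xs" using rd[of 1] t c by simp_all
    have "bnd (f_ar \<sigma>) k <= C" using bnd_mono[OF f_ar(1), of k "length \<sigma>" \<sigma>] CA c(2) by linarith
    then show ?thesis using r r8 x0 x1 t c hB tpS tpS' P[of 1] x0B f_ar(1) f_ar(2)[OF c(2)] by (auto simp: b_parse_def)
   qed
  qed
 qed
qed

definition tokf :: "nat => nat list => nat" where
 "tokf \<alpha> t = atom_val \<sigma> l (list_decode \<alpha>, nul_code \<sigma> S) (tok_args t)"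

lemma tok_step:
 assumes R: "R 6 = l" "R 8 = length mt" "R 22 = nul_code \<sigma> S" "R 31 = \<alpha>" "R 32 = h" and h: "h < length mt" and \<alpha>: "\<alpha> <= NA"
  and A7: "A 7 0 (length mt - 1 - h) = tp (l + (length mt - 1 - h))" and st: "stk st (R, A)" "2 <= length st" "length st < B"
  and Q: "!!R' A' st'. stk st' (R', A') ==> st' = tstep (tokf \<alpha>) (mt ! (length mt - 1 - h)) st ==> eqx {9, 16, 25, 26, 27, 28} R' R ==>
   (!!c i j. c ~= 8 ==> A' c i j = A c i j) ==> P (R', A')"
 shows "hl xs K W C B (b_tok \<sigma>) (csz (b_tok \<sigma>) * Suc C) (R, A) P"
proof (rule hl_wpc)
 define g where "g = length mt - 1 - h"
 have g: "g < length mt" using h by (simp add: g_def)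
 define t where "t = mt ! g"
 define p where "p = tp (l + g)"
 have tk: "tks ! (l + g) = t" "l + g < length tks" using tks_nth g by (auto simp: t_def)
 have rd: "xs ! (p + i) = t ! i" "p + i < length xs" if "i < length t" for i using read[OF tk(2), of i] that tk(1) by (auto simp: p_def)
 have tin: "t \<in> set mt" using g by (simp add: t_def)
 have t0: "t ~= []" using tok_ne tin tks by simp
 have x0: "xs ! p = t ! 0" "p < length xs" using rd[of 0] t0 by simp_all
 have pB: "p <= B" "t ! 0 <= B" using x0 B(1) xB[OF x0(2)] by simp_all
 have w: "A 7 0 (length mt - Suc (0 + h)) = p" using A7 by (simp add: g_def p_def)
 have s25: "R 25 = length st" and s8: "!!j. j < length st ==> A 8 0 (length st - Suc j) = st ! j" and s1: "!!j. A 8 0 j <= 1"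
  using st(1) by (auto simp: stk_def)
 have sne: "st ~= []" using st(2) by auto
 have top: "A 8 0 (length st - Suc 0) = st ! 0" "A 8 0 (length st - 2) = st ! 1" using s8[of 0] s8[of 1] st(2) sne by (auto simp: numeral_2_eq_2)
 have le1: "st ! 0 <= 1" "st ! 1 <= 1" using s1 top by metis+
 have B1: "1 <= B" "3 <= B" using B(3) by linarith+
 let ?R = "R(16 := p, 9 := t ! 0)"
 have conn: "P (R', aup A 8 0 (length st' - 1) (hd st'))"
  if "st' = tstep (tokf \<alpha>) t st" "hd st' <= 1" "st' ~= []" "!!j. 0 < j ==> j < length st' ==> A 8 0 (length st' - Suc j) = st' ! j" "R' 25 = length st'"
   "eqx {9, 16, 25, 26, 27, 28} R' R" for st' R'
 proof (rule Q[where st'=st'])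
  show "stk st' (R', aup A 8 0 (length st' - 1) (hd st'))"
   unfolding stk_def fst_conv snd_conv
  proof (intro conjI allI impI)
   fix j assume j: "j < length st'"
   show "aup A 8 0 (length st' - 1) (hd st') 8 0 (length st' - Suc j) = st' ! j"
   proof (cases "j = 0")
    case True then show ?thesis using that(3) by (simp add: hd_conv_nth)
   next
    case False
    then have "length st' - Suc j ~= length st' - 1" using j by linarith
    then show ?thesis using that(4)[of j] j False by simp
   qed
  qed (use that(2,5) s1 in auto)
 qed (use that in \<open>auto simp: t_def g_def\<close>)
 have atom: "wpc xs C B (Sq (Sto 8 (Cst 0) (Var 25) (Ap (nf (F_val \<sigma>)) (Pr (Var 6) (Pr (Pr (Var 31) (Var 22)) (Pr (Var 9) (Pr (Var 26) (Pr (Var 27) (Var 28))))))))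
    (Asg 25 (plus (Var 25) (Cst 1)))) P (R', A)"
  if a: "eqx {9, 16, 26, 27, 28} R' R" "R' 9 = t ! 0" "tok_args t = (t ! 0, R' 26, R' 27, R' 28)" "t ! 0 <= 2" "R' 26 <= length \<sigma>" "R' 27 <= l" "R' 28 <= l" for R'
 proof -
  let ?v = "prod_encode (l, prod_encode (prod_encode (\<alpha>, nul_code \<sigma> S), prod_encode (t ! 0, prod_encode (R' 26, prod_encode (R' 27, R' 28)))))"
  have r: "R' 6 = l" "R' 31 = \<alpha>" "R' 22 = nul_code \<sigma> S" "R' 25 = length st" using eqxD[OF a(1)] R s25 by simp_all
  have "nul_code \<sigma> S <= 2 ^ length \<sigma>" unfolding nul_code_def by (rule less_imp_le, rule binary_sum_lt)
  then have "?v <= prod_encode (l, prod_encode (prod_encode (NA, 2 ^ length \<sigma>), prod_encode (2, prod_encode (length \<sigma>, prod_encode (l, l)))))"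
   using a \<alpha> by (intro prod_encode_mono order_refl)
  then have c: "bnd (nf (F_val \<sigma>)) ?v <= C" using bnd_mono[OF nf(1)[OF PR_F_val]] CV le_trans by blast
  have v: "nf (F_val \<sigma>) ?v = tokf \<alpha> t"
   using nf(2)[OF PR_F_val[of \<sigma>], of "(l, (list_decode \<alpha>, nul_code \<sigma> S), tok_args t)"]
   by (simp add: F_val_def tokf_def cd_nat_list cd_nat_def a(3))
  have ts: "tstep (tokf \<alpha>) t st = tokf \<alpha> t # st" using a(4) t0 by (simp add: tstep_def hd_conv_nth)
  have v1: "tokf \<alpha> t <= 1" unfolding tokf_def by (rule atom_val_le)
  have e': "eqx {9, 16, 25, 26, 27, 28} (R'(25 := Suc (length st))) R" using a(1) by (auto intro: eqx_mono)
  have "P (R'(25 := Suc (length st)), aup A 8 0 (length st) (tokf \<alpha> t))"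
  proof -
   have "A 8 0 (length (tokf \<alpha> t # st) - Suc j) = (tokf \<alpha> t # st) ! j" if "0 < j" "j < length (tokf \<alpha> t # st)" for j
    using that s8[of "j - 1"] by (cases j) auto
   then show ?thesis using conn[of "tokf \<alpha> t # st" "R'(25 := Suc (length st))"] ts v1 e' by simp
  qed
  then show ?thesis using r a(2) c v v1 nf(1)[OF PR_F_val] st(3) B1 by simp
 qed
 from qf_tokens[OF mf tin] consider (z) "t = [0]" | (neg) "t = [3]" | (con) "t = [4]" | (dis) "t = [5]" | (eq) x y where "t = [2, x, y]" "x < l" "y < l"
  | (rel) k ys where "t = 1 # k # ys" "k < length \<sigma>" "length ys = \<sigma> ! k" "\<forall>x\<in>set ys. x < l" by blast
 then show "wpc xs C B (b_tok \<sigma>) P (R, A)"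
 proof cases
  case z
  show ?thesis using atom[of "?R(26 := 0, 27 := 0, 28 := 0)"] z w x0 pB R B1 by (simp add: b_tok_def c_atom_def tok_args_def)
 next
  case neg
  have "P (?R, aup A 8 0 (length st - 1) (1 - st ! 0))"
   using conn[of "(1 - st ! 0) # tl st" ?R] neg st(2) s25 s8 by (auto simp: tstep_def nth_tl nth_Cons' Suc_diff_Suc)
  then show ?thesis using neg w x0 pB R B1 s25 top by (simp add: b_tok_def c_conn_def)
 next
  case con
  have le: "st ! 0 * st ! 1 <= 1" using mult_le_mono[OF le1] by simp
  have "P (?R(25 := length st - 1), aup A 8 0 (length st - 2) (st ! 0 * st ! 1))"
   using conn[of "(st ! 0 * st ! 1) # drop 2 st" "?R(25 := length st - 1)"] con st(2) s25 s8 le by (auto simp: tstep_def nth_Cons' numeral_2_eq_2 Suc_diff_Suc)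
  then show ?thesis using con w x0 pB R B1 s25 top le st(3) by (simp add: b_tok_def c_conn_def)
 next
  case dis
  have "P (?R(25 := length st - 1), aup A 8 0 (length st - 2) (1 - (1 - st ! 0) * (1 - st ! 1)))"
   using conn[of "(1 - (1 - st ! 0) * (1 - st ! 1)) # drop 2 st" "?R(25 := length st - 1)"] dis st(2) s25 s8 by (auto simp: tstep_def nth_Cons' numeral_2_eq_2 Suc_diff_Suc)
  moreover have "1 - (1 - st ! 0) * (1 - st ! 1) <= B" using diff_le_self[of 1 "(1 - st ! 0) * (1 - st ! 1)"] B1(1) by linarith
  moreover have "length st - 1 <= B" using st(3) by linarith
  ultimately show ?thesis using dis w x0 pB R s25 top by (simp add: b_tok_def c_conn_def)
 next
  case eq
  have x: "xs ! (p + 1) = x" "xs ! (p + 2) = y" "p + 1 < length xs" "p + 2 < length xs" using rd[of 1] rd[of 2] eq by simp_all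
  have xb: "x <= B" "y <= B" using xB x by metis+
  show ?thesis using atom[of "?R(26 := 0, 27 := x, 28 := y)"] eq w x0 x xb pB R B1 by (simp add: b_tok_def c_atom_def tok_args_def)
 next
  case rel
  have ar: "f_ar \<sigma> k = \<sigma> ! k" "pr (f_ar \<sigma>)" "bnd (f_ar \<sigma>) k <= C" "\<sigma> ! k <= 2"
   using f_ar rel ar2 bnd_mono[OF f_ar(1), of k "length \<sigma>" \<sigma>] CA by auto
  have x: "xs ! (p + 1) = k" "p + 1 < length xs" "k <= B" using rd[of 1] rel xB[of "p + 1"] by simp_all
  define x2 where "x2 = (if \<sigma> ! k = 0 then 0 else ys ! 0)"
  define y2 where "y2 = (if \<sigma> ! k <= 1 then 0 else ys ! 1)"
  have x2: "\<sigma> ! k ~= 0 ==> xs ! (p + 2) = x2 & p + 2 < length xs & x2 <= B" using rd[of 2] rel xB[of "p + 2"] by (auto simp: x2_def)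
  have y2: "1 < \<sigma> ! k ==> xs ! (p + 3) = y2 & p + 3 < length xs & y2 <= B" using rd[of 3] rel xB[of "p + 3"] by (auto simp: y2_def numeral_3_eq_3)
  have ta: "tok_args t = (1, k, x2, y2)" using rel ar(4) by (auto simp: tok_args_def nthd_def x2_def y2_def numeral_3_eq_3 numeral_2_eq_2)
  have l2: "x2 <= l" "y2 <= l" using rel(3,4) by (auto simp: x2_def y2_def less_imp_le)
  have z0: "\<sigma> ! k = 0 ==> x2 = 0" "\<sigma> ! k <= 1 ==> y2 = 0" by (simp_all add: x2_def y2_def)
  show ?thesis using atom[of "?R(26 := k, 27 := x2, 28 := y2)"] rel(1,2) ar ta l2 w x0 x x2 y2 z0 pB R B1
   by (auto simp: b_tok_def c_atom_def not_less)
 qed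
qed

end

text \<open>Each token changes the height by at most one. This bounds the height without an
  invariant about well-formed formulas.\<close>

lemma tstep_length: "2 <= length st ==> length st <= Suc (length (tstep f t st)) & length (tstep f t st) <= Suc (length st)"
 by (auto simp: tstep_def)

lemma list_encode_mono: "length ys <= N ==> (!!y. y \<in> set ys ==> y <= m) ==> list_encode ys <= list_encode (replicate N m)"
proof (induction ys arbitrary: N)
 case (Cons y ys)
 then obtain N' where N: "N = Suc N'" by (cases N) auto
 show ?case unfolding N using Cons by (auto intro!: prod_encode_mono simp: N)
qed simp

text \<open>A pair entry is at most \<open>Suc (2 * c + 1)\<close> with
  \<open>c < 2 ^ length \<sigma>\<close>, and a leaf has \<open>l * l\<close> entries; so the number
  exceeds every possible table index (\<open>ecode_lt\<close>).\<close>

definition F_num :: "signature => nat => nat" where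
 "F_num \<sigma> l = list_encode (replicate (l * l) (2 * 2 ^ length \<sigma>)) + 1"

text \<open>Every number below \<open>F_num\<close> is treated as a code of pair information,
  although \<open>bits\<close> makes a claim only for genuine codes. This saves a test, and the
  matrix is evaluated a number of times that depends on the signature and \<open>l\<close>
  only.\<close>

definition c_bits :: "signature => com" where
 "c_bits \<sigma> = For 31 (Ap (nf (F_num \<sigma>)) (Var 6)) (Sq (Asg 25 (plus (Var 8) (plus (Var 8) (Cst 2)))) (Sq (For 32 (Var 8) (b_tok \<sigma>))
  (Asg 24 (push (Arr 8 (Cst 0) (Bin Sub (Var 25) (Cst 1))) (Var 24)))))"

definition t_toks :: "signature => nat => nat => nat" where
 "t_toks \<sigma> C N = 20 * Suc C + ((3 * Suc C + N * (csz (b_tok \<sigma>) * Suc C + 6) + 4) + 40 * Suc C)"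

lemma F_num: assumes "PR (F_num \<sigma>)" shows "pr (nf (F_num \<sigma>))" "nf (F_num \<sigma>) l = F_num \<sigma> l"
 using nf[OF assms] by (auto simp: cd_nat_def)

context formula_machine
begin

lemma hl_parse:
 assumes R: "R0 3 = fl" "R0 5 = 3" "R0 6 = 0" "R0 7 = 0" "R0 8 = 0"
 shows "hl xs K W C B (For 30 (Var 3) (b_parse \<sigma>)) (3 * Suc C + fl * (csz (b_parse \<sigma>) * Suc C + 6) + 4) (R0, %_ _ _. 0) (pinv R0 fl)"
proof -
 have "hl xs K W C B (For 30 (Var 3) (b_parse \<sigma>)) (esz (Var 3) * Suc C + fl * (csz (b_parse \<sigma>) * Suc C + 6) + 4) (R0, %_ _ _. 0) (pinv R0 fl)"
  by (rule hl_For[where m=fl and I="pinv R0"]) (use R parse_step[where ?R0.0=R0, OF R(1)] B(3) in \<open>auto simp: pinv_def tp_def\<close>)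
 then show ?thesis by (rule hl_mono) auto
qed

lemma tok_loop:
 assumes R: "R 6 = l" "R 8 = length mt" "R 22 = nul_code \<sigma> S" "R 31 = \<alpha>" and \<alpha>: "\<alpha> <= NA"
  and A7: "!!h. h < length mt ==> A 7 0 h = tp (l + h)" and st: "stk st0 (R, A)" "length st0 = 2 * length mt + 2"
 shows "hl xs K W C B (For 32 (Var 8) (b_tok \<sigma>)) (3 * Suc C + length mt * (csz (b_tok \<sigma>) * Suc C + 6) + 4) (R, A)
  (%s. eqx {9, 16, 25, 26, 27, 28, 32} (fst s) R & (\<forall>c i j. c ~= 8 --> snd s c i j = A c i j) & stk (foldr (tstep (tokf \<alpha>)) mt st0) s)"
proof -
 let ?N = "length mt"
 define F where "F = (%h. foldr (tstep (tokf \<alpha>)) (drop (?N - h) mt) st0)"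
 let ?I = "%h s. eqx {9, 16, 25, 26, 27, 28, 32} (fst s) R & (\<forall>c i j. c ~= 8 --> snd s c i j = A c i j) & stk (F h) s \<and>
  2 * ?N + 2 <= length (F h) + h & length (F h) <= 2 * ?N + 2 + h"
 have NB: "?N <= fl" using tok_count tks_nth(3) by linarith
 have "hl xs K W C B (For 32 (Var 8) (b_tok \<sigma>)) (esz (Var 8) * Suc C + ?N * (csz (b_tok \<sigma>) * Suc C + 6) + 4) (R, A)
  (%s. eqx {9, 16, 25, 26, 27, 28, 32} (fst s) R & (\<forall>c i j. c ~= 8 --> snd s c i j = A c i j) & stk (foldr (tstep (tokf \<alpha>)) mt st0) s)"
 proof (rule hl_For[where m="?N" and I="?I"])
  show "?I 0 (R, A)" using st by (simp add: F_def)
  fix h R' A' assume h: "h < ?N" and I: "?I h (R', A')"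
  note e = eqxD[OF I[THEN conjunct1], simplified]
  have "drop (?N - Suc h) mt = mt ! (?N - 1 - h) # drop (?N - h) mt"
   using Cons_nth_drop_Suc[of "?N - Suc h" mt] h by (simp add: Suc_diff_Suc)
  then have FS: "F (Suc h) = tstep (tokf \<alpha>) (mt ! (?N - 1 - h)) (F h)" by (simp add: F_def)
  have lF: "2 <= length (F h)" "length (F h) < B" using I h NB B(3) by auto
  show "hl xs K W C B (b_tok \<sigma>) (csz (b_tok \<sigma>) * Suc C) (R'(32 := h), A') (?I (Suc h))"
  proof (rule tok_step[where \<alpha>=\<alpha> and h=h and st="F h"])
   show "A' 7 0 (?N - 1 - h) = tp (l + (?N - 1 - h))" using I A7 h by auto
   show "stk (F h) (R'(32 := h), A')" using I by (simp add: stk_def)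
   fix R2 A2 st' assume q: "stk st' (R2, A2)" "st' = tstep (tokf \<alpha>) (mt ! (?N - 1 - h)) (F h)" "eqx {9, 16, 25, 26, 27, 28} R2 (R'(32 := h))"
    "!!c i j. c ~= 8 ==> A2 c i j = A' c i j"
   have "eqx {9, 16, 25, 26, 27, 28, 32} R2 (R'(32 := h))" using q(3) by (rule eqx_mono) auto
   moreover have "eqx {9, 16, 25, 26, 27, 28, 32} (R'(32 := h)) R" using I by simp
   ultimately have "eqx {9, 16, 25, 26, 27, 28, 32} R2 R" by (rule eqx_trans)
   moreover have "stk (F (Suc h)) (R2, A2)" using q(1,2) FS by simp
   moreover have "2 * ?N + 2 <= length (F (Suc h)) + Suc h & length (F (Suc h)) <= 2 * ?N + 2 + Suc h"
    using tstep_length[OF lF(1), of "tokf \<alpha>" "mt ! (?N - 1 - h)"] I unfolding FS by auto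
   ultimately show "?I (Suc h) (R2, A2)" using q(4) I by auto
  qed (use e R \<alpha> h lF in auto)
 qed (use R NB B(3) in \<open>auto simp: F_def\<close>)
 then show ?thesis by (rule hl_mono) auto
qed

definition ecode :: "nat list => nat" where
 "ecode e = list_encode (concat (map (%x. map (%y. pinfo (atom_code \<sigma> S) (map Some e ! x) (map Some e ! y)) [0..<l]) [0..<l]))"

definition bits :: "nat list => bool" where
 "bits bs \<longleftrightarrow> (\<forall>b\<in>set bs. b <= 1) & (\<forall>e. length e = l --> ecode e < length bs --> bs ! ecode e = of_bool (sat S e (matrix \<phi>)))"

lemma bits_snoc: assumes "bits bs" "st0 ~= []"
  "b = foldr (tstep (tokf (length bs))) mt st0 ! 0" "b <= 1"
 shows "bits (bs @ [b])"
proof -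
 have "b = of_bool (sat S e (matrix \<phi>))" if e: "length e = l" "ecode e = length bs" for e
 proof -
  have "foldr (tstep (tokf (ecode e))) mt st0 = of_bool (sat S e (matrix \<phi>)) # st0"
   using matrix_eval[OF bin mf e(1), of S st0] unfolding tokf_def ecode_def by simp
  then show ?thesis using assms(3) e(2) by simp
 qed
 then show ?thesis using assms(1,4) unfolding bits_def by (auto simp: nth_append less_Suc_eq)
qed

lemma ecode_lt: assumes "length e = l" shows "ecode e < F_num \<sigma> l"
proof -
 have "ecode e <= list_encode (replicate (l * l) (2 * 2 ^ length \<sigma>))"
  unfolding ecode_def
 proof (rule list_encode_mono)
  have "length (concat (map (%x. map (f x) [0..<l]) [0..<k])) = k * l" for f :: "nat => nat => nat" and k by (induction k) auto
  then show "length (concat (map (%x. map (%y. pinfo (atom_code \<sigma> S) (map Some e ! x) (map Some e ! y)) [0..<l]) [0..<l])) <= l * l" by simp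
  fix y assume "y \<in> set (concat (map (%x. map (%y. pinfo (atom_code \<sigma> S) (map Some e ! x) (map Some e ! y)) [0..<l]) [0..<l]))"
  then obtain u v where y: "y = Suc (2 * atom_code \<sigma> S u v + of_bool (u = v))" using assms by (auto simp: pinfo_def)
  have "atom_code \<sigma> S u v < 2 ^ length \<sigma>" unfolding atom_code_def by (rule binary_sum_lt)
  moreover have "of_bool (u = v) <= (1::nat)" by simp
  ultimately show "y <= 2 * 2 ^ length \<sigma>" unfolding y by linarith
 qed
 then show ?thesis by (simp add: F_num_def)
qed

lemma hl_bits:
 assumes PF: "PR (F_num \<sigma>)" and NA: "NA = F_num \<sigma> l" "NA <= B" "bnd (nf (F_num \<sigma>)) l <= C"
  and XB: "list_encode (replicate NA 1) <= B"
  and R: "R0 6 = l" "R0 8 = length mt" "R0 22 = nul_code \<sigma> S" "R0 24 = 0"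
  and A7: "!!h. h < length mt ==> A0 7 0 h = tp (l + h)" and A8: "!!j. A0 8 0 j = 0"
 shows "hl xs K W C B (c_bits \<sigma>) (9 * Suc C + NA * (t_toks \<sigma> C (length mt) + 6) + 4) (R0, A0)
  (%s. eqx {9, 16, 24, 25, 26, 27, 28, 31, 32} (fst s) R0 & (\<forall>c i j. c ~= 8 --> snd s c i j = A0 c i j) \<and>
   (\<exists>bs. bits bs & length bs = NA & fst s 24 = list_encode (rev bs)))"
proof -
 let ?I = "%\<alpha> s. eqx {9, 16, 24, 25, 26, 27, 28, 31, 32} (fst s) R0 & (\<forall>c i j. c ~= 8 --> snd s c i j = A0 c i j) & (\<forall>j. snd s 8 0 j <= 1) \<and>
   (\<exists>bs. bits bs & length bs = \<alpha> & fst s 24 = list_encode (rev bs))"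
 have mB: "length mt <= fl" using tok_count tks_nth(3) by linarith
 have "hl xs K W C B (c_bits \<sigma>) (esz (Ap (nf (F_num \<sigma>)) (Var 6)) * Suc C + NA * (t_toks \<sigma> C (length mt) + 6) + 4) (R0, A0)
  (%s. eqx {9, 16, 24, 25, 26, 27, 28, 31, 32} (fst s) R0 & (\<forall>c i j. c ~= 8 --> snd s c i j = A0 c i j) \<and>
   (\<exists>bs. bits bs & length bs = NA & fst s 24 = list_encode (rev bs)))"
  unfolding c_bits_def
 proof (rule hl_For[where m=NA and I="?I"])
  show "?I 0 (R0, A0)" using R A8 by (auto simp: bits_def intro!: exI[of _ "[]"])
  fix \<alpha> R A assume \<alpha>: "\<alpha> < NA" and I: "?I \<alpha> (R, A)"
  then obtain bs where bs: "bits bs" "length bs = \<alpha>" "R 24 = list_encode (rev bs)" by auto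
  note e = eqxD[OF I[THEN conjunct1], simplified]
  \<comment> \<open>Each of the \<open>length mt\<close> tokens lowers the stack by at most one, so
    this initial height keeps two operands available at every token. The initial entries are
    whatever array 8 contains, all at most 1.\<close>
  define c2 where "c2 = 2 * length mt + 2"
  define R1 where "R1 = R(31 := \<alpha>, 25 := c2)"
  define st0 where "st0 = map (%j. A 8 0 (c2 - Suc j)) [0..<c2]"
  have l0: "length st0 = 2 * length mt + 2" by (simp add: st0_def c2_def del: upt_Suc)
  have stk0: "stk st0 (R1, A)" using I by (auto simp: stk_def st0_def R1_def)
  have 1: "hl xs K W C B (Asg 25 (plus (Var 8) (plus (Var 8) (Cst 2)))) (20 * Suc C) (R(31 := \<alpha>), A) (%s. s = (R1, A))"
  proof (rule hl_mono[OF hl_wpc[where Q="%s. s = (R1, A)"]])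
   show "wpc xs C B (Asg 25 (plus (Var 8) (plus (Var 8) (Cst 2)))) (%s. s = (R1, A)) (R(31 := \<alpha>), A)"
    using e R mB B(3) by (auto simp: R1_def c2_def)
  qed (auto simp: plus_def)
  have 2: "hl xs K W C B (For 32 (Var 8) (b_tok \<sigma>)) (3 * Suc C + length mt * (csz (b_tok \<sigma>) * Suc C + 6) + 4) (R1, A)
   (%s. eqx {9, 16, 25, 26, 27, 28, 32} (fst s) R1 & (\<forall>c i j. c ~= 8 --> snd s c i j = A c i j) & stk (foldr (tstep (tokf \<alpha>)) mt st0) s)"
   by (rule tok_loop) (use e R \<alpha> I A7 l0 stk0 in \<open>auto simp: R1_def\<close>)
  have 3: "hl xs K W C B (Asg 24 (push (Arr 8 (Cst 0) (Bin Sub (Var 25) (Cst 1))) (Var 24))) (40 * Suc C) s (?I (Suc \<alpha>))"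
   if h: "eqx {9, 16, 25, 26, 27, 28, 32} (fst s) R1 & (\<forall>c i j. c ~= 8 --> snd s c i j = A c i j) & stk (foldr (tstep (tokf \<alpha>)) mt st0) s" for s
  proof (rule hl_mono[OF hl_wpc[where Q="?I (Suc \<alpha>)"]])
   define st where "st = foldr (tstep (tokf \<alpha>)) mt st0"
   define b where "b = snd s 8 0 (fst s 25 - 1)"
   have sl0: "0 < length st"
   proof -
    have "2 * k + 2 <= length st0 ==> k = length ts ==> k + 2 <= length (foldr (tstep (tokf \<alpha>)) ts st0)" for k ts
    proof (induction ts arbitrary: k)
     case (Cons t ts)
     then have "length ts + 2 <= length (foldr (tstep (tokf \<alpha>)) ts st0)" by simp
     moreover have "length (foldr (tstep (tokf \<alpha>)) ts st0) + length ts >= length st0" for ts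
     proof (induction ts)
      case (Cons t ts)
      show ?case
      proof (cases "2 <= length (foldr (tstep (tokf \<alpha>)) ts st0)")
       case True then show ?thesis using tstep_length[OF True, of "tokf \<alpha>" t] Cons by simp
      next
       case False
       then have "length (tstep (tokf \<alpha>) t (foldr (tstep (tokf \<alpha>)) ts st0)) >= 1" by (auto simp: tstep_def)
       then show ?thesis using False Cons by simp
      qed
     qed simp
     from this[of "t # ts"] Cons.prems show ?case by simp
    qed simp
    from this[of "length mt" mt] have "length mt + 2 <= length st" using l0 unfolding st_def by simp
    then show ?thesis by linarith
   qed
   have h0: "fst s 25 = length st" "!!j. j < length st ==> snd s 8 0 (length st - Suc j) = st ! j" "!!j. snd s 8 0 j <= 1"
    using h by (auto simp: stk_def st_def[symmetric])
   have b: "b = st ! 0" "b <= 1" using h0(2)[OF sl0] h0(1) h0(3)[of "length st - Suc 0"] by (simp_all add: b_def)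
   have bb: "bits (bs @ [b])" by (rule bits_snoc[OF bs(1), of st0]) (use b bs(2) l0 in \<open>auto simp: st_def\<close>)
   have s24: "fst s 24 = list_encode (rev bs)" using eqxD[OF h[THEN conjunct1], of 24] bs(3) by (simp add: R1_def)
   have enc: "list_encode (rev (bs @ [b])) = Suc (prod_encode (b, fst s 24))" using s24 by simp
   have "list_encode (rev (bs @ [b])) <= list_encode (replicate NA 1)"
    by (rule list_encode_mono) (use bb bs(2) \<alpha> in \<open>auto simp: bits_def\<close>)
   then have le: "Suc (prod_encode (b, fst s 24)) <= B" using XB unfolding enc by linarith
   have "eqx {9, 16, 24, 25, 26, 27, 28, 31, 32} (fst s) R1" using h by (auto intro: eqx_mono)
   moreover have "eqx {9, 16, 24, 25, 26, 27, 28, 31, 32} R1 R0" using I by (simp add: R1_def)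
   ultimately have eq: "eqx {9, 16, 24, 25, 26, 27, 28, 31, 32} (fst s) R0" by (rule eqx_trans)
   have "?I (Suc \<alpha>) ((fst s)(24 := Suc (prod_encode (b, fst s 24))), snd s)"
    using eq h I bb enc bs(2) by (intro conjI exI[of _ "bs @ [b]"]) (auto simp: stk_def)
   then show "wpc xs C B (Asg 24 (push (Arr 8 (Cst 0) (Bin Sub (Var 25) (Cst 1))) (Var 24))) (?I (Suc \<alpha>)) s"
    using le by (simp add: b_def)
  qed (auto simp: push_def)
  show "hl xs K W C B (Sq (Asg 25 (plus (Var 8) (plus (Var 8) (Cst 2)))) (Sq (For 32 (Var 8) (b_tok \<sigma>))
  (Asg 24 (push (Arr 8 (Cst 0) (Bin Sub (Var 25) (Cst 1))) (Var 24))))) (t_toks \<sigma> C (length mt)) (R(31 := \<alpha>), A) (?I (Suc \<alpha>))"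
   unfolding t_toks_def by (rule hl_Sq_le[OF 1], rule hl_Sq_le[OF _ 3]) (use 2 in auto)
 qed (use NA R F_num[OF PF] in auto)
 then show ?thesis by (rule hl_mono) auto
qed

end

section \<open>One merge on the machine: graph, search and types\<close>

context machine
begin

text \<open>The state between the update of the graph and the search. The lists of the merged parts
  still describe the old graph, those of the live parts the new one.\<close>

definition mid :: "(nat => nat) => (nat => nat => nat => nat) => nat => state => bool" where
 "mid Rb A i s \<longleftrightarrow> eqx ({11..21} \<union> {30..33}) (fst s) Rb & fst s 11 = pos (Suc i) & fst s 12 = n + i & queue (n + i) [xn i, yn i, n + i] s \<and>
  (\<forall>a\<in>live (Suc i). distinct (row (snd s) a) & set (row (snd s) a) = {b. rE (Suc i) a b}) \<and>
  (\<forall>a\<in>{xn i, yn i}. distinct (row (snd s) a) & set (row (snd s) a) = {b. rE i a b}) \<and>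
  (\<forall>a\<in>live i. snd s 0 a 0 < n & pn i (snd s 0 a 0) = a) & snd s 0 (n + i) 0 < n & pn i (snd s 0 (n + i) 0) = xn i \<and>
  (\<forall>a b. snd s 5 a b = (if a = n + i & b \<in> nbs i | b = n + i & a \<in> nbs i then 1 else A 5 a b)) \<and>
  (\<forall>a. snd s 2 a 0 = A 2 a 0) & (\<forall>v. snd s 3 v 0 <= n + i)"

lemma step_facts: assumes i: "Suc i < n"
 shows "finite (nbs i)" "card (nbs i) <= d" "distinct (sorted_list_of_set (nbs i))" "set (sorted_list_of_set (nbs i)) = nbs i" "length (sorted_list_of_set (nbs i)) = card (nbs i)"
  "b \<in> nbs i ==> b \<in> live i & b ~= xn i & b ~= yn i & b ~= n + i" "n + i \<notin> live i" "xn i \<in> live i" "yn i \<in> live i" "xn i ~= yn i"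
  "xn i < n + i" "yn i < n + i" "n + i \<in> live (Suc i)"
proof -
 have i': "i < n" using i by simp
 show f: "finite (nbs i)" "card (nbs i) <= d" using degree[OF i] by simp_all
 show "distinct (sorted_list_of_set (nbs i))" "set (sorted_list_of_set (nbs i)) = nbs i" "length (sorted_list_of_set (nbs i)) = card (nbs i)" using f by simp_all
 show "n + i \<notin> live i" using live_lt[OF i'] by blast
 show xy: "xn i \<in> live i" "yn i \<in> live i" "xn i ~= yn i" using xy_live[OF i] by auto
 show "xn i < n + i" "yn i < n + i" using live_lt[OF i'] xy by blast+
 show "n + i \<in> live (Suc i)" unfolding live_Suc[OF i] by simp
 show "b \<in> live i & b ~= xn i & b ~= yn i & b ~= n + i" if b: "b \<in> nbs i"
 proof -
  have "n + i ~= b" "b \<in> live (Suc i)" using b rE_irrefl[OF i, of "n + i" b] rE_live[OF i, of "n + i" b] by auto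
  then show ?thesis using live_Suc[OF i] by auto
 qed
qed

lemma row_length: "distinct (row A a) ==> set (row A a) = {b. rE i a b} ==> i < n ==> A 1 a 0 <= d"
proof -
 assume h: "distinct (row A a)" "set (row A a) = {b. rE i a b}" "i < n"
 have "A 1 a 0 = length (row A a)" by (simp add: row_def)
 also have "\<dots> = card {b. rE i a b}" using distinct_card[OF h(1)] h(2) by simp
 finally show ?thesis using degree[OF h(3)] by simp
qed

lemma dQ: "d <= Q" "Suc d <= Q"
proof -
 have "Suc d ^ 1 <= Suc d ^ (2 ^ (l + 2))" by (rule power_increasing) auto
 then show "Suc d <= Q" unfolding Q(1) by simp
 then show "d <= Q" by simp
qed

lemma first_half:
 assumes i: "Suc i < n" and Rb: "Rb 2 = n" and I: "inv Rb i (R, A)"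
  and rest: "!!s. mid Rb A i s ==> hl xs K W C B rest \<tau> s P"
 shows "hl xs K W C B (Sq c_s1 (Sq (For 31 (Var 15) c_red) (Sq c_s3 rest)))
  (csz c_s1 * Suc C + ((3 * Suc C + d * (t_red C d + 6) + 4) + (csz c_s3 * Suc C + \<tau>))) (R(30 := i), A) P"
proof -
 have i': "i < n" using i by simp
 note sf = step_facts[OF i]
 define x where "x = xn i"
 define y where "y = yn i"
 define z where "z = n + i"
 define ns where "ns = sorted_list_of_set (nbs i)"
 note sq = seq_read[OF i, folded x_def y_def ns_def]
 note e = eqxD[OF I[unfolded inv_def, THEN conjunct1], simplified]
 have I1: "R 11 = pos i" and Il: "!!a. a \<in> live i ==> A 0 a 0 < n & pn i (A 0 a 0) = a & distinct (row A a) & set (row A a) = {b. rE i a b}"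
  and I3: "!!v. A 3 v 0 < n + i"
  using I by (auto simp: inv_def)
 have R2: "R 2 = n" using e Rb by simp
 have lns: "length ns = card (nbs i)" "set ns = nbs i" "distinct ns" using sf(3-5) by (simp_all add: ns_def)
 have cB: "card (nbs i) <= B" using sf(2) dQ Q(2) by linarith
 have bB: "n + i <= B" "x <= B" "y <= B" "A 0 x 0 <= B" using B(1) i sf(11,12) Il[OF sf(8)] unfolding x_def y_def by linarith+
 have posB: "pos i + 3 + card (nbs i) <= B"
 proof (cases "card (nbs i)")
  case 0 then show ?thesis using sq(5) B(2) i B(1) by simp
 next
  case (Suc m) then show ?thesis using sq(4)[of m] B(2) by simp
 qed
 define R1 where "R1 = R(30 := i, 12 := z, 13 := x, 14 := y, 15 := card (nbs i))"
 define A1 where "A1 = aup (aup A 0 z 0 (A 0 x 0)) 1 z 0 (card (nbs i))"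
 have s1: "hl xs K W C B c_s1 (csz c_s1 * Suc C) (R(30 := i), A) (%s. s = (R1, A1))"
 proof (rule hl_wpc)
  have "pos i < length xs" "Suc (pos i) < length xs" using sq(5) by simp_all
  then show "wpc xs C B c_s1 (%s. s = (R1, A1)) (R(30 := i), A)"
   using R2 I1 sq bB cB by (simp add: c_s1_def R1_def A1_def z_def)
 qed
 have r1: "R1 11 = pos i" "R1 12 = z" "R1 13 = x" "R1 14 = y" "R1 15 = length ns" using I1 lns by (simp_all add: R1_def)
 have zx: "z ~= x" "z ~= y" "x ~= y" "z \<notin> set ns" "x \<notin> set ns" "y \<notin> set ns"
  using sf(6)[of z] sf(6)[of x] sf(6)[of y] sf(10,11,12) lns by (auto simp: x_def y_def z_def)
 have row1: "row A1 w = row A w" if "w ~= z" for w using that by (simp add: row_def A1_def)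
 let ?P2 = "%s. eqx {16, 17, 18, 31, 32} (fst s) R1 \<and>
   row (snd s) z = ns & (\<forall>w. w ~= z --> row (snd s) w = (if w \<in> set ns then filter (%v. v ~= x & v ~= y) (row A1 w) @ [z] else row A1 w)) \<and>
   (\<forall>a b. snd s 5 a b = (if a = z & b \<in> set ns | b = z & a \<in> set ns then 1 else A1 5 a b)) \<and>
   (\<forall>c i j. c ~= 1 & c ~= 4 & c ~= 5 --> snd s c i j = A1 c i j)"
 have s2: "hl xs K W C B (For 31 (Var 15) c_red) (3 * Suc C + d * (t_red C d + 6) + 4) (R1, A1) ?P2"
 proof (rule hl_mono[OF hl_red[where ?R0.0=R1 and ?A0.0=A1 and z=z and x=x and y=y and p="pos i" and ns=ns and d=d]])
  show "pos i + 3 + j < length xs & xs ! (pos i + 3 + j) = ns ! j" if "j < length ns" for j using sq(4)[of j] that lns by simp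
  show "A1 1 w 0 <= d" if "w \<in> set ns" for w
  proof -
   have w: "w \<in> live i" "w ~= z" using sf(6)[of w] that lns by (auto simp: z_def)
   show ?thesis using row_length[of A w i] Il[OF w(1)] i' w(2) by (simp add: A1_def)
  qed
  show "w <= B" if "w \<in> set ns" for w
  proof -
   have "w \<in> live i" using sf(6)[of w] that lns by auto
   then show ?thesis using live_lt[OF i', of w] bB(1) by simp
  qed
  have "esz (Var 15) * Suc C <= 3 * Suc C" by simp
  then show "esz (Var 15) * Suc C + length ns * (t_red C d + 6) + 4 <= 3 * Suc C + d * (t_red C d + 6) + 4"
   using mult_le_mono1[of "length ns" d "t_red C d + 6"] sf(2) lns(1) by linarith
  show "A1 1 z 0 = length ns" by (simp add: A1_def lns)
  show "Suc d <= B" using dQ Q(2) by linarith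
  show "1 <= B" using B(1) by linarith
  show "length ns <= B" using cB lns by simp
  show "z <= B" using bB(1) by (simp add: z_def)
 qed (use K r1 zx lns in auto)
 have s3: "hl xs K W C B c_s3 (csz c_s3 * Suc C) s (mid Rb A i)" if P2: "?P2 s" for s
 proof (cases s)
  case (Pair R2 A2)
  note e2 = eqxD[OF P2[THEN conjunct1], simplified, unfolded Pair, simplified]
  have r2: "R2 11 = pos i" "R2 12 = z" "R2 13 = x" "R2 14 = y" "R2 15 = card (nbs i)" using e2 r1 lns by simp_all
  define R3 where "R3 = R2(11 := pos i + 3 + card (nbs i), 19 := 3)"
  define A3 where "A3 = aup (aup (aup (aup (aup (aup A2 6 0 0 x) 6 0 1 y) 6 0 2 z) 3 x 0 z) 3 y 0 z) 3 z 0 z"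
  have rowz: "row A2 z = ns" and rowo: "!!w. w ~= z ==> row A2 w = (if w \<in> set ns then filter (%v. v ~= x & v ~= y) (row A w) @ [z] else row A w)"
   and A5: "!!a b. A2 5 a b = (if a = z & b \<in> set ns | b = z & a \<in> set ns then 1 else A 5 a b)"
   and Ao: "!!c i j. c ~= 1 ==> c ~= 4 ==> c ~= 5 ==> A2 c i j = A1 c i j"
   using P2 Pair row1 by (auto simp: A1_def)
  have row3: "row A3 w = row A2 w" for w by (simp add: row_def A3_def)
  have eq3: "eqx ({11..21} \<union> {30..33}) R3 Rb"
  proof -
   have "eqx ({11..21} \<union> {30..33}) R2 R1" using P2 Pair by (auto intro: eqx_mono)
   moreover have "eqx ({11..21} \<union> {30..33}) R1 Rb" using I by (simp add: inv_def R1_def)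
   ultimately have "eqx ({11..21} \<union> {30..33}) R2 Rb" by (rule eqx_trans)
   then show ?thesis by (simp add: R3_def)
  qed
  have M3: "A3 3 v 0 = (if v = x | v = y | v = z then z else A 3 v 0)" for v using Ao[of 3] by (simp add: A3_def A1_def)
  have m: "mid Rb A i (R3, A3)"
   unfolding mid_def fst_conv snd_conv
  proof (intro conjI ballI allI)
   show "R3 11 = pos (Suc i)" by (simp add: R3_def pos_def)
   show "R3 12 = n + i" using r2 by (simp add: R3_def z_def)
   show "queue (n + i) [xn i, yn i, n + i] (R3, A3)"
    unfolding queue_def fst_conv snd_conv x_def[symmetric] y_def[symmetric] z_def[symmetric]
   proof (intro conjI allI impI)
    show "distinct [x, y, z]" using zx by auto
    show "R3 19 = length [x, y, z]" by (simp add: R3_def)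
    show "A3 6 0 j = [x, y, z] ! j" if "j < length [x, y, z]" for j using that by (auto simp: A3_def less_Suc_eq numeral_2_eq_2)
    show "(A3 3 v 0 = z) = (v \<in> set [x, y, z])" for v using I3[of v] by (auto simp: M3 z_def)
   qed
   fix a assume a: "a \<in> live (Suc i)"
   have "distinct (row A3 a) & set (row A3 a) = {b. rE (Suc i) a b}"
   proof (cases "a = z")
    case True then show ?thesis using rowz row3 lns by (simp add: z_def)
   next
    case False
    have al: "a \<in> live i" "z \<notin> live i" using a False live_Suc[OF i] sf(7) by (auto simp: z_def)
    \<comment> \<open>The new name does not occur in an old list, so appending it keeps the entries
      distinct.\<close>
    have zr: "z \<notin> set (row A a)" using Il[OF al(1)] rE_live[OF i'] al(2) by auto
    have an: "a \<in> set ns \<longleftrightarrow> rE (Suc i) z a" using lns by (simp add: z_def)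
    show ?thesis using rE_new[OF i a False[unfolded z_def], folded x_def y_def z_def] rowo[OF False] row3 Il[OF al(1)] zr an by auto
   qed
   then show "distinct (row A3 a)" "set (row A3 a) = {b. rE (Suc i) a b}" by auto
  next
   fix a assume "a \<in> {xn i, yn i}"
   then have a: "a = x | a = y" by (auto simp: x_def y_def)
   then have "a \<in> live i" "a ~= z" "a \<notin> set ns" using sf(8,9) zx by (auto simp: x_def y_def)
   then show "distinct (row A3 a)" "set (row A3 a) = {b. rE i a b}" using rowo row3 Il by auto
  next
   fix a assume a: "a \<in> live i"
   then have "a ~= z" using sf(7) unfolding z_def by metis
   then have "A3 0 a 0 = A 0 a 0" using Ao[of 0] by (simp add: A3_def A1_def)
   then show "A3 0 a 0 < n" "pn i (A3 0 a 0) = a" using Il[OF a] by auto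
  next
   have "A3 0 z 0 = A 0 x 0" using Ao[of 0] by (simp add: A3_def A1_def)
   then show "A3 0 (n + i) 0 < n" "pn i (A3 0 (n + i) 0) = xn i" using Il[OF sf(8)] by (auto simp: x_def z_def)
   show "A3 5 a b = (if a = n + i & b \<in> nbs i | b = n + i & a \<in> nbs i then 1 else A 5 a b)" for a b
    using A5[of a b] lns(2) by (simp add: A3_def z_def)
   show "A3 2 a 0 = A 2 a 0" for a using Ao[of 2] by (simp add: A3_def A1_def)
   show "A3 3 v 0 <= n + i" for v using I3[of v] by (simp add: M3 z_def)
  qed (rule eq3)
  define P where "P = mid Rb A i"
  have m': "P (R3, A3)" using m by (simp only: P_def)
  have b3: "3 <= B" "z <= B" using B(1) bB by (simp_all add: z_def)
  have "wpc xs C B c_s3 P (R2, A2)" using r2 m' posB b3 bB by (simp add: c_s3_def R3_def A3_def)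
  then have "wpc xs C B c_s3 (mid Rb A i) s" unfolding P_def Pair .
  then show ?thesis by (rule hl_wpc)
 qed
 show ?thesis
 proof (rule hl_Sq_le[OF s1], rule hl_Sq_le)
  fix s assume "s = (R1, A1)"
  then show "hl xs K W C B (For 31 (Var 15) c_red) (3 * Suc C + d * (t_red C d + 6) + 4) s ?P2" using s2 by simp
 next
  fix s assume "?P2 s"
  then show "hl xs K W C B (Sq c_s3 rest) (csz c_s3 * Suc C + \<tau>) s P" by (intro hl_Sq_le[OF s3 rest])
 qed
qed

text \<open>The search runs through old and new lists together. It stays within \<open>?NM\<close>,
  because old lists lead to live old parts and new lists to live new ones, and the degree is at most
  \<open>d\<close> in both graphs.\<close>

lemma second_half:
 assumes i: "Suc i < n" and Rb: "Rb 2 = n" "Rb 3 = fl" "Rb 4 = sl" "Rb 6 = l" "Rb 10 = 2 ^ (l + 2)" and I: "inv Rb i (R, A)" and m: "mid Rb A i (R3, A3)"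
 shows "hl xs K W C B (Sq (For 31 (Var 10) (For 32 (Var 19) c_round)) (c_gather \<sigma> M)) (t_bfs C d (2 ^ (l + 2)) + t_gather \<sigma> M C Q) (R3, A3) (inv Rb (Suc i))"
proof (rule hl_Sq_le)
 have i': "i < n" using i by simp
 note sf = step_facts[OF i]
 let ?q0 = "[xn i, yn i, n + i]" and ?NM = "insert (n + i) (live i)" and ?r = "2 ^ (l + 2) :: nat"
 let ?bfs = "%s. bfs_frame ?NM R3 A3 s & (\<exists>q. queue (n + i) q s & set q \<subseteq> ?NM & take 3 q = ?q0 & length q <= 3 * Suc d ^ ?r & {v. dle (rE (Suc i)) ?r (n + i) v} \<subseteq> set q)"
 have R3: "R3 12 = n + i" "R3 11 = pos (Suc i)" "queue (n + i) ?q0 (R3, A3)" "eqx ({11..21} \<union> {30..33}) R3 Rb" using m by (simp_all add: mid_def)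
 have rows: "!!a. a \<in> live (Suc i) ==> distinct (row A3 a) & set (row A3 a) = {b. rE (Suc i) a b}"
  "!!a. a = xn i | a = yn i ==> distinct (row A3 a) & set (row A3 a) = {b. rE i a b}" using m by (auto simp: mid_def)
 have reps: "!!a. a \<in> live i ==> A3 0 a 0 < n & pn i (A3 0 a 0) = a" "A3 0 (n + i) 0 < n" "pn i (A3 0 (n + i) 0) = xn i" using m by (auto simp: mid_def)
 have ra: "!!a b. A3 5 a b = (if a = n + i & b \<in> nbs i | b = n + i & a \<in> nbs i then 1 else A 5 a b)" using m by (simp add: mid_def)
 have T3: "!!a. A3 2 a 0 = A 2 a 0" and M3: "!!v. A3 3 v 0 <= n + i" using m by (simp_all add: mid_def)
 have IA: "!!a. a \<in> live i ==> A 2 a 0 = T_at i a" "!!a b. a \<in> live i ==> b \<in> live i ==> A 5 a b = of_bool (rE i a b)"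
  "!!a b. n + i <= a | n + i <= b ==> A 5 a b = 0" "!!a. n + i <= a ==> A 2 a 0 = 0" using I by (auto simp: inv_def)
 have NMl: "live (Suc i) \<subseteq> ?NM" unfolding live_Suc[OF i] by auto
 have xl: "w = xn i | w = yn i | w \<in> live (Suc i)" if "w \<in> ?NM" for w using that live_Suc[OF i] by auto
 show "hl xs K W C B (For 31 (Var 10) (For 32 (Var 19) c_round)) (t_bfs C d ?r) (R3, A3) ?bfs"
 proof (rule hl_bfs)
  show "set (row A3 w) \<subseteq> ?NM & A3 1 w 0 <= d" if w: "w \<in> ?NM" for w
  proof (cases "w \<in> live (Suc i)")
   case True
   then show ?thesis using rows(1)[OF True] rE_live[OF i, of w] NMl row_length[of A3 w "Suc i"] i by blast
  next
   case False
   then have "w = xn i | w = yn i" using xl[OF w] by simp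
   then show ?thesis using rows(2) rE_live[OF i', of w] row_length[of A3 w i] i' by blast
  qed
  show "3 * Suc d ^ ?r <= B" using Q by simp
  show "?r <= B" by (rule B(4))
  show "R3 10 = ?r" using eqxD[OF R3(4), of 10] Rb by simp
  fix k w u assume h: "dle (rE (Suc i)) k (n + i) w" "rE (Suc i) w u"
  have "w \<in> live (Suc i)" by (rule dle_live[OF i h(1) sf(13)])
  then show "u \<in> set (row A3 w)" using rows(1) h(2) by auto
 qed (use K R3 sf in auto)
 fix s assume bf: "?bfs s"
 show "hl xs K W C B (c_gather \<sigma> M) (t_gather \<sigma> M C Q) s (inv Rb (Suc i))"
 proof (cases s)
  case (Pair R4 A4)
  obtain q where q: "queue (n + i) q (R4, A4)" "set q \<subseteq> ?NM" "take 3 q = ?q0" "length q <= Q" "{v. dle (rE (Suc i)) ?r (n + i) v} \<subseteq> set q"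
   using bf Pair unfolding Q(1) by blast
  have fr: "bfs_frame ?NM R3 A3 (R4, A4)" using bf Pair by simp
  have A4: "!!c i j. c ~= 3 ==> c ~= 6 ==> A4 c i j = A3 c i j" and M4: "!!v. A4 3 v 0 <= n + i"
  proof -
   show "A4 c i j = A3 c i j" if "c ~= 3" "c ~= 6" for c i j using fr that by (simp add: bfs_frame_def)
   show "A4 3 v 0 <= n + i" for v using fr M3[of v] R3(1) unfolding bfs_frame_def by (metis order_refl snd_conv)
  qed
  have eq4: "eqx ({11..21} \<union> {30..33}) R4 Rb"
  proof (rule eqx_trans[OF _ R3(4)])
   show "eqx ({11..21} \<union> {30..33}) R4 R3" using fr unfolding bfs_frame_def by (auto intro: eqx_mono)
  qed
  have r4: "R4 2 = n" "R4 3 = fl" "R4 4 = sl" "R4 6 = l" using eqxD[OF eq4] Rb by auto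
  have r4': "R4 12 = n + i" "R4 11 = pos (Suc i)" using fr R3(1,2) by (auto simp: bfs_frame_def eqx_def)
  have rr: "A4 0 a b = A3 0 a b" "A4 5 a b = A3 5 a b" "A4 2 a b = A3 2 a b" "row A4 a = row A3 a" for a b using A4 by (simp_all add: row_def)
  define g where "g = (%j k. of_bool (q ! j < q ! k) + 2 * A4 5 (q ! j) (q ! k) + 4 * alf (A4 0 (q ! j) 0) (A4 0 (q ! k) 0))"
  define ifo where "ifo = concat (map (%j. map (g j) [0..<length q]) [0..<length q])"
  define ts where "ts = map (%j. A4 2 (q ! j) 0) [0..<length q]"
  have ra1: "A4 5 a b = of_bool (rE i a b)" if "a \<in> live i" "b \<in> live i" for a b
  proof -
   have "a ~= n + i" "b ~= n + i" using that sf(7) by metis+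
   then show ?thesis using ra[of a b] IA(2)[OF that] rr(2)[of a b] by simp
  qed
  have ra2: "A4 5 a b = of_bool (rE (Suc i) a b)" if ab: "a \<in> live (Suc i)" "b \<in> live (Suc i)" for a b
  proof -
   consider "a = n + i" | "b = n + i" "a ~= n + i" | "a ~= n + i" "b ~= n + i" by blast
   then show ?thesis
   proof cases
    case 1 then show ?thesis using ra[of a b] IA(3)[of a b] rr(2)[of a b] sf(6)[of "n + i"] by auto
   next
    case 2
    have "rE (Suc i) (n + i) a \<longleftrightarrow> rE (Suc i) a (n + i)" using rE_sym by blast
    then show ?thesis using 2 ra[of a b] IA(3)[of a b] rr(2)[of a b] by auto
   next
    case 3
    then have abl: "a \<in> live i" "b \<in> live i" "b ~= xn i" "b ~= yn i" using ab live_Suc[OF i] by auto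
    have "rE (Suc i) a b \<longleftrightarrow> rE i a b" using rE_new[OF i ab(1) 3(1)] abl(3,4) 3(2) by (auto split: if_splits)
    then show ?thesis using ra1[OF abl(1,2)] by simp
   qed
  qed
  have ra3: "A4 5 a b <= 1" if "a \<in> set q" "b \<in> set q" for a b
  proof -
   have "a \<in> ?NM" "b \<in> ?NM" using that q(2) by auto
   then consider "a \<in> live i" "b \<in> live i" | "a = n + i | b = n + i" by blast
   then show ?thesis
   proof cases
    case 1 then show ?thesis using ra1 by simp
   next
    case 2 then show ?thesis using ra[of a b] IA(3)[of a b] rr(2)[of a b] by auto
   qed
  qed
  have qd: "distinct q" using q(1) by (simp add: queue_def)
  have rp: "!!a. a \<in> live i ==> A4 0 a 0 < n & pn i (A4 0 a 0) = a" "A4 0 (n + i) 0 < n" using reps rr by auto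
  have Tl: "!!a. a \<in> live i ==> A4 2 a 0 = T_at i a" using rr T3 IA(1) by auto
  have gg: "!!j k. g j k = of_bool (q ! j < q ! k) + 2 * A4 5 (q ! j) (q ! k) + 4 * alf (A4 0 (q ! j) 0) (A4 0 (q ! k) 0)" by (simp add: g_def)
  have ty1: "upd M l (length q, ifo) ts j = T_at (Suc i) (q ! j)" if "j < length q" "q ! j \<in> live (Suc i)" for j
   by (rule types_after_step(1)[OF i qd q(3,2,5), where rp="%a. A4 0 a 0" and ra="A4 5" and T="%a. A4 2 a 0" and g=g and ifo=ifo and ts=ts]) (rule rp ra1 ra2 ra3 Tl gg ifo_def ts_def that; assumption)+
  have ty2: "upd M l (length q, ifo) ts j <= mx" if "j < length q" for j
   by (rule types_after_step(2)[OF i qd q(3,2,5), where rp="%a. A4 0 a 0" and ra="A4 5" and T="%a. A4 2 a 0" and g=g and ifo=ifo and ts=ts]) (rule rp ra1 ra2 ra3 Tl gg ifo_def ts_def that; assumption)+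
  have ty3: "A4 2 a 0 = T_at (Suc i) a" if "a \<in> live (Suc i)" "a \<notin> set q" for a
   by (rule types_after_step(3)[OF i qd q(3,2,5), where rp="%a. A4 0 a 0" and ra="A4 5" and T="%a. A4 2 a 0" and g=g and ifo=ifo and ts=ts]) (rule rp ra1 ra2 ra3 Tl gg ifo_def ts_def that; assumption)+
  note ty = ty1 ty2 ty3
  have qNM: "q ! j \<in> ?NM" if "j < length q" for j using q(2) nth_mem[OF that] by blast
  show ?thesis unfolding Pair
  proof (rule hl_mono[OF gather[where q=q and g=g and ifo=ifo and ts=ts, OF r4 _ qd]])
   fix s' assume h: "eqx {20, 21, 31, 32} (fst s') R4 & (\<forall>j<length q. snd s' 2 (q ! j) 0 = upd M l (length q, ifo) ts j) \<and>
    (\<forall>c a b. c ~= 2 | a \<notin> set q --> snd s' c a b = A4 c a b)"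
   have S: "!!c a b. c ~= 2 ==> snd s' c a b = A4 c a b" "!!a b. a \<notin> set q ==> snd s' 2 a b = A4 2 a b" using h by auto
   have S4: "row (snd s') a = row A3 a" for a
   proof -
    have "snd s' 1 a 0 = A4 1 a 0" "snd s' 4 a = A4 4 a" using S(1)[of 1] S(1)[of 4] by auto
    then have "row (snd s') a = row A4 a" by (simp add: row_def)
    then show ?thesis using rr(4) by simp
   qed
   have imz: "pn (Suc i) u = im i (pn i u)" if "u < n" for u by (rule pn_Suc[OF i that])
   show "inv Rb (Suc i) s'"
    unfolding inv_def
   proof (intro conjI ballI allI impI)
    show "eqx ({11..21} \<union> {30..33}) (fst s') Rb"
    proof (rule eqx_trans[OF _ eq4])
     show "eqx ({11..21} \<union> {30..33}) (fst s') R4" using h by (auto intro: eqx_mono)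
    qed
    show "fst s' 11 = pos (Suc i)" "fst s' 12 = (if Suc i = 0 then 0 else n + Suc i - 1)" using h r4' by (auto simp: eqx_def)
   next
    fix a assume a: "a \<in> live (Suc i)"
    show "distinct (row (snd s') a)" "set (row (snd s') a) = {b. rE (Suc i) a b}" using rows(1)[OF a] S4 by simp_all
    have "A4 0 a 0 < n & pn (Suc i) (A4 0 a 0) = a"
    proof (cases "a = n + i")
     case True
     then show ?thesis using reps(2,3) imz rr(1) by (simp add: im_def)
    next
     case False
     then have "a \<in> live i" "a ~= xn i" "a ~= yn i" using a live_Suc[OF i] by auto
     then show ?thesis using rp(1)[of a] imz by (simp add: im_def)
    qed
    then show "snd s' 0 a 0 < n" "pn (Suc i) (snd s' 0 a 0) = a" using S(1)[of 0] by simp_all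
    show "snd s' 2 a 0 = T_at (Suc i) a"
    proof (cases "a \<in> set q")
     case True
     then obtain j where j: "j < length q" "a = q ! j" by (auto simp: in_set_conv_nth)
     then show ?thesis using ty(1)[OF j(1)] a h by auto
    next
     case False then show ?thesis using ty(3)[OF a False] S(2) by simp
    qed
    fix b assume "b \<in> live (Suc i)"
    then show "snd s' 5 a b = of_bool (rE (Suc i) a b)" using ra2[OF a] S(1)[of 5] by simp
   next
    fix a b assume "n + Suc i <= a | n + Suc i <= b"
    then have "A3 5 a b = 0" using ra[of a b] IA(3)[of a b] sf(6)[of a] sf(6)[of b] live_lt[OF i', of a] live_lt[OF i', of b] by auto
    then show "snd s' 5 a b = 0" using S(1)[of 5] rr(2) by simp
   next
    fix a assume a: "n + Suc i <= a"
    have "a \<notin> set q" using q(2) live_lt[OF i', of a] a by auto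
    then show "snd s' 2 a 0 = 0" using S(2) rr(3) T3 IA(4)[of a] a by simp
   next
    show "snd s' 3 v 0 < n + Suc i" for v using M4[of v] S(1)[of 3] by simp
   qed
  next
   fix j assume j: "j < length q"
   show "A4 0 (q ! j) 0 < n" using qNM[OF j] rp by auto
   show "A4 2 (q ! j) 0 <= mx"
   proof (cases "q ! j \<in> live i")
    case True then show ?thesis using Tl tb[OF i'] by simp
   next
    case False
    then have "q ! j = n + i" using qNM[OF j] by simp
    then show ?thesis using rr(3) T3 IA(4) by simp
   qed
   show "upd M l (length q, ifo) ts j <= B" using ty(2)[OF j] mx(2) by linarith
  qed (use q ra3 in \<open>auto simp: queue_def g_def ifo_def ts_def\<close>)
 qed
qed

lemma step:
 assumes i: "Suc i < n" and Rb: "Rb 2 = n" "Rb 3 = fl" "Rb 4 = sl" "Rb 6 = l" "Rb 10 = 2 ^ (l + 2)" and I: "inv Rb i (R, A)"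
 shows "hl xs K W C B (c_step \<sigma> M) (t_step \<sigma> M C d (2 ^ (l + 2))) (R(30 := i), A) (inv Rb (Suc i))"
 unfolding c_step_def t_step_def Q(1)[symmetric]
proof (rule first_half[OF i Rb(1) I])
 fix s assume "mid Rb A i s"
 then show "hl xs K W C B (Sq (For 31 (Var 10) (For 32 (Var 19) c_round)) (c_gather \<sigma> M)) (t_bfs C d (2 ^ (l + 2)) + t_gather \<sigma> M C Q) s (inv Rb (Suc i))"
  using second_half[OF i Rb I, of "fst s" "snd s"] by simp
qed

end

section \<open>Bounds in terms of rank and width\<close>

lemma PR_pe: "PR f ==> PR g ==> PR (%x. prod_encode (f x, g x))"
 using PR_cd[OF PR_Pair, of f g] by (simp add: cd_nat_def)

text \<open>A node consists of the type of its skipping child and a list indexed by child types. If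
  these are at most \<open>y\<close>, the list has at most \<open>Suc y\<close> entries, each a
  capped count and so at most \<open>M\<close>.\<close>

definition tbr :: "nat => nat => nat => nat" where
 "tbr M L k = rec_nat L (%_ y. Suc (prod_encode (y, list_encode (replicate (Suc y) M)))) k"

lemma ty_bound:
 assumes M: "M > 0" and lm: "!!a. length a = l ==> lm a <= L"
 shows "length a + k = l ==> ty M U lm k a <= tbr M L k"
proof (induction k arbitrary: a)
 case 0 then show ?case using lm by (simp add: tbr_def)
next
 case (Suc k)
 let ?m = "%\<kappa>. if \<kappa> = 0 then 0 else card {b \<in> U. ty M U lm k (Some b # a) = \<kappa>}"
 have c: "ty M U lm k (x # a) <= tbr M L k" for x using Suc.IH[of "x # a"] Suc.prems by simp
 have "?m \<kappa> = 0" if "Suc (tbr M L k) <= \<kappa>" for \<kappa>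
 proof -
  have "ty M U lm k (Some b # a) ~= \<kappa>" for b using c[of "Some b"] that by linarith
  then have e: "{b \<in> U. ty M U lm k (Some b # a) = \<kappa>} = {}" by blast
  show ?thesis unfolding e by simp
 qed
 then have "top_of ?m <= Suc (tbr M L k)" unfolding top_of_def by (intro Least_le) blast
 then have "cd (mcode M ?m) <= list_encode (replicate (Suc (tbr M L k)) M)"
  unfolding cd_nat_list by (intro list_encode_mono) (auto simp: mcode_def cap_le[OF M])
 then have "nd M (ty M U lm k (None # a)) ?m <= Suc (prod_encode (tbr M L k, list_encode (replicate (Suc (tbr M L k)) M)))"
  using c[of None] by (simp add: nd_def cd_nat_def prod_encode_mono)
 then show ?case by (simp add: tbr_def)
qed

text \<open>Ranks are bounded by the size of a ball of radius \<open>2 ^ l\<close>, which is at most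
  \<open>Suc d ^ (2 ^ l)\<close> (\<open>dle_card\<close>).\<close>

definition leaf_bd :: "signature => nat => nat => nat" where
 "leaf_bd \<sigma> l d = Suc (prod_encode (list_encode (replicate l (Suc (Suc d ^ (2 ^ l)))), list_encode (replicate (l * l) (2 * 2 ^ length \<sigma>))))"

text \<open>The second summand makes room for the pair numbers of the neighbourhood: two bits and
  four times an atom code.\<close>

definition mxf :: "signature => nat => nat => nat => nat" where
 "mxf \<sigma> M l d = tbr M (leaf_bd \<sigma> l d) l + (3 + 4 * 2 ^ length \<sigma>)"

lemma (in contraction) dle_card: "i < n ==> finite {v. dle (rE i) k a v} & card {v. dle (rE i) k a v} <= Suc d ^ k"
proof (induction k)
 case 0
 have "{v. dle (rE i) 0 a v} = {a}" by auto
 then show ?case by simp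
next
 case (Suc k)
 let ?S = "{v. dle (rE i) k a v}"
 have S: "finite ?S" "card ?S <= Suc d ^ k" using Suc by simp_all
 have e: "{v. dle (rE i) (Suc k) a v} = ?S \<union> (\<Union>c\<in>?S. {b. rE i c b})" by auto
 have "card (\<Union>c\<in>?S. {b. rE i c b}) <= (\<Sum>c\<in>?S. card {b. rE i c b})" using S(1) by (rule card_UN_le)
 also have "\<dots> <= card ?S * d" using sum_bounded_above[of ?S "%c. card {b. rE i c b}" d] degree[OF Suc.prems] by simp
 finally have "card {v. dle (rE i) (Suc k) a v} <= card ?S + card ?S * d" unfolding e using card_Un_le[of ?S "\<Union>c\<in>?S. {b. rE i c b}"] by linarith
 also have "\<dots> = card ?S * Suc d" by simp
 also have "\<dots> <= Suc d ^ k * Suc d" using S(2) by (rule mult_le_mono1)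
 finally show ?case unfolding e using S(1) degree[OF Suc.prems] by (auto simp: mult.commute)
qed

lemma (in contraction) part_type_bound:
 assumes M: "M > 0" and i: "i < n"
 shows "part_type M l (atom_code \<sigma> S) {..<n} (pn i) (rE i) a <= mxf \<sigma> M l d"
proof -
 have rk: "rk l (rE i) a v <= Suc d ^ (2 ^ l)" for v
 proof -
  have "rk l (rE i) a v <= card {v. dle (rE i) (2 ^ l) a v}" unfolding rk_def by (rule card_mono) (use dle_card[OF i] in auto)
  then show ?thesis using dle_card[OF i, of "2 ^ l" a] by linarith
 qed
 have lb: "lam l (atom_code \<sigma> S) (pn i) (rE i) a c <= leaf_bd \<sigma> l d" if c: "length c = l" for c
 proof -
  let ?r = "map (%x. case x of None => 0 | Some u => Suc (rk l (rE i) a (pn i u))) c"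
  let ?p = "concat (map (%x. map (%y. pinfo (atom_code \<sigma> S) (c ! x) (c ! y)) [0..<l]) [0..<l])"
  have "list_encode ?r <= list_encode (replicate l (Suc (Suc d ^ (2 ^ l))))"
   by (rule list_encode_mono) (use c rk in \<open>auto split: option.splits\<close>)
  moreover have "list_encode ?p <= list_encode (replicate (l * l) (2 * 2 ^ length \<sigma>))"
  proof (rule list_encode_mono)
   have "length (concat (map (%x. map (f x) [0..<l]) [0..<k])) = k * l" for f :: "nat => nat => nat" and k by (induction k) auto
   then show "length ?p <= l * l" by simp
   fix y assume "y \<in> set ?p"
   then obtain u v where y: "y = pinfo (atom_code \<sigma> S) u v" by auto
   have al: "atom_code \<sigma> S u v < 2 ^ length \<sigma>" for u v unfolding atom_code_def by (rule binary_sum_lt)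
   have "Suc (2 * atom_code \<sigma> S u v + of_bool (u = v)) <= 2 * 2 ^ length \<sigma>" for u v
   proof -
    have "of_bool (u = v) <= (1::nat)" by simp
    then show ?thesis using al[of u v] by linarith
   qed
   then show "y <= 2 * 2 ^ length \<sigma>" unfolding y pinfo_def by (auto split: option.splits)
  qed
  ultimately show ?thesis unfolding lam_def leaf_def leaf_bd_def cd_pair cd_nat_list by (simp add: prod_encode_mono)
 qed
 have "ty M {..<n} (lam l (atom_code \<sigma> S) (pn i) (rE i) a) l [] <= tbr M (leaf_bd \<sigma> l d) l"
  by (rule ty_bound[where l=l, OF M lb]) simp_all
 then show ?thesis unfolding part_type_def mxf_def by (rule trans_le_add1)
qed

lemma formula_code_le:
 assumes P: "!!p. p \<in> Mods ==> p <= P"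
 shows "formula \<sigma> Mods m \<phi> ==> x \<in> set (formula_code \<phi>) ==> x <= 8 + length \<sigma> + P + m + quantifier_rank \<phi>"
proof (induction \<phi> arbitrary: m)
 case (Rel k ys)
 then have "x = 1 | x < length \<sigma> | x < m" by auto
 then show ?case by auto
next
 case (Equal y z)
 then have "x = 2 | x < m" by auto
 then show ?case by auto
next
 case (Neg \<phi>) then show ?case using Neg.IH[of m] by auto
next
 case (Conj \<phi> \<psi>)
 have f: "formula \<sigma> Mods m \<phi>" "formula \<sigma> Mods m \<psi>" using Conj.prems(1) by simp_all
 have "x = 4 | x \<in> set (formula_code \<phi>) | x \<in> set (formula_code \<psi>)" using Conj.prems(2) by auto
 then show ?case using Conj.IH(1)[OF f(1)] Conj.IH(2)[OF f(2)] by (auto simp: max_def)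
next
 case (Disj \<phi> \<psi>)
 have f: "formula \<sigma> Mods m \<phi>" "formula \<sigma> Mods m \<psi>" using Disj.prems(1) by simp_all
 have "x = 5 | x \<in> set (formula_code \<phi>) | x \<in> set (formula_code \<psi>)" using Disj.prems(2) by auto
 then show ?case using Disj.IH(1)[OF f(1)] Disj.IH(2)[OF f(2)] by (auto simp: max_def)
next
 case (Exists \<phi>) then show ?case using Exists.IH[of "Suc m"] by auto
next
 case (Forall \<phi>) then show ?case using Forall.IH[of "Suc m"] by auto
next
 case (ExistsMod i p \<phi>)
 have p: "p <= P" "i < p" "formula \<sigma> Mods (Suc m) \<phi>" using ExistsMod.prems P by auto
 have "x = 8 | x = i | x = p | x \<in> set (formula_code \<phi>)" using ExistsMod.prems by auto
 then show ?case using ExistsMod.IH[OF p(3)] p(1,2) by auto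
qed simp

lemma qprefix_mods: "formula \<sigma> Mods m \<phi> ==> q \<in> set (qprefix \<phi>) ==> (!!p. p \<in> Mods ==> p <= P) ==>
  fst q <= 8 & fst (snd q) <= P & snd (snd q) <= P"
proof (induction \<phi> arbitrary: m)
 case (ExistsMod i p \<phi>)
 have p: "p <= P" "i < p" "formula \<sigma> Mods (Suc m) \<phi>" using ExistsMod.prems by auto
 then show ?case using ExistsMod.IH[OF p(3) _ ExistsMod.prems(3)] ExistsMod.prems(2) by auto
qed auto

definition F_rad :: "nat => nat" where "F_rad l = 2 ^ (l + 2)"
definition F_init :: "nat => nat \<times> nat => nat" where "F_init M p = init_fun M (fst p) ((fst p, snd p), [])"
definition F_ev :: "nat \<times> nat list \<times> (nat \<times> nat \<times> nat) list \<times> nat => nat" where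
 "F_ev p = ev_fun (fst p) (rev (fst (snd p)), rev (fst (snd (snd p))), snd (snd (snd p)))"

lemma PR_F: "PR F_rad" "PR (F_init M)" "PR F_ev" "PR (F_num \<sigma>)"
 unfolding F_rad_def F_init_def F_ev_def F_num_def by (intro PR_init_fun PR_ev_fun PR_intros)+

text \<open>The formula phase has a constant of its own, depending on \<open>l\<close> only: its
  cost is charged to \<open>gf\<close>, which must not depend on \<open>d\<close>.\<close>

definition C1f :: "signature => nat => nat" where
 "C1f \<sigma> l = bnd (f_ar \<sigma>) (length \<sigma>) + bnd (nf (F_val \<sigma>)) (prod_encode (l, prod_encode (prod_encode (F_num \<sigma> l, 2 ^ length \<sigma>), prod_encode (2, prod_encode (length \<sigma>, prod_encode (l, l)))))) +
  bnd (nf (F_num \<sigma>)) l"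
definition Qf :: "nat => nat => nat" where "Qf l d = 3 * Suc d ^ (2 ^ (l + 2))"
definition Xf :: "signature => nat => nat => nat => nat" where "Xf \<sigma> M l d = list_encode (replicate (Qf l d * Qf l d) (mxf \<sigma> M l d))"
definition Xq :: "nat => nat => nat" where "Xq M l = list_encode (replicate l (prod_encode (8, prod_encode (M, M))))"
definition XBf :: "signature => nat => nat" where "XBf \<sigma> l = list_encode (replicate (F_num \<sigma> l) 1)"
definition C2f :: "signature => nat => nat => nat => nat" where
 "C2f \<sigma> M l d = C1f \<sigma> l + bnd (nf (F_upd M)) (prod_encode (l, prod_encode (Qf l d, prod_encode (Xf \<sigma> M l d, prod_encode (Xf \<sigma> M l d, Qf l d))))) +
  bnd (nf F_rad) l + bnd (nf (F_init M)) (prod_encode (l, 2 ^ length \<sigma>)) + bnd (nf F_ev) (prod_encode (l, prod_encode (XBf \<sigma> l, prod_encode (Xq M l, mxf \<sigma> M l d))))"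

lemma PR_num: "PR f ==> PR (%x. F_num \<sigma> (f x))" by (rule PR_comp[OF PR_F(4)])

lemma PR_tbr: assumes "PR f" "PR g" shows "PR (%x. tbr M (f x) (g x))"
 unfolding tbr_def by (intro PR_rec PR_pe PR_intros assms)

lemma PR_C1f: assumes "PR f" shows "PR (%x. C1f \<sigma> (f x))"
 unfolding C1f_def by (intro PR_add PR_bnd f_ar(1) nf(1) PR_F PR_F_val PR_pe PR_num PR_const assms)

lemma PR_mxf: assumes "PR f" "PR g" shows "PR (%x. mxf \<sigma> M (f x) (g x))"
 unfolding mxf_def leaf_bd_def by (intro PR_tbr PR_pe PR_intros assms)
lemma PR_Qf: assumes "PR f" "PR g" shows "PR (%x. Qf (f x) (g x))"
 unfolding Qf_def by (intro PR_intros assms)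
lemma PR_Xf: assumes "PR f" "PR g" shows "PR (%x. Xf \<sigma> M (f x) (g x))"
 unfolding Xf_def by (intro PR_list_encode PR_replicate PR_mult PR_Qf PR_mxf assms)
lemma PR_Xq: assumes "PR f" shows "PR (%x. Xq M (f x))"
 unfolding Xq_def by (intro PR_list_encode PR_replicate PR_const assms)
lemma PR_XBf: assumes "PR f" shows "PR (%x. XBf \<sigma> (f x))"
 unfolding XBf_def by (intro PR_list_encode PR_replicate PR_num PR_const assms)
lemma PR_C2f: assumes "PR f" "PR g" shows "PR (%x. C2f \<sigma> M (f x) (g x))"
 unfolding C2f_def by (intro PR_add PR_bnd nf(1) PR_F PR_F_upd PR_pe PR_C1f PR_Qf PR_Xf PR_XBf PR_Xq PR_mxf PR_const assms)

section \<open>The whole program and its time bounds\<close>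

definition c_init :: "signature => com" where
 "c_init \<sigma> = Sq (Asg 2 (Inp (Cst 0))) (Sq (Asg 3 (Inp (Cst 1))) (Sq (Asg 4 (Inp (Cst 2))) (Sq (Asg 22 (nulx \<sigma> (length \<sigma>))) (Asg 5 (Cst 3)))))"
definition c_pre :: com where "c_pre = Sq (Asg 10 (Ap (nf F_rad) (Var 6))) (Asg 11 (plus (Cst 3) (Var 3)))"
definition b_part :: "signature => nat => com" where
 "b_part \<sigma> M = Sq (Sto 0 (Var 30) (Cst 0) (Var 30)) (Sto 2 (Var 30) (Cst 0) (Ap (nf (F_init M)) (Pr (Var 6) (atomx \<sigma> (Var 30) (Var 30) (length \<sigma>)))))"
definition c_fin :: com where
 "c_fin = Asg 0 (Ap (nf F_ev) (Pr (Var 6) (Pr (Var 24) (Pr (Var 7) (Arr 2 (Var 12) (Cst 0))))))"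
definition c_main :: "signature => nat => com" where
 "c_main \<sigma> M = Sq (c_init \<sigma>) (Sq (For 30 (Var 3) (b_parse \<sigma>)) (Sq (Sq (Asg 24 (Cst 0)) (c_bits \<sigma>)) (Sq c_pre (Sq (For 30 (Var 2) (b_part \<sigma> M))
  (Sq (For 30 (Bin Sub (Var 2) (Cst 1)) (c_step \<sigma> M)) c_fin)))))"

definition gf :: "signature => nat => nat" where
 "gf \<sigma> l = csz (b_parse \<sigma>) * Suc (C1f \<sigma> l) + 6 + F_num \<sigma> l * (63 * Suc (C1f \<sigma> l) + 4 + (csz (b_tok \<sigma>) * Suc (C1f \<sigma> l) + 6) + 6) + 10"
text \<open>Costs that are paid once, while \<open>beta\<close> collects those paid per element or
  merge. The last summand contains all constants of the construction, so that the time bound exceeds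
  them. Multiplying the fixed costs by \<open>n\<close> is allowed since
  \<open>n >= 1\<close>.\<close>

definition alpha :: "signature => nat => nat => nat => nat" where
 "alpha \<sigma> M l d = csz (c_init \<sigma>) * Suc (C1f \<sigma> l) + (3 * Suc (C1f \<sigma> l) + 4) + (14 * Suc (C1f \<sigma> l) + 4) + csz c_pre * Suc (C2f \<sigma> M l d) + (3 * Suc (C2f \<sigma> M l d) + 4) +
  (9 * Suc (C2f \<sigma> M l d) + 4) + csz c_fin * Suc (C2f \<sigma> M l d) + esz (lenx \<sigma>) * Suc (C2f \<sigma> M l d) + 2 +
  (C2f \<sigma> M l d + mxf \<sigma> M l d + Xf \<sigma> M l d + Qf l d + XBf \<sigma> l + Xq M l + F_num \<sigma> l + d + l + 2 ^ (l + 2) + 2 ^ length \<sigma> + M + length \<sigma> + 20)"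
definition beta :: "signature => nat => nat => nat => nat" where
 "beta \<sigma> M l d = csz (b_part \<sigma> M) * Suc (C2f \<sigma> M l d) + 6 + t_step \<sigma> M (C2f \<sigma> M l d) d (2 ^ (l + 2)) + 6"
definition ff :: "signature => nat => nat => nat => nat" where "ff \<sigma> M l d = alpha \<sigma> M l d + beta \<sigma> M l d"

lemma computable_gf: "computable1 (gf \<sigma>)"
proof (rule computable1_PR)
 show "PR (gf \<sigma>)" unfolding gf_def by (intro PR_add PR_mult PR_Suc PR_C1f PR_num PR_const PR_id)
qed

text \<open>The chosen bounds \<open>bnd\<close> are primitive recursive, and so is every cost built
  from them.\<close>

lemma computable_ff: "computable2 (ff \<sigma> M)"
proof (rule computable2_PR)
 have "PR (%p. t_step \<sigma> M (C2f \<sigma> M (fst p) (snd p)) (snd p) (2 ^ (fst p + 2)))"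
  unfolding t_step_def t_red_def t_bfs_def t_round_def t_gather_def
  by (intro PR_const PR_add PR_mult PR_Suc PR_power PR_C2f PR_fst PR_snd PR_id)
 then show "PR (%p. ff \<sigma> M (fst p) (snd p))" unfolding ff_def alpha_def beta_def
  by (intro PR_const PR_add PR_mult PR_Suc PR_power PR_C1f PR_C2f PR_mxf PR_Xf PR_Qf PR_XBf PR_Xq PR_num PR_fst PR_snd PR_id)
qed

lemma evars_lenx: "evars (lenx \<sigma>) = {}"
proof -
 have "evars (foldr (%a b. plus (if a = 0 then Cst 1 else if a = 1 then Inp (Cst 0) else times (Inp (Cst 0)) (Inp (Cst 0))) b) as (Cst 0)) = {}" for as :: "nat list"
  by (induction as) (auto simp: plus_def times_def)
 then show ?thesis by (simp add: lenx_def plus_def)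
qed

lemma asgs_main: "1 \<notin> asgs (c_main \<sigma> M)"
 by (simp add: c_main_def c_init_def b_parse_def c_bits_def b_tok_def c_conn_def c_atom_def c_pre_def b_part_def c_step_def c_s1_def c_red_def c_filter_def
   c_s3_def c_round_def c_ext_def c_gather_def c_ts_def c_inf_def b_inf_def b_upd_def c_fin_def)

text \<open>The formula phase, timed with \<open>C1\<close>, and the merge phase, timed with
  \<open>C\<close>, share words, arrays and the bound \<open>B\<close>.\<close>

locale total = machine \<sigma> S n d Ps \<phi> l M K W C B mx X Q + fm: formula_machine \<sigma> S n d Ps \<phi> Mods l K W C1 B NA
 for \<sigma> S n d Ps \<phi> l M K W C B mx X Q Mods C1 NA +
 assumes C1: "C1 <= C" "C <= B" and NA: "NA = F_num \<sigma> l" "NA <= B" "bnd (nf (F_num \<sigma>)) l <= C1" and XB: "list_encode (replicate NA 1) <= B"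
  and CR: "bnd (nf F_rad) l <= C" and CI: "bnd (nf (F_init M)) (prod_encode (l, 2 ^ length \<sigma>)) <= C"
  and CE: "bnd (nf F_ev) (prod_encode (l, prod_encode (list_encode (replicate NA 1), prod_encode (Xq M l, mx)))) <= C"
  and qX: "list_encode (rev (map cd (qprefix \<phi>))) <= Xq M l" and Mods: "!!p. p \<in> Mods ==> p dvd M"
begin

definition Ri :: "nat => nat" where
 "Ri = (%r. if r = 1 then length xs else 0)(2 := n, 3 := fl, 4 := sl, 22 := nul_code \<sigma> S, 5 := 3)"

lemma hl_init: "hl xs K W C1 B (c_init \<sigma>) (csz (c_init \<sigma>) * Suc C1) (%r. if r = 1 then length xs else 0, %_ _ _. 0) (%s. s = (Ri, %_ _ _. 0))"
proof (rule hl_wpc)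
 let ?R = "(%r. if r = 1 then length xs else 0)(2 := n, 3 := fl, 4 := sl)"
 have nu: "val xs (?R, %_ _ _. 0) (nulx \<sigma> (length \<sigma>)) = nul_code \<sigma> S" "eok xs C1 (?R, %_ _ _. 0) (nulx \<sigma> (length \<sigma>))"
  by (rule nulx; simp)+
 have "nul_code \<sigma> S < 2 ^ length \<sigma>" unfolding nul_code_def by (rule binary_sum_lt)
 then have nB: "nul_code \<sigma> S <= B" using fm.B(4) by linarith
 have b: "n <= B" "fl <= B" "sl <= B" "3 <= B" using fm.B(1) B(1) by simp_all
 show "wpc xs C1 B (c_init \<sigma>) (%s. s = (Ri, %_ _ _. 0)) (%r. if r = 1 then length xs else 0, %_ _ _. 0)"
  using nu nB b by (simp add: c_init_def Ri_def)
qed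

definition after_bits :: "state => bool" where
 "after_bits s \<longleftrightarrow> fst s 2 = n & fst s 3 = fl & fst s 4 = sl & fst s 6 = l & fst s 12 = 0 & fst s 7 = list_encode (rev (map cd (qprefix \<phi>))) \<and>
  (\<exists>bs. fm.bits bs & length bs = NA & fst s 24 = list_encode (rev bs)) & (\<forall>c i j. c ~= 7 --> c ~= 8 --> snd s c i j = 0)"

lemma hl_bits': assumes p: "fm.pinv Ri fl s"
 shows "hl xs K W C1 B (Sq (Asg 24 (Cst 0)) (c_bits \<sigma>)) (5 * Suc C1 + (9 * Suc C1 + NA * (t_toks \<sigma> C1 (length (toks (matrix \<phi>))) + 6) + 4)) s after_bits"
proof (cases s)
 case (Pair R A)
 note e = eqxD[OF p[unfolded fm.pinv_def Pair, THEN conjunct1], simplified]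
 have lf: "length (toks \<phi>) <= fl" "l <= fl" using fm.tok_count fm.tks_nth(3) by linarith+
 have r: "R 6 = l" "R 7 = list_encode (rev (map cd (qprefix \<phi>)))" "R 8 = length (toks (matrix \<phi>))"
  using p lf fm.lq fm.tks_nth(3) by (simp_all add: fm.pinv_def Pair)
 have r': "R 22 = nul_code \<sigma> S" "R 2 = n" "R 3 = fl" "R 4 = sl" "R 12 = 0" using e by (simp_all add: Ri_def)
 have A7: "A 7 0 h = fm.tp (l + h)" if "h < length (toks (matrix \<phi>))" for h
  using p that lf fm.tks_nth(3) by (simp add: fm.pinv_def Pair)
 have Az: "A c i j = 0" if "c ~= 7" for c i j using p that by (simp add: fm.pinv_def Pair)
 have 1: "hl xs K W C1 B (Asg 24 (Cst 0)) (5 * Suc C1) s (%s. s = (R(24 := 0), A))"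
  unfolding Pair by (rule hl_mono[OF hl_wpc[where Q="%s. s = (R(24 := 0), A)"]]) auto
 have 2: "hl xs K W C1 B (c_bits \<sigma>) (9 * Suc C1 + NA * (t_toks \<sigma> C1 (length (toks (matrix \<phi>))) + 6) + 4) (R(24 := 0), A) after_bits"
 proof (rule hl_mono[OF fm.hl_bits])
  fix s' assume h: "eqx {9, 16, 24, 25, 26, 27, 28, 31, 32} (fst s') (R(24 := 0)) & (\<forall>c i j. c ~= 8 --> snd s' c i j = A c i j) \<and>
   (\<exists>bs. fm.bits bs & length bs = NA & fst s' 24 = list_encode (rev bs))"
  note e' = eqxD[OF h[THEN conjunct1], simplified]
  show "after_bits s'" unfolding after_bits_def using e' h r r' Az by simp
 qed (use PR_F NA XB r r' A7 Az in auto)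
 show ?thesis by (rule hl_Sq_le[OF 1]) (use 2 in simp)
qed

lemma hl_parts:
 assumes R: "R5 2 = n" "R5 3 = fl" "R5 4 = sl" "R5 6 = l" "R5 11 = 3 + fl" "R5 12 = 0" and A: "!!c i j. c ~= 7 ==> c ~= 8 ==> A5 c i j = 0"
 shows "hl xs K W C B (For 30 (Var 2) (b_part \<sigma> M)) (3 * Suc C + n * (csz (b_part \<sigma> M) * Suc C + 6) + 4) (R5, A5) (inv R5 0)"
proof -
 have n1: "0 < n" using n by simp
 let ?I = "%j (s :: state). eqx {30} (fst s) R5 & (\<forall>v<j. snd s 0 v 0 = v & snd s 2 v 0 = T_at 0 v) & (\<forall>v\<ge>j. snd s 2 v 0 = 0) \<and>
  (\<forall>c i k. c ~= 0 & c ~= 2 & c ~= 7 & c ~= 8 --> snd s c i k = 0)"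
 have "hl xs K W C B (For 30 (Var 2) (b_part \<sigma> M)) (esz (Var 2) * Suc C + n * (csz (b_part \<sigma> M) * Suc C + 6) + 4) (R5, A5) (inv R5 0)"
 proof (rule hl_For[where m=n and I="?I"])
  fix j R A assume j: "j < n" and I: "?I j (R, A)"
  note e = eqxD[OF I[THEN conjunct1], simplified]
  show "hl xs K W C B (b_part \<sigma> M) (csz (b_part \<sigma> M) * Suc C) (R(30 := j), A) (?I (Suc j))"
  proof (rule hl_wpc)
   define A' where "A' = aup A 0 j 0 j"
   let ?s = "(R(30 := j), A')"
   have at: "val xs ?s (atomx \<sigma> (Var 30) (Var 30) (length \<sigma>)) = alf j j" "eok xs C ?s (atomx \<sigma> (Var 30) (Var 30) (length \<sigma>))"
    using atomx[of "R(30 := j)" C A' "Var 30" "Var 30"] e R j by simp_all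
   have "alf j j < 2 ^ length \<sigma>" unfolding atom_code_def by (rule binary_sum_lt)
   then have "bnd (nf (F_init M)) (prod_encode (l, alf j j)) <= bnd (nf (F_init M)) (prod_encode (l, 2 ^ length \<sigma>))"
    by (intro bnd_mono nf(1) PR_F prod_encode_mono) auto
   then have c: "bnd (nf (F_init M)) (prod_encode (l, alf j j)) <= C" using CI by linarith
   have rE0: "rE 0 = (%_ _. False)" using rE_0 by blast
   have v: "nf (F_init M) (prod_encode (l, alf j j)) = T_at 0 j"
    using nf(2)[OF PR_F(2)[of M], of "(l, alf j j)"] init_fun_correct[of "{..<n}" j "pn 0" M l alf] j pn_0 by (simp add: F_init_def cd_nat_def rE0)
   have vB: "T_at 0 j <= B" using tb[OF n1, of j] mx(2) by linarith
   have jB: "j <= B" using B(1) j by linarith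
   show "wpc xs C B (b_part \<sigma> M) (?I (Suc j)) (R(30 := j), A)"
    using at[unfolded A'_def] c v vB jB nf(1)[OF PR_F(2)] e R I by (auto simp: b_part_def less_Suc_eq)
  qed
 next
  fix s assume I: "?I n s"
  note e = eqxD[OF I[THEN conjunct1], simplified]
  have l0: "live 0 = {..<n}" using pn_0 by force
  have row0: "row (snd s) a = []" for a using I by (simp add: row_def)
  have s0: "!!v. v < n ==> snd s 0 v 0 = v & snd s 2 v 0 = T_at 0 v" "!!v. v >= n ==> snd s 2 v 0 = 0" "!!i k. snd s 5 i k = 0" "!!i k. snd s 3 i k = 0"
   using I by auto
  have eq: "eqx ({11..21} \<union> {30..33}) (fst s) R5" using I by (auto intro: eqx_mono)
  show "inv R5 0 s" unfolding inv_def l0 using eq e R s0 row0 rE_0 pn_0 n1 by (auto simp: pos_def)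
 qed (use R A B(1) in auto)
 then show ?thesis by (rule hl_mono) auto
qed

lemma hl_rest:
 assumes a: "after_bits s"
 shows "hl xs K W C B (Sq c_pre (Sq (For 30 (Var 2) (b_part \<sigma> M)) (Sq (For 30 (Bin Sub (Var 2) (Cst 1)) (c_step \<sigma> M)) c_fin)))
  (csz c_pre * Suc C + ((3 * Suc C + n * (csz (b_part \<sigma> M) * Suc C + 6) + 4) + ((9 * Suc C + (n - 1) * (t_step \<sigma> M C d (2 ^ (l + 2)) + 6) + 4) + csz c_fin * Suc C)))
  s (%s. fst s 0 = (if models S \<phi> then 1 else 0))"
proof (cases s)
 case (Pair R4 A4)
 define R5 where "R5 = R4(10 := 2 ^ (l + 2), 11 := 3 + fl)"
 have r4: "R4 2 = n" "R4 3 = fl" "R4 4 = sl" "R4 6 = l" "R4 12 = 0" "R4 7 = list_encode (rev (map cd (qprefix \<phi>)))" using a by (simp_all add: after_bits_def Pair)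
 obtain bs where bs: "fm.bits bs" "length bs = NA" "R4 24 = list_encode (rev bs)" using a by (auto simp: after_bits_def Pair)
 have A4: "!!c i j. c ~= 7 ==> c ~= 8 ==> A4 c i j = 0" using a by (simp add: after_bits_def Pair)
 have 1: "hl xs K W C B c_pre (csz c_pre * Suc C) s (%s. s = (R5, A4))"
 proof (rule hl_wpc)
  have v: "nf F_rad l = 2 ^ (l + 2)" using nf(2)[OF PR_F(1), of l] by (simp add: cd_nat_def F_rad_def)
  have "3 + fl <= B" using fm.B(1) by simp
  then show "wpc xs C B c_pre (%s. s = (R5, A4)) s" unfolding Pair using r4 v nf(1)[OF PR_F(1)] CR B(4) by (simp add: c_pre_def R5_def)
 qed
 have r5: "R5 2 = n" "R5 3 = fl" "R5 4 = sl" "R5 6 = l" "R5 12 = 0" "R5 11 = 3 + fl" "R5 10 = 2 ^ (l + 2)" using r4 by (simp_all add: R5_def)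
 have 2: "hl xs K W C B (For 30 (Var 2) (b_part \<sigma> M)) (3 * Suc C + n * (csz (b_part \<sigma> M) * Suc C + 6) + 4) (R5, A4) (inv R5 0)"
  by (rule hl_parts) (use r5 A4 in auto)
 have 3: "hl xs K W C B (For 30 (Bin Sub (Var 2) (Cst 1)) (c_step \<sigma> M)) (9 * Suc C + (n - 1) * (t_step \<sigma> M C d (2 ^ (l + 2)) + 6) + 4) s' (inv R5 (n - 1))" if I: "inv R5 0 s'" for s'
 proof -
  have "fst s' 2 = n" using I r5 by (simp add: inv_def eqx_def)
  then have "hl xs K W C B (For 30 (Bin Sub (Var 2) (Cst 1)) (c_step \<sigma> M)) (esz (Bin Sub (Var 2) (Cst 1)) * Suc C + (n - 1) * (t_step \<sigma> M C d (2 ^ (l + 2)) + 6) + 4) s' (inv R5 (n - 1))"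
   by (intro hl_For[where m="n - 1" and I="inv R5"] step) (use r5 I B(1) in auto)
  then show ?thesis by (rule hl_mono) auto
 qed
 have 4: "hl xs K W C B c_fin (csz c_fin * Suc C) s' (%s. fst s 0 = (if models S \<phi> then 1 else 0))" if I: "inv R5 (n - 1) s'" for s'
 proof (rule hl_wpc)
  let ?r = "if n = 1 then 0 else 2 * n - 2 :: nat"
  have n1: "n - 1 < n" using n by simp
  have e: "eqx ({11..21} \<union> {30..33}) (fst s') R5" using I by (simp add: inv_def)
  have r: "fst s' 6 = l" "fst s' 7 = list_encode (rev (map cd (qprefix \<phi>)))" "fst s' 24 = list_encode (rev bs)"
   using eqxD[OF e] r4 bs(3) by (simp_all add: R5_def)
  \<comment> \<open>Register 12 holds the name of the last part even for \<open>n = 1\<close>: no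
    merge has set it then, and its initial value 0 is the name of the only singleton.\<close>
  have r12: "fst s' 12 = ?r" using I n by (auto simp: inv_def)
  have "?r \<in> live (n - 1)" using pn_last[of 0] n by (intro image_eqI[of _ _ 0]) auto
  then have T: "snd s' 2 ?r 0 = T_at (n - 1) ?r" using I unfolding inv_def by blast
  have bsl: "list_encode (rev bs) <= list_encode (replicate NA 1)" by (rule list_encode_mono) (use bs in \<open>auto simp: fm.bits_def\<close>)
  let ?v = "prod_encode (l, prod_encode (list_encode (rev bs), prod_encode (list_encode (rev (map cd (qprefix \<phi>))), T_at (n - 1) ?r)))"
  have "?v <= prod_encode (l, prod_encode (list_encode (replicate NA 1), prod_encode (Xq M l, mx)))"
   by (intro prod_encode_mono order_refl bsl qX tb n1)
  then have c: "bnd (nf F_ev) ?v <= C" using bnd_mono[OF nf(1)[OF PR_F(3)]] CE le_trans by blast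
  have "nf F_ev ?v = ev_fun l (bs, qprefix \<phi>, T_at (n - 1) ?r)"
   using nf(2)[OF PR_F(3), of "(l, rev bs, rev (qprefix \<phi>), T_at (n - 1) ?r)"] by (simp add: F_ev_def cd_nat_list cd_nat_def cd_list_def rev_map)
  also have "\<dots> = of_bool (sat S [] \<phi>)"
  proof -
   have "ev_fun (quantifier_rank \<phi>) (bs, qprefix \<phi>, ty M {..<n} (lam l alf (pn (n - 1)) (rE (n - 1)) ?r) (quantifier_rank \<phi>) (map Some [])) = of_bool (sat S [] \<phi>)"
   proof (rule ev_fun_correct[where \<psi>="matrix \<phi>" and Mods=Mods and \<sigma>=\<sigma> and m=0])
    fix e assume e: "length e = l" "set e \<subseteq> {..<n}"
    have "psnd (leaf l alf (pn (n - 1)) (rE (n - 1)) ?r (map Some e) - 1) = fm.ecode e" unfolding leaf_pairs fm.ecode_def ..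
    then show "nthd 0 bs (psnd (leaf l alf (pn (n - 1)) (rE (n - 1)) ?r (map Some e) - 1)) = of_bool (sat S e (matrix \<phi>))"
     using bs(1,2) fm.ecode_lt[OF e(1)] e(1) NA(1) by (simp add: nthd_def fm.bits_def)
   qed (use M U pn_last Mods fm.\<phi> in auto)
   then show ?thesis using fm.\<phi>(3) by (simp add: part_type_def)
  qed
  finally have v: "nf F_ev ?v = (if models S \<phi> then 1 else 0)" by (simp add: models_def)
  have "1 <= B" using B(1) by linarith
  then show "wpc xs C B c_fin (%s. fst s 0 = (if models S \<phi> then 1 else 0)) s'"
   unfolding c_fin_def using r r12 T c v nf(1)[OF PR_F(3)] by (simp del: One_nat_def)
 qed
 show ?thesis
 proof (rule hl_Sq_le[OF 1], rule hl_Sq_le)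
  fix s assume "s = (R5, A4)"
  then show "hl xs K W C B (For 30 (Var 2) (b_part \<sigma> M)) (3 * Suc C + n * (csz (b_part \<sigma> M) * Suc C + 6) + 4) s (inv R5 0)" using 2 by simp
 next
  fix s assume I: "inv R5 0 s"
  show "hl xs K W C B (Sq (For 30 (Bin Sub (Var 2) (Cst 1)) (c_step \<sigma> M)) c_fin) (9 * Suc C + (n - 1) * (t_step \<sigma> M C d (2 ^ (l + 2)) + 6) + 4 + csz c_fin * Suc C) s (%s. fst s 0 = (if models S \<phi> then 1 else 0))"
   by (rule hl_Sq_le[OF 3[OF I] 4])
 qed
qed

lemma hl_main:
 "hl xs K W C B (c_main \<sigma> M) (csz (c_init \<sigma>) * Suc C1 + ((3 * Suc C1 + fl * (csz (b_parse \<sigma>) * Suc C1 + 6) + 4) +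
  ((5 * Suc C1 + (9 * Suc C1 + NA * (t_toks \<sigma> C1 (length (toks (matrix \<phi>))) + 6) + 4)) +
  (csz c_pre * Suc C + ((3 * Suc C + n * (csz (b_part \<sigma> M) * Suc C + 6) + 4) + ((9 * Suc C + (n - 1) * (t_step \<sigma> M C d (2 ^ (l + 2)) + 6) + 4) + csz c_fin * Suc C))))))
  (%r. if r = 1 then length xs else 0, %_ _ _. 0) (%s. fst s 0 = (if models S \<phi> then 1 else 0))"
 unfolding c_main_def
proof (rule hl_Sq_le[OF hl_change_C[OF hl_init]])
 have C1B: "C1 <= B" using C1 by linarith
 show "C1 <= B" by (rule C1B)
 fix s :: state assume s: "s = (Ri, %_ _ _. 0 :: nat)"
 show "hl xs K W C B (Sq (For 30 (Var 3) (b_parse \<sigma>)) (Sq (Sq (Asg 24 (Cst 0)) (c_bits \<sigma>)) (Sq c_pre (Sq (For 30 (Var 2) (b_part \<sigma> M)) (Sq (For 30 (Bin Sub (Var 2) (Cst 1)) (c_step \<sigma> M)) c_fin)))))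
  ((3 * Suc C1 + fl * (csz (b_parse \<sigma>) * Suc C1 + 6) + 4) + ((5 * Suc C1 + (9 * Suc C1 + NA * (t_toks \<sigma> C1 (length (toks (matrix \<phi>))) + 6) + 4)) +
  (csz c_pre * Suc C + ((3 * Suc C + n * (csz (b_part \<sigma> M) * Suc C + 6) + 4) + ((9 * Suc C + (n - 1) * (t_step \<sigma> M C d (2 ^ (l + 2)) + 6) + 4) + csz c_fin * Suc C)))))
  s (%s. fst s 0 = (if models S \<phi> then 1 else 0))" unfolding s
 proof (rule hl_Sq_le[OF hl_change_C[OF fm.hl_parse C1B]])
  fix s' assume "fm.pinv Ri fl s'"
  from hl_change_C[OF hl_bits'[OF this] C1B] show "hl xs K W C B (Sq (Sq (Asg 24 (Cst 0)) (c_bits \<sigma>)) (Sq c_pre (Sq (For 30 (Var 2) (b_part \<sigma> M)) (Sq (For 30 (Bin Sub (Var 2) (Cst 1)) (c_step \<sigma> M)) c_fin))))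
   ((5 * Suc C1 + (9 * Suc C1 + NA * (t_toks \<sigma> C1 (length (toks (matrix \<phi>))) + 6) + 4)) +
  (csz c_pre * Suc C + ((3 * Suc C + n * (csz (b_part \<sigma> M) * Suc C + 6) + 4) + ((9 * Suc C + (n - 1) * (t_step \<sigma> M C d (2 ^ (l + 2)) + 6) + 4) + csz c_fin * Suc C))))
   s' (%s. fst s 0 = (if models S \<phi> then 1 else 0))" by (rule hl_Sq_le) (rule hl_rest)
 qed (simp_all add: Ri_def)
qed

end

section \<open>Size of the input and the conclusion\<close>

context input
begin

text \<open>A merge is listed by at most \<open>3 + d\<close> numbers. Only the binary tables take
  quadratic space, which is why \<open>B\<close> will be the square of the time bound.\<close>

lemma length_xs_le: "length xs + 4 <= 7 + fl + n * (3 + d) + length \<sigma> * n ^ 2"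
proof -
 have n1: "1 <= n" by (rule n)
 have "sl = (\<Sum>j<n - 1. 3 + card (nbs j))"
 proof -
  have "length (concat (map (%i. [xn i, yn i, card (nbs i)] @ sorted_list_of_set (nbs i)) [0..<m])) = (\<Sum>j<m. 3 + card (nbs j))" for m
   by (induction m) auto
  then show ?thesis unfolding sequence_code_eq .
 qed
 also have "\<dots> <= (\<Sum>j<n - 1. 3 + d)" by (rule sum_mono) (use degree in auto)
 also have "\<dots> <= n * (3 + d)" using mult_le_mono1[of "n - 1" n "3 + d"] by simp
 finally have 1: "sl <= n * (3 + d)" .
 have "set as \<subseteq> set \<sigma> ==> sum_list (map (%a. n ^ a) as) <= length as * n ^ 2" for as
 proof (induction as)
  case (Cons a as)
  then have "n ^ a <= n ^ 2" using sig_le[of a] n1 by (intro power_increasing) auto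
  then show ?case using Cons by simp
 qed simp
 then have "length (structure_code \<sigma> n S) <= length \<sigma> * n ^ 2" unfolding length_structure_code by blast
 then show ?thesis using 1 by simp
qed

lemma xs_elements:
 assumes "formula \<sigma> Mods 0 \<phi>" "!!p. p \<in> Mods ==> p <= P" "x \<in> set xs"
 shows "x <= max (length xs) (8 + length \<sigma> + P + quantifier_rank \<phi> + d + 2 * n)"
proof -
 have "x = n | x = fl | x = sl | x \<in> set (formula_code \<phi>) | x \<in> set (sequence_code \<sigma> n S Ps) | x \<in> set (structure_code \<sigma> n S)"
  using assms(3) by (auto simp: xs_def input_code_def formula_length_def)
 moreover have "x <= 8 + length \<sigma> + P + quantifier_rank \<phi>" if "x \<in> set (formula_code \<phi>)"
  using formula_code_le[OF assms(2,1) that] by simp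
 moreover have "x <= d + 2 * n" if "x \<in> set (sequence_code \<sigma> n S Ps)"
 proof -
  obtain i where i: "i < n - 1" "x \<in> set ([xn i, yn i, card (nbs i)] @ sorted_list_of_set (nbs i))" using \<open>x \<in> set (sequence_code \<sigma> n S Ps)\<close> unfolding sequence_code_eq by auto
  have i': "Suc i < n" "i < n" using i(1) by simp_all
  have xy: "xn i < n + i" "yn i < n + i" using xy_live[OF i'(1)] live_lt[OF i'(2)] by blast+
  have nb: "b < n + Suc i" if "b \<in> nbs i" for b using rE_live[OF i'(1), of "n + i" b] live_lt[OF i'(1)] that by blast
  have fin: "finite (nbs i)" "card (nbs i) <= d" using degree[OF i'(1)] by simp_all
  have "x = xn i | x = yn i | x = card (nbs i) | x \<in> nbs i" using i(2) fin(1) by auto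
  then show ?thesis using xy nb[of x] fin(2) i' by linarith
 qed
 moreover have "x <= 1" if "x \<in> set (structure_code \<sigma> n S)"
  using that by (auto simp: structure_code_def relation_table_def)
 moreover have "n <= d + 2 * n" "fl <= length xs" "sl <= length xs" by simp_all
 ultimately show ?thesis unfolding le_max_iff_disj by linarith
qed

end

theorem theorem25:
  fixes \<sigma> :: signature and Mods :: "nat set"
  assumes "binary_signature \<sigma>" and "finite Mods" and "\<forall>p\<in>Mods. p \<ge> 2"
  shows "\<exists>(f :: nat \<Rightarrow> nat \<Rightarrow> nat) (g :: nat \<Rightarrow> nat) (k :: nat) (c :: prog).
    computable2 f \<and> computable1 g \<and>
    (\<forall>(n :: nat) (d :: nat) (l :: nat) (S :: nat struc) (Ps :: nat set set list) (\<phi> :: fm).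
       structure_over \<sigma> S \<and> univ S = {..<n} \<and> d_sequence \<sigma> S d Ps \<and>
       sentence \<sigma> Mods \<phi> \<and> prenex \<phi> \<and> quantifier_rank \<phi> = l \<longrightarrow>
       (let T = f l d * n + g l * formula_length \<phi>
        in outputs_within (T ^ k) T c (input_code \<sigma> n S Ps \<phi>) (if models S \<phi> then 1 else 0)))"
proof -
 \<comment> \<open>A common multiple of all moduli; it is positive, as the empty product is
   1.\<close>
 define M where "M = (\<Prod>p\<in>Mods. p)"
 have M: "M > 0" unfolding M_def using assms(3) by (intro prod_pos) fastforce
 have dvdM: "p dvd M" if "p \<in> Mods" for p unfolding M_def using dvd_prodI[OF assms(2) that, of "%p. p"] .
 have leM: "p <= M" if "p \<in> Mods" for p using dvd_imp_le[OF dvdM[OF that] M] .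
 obtain k1 where k1: "!!B. B >= 2 ==> cmax B (c_main \<sigma> M) <= B ^ k1" using cmax_poly by blast
 obtain k2 where k2: "!!B. B >= 2 ==> emax B (lenx \<sigma>) <= B ^ k2" using emax_poly by blast
 define K where "K = Suc (Max (insert 40 (cvars (c_main \<sigma> M))))"
 have K: "40 <= K" "1 < K" "cvars (c_main \<sigma> M) \<subseteq> {..<K}"
 proof -
  have f: "finite (insert 40 (cvars (c_main \<sigma> M)))" using finite_cvars by simp
  show "40 <= K" using Max_ge[OF f, of 40] unfolding K_def by simp
  then show "1 < K" by simp
  show "cvars (c_main \<sigma> M) \<subseteq> {..<K}" using Max_ge[OF f] unfolding K_def by (auto simp: less_Suc_eq_le)
 qed
 note Kv = K
 \<comment> \<open>Words must hold polynomials in \<open>B\<close> of degree \<open>k1\<close> for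
   the program and \<open>k2\<close> for the length of the input. As \<open>B = T * T\<close>,
   exponents are doubled, and the summand 1 ensures \<open>B <= W\<close>.\<close>
 define k where "k = 2 * (k1 + k2 + 1)"
 define c where "c = Seq (ecomp (lenx \<sigma>) K) (Seq (copy 1 K) (ccomp (c_main \<sigma> M) K))"
 have main: "outputs_within (T ^ k) T c (input_code \<sigma> n S Ps \<phi>) (if models S \<phi> then 1 else 0)"
  if h: "univ S = {..<n}" "d_sequence \<sigma> S d Ps" "formula \<sigma> Mods 0 \<phi>" "prenex \<phi>" "quantifier_rank \<phi> = l"
   and Tdef: "T = ff \<sigma> M l d * n + gf \<sigma> l * length (formula_code \<phi>)"
  for n d l S Ps \<phi> T
 proof -
  interpret input \<sigma> S n d Ps \<phi> by unfold_locales (use h assms(1) in auto)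
  define C1 where "C1 = C1f \<sigma> l"
  define C where "C = C2f \<sigma> M l d"
  define mx where "mx = mxf \<sigma> M l d"
  define Q where "Q = Qf l d"
  define X where "X = Xf \<sigma> M l d"
  define NA where "NA = F_num \<sigma> l"
  define B where "B = T * T"
  define W where "W = T ^ k"
  \<comment> \<open>All constants of the construction. They are contained in \<open>alpha\<close>
    and so in \<open>ff\<close>, hence \<open>s * n\<close> stays below the time bound.\<close>
  define s where "s = C + mx + X + Q + XBf \<sigma> l + Xq M l + NA + d + l + 2 ^ (l + 2) + 2 ^ length \<sigma> + M + length \<sigma> + 20"
  have n1: "1 <= n" by (rule n)
  have fl1: "1 <= fl" by (cases \<phi>) auto
  have "s <= ff \<sigma> M l d" unfolding ff_def alpha_def s_def C_def mx_def X_def Q_def NA_def by linarith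
  then have "s * n <= ff \<sigma> M l d * n" by (rule mult_le_mono1)
  moreover have "10 * fl <= gf \<sigma> l * fl" unfolding gf_def by (intro mult_le_mono1) simp
  ultimately have T1: "s * n + 10 * fl <= T" unfolding Tdef by linarith
  have sn: "s <= s * n" using n1 by simp
  have sT: "s + 10 <= T" using T1 sn fl1 by linarith
  have TB: "T <= B" unfolding B_def by (rule le_square)
  have sB: "s <= B" using sT TB by linarith
  have s20: "(length \<sigma> + d + 20) * n <= s * n" by (intro mult_le_mono1) (simp add: s_def)
  have nT: "n <= T" and nB: "4 * n + 4 <= B" and flB: "4 * fl + 4 <= B"
  proof -
   have "20 * n <= (length \<sigma> + d + 20) * n" by (intro mult_le_mono1) simp
   then have "20 * n <= T" using s20 T1 by linarith
   then show "n <= T" "4 * n + 4 <= B" using n1 TB by linarith+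
   show "4 * fl + 4 <= B" using T1 sn sT TB unfolding s_def by linarith
  qed
  have lenB: "length xs + 4 <= B"
  proof -
   define p1 where "p1 = length \<sigma> * n"
   define p2 where "p2 = (d + 20) * n + 10 * fl"
   have "p1 + p2 <= T" using s20 T1 unfolding p1_def p2_def by (simp add: algebra_simps)
   then have "p1 * T + p2 * T <= B" unfolding B_def add_mult_distrib[symmetric] by (rule mult_le_mono1)
   moreover have "p1 * n <= p1 * T" using nT by (rule mult_le_mono2)
   moreover have "p2 * 1 <= p2 * T" using sT by (intro mult_le_mono2) linarith
   ultimately have "p1 * n + p2 <= B" by linarith
   then have "length \<sigma> * n * n + ((d + 20) * n + 10 * fl) <= B" unfolding p1_def p2_def .
   moreover have "7 + fl + n * (3 + d) + length \<sigma> * n ^ 2 <= length \<sigma> * n * n + ((d + 20) * n + 10 * fl)"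
    using n1 fl1 by (simp add: algebra_simps power2_eq_square)
   ultimately show ?thesis using length_xs_le by linarith
  qed
  have elB: "x <= B" if "x \<in> set xs" for x
  proof -
   have "8 + length \<sigma> + M + l + d + 2 * n <= T"
   proof -
    have "2 * n + (s - 2) <= s * n + 10 * fl"
    proof -
     have "(s - 2) * 1 + 2 * n <= (s - 2) * n + 2 * n" using n1 by (intro add_mono mult_le_mono2) auto
     also have "\<dots> = s * n" unfolding s_def by (simp add: algebra_simps)
     finally show ?thesis by linarith
    qed
    moreover have "8 + length \<sigma> + M + l + d <= s - 2" unfolding s_def by linarith
    ultimately show ?thesis using T1 by linarith
   qed
   then show ?thesis using xs_elements[OF h(3) leM that] lenB TB h(5) unfolding le_max_iff_disj by auto
  qed
  have qX: "list_encode (rev (map cd (take j (qprefix \<phi>)))) <= Xq M l" for j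
   unfolding Xq_def
  proof (rule list_encode_mono)
   show "length (rev (map cd (take j (qprefix \<phi>)))) <= l" using length_qprefix[OF h(4)] h(5) by simp
   fix y assume "y \<in> set (rev (map cd (take j (qprefix \<phi>))))"
   then obtain q where q: "q \<in> set (qprefix \<phi>)" "y = cd q" by (auto dest: in_set_takeD)
   obtain a b e where abe: "q = (a, b, e)" by (cases q)
   show "y <= prod_encode (8, prod_encode (M, M))"
    using qprefix_mods[OF h(3) q(1) leM] by (simp add: q(2) abe cd_nat_def prod_encode_mono)
  qed
  have XqB: "Xq M l <= B" using sB unfolding s_def by linarith
  have comp: "mx <= B" "Q <= B" "X <= B" "NA <= B" "2 ^ (l + 2) <= B" "2 ^ length \<sigma> <= B" "C <= B" "list_encode (replicate NA 1) <= B"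
   using sB unfolding s_def XBf_def NA_def[symmetric] by linarith+
  have T0: "i < n ==> part_type M l (atom_code \<sigma> S) {..<n} (pn i) (rE i) a <= mx" for i a unfolding mx_def by (rule part_type_bound[OF M])
  have m0: "3 + 4 * 2 ^ length \<sigma> <= mx" by (simp add: mx_def mxf_def)
  have lst: "length ys <= Q * Q ==> (!!y. y \<in> set ys ==> y <= mx) ==> list_encode ys <= X" for ys
   unfolding X_def Xf_def Q_def mx_def by (rule list_encode_mono)
  have Cs: "bnd (nf (F_upd M)) (prod_encode (l, prod_encode (Q, prod_encode (X, prod_encode (X, Q))))) <= C" "C1 <= C"
   "bnd (nf F_rad) l <= C" "bnd (nf (F_init M)) (prod_encode (l, 2 ^ length \<sigma>)) <= C"
   "bnd (nf F_ev) (prod_encode (l, prod_encode (list_encode (replicate NA 1), prod_encode (Xq M l, mx)))) <= C"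
   unfolding C_def C2f_def Q_def X_def mx_def C1_def NA_def XBf_def by simp_all
  have C1s: "bnd (f_ar \<sigma>) (length \<sigma>) <= C1" "bnd (nf (F_num \<sigma>)) l <= C1"
   "bnd (nf (F_val \<sigma>)) (prod_encode (l, prod_encode (prod_encode (NA, 2 ^ length \<sigma>), prod_encode (2, prod_encode (length \<sigma>, prod_encode (l, l)))))) <= C1"
   unfolding C1_def C1f_def NA_def by simp_all
  have mach: "machine \<sigma> S n d Ps \<phi> l M K C B mx X Q"
  proof unfold_locales
   show "part_type M l (atom_code \<sigma> S) {..<n} (pn i) (rE i) a <= mx" if "i < n" for i a using T0[OF that] .
   show "list_encode ys <= X" if "length ys <= Q * Q" "!!y. y \<in> set ys ==> y <= mx" for ys using lst[OF that] .
   show "x <= B" if "x \<in> set xs" for x using elB[OF that] .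
  qed (use M K m0 comp Cs nB lenB in \<open>auto simp: Q_def Qf_def\<close>)
  have form: "formula_machine \<sigma> S n d Ps \<phi> Mods l K C1 B NA"
  proof unfold_locales
   show "x <= B" if "x \<in> set xs" for x using elB[OF that] .
   show "list_encode (rev (map cd (take j (qprefix \<phi>)))) <= B" for j using qX[of j] XqB by linarith
  qed (use K h comp C1s flB lenB in auto)
  interpret machine \<sigma> S n d Ps \<phi> l M K W C B mx X Q by (rule mach)
  interpret fm: formula_machine \<sigma> S n d Ps \<phi> Mods l K W C1 B NA by (rule form)
  interpret total \<sigma> S n d Ps \<phi> l M K W C B mx X Q Mods C1 NA
  proof unfold_locales
   show "list_encode (rev (map cd (qprefix \<phi>))) <= Xq M l" using qX[of "length (qprefix \<phi>)"] by simp
   show "p dvd M" if "p \<in> Mods" for p using dvdM[OF that] .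
  qed (use Cs C1s comp in \<open>auto simp: NA_def\<close>)
  let ?N = "length (toks (matrix \<phi>))"
  let ?\<tau> = "csz (c_init \<sigma>) * Suc C1 + ((3 * Suc C1 + fl * (csz (b_parse \<sigma>) * Suc C1 + 6) + 4) +
  ((5 * Suc C1 + (9 * Suc C1 + NA * (t_toks \<sigma> C1 ?N + 6) + 4)) +
  (csz c_pre * Suc C + ((3 * Suc C + n * (csz (b_part \<sigma> M) * Suc C + 6) + 4) + ((9 * Suc C + (n - 1) * (t_step \<sigma> M C d (2 ^ (l + 2)) + 6) + 4) + csz c_fin * Suc C)))))"
  have tau: "?\<tau> + esz (lenx \<sigma>) * Suc C + 2 <= T"
  proof -
   define a where "a = Suc C1"
   define b where "b = Suc C"
   define u where "u = csz (b_parse \<sigma>) * a + 6"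
   define bt where "bt = csz (b_tok \<sigma>) * a + 6"
   define v where "v = NA * (63 * a + 4 + bt + 6)"
   define w where "w = csz (b_part \<sigma> M) * b + 6"
   define t where "t = t_step \<sigma> M C d (2 ^ (l + 2)) + 6"
   define al where "al = alpha \<sigma> M l d"
   have N: "?N <= fl" using fm.tok_count fm.tks_nth(3) by linarith
   \<comment> \<open>The fixed cost per table entry is charged to the formula length as well, which
     is at least 1.\<close>
   have "t_toks \<sigma> C1 ?N + 6 = (63 * a + 4 + 6) + ?N * bt" unfolding t_toks_def a_def[symmetric] bt_def by simp
   also have "\<dots> <= fl * (63 * a + 4 + 6) + fl * bt"
    by (intro add_mono mult_le_mono1 N) (use mult_le_mono1[OF fl1, of "63 * a + 4 + 6"] in simp)
   also have "\<dots> = fl * (63 * a + 4 + bt + 6)" by (simp add: algebra_simps)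
   finally have "NA * (t_toks \<sigma> C1 ?N + 6) <= NA * (fl * (63 * a + 4 + bt + 6))" by (rule mult_le_mono2)
   also have "\<dots> = fl * v" unfolding v_def by (rule mult.left_commute)
   finally have 1: "NA * (t_toks \<sigma> C1 ?N + 6) <= fl * v" .
   have 2: "(n - 1) * t <= n * t" by (intro mult_le_mono1) simp
   have 3: "al <= al * n" using n1 by simp
   have g: "gf \<sigma> l = u + v + 10" unfolding gf_def u_def v_def bt_def a_def C1_def NA_def by simp
   have f: "ff \<sigma> M l d = al + (w + t)" unfolding ff_def beta_def al_def w_def t_def b_def C_def by simp
   have "T = al * n + (n * w + n * t) + (fl * u + fl * v + 10 * fl)" unfolding Tdef f g by (simp add: algebra_simps)
   moreover have "csz (c_init \<sigma>) * a + (3 * a + 4) + (14 * a + 4) + csz c_pre * b + (3 * b + 4) + (9 * b + 4) + csz c_fin * b + esz (lenx \<sigma>) * b + 2 <= al"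
    unfolding al_def alpha_def a_def b_def C1_def C_def by linarith
   ultimately show ?thesis unfolding a_def[symmetric] b_def[symmetric] u_def[symmetric] w_def[symmetric] t_def[symmetric] using 1 2 3 by linarith
  qed
  have T2: "2 <= T" "1 <= T" using sT by linarith+
  have B2: "2 <= B" using TB T2 by linarith
  have Bk: "B ^ j = T ^ (2 * j)" for j unfolding B_def by (simp add: power_mult power2_eq_square)
  have W: "B ^ k1 <= W" "B ^ k2 <= W" "B ^ 1 <= W" unfolding W_def Bk k_def by (rule power_increasing; use T2 in simp)+
  have cW: "cmax B (c_main \<sigma> M) <= W" and eW: "emax B (lenx \<sigma>) <= W" and BW: "B <= W"
   using k1[OF B2] k2[OF B2] W by simp_all
  have "outputs_within W T c xs (if models S \<phi> then 1 else 0)"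
   unfolding c_def
  proof (rule outputs_within_hl[OF hl_main])
   show "\<forall>x\<in>set xs. x <= B" using elB by blast
   show "length xs <= B" using lenB by linarith
   show "cvars (c_main \<sigma> M) \<subseteq> {..<K}" by (rule Kv(3))
   show "val xs ((%r. 0), (%c i j. 0)) (lenx \<sigma>) = length xs" "eok xs C ((%r. 0), (%c i j. 0)) (lenx \<sigma>)" by (rule lenx)+
   show "?\<tau> + esz (lenx \<sigma>) * Suc C + 2 <= T" by (rule tau)
  qed (use Kv(1,2) cW eW BW comp(7) asgs_main evars_lenx in auto)
  then show ?thesis unfolding W_def xs_def .
 qed
 show ?thesis
 proof (intro exI[of _ "ff \<sigma> M"] exI[of _ "gf \<sigma>"] exI[of _ k] exI[of _ c] conjI allI impI computable_ff computable_gf)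
  fix n d l :: nat and S :: "nat struc" and Ps :: "nat set set list" and \<phi> :: fm
  assume h: "structure_over \<sigma> S & univ S = {..<n} & d_sequence \<sigma> S d Ps & sentence \<sigma> Mods \<phi> & prenex \<phi> & quantifier_rank \<phi> = l"
  show "let T = ff \<sigma> M l d * n + gf \<sigma> l * formula_length \<phi>
    in outputs_within (T ^ k) T c (input_code \<sigma> n S Ps \<phi>) (if models S \<phi> then 1 else 0)"
   unfolding Let_def by (rule main) (use h in \<open>auto simp: sentence_def formula_length_def\<close>)
 qed
qed

end
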